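(* Let $n\ge 3$ and let $(f,\Gamma)$ satisfy the standing structural assumptions below. Let $\Omega\subset\mathbb R^n$ be a bounded domain with smooth boundary $\partial\Omega$. Then the problem $$f(\lambda(-A^u))=1,\quad u>0 \text{ in } \Omega,\qquad u(x)\to+\infty \text{ as } \mathrm{dist}(x,\partial\Omega)\to0,$$ has a unique continuous viscosity solution $u$. Moreover $u$ is locally Lipschitz in $\Omega$ and $$\lim_{\mathrm{dist}(x,\partial\Omega)\to0}\mathrm{dist}(x,\partial\Omega)^{\frac{n-2}{2}}u(x)=C(f,\Gamma)\in(0,\infty)$$ for a constant $C(f,\Gamma)$ depending only on $(f,\Gamma)$ (and $n$).
   Context: Let $n\ge3$. For a positive $C^2$ function $u$ on an open subset of $\mathbb R^n$, its conformal Hessian is $A^u=-\frac{2}{n-2}u^{-\frac{n+2}{n-2}}\nabla^2u+\frac{2n}{(n-2)^2}u^{-\frac{2n}{n-2}}\nabla u\otimes\nabla u-\frac{2}{(n-2)^2}u^{-\frac{2n}{n-2}}|\nabla u|^2I$, and $\lambda(-A^u)$ denotes the vector of eigenvalues of $-A^u$. Let $\Gamma_n=\{\mu\in\mathbb R^n:\mu_i>0\ \forall i\}$. Standing structural assumptions on $(f,\Gamma)$: $\Gamma\subset\mathbb R^n$ is an open cone with vertex at the origin, symmetric under permutations of coordinates, with $\Gamma+\Gamma_n\subset\Gamma$; $f\in C^0(\bar\Gamma)$ is symmetric in its arguments, $f>0$ in $\Gamma$, $f=0$ on $\partial\Gamma$, $f(\lambda+\mu)\ge f(\lambda)$ for all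 $\lambda\in\Gamma,\mu\in\Gamma_n$, and $f$ is homogeneous of some positive degree ($f$ need not be concave nor $\Gamma$ convex). Whenever $f(\lambda)$ is written, $\lambda\in\bar\Gamma$ is implicitly required. Viscosity notions: $USC(\Omega)$ is the set of upper semicontinuous $\psi:\Omega\to\mathbb R\cup\{-\infty\}$, $\psi\not\equiv-\infty$; $LSC(\Omega)$ is the set of lower semicontinuous $\psi:\Omega\to\mathbb R\cup\{+\infty\}$, $\psi\not\equiv+\infty$. A function $u\in USC(\Omega)$ is a viscosity sub-solution of $f(\lambda(-A^u))=1$ (written $f(\lambda(-A^u))\ge1$) if for every $x_0\in\Omega$ and every $\varphi\in C^2(\Omega)$ with $(u-\varphi)(x_0)=0$ and $u-\varphi\le0$ near $x_0$, one has $\lambda(-A^\varphi(x_0))\in\bar\Gamma$ and $f(\lambda(-A^\varphi(x_0)))\ge1$. A function $u\in LSC(\Omega)$ is a viscosity super-solution (written $f(\lambda(-A^u))\le1$) if for every $x_0\in\Omega$ and $\varphi\in C^2(\Omega)$ with $(u-\varphi)(x_0)=0$ and $u-\varphi\ge0$ near $x_0$, either $\lambda(-A^\varphi(x_0))\notin\bar\Gamma$ or $f(\lambda(-A^\varphi(x_0)))\le1$. A viscosity solution is a $u\in C^0(\Omega)$ which is both a sub- and a super-solution. *)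

theory Defs
  imports "HOL-Analysis.Analysis"
begin

definition diag_mat :: "real^'n \<Rightarrow> real^'n^'n" where
  "diag_mat lam = (\<chi> i j. if i = j then lam $ i else 0)"

definition is_eigvec :: "real^'n^'n \<Rightarrow> real^'n \<Rightarrow> bool" where
  "is_eigvec M lam \<longleftrightarrow>
     (\<exists>Q. orthogonal_matrix Q \<and> M = Q ** diag_mat lam ** transpose Q)"

text \<open>The vector of eigenvalues (some ordering; irrelevant for symmetric f, Gamma).\<close>
definition eigs :: "real^'n^'n \<Rightarrow> real^'n" where
  "eigs M = (SOME lam. is_eigvec M lam)"

definition outer :: "real^'n \<Rightarrow> real^'n \<Rightarrow> real^'n^'n" where
  "outer p q = (\<chi> i j. p $ i * q $ j)"

text \<open>Conformal Hessian A^u at a point, in terms of the value v = u(x),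
  the gradient p = grad u(x) and the Hessian H = D^2 u(x); n = CARD('n).\<close>
definition conf_hess :: "real \<Rightarrow> real^'n \<Rightarrow> real^'n^'n \<Rightarrow> real^'n^'n" where
  "conf_hess v p H =
     (let n = real CARD('n) in
        (- 2 / (n - 2) * v powr (- (n + 2) / (n - 2))) *\<^sub>R H
      + (2 * n / (n - 2)^2 * v powr (- 2 * n / (n - 2))) *\<^sub>R outer p p
      - (2 / (n - 2)^2 * v powr (- 2 * n / (n - 2)) * (p \<bullet> p)) *\<^sub>R mat 1)"

definition C2_with :: "(real^'n) set \<Rightarrow> (real^'n \<Rightarrow> real) \<Rightarrow> (real^'n \<Rightarrow> real^'n)
                       \<Rightarrow> (real^'n \<Rightarrow> real^'n^'n) \<Rightarrow> bool" where
  "C2_with \<Omega> \<phi> D H \<longleftrightarrow>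
     (\<forall>x\<in>\<Omega>. (\<phi> has_derivative (\<lambda>h. D x \<bullet> h)) (at x)) \<and>
     (\<forall>x\<in>\<Omega>. (D has_derivative (\<lambda>h. H x *v h)) (at x)) \<and>
     continuous_on \<Omega> H"

definition pos_cone :: "(real^'n) set" where
  "pos_cone = {mu. \<forall>i. mu $ i > 0}"

definition perm_vec :: "('n \<Rightarrow> 'n) \<Rightarrow> real^'n \<Rightarrow> real^'n" where
  "perm_vec \<sigma> lam = (\<chi> i. lam $ \<sigma> i)"

definition structural :: "(real^'n \<Rightarrow> real) \<Rightarrow> (real^'n) set \<Rightarrow> bool" where
  "structural f \<Gamma> \<longleftrightarrow>
     open \<Gamma> \<and> \<Gamma> \<noteq> {} \<and>
     (\<forall>lam\<in>\<Gamma>. \<forall>t>0. t *\<^sub>R lam \<in> \<Gamma>) \<and>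
     (\<forall>\<sigma>. bij \<sigma> \<longrightarrow> (\<forall>lam\<in>\<Gamma>. perm_vec \<sigma> lam \<in> \<Gamma>)) \<and>
     (\<forall>lam\<in>\<Gamma>. \<forall>mu\<in>pos_cone. lam + mu \<in> \<Gamma>) \<and>
     continuous_on (closure \<Gamma>) f \<and>
     (\<forall>\<sigma>. bij \<sigma> \<longrightarrow> (\<forall>lam\<in>closure \<Gamma>. f (perm_vec \<sigma> lam) = f lam)) \<and>
     (\<forall>lam\<in>\<Gamma>. f lam > 0) \<and>
     (\<forall>lam\<in>frontier \<Gamma>. f lam = 0) \<and>
     (\<forall>lam\<in>\<Gamma>. \<forall>mu\<in>pos_cone. f (lam + mu) \<ge> f lam) \<and>
     (\<exists>a>0. \<forall>lam\<in>closure \<Gamma>. \<forall>t>0. f (t *\<^sub>R lam) = t powr a * f lam)"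

definition visc_sub :: "(real^'n \<Rightarrow> real) \<Rightarrow> (real^'n) set \<Rightarrow> (real^'n) set
                        \<Rightarrow> (real^'n \<Rightarrow> real) \<Rightarrow> bool" where
  "visc_sub f \<Gamma> \<Omega> u \<longleftrightarrow>
     (\<forall>x0\<in>\<Omega>. \<forall>\<phi> D H. C2_with \<Omega> \<phi> D H \<and> \<phi> x0 = u x0 \<and>
        (\<exists>e>0. \<forall>x\<in>\<Omega> \<inter> ball x0 e. u x \<le> \<phi> x) \<longrightarrow>
        (let lam = eigs (- conf_hess (\<phi> x0) (D x0) (H x0)) in
           lam \<in> closure \<Gamma> \<and> f lam \<ge> 1))"

definition visc_super :: "(real^'n \<Rightarrow> real) \<Rightarrow> (real^'n) set \<Rightarrow> (real^'n) set
                        \<Rightarrow> (real^'n \<Rightarrow> real) \<Rightarrow> bool" where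
  "visc_super f \<Gamma> \<Omega> u \<longleftrightarrow>
     (\<forall>x0\<in>\<Omega>. \<forall>\<phi> D H. C2_with \<Omega> \<phi> D H \<and> \<phi> x0 = u x0 \<and>
        (\<exists>e>0. \<forall>x\<in>\<Omega> \<inter> ball x0 e. u x \<ge> \<phi> x) \<longrightarrow>
        (let lam = eigs (- conf_hess (\<phi> x0) (D x0) (H x0)) in
           lam \<notin> closure \<Gamma> \<or> f lam \<le> 1))"

definition visc_sol :: "(real^'n \<Rightarrow> real) \<Rightarrow> (real^'n) set \<Rightarrow> (real^'n) set
                        \<Rightarrow> (real^'n \<Rightarrow> real) \<Rightarrow> bool" where
  "visc_sol f \<Gamma> \<Omega> u \<longleftrightarrow>
     continuous_on \<Omega> u \<and> visc_sub f \<Gamma> \<Omega> u \<and> visc_super f \<Gamma> \<Omega> u"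

primrec Ck :: "nat \<Rightarrow> (real^'n \<Rightarrow> real) \<Rightarrow> bool" where
  "Ck 0 g = continuous_on UNIV g"
| "Ck (Suc k) g = (\<exists>D. (\<forall>x. (g has_derivative (\<lambda>h. \<Sum>i\<in>UNIV. D i x * h $ i)) (at x))
                       \<and> (\<forall>i. Ck k (D i)))"

definition smooth_fun :: "(real^'n \<Rightarrow> real) \<Rightarrow> bool" where
  "smooth_fun g \<longleftrightarrow> (\<forall>k. Ck k g)"

definition smooth_boundary :: "(real^'n) set \<Rightarrow> bool" where
  "smooth_boundary \<Omega> \<longleftrightarrow>
     (\<forall>p\<in>frontier \<Omega>. \<exists>r>0. \<exists>\<rho> G. smooth_fun \<rho> \<and>
        (\<forall>x. (\<rho> has_derivative (\<lambda>h. G x \<bullet> h)) (at x)) \<and> G p \<noteq> 0 \<and>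
        \<Omega> \<inter> ball p r = {x \<in> ball p r. \<rho> x < 0})"

definition bdd_smooth_domain :: "(real^'n) set \<Rightarrow> bool" where
  "bdd_smooth_domain \<Omega> \<longleftrightarrow>
     open \<Omega> \<and> connected \<Omega> \<and> \<Omega> \<noteq> {} \<and> bounded \<Omega> \<and> smooth_boundary \<Omega>"

definition blowup_sol :: "(real^'n \<Rightarrow> real) \<Rightarrow> (real^'n) set \<Rightarrow> (real^'n) set
                        \<Rightarrow> (real^'n \<Rightarrow> real) \<Rightarrow> bool" where
  "blowup_sol f \<Gamma> \<Omega> u \<longleftrightarrow>
     visc_sol f \<Gamma> \<Omega> u \<and> (\<forall>x\<in>\<Omega>. u x > 0) \<and>
     (\<forall>M. \<exists>\<delta>>0. \<forall>x\<in>\<Omega>. infdist x (frontier \<Omega>) < \<delta> \<longrightarrow> u x > M)"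

end

theory Submission
  imports Defs "HOL-Complex_Analysis.Great_Picard"
begin

text \<open>
  Writing \<open>u = exp ((n - 2) / 2 * \<psi>)\<close> turns the equation into \<open>F (\<nabla>\<^sup>2 \<psi> - \<nabla> \<psi> \<otimes> \<nabla> \<psi> + |\<nabla> \<psi>|\<^sup>2 / 2 * I) = exp (2 * a * \<psi>)\<close>,
  where \<open>F M = f (\<lambda> M)\<close> is monotone and \<open>a\<close> is the degree of homogeneity. Since the equation is translation invariant
  and strictly increasing in \<open>\<psi>\<close>, doubling of variables and the theorem on sums give the comparison principle without any
  concavity. The hyperbolic metrics of balls and of complements of balls are explicit solutions; uniform interior and exterior
  touching balls trap every blow-up solution between two of them, so that \<open>\<psi> + ln dist\<close> has a universal limit at the
  boundary. This gives the asymptotics, and with the comparison principle uniqueness and, by Perron's method, existence.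
  The equation is invariant under inversions: comparing \<open>\<psi>\<close> with its Kelvin transforms in spheres contained in the domain,
  which lie below \<open>\<psi>\<close> outside the sphere, bounds the difference quotients of \<open>\<psi>\<close>.
\<close>

section \<open>Eigenvalues of symmetric matrices\<close>

text \<open>The theorem on sums asks for second order expansions of semiconvex functions, but a
  limiting superjet needs less than a Hessian: a quadratic limit of rescalings along one sequence of
  scales, at one suitable point. The point is taken from the set of maxima of slightly tilted sums.
  There both functions lie between paraboloids, so their gradients are Lipschitz on the set; since
  the sums of the gradients fill a ball, the set is not negligible. A Lipschitz function has dyadic
  second differences of size o(h) almost everywhere. Applied to the extended gradients, this makes
  their rescalings additive in the limit; applied to the distance from the set, it shows that the
  set is dense enough at the point for the functions to follow their gradients. As the equation does
  not contain the point, the inequality X + Y <= 0 between the two Hessians suffices for comparison.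
  The doubling can therefore be hidden in two separate sup-convolutions, whose sum is maximised in a
  single variable.\<close>

lemma sym_mat_inner:
  fixes M :: "real^'n^'n"
  assumes "transpose M = M"
  shows "x \<bullet> (M *v y) = (M *v x) \<bullet> y"
  using assms by (metis dot_lmul_matrix transpose_matrix_vector)

text \<open>A maximiser \<open>v\<close> of the quadratic form on the unit sphere of
  \<open>S\<close> is an eigenvector: the residual \<open>M *v v - l *\<^sub>R v\<close> lies in
  \<open>S\<close> again, so it is an admissible direction of variation, and maximality forces it to
  vanish.\<close>

lemma sym_mat_invariant_eigenvector:
  fixes M :: "real^'n^'n"
  assumes sym: "transpose M = M" and S: "subspace S" "S \<noteq> {0}"
    and inv: "\<And>x. x \<in> S \<Longrightarrow> M *v x \<in> S"
  obtains v l where "v \<in> S" "norm v = 1" "M *v v = l *\<^sub>R v"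
proof -
  have "compact (S \<inter> sphere 0 1)"
    using closed_subspace[OF S(1)] by (simp add: closed_Int_compact)
  moreover have "S \<inter> sphere 0 1 \<noteq> {}"
  proof -
    obtain x where x: "x \<in> S" "x \<noteq> 0"
      using S subspace_0 by blast
    then have "x /\<^sub>R norm x \<in> S \<inter> sphere 0 1"
      using S(1) by (auto simp: subspace_scale)
    then show ?thesis by blast
  qed
  moreover have "continuous_on (S \<inter> sphere 0 1) (\<lambda>x. x \<bullet> (M *v x))"
    by (intro continuous_intros matrix_vector_mult_linear_continuous_on)
  ultimately have "\<exists>v\<in>S \<inter> sphere 0 1. \<forall>y\<in>S \<inter> sphere 0 1. y \<bullet> (M *v y) \<le> v \<bullet> (M *v v)"
    by (rule continuous_attains_sup)
  then obtain v where v: "v \<in> S \<inter> sphere 0 1"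
    and max: "\<And>y. y \<in> S \<inter> sphere 0 1 \<Longrightarrow> y \<bullet> (M *v y) \<le> v \<bullet> (M *v v)"
    by blast
  define l where "l = v \<bullet> (M *v v)"
  have le: "x \<bullet> (M *v x) \<le> l * (x \<bullet> x)" if "x \<in> S" for x
  proof (cases "x = 0")
    case False
    have "x /\<^sub>R norm x \<in> S \<inter> sphere 0 1"
      using S(1) that False by (auto simp: subspace_scale)
    from max[OF this] have "(x \<bullet> (M *v x)) / (norm x)\<^sup>2 \<le> l"
      by (simp add: l_def matrix_vector_mult_scaleR power2_eq_square field_simps)
    then show ?thesis
      using False by (simp add: power2_norm_eq_inner field_simps)
  qed simp
  define w where "w = M *v v - l *\<^sub>R v"
  have wS: "w \<in> S"
    unfolding w_def using v inv S(1) by (simp add: subspace_diff subspace_scale)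
  have vv: "v \<bullet> v = 1"
    using v by (simp add: norm_eq_1)
  \<comment> \<open>Moving from \<open>v\<close> to \<open>v + t *\<^sub>R w\<close> gains a term
    linear in \<open>t\<close> and costs only a quadratic one; a small positive \<open>t\<close>
    then excludes \<open>w \<noteq> 0\<close>.\<close>
  have key: "2 * t * (w \<bullet> w) \<le> t\<^sup>2 * (l * (w \<bullet> w) - w \<bullet> (M *v w))" for t
  proof -
    have "(v + t *\<^sub>R w) \<bullet> (M *v (v + t *\<^sub>R w)) \<le> l * ((v + t *\<^sub>R w) \<bullet> (v + t *\<^sub>R w))"
      using le v wS S(1) by (simp add: subspace_add subspace_scale)
    moreover have "v \<bullet> (M *v w) = w \<bullet> (M *v v)"
      using sym_mat_inner[OF sym] by (metis inner_commute)
    moreover have "w \<bullet> (M *v v) = w \<bullet> w + l * (w \<bullet> v)"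
      by (simp add: w_def inner_diff_left inner_diff_right algebra_simps)
    ultimately show ?thesis
      by (simp add: matrix_vector_right_distrib matrix_vector_mult_scaleR inner_add_left
          inner_add_right l_def[symmetric] vv power2_eq_square algebra_simps inner_commute)
  qed
  have "w \<bullet> w = 0"
  proof (rule ccontr)
    assume "w \<bullet> w \<noteq> 0"
    then have ww: "w \<bullet> w > 0"
      using inner_ge_zero[of w] by linarith
    define K where "K = \<bar>l * (w \<bullet> w) - w \<bullet> (M *v w)\<bar> + 1"
    define t where "t = (w \<bullet> w) / K"
    have K: "K > 0" by (simp add: K_def)
    have t: "t > 0" using ww K by (simp add: t_def)
    have "l * (w \<bullet> w) - w \<bullet> (M *v w) \<le> K"
      unfolding K_def by linarith
    then have "2 * t * (w \<bullet> w) \<le> t\<^sup>2 * K"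
      using key[of t] mult_left_mono[OF _ zero_le_power2[of t]] by (meson order_trans)
    also have "t\<^sup>2 * K = t * (t * K)"
      by (simp add: power2_eq_square)
    also have "t * K = w \<bullet> w"
      unfolding t_def using K by simp
    finally have "2 * t * (w \<bullet> w) \<le> t * (w \<bullet> w)" .
    moreover have "t * (w \<bullet> w) > 0"
      using t ww by (rule mult_pos_pos)
    ultimately show False by linarith
  qed
  then have "M *v v = l *\<^sub>R v"
    by (simp add: w_def)
  then show thesis
    using v that[of v l] by auto
qed

text \<open>Symmetry makes the orthogonal complement of an eigenvector invariant again, so the
  induction on \<open>dim S\<close> runs over invariant subspaces rather than over smaller
  matrices.\<close>

lemma sym_mat_invariant_eigenbasis:
  fixes M :: "real^'n^'n"
  assumes sym: "transpose M = M"
  shows "subspace S \<Longrightarrow> (\<And>x. x \<in> S \<Longrightarrow> M *v x \<in> S) \<Longrightarrow>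
    \<exists>B. B \<subseteq> S \<and> pairwise orthogonal B \<and> (\<forall>b\<in>B. norm b = 1 \<and> (\<exists>l. M *v b = l *\<^sub>R b)) \<and> S \<subseteq> span B"
proof (induction "dim S" arbitrary: S rule: less_induct)
  case less
  show ?case
  proof (cases "S = {0}")
    case True
    then show ?thesis
      by (intro exI[of _ "{}"]) auto
  next
    case False
    obtain v l where v: "v \<in> S" "norm v = 1" "M *v v = l *\<^sub>R v"
      using sym_mat_invariant_eigenvector[OF sym less.prems(1) False less.prems(2)] by blast
    define S' where "S' = S \<inter> {x. v \<bullet> x = 0}"
    have sub: "subspace S'"
      unfolding S'_def using less.prems(1) subspace_hyperplane by (rule subspace_inter)
    have inv: "M *v x \<in> S'" if "x \<in> S'" for x
      using that less.prems(2) sym_mat_inner[OF sym, of v x] v(3) by (auto simp: S'_def)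
    have "v \<notin> S'"
      using v(2) by (auto simp: S'_def)
    then have "S' \<subset> S"
      using v(1) unfolding S'_def by blast
    then have "dim S' < dim S"
      using sub less.prems(1) by (metis dim_psubset span_eq_iff)
    from less.hyps[OF this sub inv] obtain B where B: "B \<subseteq> S'" "pairwise orthogonal B"
      "\<forall>b\<in>B. norm b = 1 \<and> (\<exists>l. M *v b = l *\<^sub>R b)" "S' \<subseteq> span B" by blast
    have "S \<subseteq> span (insert v B)"
    proof
      fix x assume x: "x \<in> S"
      have "x - (v \<bullet> x) *\<^sub>R v \<in> S'"
        using x v less.prems(1)
        by (auto simp: S'_def subspace_diff subspace_scale inner_diff_right norm_eq_1)
      then have "x - (v \<bullet> x) *\<^sub>R v \<in> span B"
        using B(4) by blast
      then show "x \<in> span (insert v B)"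
        by (metis span_breakdown_eq)
    qed
    moreover have "pairwise orthogonal (insert v B)"
      using B(1,2) by (auto simp: pairwise_insert S'_def orthogonal_def inner_commute)
    ultimately show ?thesis
      using B v by (intro exI[of _ "insert v B"]) (auto simp: S'_def)
  qed
qed

lemma is_eigvec_iff:
  "is_eigvec M lam \<longleftrightarrow> (\<exists>Q. orthogonal_matrix Q \<and> M ** Q = Q ** diag_mat lam)"
proof -
  have "M = Q ** diag_mat lam ** transpose Q \<longleftrightarrow> M ** Q = Q ** diag_mat lam"
    if "orthogonal_matrix Q" for Q
    using that unfolding orthogonal_matrix_def by (metis matrix_mul_assoc matrix_mul_rid)
  then show ?thesis
    unfolding is_eigvec_def by blast
qed

lemma matrix_mul_diag: "(Q ** diag_mat lam) $ i $ j = lam $ j * Q $ i $ j"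
  unfolding matrix_matrix_mult_def diag_mat_def
  by (simp add: if_distrib[of "\<lambda>z. _ * z"] sum.delta cong: if_cong)

lemma sym_mat_eigvec_exists:
  fixes M :: "real^'n^'n"
  assumes sym: "transpose M = M"
  shows "\<exists>lam. is_eigvec M lam"
proof -
  obtain B where B: "pairwise orthogonal B"
    "\<forall>b\<in>B. norm b = 1 \<and> (\<exists>l. M *v b = l *\<^sub>R b)" "UNIV \<subseteq> span B"
    using sym_mat_invariant_eigenbasis[OF sym subspace_UNIV] by auto
  have ind: "independent B"
    using B by (intro pairwise_orthogonal_independent) (auto simp: pairwise_def)
  have fin: "finite B"
    using ind by (rule independent_imp_finite)
  have "card B = CARD('n)"
  proof -
    have "span B = UNIV" using B(3) by blast
    then have "dim B = DIM(real^'n)" by (metis dim_UNIV dim_span)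
    then show ?thesis using dim_eq_card_independent[OF ind] by simp
  qed
  then obtain e where e: "bij_betw e (UNIV::'n set) B"
    using fin finite_same_card_bij[of "UNIV::'n set" B] by auto
  have eB: "e i \<in> B" for i
    using e by (auto simp: bij_betw_def)
  then have "\<forall>i. \<exists>l. M *v e i = l *\<^sub>R e i"
    using B(2) by blast
  then obtain l where l: "\<And>i. M *v e i = l i *\<^sub>R e i"
    by metis
  define Q where "Q = (\<chi> i j. e j $ i)"
  have col: "column j Q = e j" for j
    by (simp add: Q_def column_def vec_eq_iff)
  have "orthogonal_matrix Q"
    unfolding orthogonal_matrix_orthonormal_columns col
  proof (intro conjI allI impI)
    show "norm (e i) = 1" for i
      using B(2) eB by blast
    show "orthogonal (e i) (e j)" if "i \<noteq> j" for i j
      using that e eB[of i] eB[of j] pairwiseD[OF B(1)] by (metis UNIV_I bij_betw_imp_inj_on inj_onD)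
  qed
  moreover have "M ** Q = Q ** diag_mat (\<chi> i. l i)"
  proof -
    have "(M ** Q) $ i $ j = (M *v e j) $ i" for i j
      by (simp add: Q_def matrix_matrix_mult_def matrix_vector_mult_def)
    then show ?thesis
      by (simp add: vec_eq_iff matrix_mul_diag l) (simp add: Q_def)
  qed
  ultimately show ?thesis
    unfolding is_eigvec_iff by blast
qed

lemma is_eigvec_eigs: "transpose M = M \<Longrightarrow> is_eigvec M (eigs M)"
  unfolding eigs_def using sym_mat_eigvec_exists by (metis someI_ex)

section \<open>Monotonicity of eigenvalues in the quadratic form\<close>

lemma is_eigvec_form:
  assumes "orthogonal_matrix Q" "M ** Q = Q ** diag_mat lam"
  shows "(Q *v y) \<bullet> (M *v (Q *v y)) = (\<Sum>i\<in>UNIV. lam $ i * (y $ i)\<^sup>2)"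
    and "(Q *v y) \<bullet> (Q *v y) = (\<Sum>i\<in>UNIV. (y $ i)\<^sup>2)"
proof -
  have iso: "(Q *v y) \<bullet> (Q *v z) = y \<bullet> z" for y z
    using assms(1) by (metis dot_lmul_matrix matrix_vector_mul_assoc matrix_vector_mul_lid
        orthogonal_matrix transpose_matrix_vector vector_transpose_matrix)
  have "M *v (Q *v y) = Q *v (diag_mat lam *v y)"
    by (simp add: matrix_vector_mul_assoc assms(2))
  moreover have "diag_mat lam *v y = (\<chi> i. lam $ i * y $ i)"
    by (simp add: vec_eq_iff diag_mat_def matrix_vector_mult_def if_distrib[of "\<lambda>z. z * _"]
        sum.delta cong: if_cong)
  ultimately show "(Q *v y) \<bullet> (M *v (Q *v y)) = (\<Sum>i\<in>UNIV. lam $ i * (y $ i)\<^sup>2)"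
    by (simp add: iso) (simp add: inner_vec_def power2_eq_square algebra_simps)
  show "(Q *v y) \<bullet> (Q *v y) = (\<Sum>i\<in>UNIV. (y $ i)\<^sup>2)"
    by (simp add: iso) (simp add: inner_vec_def power2_eq_square)
qed

text \<open>Counting eigenvalues above each threshold replaces a sorted min-max formula. The span of
  the eigenvectors of \<open>M\<close> with eigenvalue above \<open>t\<close> and the span of those
  of \<open>N\<close> with eigenvalue at most \<open>t\<close> meet only in 0, because the forms of
  \<open>M\<close> and \<open>N\<close> lie on opposite sides of \<open>t\<close> times the squared
  norm there; then the dimensions are compared.\<close>

lemma eigvec_card_mono:
  fixes M N :: "real^'n^'n"
  assumes "is_eigvec M lam" "is_eigvec N mu"
    and le: "\<And>h. h \<bullet> (M *v h) \<le> h \<bullet> (N *v h)"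
  shows "card {i. lam $ i > t} \<le> card {i. mu $ i > t}"
proof -
  obtain Q where Q: "orthogonal_matrix Q" "M ** Q = Q ** diag_mat lam"
    using assms(1) is_eigvec_iff by blast
  obtain R where R: "orthogonal_matrix R" "N ** R = R ** diag_mat mu"
    using assms(2) is_eigvec_iff by blast
  have inj: "inj ((*v) Q)" if "orthogonal_matrix Q" for Q :: "real^'n^'n"
    using that by (intro inj_on_inverseI[where g="(*v) (transpose Q)"])
      (simp add: matrix_vector_mul_assoc orthogonal_matrix)
  define V where "V = (*v) Q ` {y. \<forall>i. i \<notin> {i. lam $ i > t} \<longrightarrow> y $ i = 0}"
  define W where "W = (*v) R ` {y. \<forall>i. i \<notin> {i. mu $ i \<le> t} \<longrightarrow> y $ i = 0}"
  have sub0: "subspace {y::real^'n. \<forall>i. i \<notin> I \<longrightarrow> y $ i = 0}" for I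
    by (auto simp: subspace_def)
  have dim_sub: "dim {y::real^'n. \<forall>i. i \<notin> I \<longrightarrow> y $ i = 0} = card I" for I
    using dim_substandard_cart[where 'a=real, of I] by (simp add: dim_vec_eq)
  have dV: "dim V = card {i. lam $ i > t}"
    unfolding V_def dim_image_eq[OF matrix_vector_mul_linear inj_on_subset[OF inj[OF Q(1)] subset_UNIV]]
    by (simp only: dim_sub)
  have dW: "dim W = card {i. mu $ i \<le> t}"
    unfolding W_def dim_image_eq[OF matrix_vector_mul_linear inj_on_subset[OF inj[OF R(1)] subset_UNIV]]
    by (simp only: dim_sub)
  have "V \<inter> W \<subseteq> {0}"
  proof
    fix x assume "x \<in> V \<inter> W"
    then obtain y z where y: "x = Q *v y" "\<And>i. \<not> lam $ i > t \<Longrightarrow> y $ i = 0"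
      and z: "x = R *v z" "\<And>i. \<not> mu $ i \<le> t \<Longrightarrow> z $ i = 0"
      unfolding V_def W_def by blast
    have "x \<bullet> (N *v x) - t * (x \<bullet> x) = (\<Sum>i\<in>UNIV. (mu $ i - t) * (z $ i)\<^sup>2)"
      unfolding z(1) is_eigvec_form[OF R] by (simp add: sum_distrib_left sum_subtractf algebra_simps)
    also have "\<dots> \<le> 0"
    proof (rule sum_nonpos)
      show "(mu $ i - t) * (z $ i)\<^sup>2 \<le> 0" for i
        using z(2)[of i] by (cases "mu $ i \<le> t") (auto simp: mult_nonpos_nonneg)
    qed
    finally have A: "x \<bullet> (N *v x) - t * (x \<bullet> x) \<le> 0" .
    have B: "x \<bullet> (M *v x) - t * (x \<bullet> x) = (\<Sum>i\<in>UNIV. (lam $ i - t) * (y $ i)\<^sup>2)"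
      unfolding y(1) is_eigvec_form[OF Q] by (simp add: sum_distrib_left sum_subtractf algebra_simps)
    have nn: "0 \<le> (lam $ i - t) * (y $ i)\<^sup>2" for i
      using y(2)[of i] by (cases "lam $ i > t") auto
    have "(\<Sum>i\<in>UNIV. (lam $ i - t) * (y $ i)\<^sup>2) \<le> 0"
      using A B le[of x] by linarith
    then have "(\<Sum>i\<in>UNIV. (lam $ i - t) * (y $ i)\<^sup>2) = 0"
      using nn by (meson antisym sum_nonneg)
    then have "(lam $ i - t) * (y $ i)\<^sup>2 = 0" for i
      using nn by (simp add: sum_nonneg_eq_0_iff)
    then have "y $ i = 0" for i
      using y(2)[of i] by (cases "lam $ i > t") (auto, metis less_irrefl)
    then have "y = 0" by (simp add: vec_eq_iff)
    then show "x \<in> {0}" by (simp add: y)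
  qed
  then have dim0: "dim (V \<inter> W) = 0"
    by simp
  have "subspace V" "subspace W"
    unfolding V_def W_def by (intro linear_subspace_image matrix_vector_mul_linear sub0)+
  then have "dim V + dim W \<le> CARD('n)"
    using dim0 dim_sums_Int[of V W] dim_subset_UNIV[of "{x + y |x y. x \<in> V \<and> y \<in> W}"]
    by (simp del: dim_eq_0)
  moreover have "card {i. mu $ i > t} + card {i. mu $ i \<le> t} = CARD('n)"
  proof -
    have "card ({i. mu $ i > t} \<union> {i. mu $ i \<le> t}) = card {i. mu $ i > t} + card {i. mu $ i \<le> t}"
      by (rule card_Un_disjoint) auto
    moreover have "{i. mu $ i > t} \<union> {i. mu $ i \<le> t} = UNIV"
      by auto
    ultimately show ?thesis by simp
  qed
  ultimately show ?thesis
    by (simp add: dV dW)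
qed

text \<open>Pair the largest value of \<open>a\<close> with the largest value of \<open>b\<close>
  and remove both; the counting hypothesis survives. The index sets are arbitrary finite sets so
  that the removal fits the induction.\<close>

lemma card_dominated_bij:
  fixes a b :: "'i \<Rightarrow> real"
  assumes "finite A" "finite B" "card A = card B"
    and "\<And>t. card {i\<in>A. a i > t} \<le> card {i\<in>B. b i > t}"
  shows "\<exists>\<sigma>. bij_betw \<sigma> B A \<and> (\<forall>i\<in>B. a (\<sigma> i) \<le> b i)"
  using assms
proof (induction "card A" arbitrary: A B)
  case 0
  then show ?case by (intro exI[of _ id]) (auto simp: bij_betw_def)
next
  case (Suc m)
  have nA: "A \<noteq> {}" and nB: "B \<noteq> {}" using Suc by auto
  have "Max (a ` A) \<in> a ` A"
    using \<open>finite A\<close> nA by (intro Max_in) auto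
  then obtain i where i0: "i \<in> A" "Max (a ` A) = a i" by blast
  have i: "i \<in> A" "\<And>k. k \<in> A \<Longrightarrow> a k \<le> a i"
    using i0 \<open>finite A\<close> Max_ge[of "a ` A"] by auto
  have "Max (b ` B) \<in> b ` B"
    using \<open>finite B\<close> nB by (intro Max_in) auto
  then obtain j where j0: "j \<in> B" "Max (b ` B) = b j" by blast
  have j: "j \<in> B" "\<And>k. k \<in> B \<Longrightarrow> b k \<le> b j"
    using j0 \<open>finite B\<close> Max_ge[of "b ` B"] by auto
  have ij: "a i \<le> b j"
  proof (rule ccontr)
    assume "\<not> a i \<le> b j"
    then have "i \<in> {k\<in>A. a k > b j}" using i by auto
    then have "card {k\<in>A. a k > b j} \<noteq> 0" using \<open>finite A\<close> by (subst card_eq_0_iff) auto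
    moreover have "{k\<in>B. b k > b j} = {}" using j by (auto simp: not_less)
    ultimately show False using Suc.prems(4)[of "b j"] by (metis card.empty le_zero_eq)
  qed
  have "card {k\<in>A - {i}. a k > t} \<le> card {k\<in>B - {j}. b k > t}" for t
  proof (cases "a i > t")
    case True
    then have "{k\<in>A - {i}. a k > t} = {k\<in>A. a k > t} - {i}" "i \<in> {k\<in>A. a k > t}"
      "{k\<in>B - {j}. b k > t} = {k\<in>B. b k > t} - {j}" "j \<in> {k\<in>B. b k > t}"
      using i j ij by auto
    then show ?thesis using Suc.prems(4)[of t] by (simp add: card_Diff_singleton)
  next
    case False
    then have "{k\<in>A - {i}. a k > t} = {}" using i(2) by (force simp: not_less dest: order_trans)
    then show ?thesis by (metis card.empty le0)
  qed
  moreover have "m = card (A - {i})" "card (A - {i}) = card (B - {j})"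
    using Suc i j by auto
  ultimately obtain \<sigma> where \<sigma>: "bij_betw \<sigma> (B - {j}) (A - {i})" "\<forall>k\<in>B - {j}. a (\<sigma> k) \<le> b k"
    using Suc.hyps(1)[of "A - {i}" "B - {j}"] Suc.prems by auto
  have "bij_betw (\<sigma>(j := i)) (insert j (B - {j})) (insert i (A - {i}))"
    unfolding bij_betw_def
  proof
    have inj: "inj_on \<sigma> (B - {j})" and im: "\<sigma> ` (B - {j}) = A - {i}"
      using \<sigma>(1) by (auto simp: bij_betw_def)
    show "inj_on (\<sigma>(j := i)) (insert j (B - {j}))"
      using inj im by (intro inj_on_fun_updI[THEN inj_on_insert[THEN iffD2, OF conjI]]) auto
    show "(\<sigma>(j := i)) ` insert j (B - {j}) = insert i (A - {i})"
    proof -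
      have "(\<sigma>(j := i)) ` (B - {j}) = \<sigma> ` (B - {j})"
        by (rule image_cong) auto
      then show ?thesis unfolding image_insert im by simp
    qed
  qed
  then have "bij_betw (\<sigma>(j := i)) B A"
    unfolding insert_Diff[OF i(1)] insert_Diff[OF j(1)] .
  then show ?case
    using \<sigma>(2) ij by (intro exI[of _ "\<sigma>(j := i)"]) auto
qed

text \<open>Weyl's monotonicity up to a permutation, which is all that a symmetric \<open>f\<close>
  on a symmetric \<open>\<Gamma>\<close> can see.\<close>

lemma eigvec_mono:
  fixes M N :: "real^'n^'n"
  assumes "is_eigvec M lam" "is_eigvec N mu" "\<And>h. h \<bullet> (M *v h) \<le> h \<bullet> (N *v h)"
  shows "\<exists>\<sigma>. bij \<sigma> \<and> (\<forall>i. lam $ \<sigma> i \<le> mu $ i)"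
  using card_dominated_bij[of UNIV UNIV "\<lambda>i. lam $ i" "\<lambda>i. mu $ i"] eigvec_card_mono[OF assms]
  by auto


section \<open>The operator on symmetric matrices\<close>

text \<open>Extending by \<open>0\<close>, the viscosity conditions at \<open>\<lambda>\<close> become just \<open>ext0 f \<Gamma> \<lambda> \<ge> 1\<close> and \<open>ext0 f \<Gamma> \<lambda> \<le> 1\<close>.\<close>

definition ext0 :: "(real^'n \<Rightarrow> real) \<Rightarrow> (real^'n) set \<Rightarrow> real^'n \<Rightarrow> real" where
  "ext0 f \<Gamma> lam = (if lam \<in> closure \<Gamma> then f lam else 0)"

definition mat_op :: "(real^'n \<Rightarrow> real) \<Rightarrow> (real^'n) set \<Rightarrow> real^'n^'n \<Rightarrow> real" where
  "mat_op f \<Gamma> M = ext0 f \<Gamma> (eigs M)"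

text \<open>All that the differential equation uses of \<open>(f, \<Gamma>)\<close>. Continuity is
  asked only along the identity, since monotonicity upgrades it to continuity on symmetric matrices.
  Invariance under conjugation serves the inversions, and the value at \<open>mat 1\<close>
  normalises the barriers.\<close>

locale conf_op =
  fixes F :: "real^'n^'n \<Rightarrow> real" and a :: real
  assumes a_pos: "a > 0"
    and F_mono: "\<And>M N. transpose M = M \<Longrightarrow> transpose N = N \<Longrightarrow>
      (\<And>h. h \<bullet> (M *v h) \<le> h \<bullet> (N *v h)) \<Longrightarrow> F M \<le> F N"
    and F_shift: "\<And>M. transpose M = M \<Longrightarrow> isCont (\<lambda>e. F (M + e *\<^sub>R mat 1)) 0"
    and F_homog: "\<And>M t. transpose M = M \<Longrightarrow> t > 0 \<Longrightarrow> F (t *\<^sub>R M) = t powr a * F M"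
    and F_conj: "\<And>M Q. transpose M = M \<Longrightarrow> orthogonal_matrix Q \<Longrightarrow> F (Q ** M ** transpose Q) = F M"
    and F_one: "F (mat 1) > 0"

section \<open>The operator defined by the structural assumptions\<close>

context
  fixes f :: "real^'n \<Rightarrow> real" and \<Gamma> :: "(real^'n) set"
  assumes str: "structural f \<Gamma>"
begin

lemma structural_add:
  assumes "l \<in> \<Gamma>" "m \<in> pos_cone"
  shows "l + m \<in> \<Gamma>" and "f l \<le> f (l + m)"
  using str assms by (simp_all add: structural_def)

lemma structural_perm: "bij \<sigma> \<Longrightarrow> l \<in> \<Gamma> \<Longrightarrow> perm_vec \<sigma> l \<in> \<Gamma>"
  and structural_fperm: "bij \<sigma> \<Longrightarrow> l \<in> closure \<Gamma> \<Longrightarrow> f (perm_vec \<sigma> l) = f l"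
  and structural_scale: "t > 0 \<Longrightarrow> l \<in> \<Gamma> \<Longrightarrow> t *\<^sub>R l \<in> \<Gamma>"
  and structural_pos: "l \<in> \<Gamma> \<Longrightarrow> f l > 0"
  and structural_homog: "\<exists>a>0. \<forall>lam\<in>closure \<Gamma>. \<forall>t>0. f (t *\<^sub>R lam) = t powr a * f lam"
  using str by (simp_all add: structural_def)

text \<open>Shrink a vector of the cone until every component is below 1; adding the positive
  difference stays in the cone.\<close>

lemma structural_one_mem: "(\<chi> i. 1) \<in> \<Gamma>"
proof -
  obtain l where l: "l \<in> \<Gamma>"
    using str by (auto simp: structural_def)
  define K where "K = 1 + norm l"
  have K: "K > 0" using norm_ge_zero[of l] unfolding K_def by linarith
  have sc: "(1/K) *\<^sub>R l \<in> \<Gamma>"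
    using structural_scale l K by simp
  have "\<bar>l $ i\<bar> < K" for i
    using component_le_norm_cart[of l i] by (simp add: K_def)
  then have "l $ i < K" for i by (meson abs_less_iff)
  then have "(\<chi> i. 1) - (1/K) *\<^sub>R l \<in> pos_cone"
    using K by (simp add: pos_cone_def)
  then have "(1/K) *\<^sub>R l + ((\<chi> i. 1) - (1/K) *\<^sub>R l) \<in> \<Gamma>"
    by (rule structural_add(1)[OF sc])
  then show ?thesis by simp
qed

lemma structural_nonneg: "lam \<in> closure \<Gamma> \<Longrightarrow> f lam \<ge> 0"
proof -
  assume l: "lam \<in> closure \<Gamma>"
  show "f lam \<ge> 0"
  proof (cases "lam \<in> \<Gamma>")
    case True
    then show ?thesis using structural_pos less_imp_le by blast
  next
    case False
    moreover have "open \<Gamma>" using str by (simp add: structural_def)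
    ultimately have "lam \<in> frontier \<Gamma>"
      using l by (simp add: frontier_def interior_open)
    then show ?thesis using str by (simp add: structural_def)
  qed
qed

lemma ext0_nonneg: "ext0 f \<Gamma> lam \<ge> 0"
  using structural_nonneg by (simp add: ext0_def)

lemma continuous_ext0: "continuous_on UNIV (ext0 f \<Gamma>)"
proof -
  have "continuous_on (closure \<Gamma> \<union> closure (- \<Gamma>)) (\<lambda>x. if x \<in> closure \<Gamma> then f x else 0)"
  proof (rule continuous_on_cases)
    show "continuous_on (closure \<Gamma>) f"
      using str by (simp add: structural_def)
    show "\<forall>x. x \<in> closure \<Gamma> \<and> x \<notin> closure \<Gamma> \<or> x \<in> closure (- \<Gamma>) \<and> x \<in> closure \<Gamma> \<longrightarrow> f x = 0"
      using str by (auto simp: structural_def frontier_closures)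
  qed auto
  moreover have "closure \<Gamma> \<union> closure (- \<Gamma>) = UNIV"
    using closure_subset[of \<Gamma>] closure_subset[of "- \<Gamma>"] by blast
  ultimately show ?thesis
    by (simp add: ext0_def[abs_def])
qed

text \<open>The assumptions give monotonicity only from points of the open cone and in strictly
  positive directions. Approximating \<open>lam\<close> from \<open>\<Gamma>\<close> and adding a
  vanishing multiple of the all-ones vector reaches weak inequalities by continuity.\<close>

lemma ext0_mono:
  assumes le: "\<And>i. lam $ i \<le> mu $ i"
  shows "ext0 f \<Gamma> lam \<le> ext0 f \<Gamma> mu"
proof (cases "lam \<in> closure \<Gamma>")
  case True
  then obtain x where x: "\<And>k. x k \<in> \<Gamma>" "x \<longlonglongrightarrow> lam"
    using closure_sequential by blast
  define c where "c k = mu - lam + inverse (real (Suc k)) *\<^sub>R (\<chi> i. 1)" for k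
  have cpos: "c k \<in> pos_cone" for k
  proof -
    have "0 < mu $ i - lam $ i + inverse (real (Suc k))" for i
      using le[of i] by (intro add_nonneg_pos) auto
    then show ?thesis
      unfolding c_def pos_cone_def by (simp del: of_nat_Suc)
  qed
  define y where "y k = x k + c k" for k
  have y\<Gamma>: "y k \<in> \<Gamma>" and fy: "f (x k) \<le> f (y k)" for k
    unfolding y_def by (rule structural_add[OF x(1) cpos])+
  have "c \<longlonglongrightarrow> mu - lam + 0 *\<^sub>R (\<chi> i. 1)"
    unfolding c_def by (intro tendsto_intros LIMSEQ_inverse_real_of_nat)
  then have "y \<longlonglongrightarrow> lam + (mu - lam + 0 *\<^sub>R (\<chi> i. 1))"
    unfolding y_def by (intro tendsto_add x(2))
  then have ylim: "y \<longlonglongrightarrow> mu" by simp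
  have ge: "ext0 f \<Gamma> (x k) \<le> ext0 f \<Gamma> (y k)" for k
    using fy x(1) y\<Gamma> closure_subset[of \<Gamma>] by (auto simp: ext0_def)
  have cont: "(\<lambda>k. ext0 f \<Gamma> (z k)) \<longlonglongrightarrow> ext0 f \<Gamma> l" if "z \<longlonglongrightarrow> l" for z l
    using continuous_on_tendsto_compose[OF continuous_ext0 that] by simp
  show ?thesis
    by (rule LIMSEQ_le[OF cont[OF x(2)] cont[OF ylim]]) (use ge in blast)
next
  case False
  then show ?thesis using ext0_nonneg[of mu] by (simp add: ext0_def)
qed

lemma ext0_perm:
  assumes "bij \<sigma>"
  shows "ext0 f \<Gamma> (perm_vec \<sigma> lam) = ext0 f \<Gamma> lam"
proof -
  have cl: "perm_vec \<tau> l \<in> closure \<Gamma>" if \<tau>: "bij \<tau>" and l: "l \<in> closure \<Gamma>" for \<tau> l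
  proof -
    obtain x where x: "\<And>k. x k \<in> \<Gamma>" "x \<longlonglongrightarrow> l"
      using l closure_sequential by blast
    have "(\<lambda>k. perm_vec \<tau> (x k)) \<longlonglongrightarrow> perm_vec \<tau> l"
      unfolding perm_vec_def by (intro vec_tendstoI) (simp add: tendsto_vec_nth[OF x(2)])
    moreover have "perm_vec \<tau> (x k) \<in> \<Gamma>" for k
      using structural_perm \<tau> x(1) by blast
    ultimately show ?thesis
      unfolding closure_sequential by (intro exI[of _ "\<lambda>k. perm_vec \<tau> (x k)"]) simp
  qed
  have "perm_vec (inv \<sigma>) (perm_vec \<sigma> lam) = lam"
    using assms by (simp add: perm_vec_def vec_eq_iff bij_is_surj surj_f_inv_f)
  then have "perm_vec \<sigma> lam \<in> closure \<Gamma> \<longleftrightarrow> lam \<in> closure \<Gamma>"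
    using cl[OF assms, of lam] cl[OF bij_imp_bij_inv[OF assms], of "perm_vec \<sigma> lam"] by auto
  then show ?thesis
    using structural_fperm[OF assms] by (simp add: ext0_def)
qed

lemma ext0_eigvec_mono:
  assumes "is_eigvec M lam" "is_eigvec N mu" "\<And>h. h \<bullet> (M *v h) \<le> h \<bullet> (N *v h)"
  shows "ext0 f \<Gamma> lam \<le> ext0 f \<Gamma> mu"
proof -
  obtain \<sigma> where \<sigma>: "bij \<sigma>" "\<And>i. lam $ \<sigma> i \<le> mu $ i"
    using eigvec_mono[OF assms] by blast
  have "ext0 f \<Gamma> (perm_vec \<sigma> lam) \<le> ext0 f \<Gamma> mu"
    by (rule ext0_mono) (simp add: perm_vec_def \<sigma>)
  then show ?thesis
    by (simp add: ext0_perm[OF \<sigma>(1)])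
qed

text \<open>\<open>eigs\<close> picks some ordering of the eigenvalues; two-sided monotonicity shows
  that the choice does not matter.\<close>

lemma mat_op_eigvec: "is_eigvec M lam \<Longrightarrow> mat_op f \<Gamma> M = ext0 f \<Gamma> lam"
proof -
  assume l: "is_eigvec M lam"
  then have "is_eigvec M (eigs M)"
    unfolding eigs_def by (rule someI)
  then show ?thesis
    unfolding mat_op_def using ext0_eigvec_mono l by (intro antisym) blast+
qed

lemma conf_op_mat_op: "\<exists>a. conf_op (mat_op f \<Gamma>) a"
proof -
  obtain a where a: "a > 0" "\<And>lam t. lam \<in> closure \<Gamma> \<Longrightarrow> t > 0 \<Longrightarrow> f (t *\<^sub>R lam) = t powr a * f lam"
    using structural_homog by blast
  have homog: "ext0 f \<Gamma> (t *\<^sub>R lam) = t powr a * ext0 f \<Gamma> lam" if t: "t > 0" for t lam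
  proof -
    have cl: "s *\<^sub>R l \<in> closure \<Gamma>" if s: "s > 0" and l: "l \<in> closure \<Gamma>" for s l
    proof -
      obtain x where x: "\<And>k. x k \<in> \<Gamma>" "x \<longlonglongrightarrow> l"
        using l closure_sequential by blast
      have "(\<lambda>k. s *\<^sub>R x k) \<longlonglongrightarrow> s *\<^sub>R l"
        by (intro tendsto_intros x)
      moreover have "s *\<^sub>R x k \<in> \<Gamma>" for k
        using structural_scale s x(1) by blast
      ultimately show ?thesis
        unfolding closure_sequential by (intro exI[of _ "\<lambda>k. s *\<^sub>R x k"]) simp
    qed
    have "t *\<^sub>R lam \<in> closure \<Gamma> \<longleftrightarrow> lam \<in> closure \<Gamma>"
      using cl[of t lam] cl[of "inverse t" "t *\<^sub>R lam"] t by auto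
    then show ?thesis
      using a(2) t by (simp add: ext0_def)
  qed
  have "conf_op (mat_op f \<Gamma>) a"
  proof
    show "a > 0" by (rule a)
  next
    fix M N :: "real^'n^'n"
    assume "transpose M = M" "transpose N = N" "\<And>h. h \<bullet> (M *v h) \<le> h \<bullet> (N *v h)"
    then show "mat_op f \<Gamma> M \<le> mat_op f \<Gamma> N"
      unfolding mat_op_def using ext0_eigvec_mono is_eigvec_eigs by blast
  next
    fix M :: "real^'n^'n"
    assume M: "transpose M = M"
    obtain Q where Q: "orthogonal_matrix Q" "M ** Q = Q ** diag_mat (eigs M)"
      using is_eigvec_eigs[OF M] is_eigvec_iff by blast
    \<comment> \<open>Adding a multiple of the identity keeps the eigenbasis and shifts every
      eigenvalue, so continuity reduces to that of \<open>ext0\<close> along a line.\<close>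
    have "mat_op f \<Gamma> (M + e *\<^sub>R mat 1) = ext0 f \<Gamma> (eigs M + e *\<^sub>R (\<chi> i. 1))" for e
    proof (rule mat_op_eigvec)
      have "(M + e *\<^sub>R mat 1) ** Q = M ** Q + e *\<^sub>R Q"
        by (simp add: vec_eq_iff matrix_matrix_mult_def mat_def distrib_right sum.distrib
            if_distrib[of "\<lambda>z. z * _"] if_distrib[of "(*) _"] cong: if_cong)
      also have "\<dots> = Q ** diag_mat (eigs M + e *\<^sub>R (\<chi> i. 1))"
        unfolding Q(2) by (simp add: vec_eq_iff matrix_mul_diag algebra_simps)
      finally show "is_eigvec (M + e *\<^sub>R mat 1) (eigs M + e *\<^sub>R (\<chi> i. 1))"
        using Q(1) is_eigvec_iff by blast
    qed
    moreover have "isCont (\<lambda>e. ext0 f \<Gamma> (eigs M + e *\<^sub>R (\<chi> i. 1))) 0"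
    proof (rule continuous_at_compose[unfolded o_def, where g="ext0 f \<Gamma>"])
      show "isCont (\<lambda>e::real. eigs M + e *\<^sub>R (\<chi> i. 1)) 0"
        by (intro continuous_intros)
      show "isCont (ext0 f \<Gamma>) (eigs M + 0 *\<^sub>R (\<chi> i. 1))"
        using continuous_ext0 by (simp add: continuous_on_eq_continuous_at)
    qed
    ultimately show "isCont (\<lambda>e. mat_op f \<Gamma> (M + e *\<^sub>R mat 1)) 0"
      by simp
  next
    fix M :: "real^'n^'n" and t :: real
    assume M: "transpose M = M" and t: "t > 0"
    obtain Q where Q: "orthogonal_matrix Q" "M ** Q = Q ** diag_mat (eigs M)"
      using is_eigvec_eigs[OF M] is_eigvec_iff by blast
    have "(t *\<^sub>R M) ** Q = t *\<^sub>R (M ** Q)"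
      by (simp add: vec_eq_iff matrix_matrix_mult_def sum_distrib_left mult.assoc)
    also have "\<dots> = Q ** diag_mat (t *\<^sub>R eigs M)"
      unfolding Q(2) by (simp add: vec_eq_iff matrix_mul_diag algebra_simps)
    finally have "is_eigvec (t *\<^sub>R M) (t *\<^sub>R eigs M)"
      using Q(1) is_eigvec_iff by blast
    then show "mat_op f \<Gamma> (t *\<^sub>R M) = t powr a * mat_op f \<Gamma> M"
      using homog[OF t] mat_op_eigvec by (metis mat_op_def)
  next
    fix M Q :: "real^'n^'n"
    assume M: "transpose M = M" and Q: "orthogonal_matrix Q"
    obtain R where R: "orthogonal_matrix R" "M = R ** diag_mat (eigs M) ** transpose R"
      using is_eigvec_eigs[OF M] is_eigvec_def by blast
    have "Q ** M ** transpose Q = (Q ** R) ** diag_mat (eigs M) ** transpose (Q ** R)"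
      by (subst R(2)) (simp add: matrix_transpose_mul matrix_mul_assoc)
    moreover have "orthogonal_matrix (Q ** R)"
      using Q R(1) by (rule orthogonal_matrix_mul)
    ultimately have "is_eigvec (Q ** M ** transpose Q) (eigs M)"
      unfolding is_eigvec_def by blast
    then show "mat_op f \<Gamma> (Q ** M ** transpose Q) = mat_op f \<Gamma> M"
      by (simp add: mat_op_eigvec mat_op_def[of f \<Gamma> M])
  next
    have "diag_mat (\<chi> i. 1) = (mat 1 :: real^'n^'n)"
      by (simp add: diag_mat_def mat_def vec_eq_iff)
    then have "is_eigvec (mat 1 :: real^'n^'n) (\<chi> i. 1)"
      unfolding is_eigvec_iff using orthogonal_matrix_id by (intro exI[of _ "mat 1"]) simp
    moreover have "f (\<chi> i. 1) > 0" "(\<chi> i. 1) \<in> closure \<Gamma>"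
      using structural_one_mem structural_pos closure_subset by blast+
    ultimately show "mat_op f \<Gamma> (mat 1) > 0"
      by (simp add: mat_op_eigvec ext0_def)
  qed
  then show ?thesis by blast
qed

end

section \<open>Second order jets\<close>

lemma norm_matrix_vector_le:
  fixes M :: "real^'n^'m"
  shows "norm (M *v h) \<le> norm M * norm h"
proof -
  have "norm (M *v h) \<le> L2_set (\<lambda>i. norm (M $ i) * norm h) UNIV"
    unfolding norm_vec_def[of "M *v h"]
  proof (rule L2_set_mono)
    show "norm ((M *v h) $ i) \<le> norm (M $ i) * norm h" for i
      using Cauchy_Schwarz_ineq2[of "M $ i" h]
      by (simp add: matrix_vector_mult_def inner_vec_def)
  qed simp
  also have "\<dots> = norm M * norm h"
    by (simp add: L2_set_left_distrib norm_vec_def[of M])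
  finally show ?thesis .
qed

lemma quad_form_le:
  fixes M :: "real^'n^'n"
  shows "h \<bullet> (M *v h) \<le> norm M * (h \<bullet> h)"
proof -
  have "h \<bullet> (M *v h) \<le> norm h * (norm M * norm h)"
    by (meson norm_matrix_vector_le mult_left_mono norm_cauchy_schwarz norm_ge_zero order_trans)
  then show ?thesis
    by (simp add: power2_norm_eq_inner[symmetric] power2_eq_square mult_ac)
qed

text \<open>The quantified \<open>e\<close> encodes an error o(|h|^2). Jets carry the gradient and
  Hessian of a test function while asking only for local information.\<close>

definition superjet :: "(real^'n \<Rightarrow> real) \<Rightarrow> real^'n \<Rightarrow> real^'n \<Rightarrow> real^'n^'n \<Rightarrow> bool" where
  "superjet u x p X \<longleftrightarrow> transpose X = X \<and>
     (\<forall>e>0. \<forall>\<^sub>F h in nhds 0. u (x + h) \<le> u x + p \<bullet> h + h \<bullet> (X *v h) / 2 + e * (h \<bullet> h))"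

definition subjet :: "(real^'n \<Rightarrow> real) \<Rightarrow> real^'n \<Rightarrow> real^'n \<Rightarrow> real^'n^'n \<Rightarrow> bool" where
  "subjet u x p X \<longleftrightarrow> superjet (\<lambda>y. - u y) x (- p) (- X)"

lemma transpose_uminus [simp]: "transpose (- X) = - transpose X"
  and transpose_add: "transpose (X + Y) = transpose X + transpose Y"
  and transpose_diff: "transpose (X - Y) = transpose X - transpose Y"
  and transpose_scaleR: "transpose (c *\<^sub>R X) = c *\<^sub>R transpose X"
  for X Y :: "real^'n^'m"
  by (simp_all add: transpose_def vec_eq_iff)

lemma uminus_matrix_vector [simp]: "(- X) *v h = - (X *v h)" for X :: "real^'n^'m"
  by (simp add: matrix_vector_mult_def vec_eq_iff sum_negf)

lemma superjet_sym: "superjet u x p X \<Longrightarrow> transpose X = X"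
  by (simp add: superjet_def)

text \<open>The points \<open>x\<close> and \<open>z\<close> may differ: a function whose increments
  are dominated by those at another base point inherits the jets of that point. Sup-convolutions
  rely on this shift.\<close>

lemma superjet_translate:
  assumes "superjet \<phi> z p X" "\<forall>\<^sub>F h in nhds 0. u (x + h) - u x \<le> \<phi> (z + h) - \<phi> z"
  shows "superjet u x p X"
  unfolding superjet_def
proof (intro conjI allI impI)
  show "transpose X = X" using assms(1) by (rule superjet_sym)
  fix e :: real assume "e > 0"
  then have "\<forall>\<^sub>F h in nhds 0. \<phi> (z + h) \<le> \<phi> z + p \<bullet> h + h \<bullet> (X *v h) / 2 + e * (h \<bullet> h)"
    using assms(1) by (simp add: superjet_def)
  with assms(2) show "\<forall>\<^sub>F h in nhds 0. u (x + h) \<le> u x + p \<bullet> h + h \<bullet> (X *v h) / 2 + e * (h \<bullet> h)"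
    by eventually_elim linarith
qed

lemma sym_mat_inner_swap:
  fixes M :: "real^'n^'n"
  assumes "transpose M = M"
  shows "x \<bullet> (M *v y) = y \<bullet> (M *v x)"
proof -
  have "x \<bullet> (M *v y) = (transpose M *v x) \<bullet> y"
    by (metis dot_lmul_matrix transpose_matrix_vector)
  then show ?thesis by (simp add: assms inner_commute)
qed

definition quadr :: "real \<Rightarrow> real^'n \<Rightarrow> real^'n^'n \<Rightarrow> real^'n \<Rightarrow> real^'n \<Rightarrow> real" where
  "quadr c p X z y = c + p \<bullet> (y - z) + (y - z) \<bullet> (X *v (y - z)) / 2"

lemma quadr_shift:
  assumes "transpose X = X"
  shows "quadr c p X z (y + h) = quadr c p X z y + (p + X *v (y - z)) \<bullet> h + h \<bullet> (X *v h) / 2"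
proof -
  define w where "w = y - z"
  have e: "y + h - z = w + h" "y - z = w" by (simp_all add: w_def)
  show ?thesis
    unfolding quadr_def e using sym_mat_inner_swap[OF assms, of h w]
    by (simp add: matrix_vector_right_distrib inner_add_left inner_add_right inner_commute[of "X *v w" h]
         add_divide_distrib)
qed

lemma superjet_quadr:
  assumes "transpose X = X"
  shows "superjet (quadr c p X z) y (p + X *v (y - z)) X"
  unfolding superjet_def quadr_shift[OF assms] using assms by (auto intro!: always_eventually)

lemma uminus_quadr: "- quadr c p X z y = quadr (- c) (- p) (- X) z y"
  by (simp add: quadr_def)

lemma subjet_quadr:
  assumes "transpose X = X"
  shows "subjet (quadr c p X z) y (p + X *v (y - z)) X"
  unfolding subjet_def uminus_quadr using superjet_quadr[of "- X" "- c" "- p" z y] assms by simp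

lemma eventually_nhds_0_ball:
  fixes x :: "'a::real_normed_vector"
  shows "(\<forall>\<^sub>F h in nhds 0. P (x + h)) \<longleftrightarrow> (\<forall>\<^sub>F y in nhds x. P y)"
proof -
  have "nhds x = filtermap (\<lambda>h. x + h) (nhds 0)"
    using filtermap_nhds_shift[of "-x" 0] by (simp add: add.commute)
  then show ?thesis by (simp add: eventually_filtermap)
qed

text \<open>Replace \<open>h\<close> by \<open>t *\<^sub>R h\<close> and let \<open>t\<close>
  decrease to 0: the first order terms force the gradients to agree, and then the second order terms
  order the Hessians.\<close>

lemma superjet_subjet_le:
  assumes A: "superjet u x p X" and B: "subjet u x q Y"
  shows "p = q" and "h \<bullet> (Y *v h) \<le> h \<bullet> (X *v h)"
proof -
  have ev: "\<forall>\<^sub>F h in nhds 0. (q - p) \<bullet> h + h \<bullet> (Y *v h) / 2 \<le> h \<bullet> (X *v h) / 2 + 2 * e * (h \<bullet> h)"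
    if "e > 0" for e
  proof -
    have "\<forall>\<^sub>F h in nhds 0. u (x + h) \<le> u x + p \<bullet> h + h \<bullet> (X *v h) / 2 + e * (h \<bullet> h)"
      using A that by (simp add: superjet_def)
    moreover have "\<forall>\<^sub>F h in nhds 0. - u (x + h) \<le> - u x + (- q) \<bullet> h + h \<bullet> ((- Y) *v h) / 2 + e * (h \<bullet> h)"
      using B that unfolding subjet_def superjet_def by blast
    ultimately show ?thesis
      by eventually_elim (simp add: inner_diff_left)
  qed
  have line: "\<forall>\<^sub>F t in at_right 0. t * ((q - p) \<bullet> h) + t\<^sup>2 * (h \<bullet> (Y *v h) / 2) \<le> t\<^sup>2 * (h \<bullet> (X *v h) / 2 + 2 * e * (h \<bullet> h))"
    if "e > 0" for e h
  proof -
    have "((\<lambda>t. t *\<^sub>R h) \<longlongrightarrow> 0 *\<^sub>R h) (at_right (0::real))"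
      by (intro tendsto_intros)
    then have "filterlim (\<lambda>t. t *\<^sub>R h) (nhds 0) (at_right (0::real))" by simp
    then have "\<forall>\<^sub>F t in at_right (0::real). (q - p) \<bullet> (t *\<^sub>R h) + (t *\<^sub>R h) \<bullet> (Y *v (t *\<^sub>R h)) / 2
        \<le> (t *\<^sub>R h) \<bullet> (X *v (t *\<^sub>R h)) / 2 + 2 * e * ((t *\<^sub>R h) \<bullet> (t *\<^sub>R h))"
      using ev[OF that] unfolding filterlim_iff by blast
    then show ?thesis
      by eventually_elim (simp add: matrix_vector_mult_scaleR power2_eq_square algebra_simps)
  qed
  have le0: "(q - p) \<bullet> h \<le> 0" for h
  proof -
    let ?K = "h \<bullet> (X *v h) / 2 + 2 * 1 * (h \<bullet> h) - h \<bullet> (Y *v h) / 2"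
    have "\<forall>\<^sub>F t in at_right 0. (q - p) \<bullet> h \<le> t * ?K"
      using line[OF zero_less_one, of h] eventually_at_right_less[of "0::real"]
    proof eventually_elim
      case (elim t)
      then have "t * ((q - p) \<bullet> h) \<le> t * (t * ?K)"
        by (simp add: power2_eq_square algebra_simps)
      then show ?case using elim by (simp add: mult_le_cancel_left_pos)
    qed
    moreover have "((\<lambda>t. t * ?K) \<longlongrightarrow> 0 * ?K) (at_right (0::real))"
      by (intro tendsto_intros)
    ultimately show ?thesis
      using tendsto_lowerbound[of "\<lambda>t. t * ?K" "0 * ?K" "at_right (0::real)" "(q - p) \<bullet> h"] by simp
  qed
  have "(q - p) \<bullet> (q - p) \<le> 0" by (rule le0)
  then show pq: "p = q" by (metis inner_ge_zero inner_eq_zero_iff antisym eq_iff_diff_eq_0)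
  show "h \<bullet> (Y *v h) \<le> h \<bullet> (X *v h)"
  proof (rule field_le_epsilon)
    fix d :: real assume d: "d > 0"
    define c where "c = h \<bullet> h + 1"
    have c: "c > 0" unfolding c_def by (intro add_nonneg_pos) simp_all
    define e where "e = d / (4 * c)"
    have e: "e > 0" unfolding e_def using d c by simp
    obtain t where "t * ((q - p) \<bullet> h) + t\<^sup>2 * (h \<bullet> (Y *v h) / 2) \<le> t\<^sup>2 * (h \<bullet> (X *v h) / 2 + 2 * e * (h \<bullet> h))" "0 < t"
      using eventually_happens'[OF trivial_limit_at_right_real
          eventually_conj[OF line[OF e, of h] eventually_at_right_less[of "0::real"]]] by blast
    then have "h \<bullet> (Y *v h) / 2 \<le> h \<bullet> (X *v h) / 2 + 2 * e * (h \<bullet> h)"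
      using pq by (simp add: mult_le_cancel_left_pos)
    moreover have "4 * e * (h \<bullet> h) \<le> d"
    proof -
      have "4 * e * (h \<bullet> h) \<le> 4 * e * c"
        using e by (intro mult_left_mono) (auto simp: c_def)
      also have "\<dots> = d"
        unfolding e_def using c by simp
      finally show ?thesis .
    qed
    ultimately show "h \<bullet> (Y *v h) \<le> h \<bullet> (X *v h) + d" by linarith
  qed
qed

section \<open>Jets of twice differentiable functions\<close>

lemma DERIV_along_line:
  fixes \<phi> :: "'a::real_inner \<Rightarrow> real"
  assumes "(\<phi> has_derivative (\<lambda>h. D \<bullet> h)) (at (y + s *\<^sub>R u))"
  shows "((\<lambda>s. \<phi> (y + s *\<^sub>R u)) has_real_derivative D \<bullet> u) (at s)"
proof -
  have "((\<lambda>s. y + s *\<^sub>R u) has_derivative (\<lambda>t. t *\<^sub>R u)) (at s)"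
    by (auto intro!: derivative_eq_intros)
  from has_derivative_compose[OF this assms]
  show ?thesis
    by (simp add: has_field_derivative_def mult.commute[of "D \<bullet> u"] fun_eq_iff)
      (simp add: mult_commute_abs mult.commute)
qed

context
  fixes \<phi> :: "real^'n \<Rightarrow> real" and D :: "real^'n \<Rightarrow> real^'n" and H :: "real^'n^'n" and x r
  assumes r: "r > 0" and D1: "\<And>y. y \<in> ball x r \<Longrightarrow> (\<phi> has_derivative (\<lambda>h. D y \<bullet> h)) (at y)"
    and D2: "(D has_derivative (\<lambda>h. H *v h)) (at x)"
begin

lemma gradient_expansion:
  assumes "e > 0"
  obtains d where "d > 0" "d \<le> r" "\<And>h. norm h < d \<Longrightarrow> norm (D (x + h) - D x - H *v h) \<le> e * norm h"
proof -
  obtain d where "d > 0" "\<forall>y. norm (y - x) < d \<longrightarrow> norm (D y - D x - H *v (y - x)) \<le> e * norm (y - x)"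
    using D2 assms unfolding has_derivative_at_alt by blast
  then show thesis
    using r by (intro that[of "min d r"]) (auto dest: spec[of _ "x + _"])
qed

text \<open>\<open>C2_with\<close> does not demand a symmetric Hessian, so symmetry is derived, from
  differentiability of the gradient at the single point \<open>x\<close>. The mixed second
  difference of \<open>\<phi>\<close> is symmetric in its two directions, and the mean value theorem
  evaluates it in either order up to o(t^2).\<close>

lemma second_derivative_symmetric: "transpose H = H"
proof -
  have swap: "(H *v v) \<bullet> u = (H *v u) \<bullet> v" for u v
  proof (rule ccontr)
    assume neq: "(H *v v) \<bullet> u \<noteq> (H *v u) \<bullet> v"
    define g where "g = \<bar>(H *v v) \<bullet> u - (H *v u) \<bullet> v\<bar>"
    define n where "n = norm u + norm v + 1"
    have g: "g > 0" using neq by (simp add: g_def)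
    have n: "n > 0" by (simp add: n_def add_nonneg_pos)
    \<comment> \<open>The two evaluations below err by 2 e t^2 n^2 each; this \<open>e\<close> makes
      the total half of the assumed asymmetry.\<close>
    define e where "e = g / (8 * n\<^sup>2)"
    have e: "e > 0" using g n by (simp add: e_def)
    obtain d where d: "d > 0" "d \<le> r" "\<And>h. norm h < d \<Longrightarrow> norm (D (x + h) - D x - H *v h) \<le> e * norm h"
      using gradient_expansion[OF e] by blast
    define t where "t = d / (2 * n)"
    have t: "t > 0" using d n by (simp add: t_def)
    have tn: "t * n < d" using d n by (simp add: t_def)
    define \<Delta> where "\<Delta> = \<phi> (x + t *\<^sub>R u + t *\<^sub>R v) - \<phi> (x + t *\<^sub>R u) - \<phi> (x + t *\<^sub>R v) + \<phi> x"
    have est: "\<bar>\<Delta>' - t\<^sup>2 * ((H *v b) \<bullet> a)\<bar> \<le> 2 * e * t\<^sup>2 * n\<^sup>2"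
      if ab: "norm a + norm b + 1 = n"
        and \<Delta>': "\<Delta>' = \<phi> (x + t *\<^sub>R a + t *\<^sub>R b) - \<phi> (x + t *\<^sub>R a) - \<phi> (x + t *\<^sub>R b) + \<phi> x" for a b \<Delta>'
    proof -
      have small: "norm (t *\<^sub>R b + s *\<^sub>R a) \<le> t * n" "norm (s *\<^sub>R a) \<le> t * n" if "0 \<le> s" "s \<le> t" for s
      proof -
        have "norm (s *\<^sub>R a) \<le> t * norm a" using that by (simp add: mult_right_mono)
        moreover have "norm (t *\<^sub>R b) = t * norm b" using t by simp
        moreover have "t * n = t * norm a + t * norm b + t" using ab by (simp add: algebra_simps flip: ab)
        moreover have "t * norm b \<ge> 0" using t by simp
        ultimately show "norm (t *\<^sub>R b + s *\<^sub>R a) \<le> t * n" "norm (s *\<^sub>R a) \<le> t * n"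
          using norm_triangle_ineq[of "t *\<^sub>R b" "s *\<^sub>R a"] t by linarith+
      qed
      have "\<exists>s. 0 < s \<and> s < t \<and> (\<phi> ((x + t *\<^sub>R b) + t *\<^sub>R a) - \<phi> (x + t *\<^sub>R a)) - (\<phi> ((x + t *\<^sub>R b) + 0 *\<^sub>R a) - \<phi> (x + 0 *\<^sub>R a))
            = (t - 0) * (D ((x + t *\<^sub>R b) + s *\<^sub>R a) \<bullet> a - D (x + s *\<^sub>R a) \<bullet> a)"
      proof (rule MVT2[OF t])
        fix s assume s: "0 \<le> s" "s \<le> t"
        have "norm (t *\<^sub>R b + s *\<^sub>R a) < r" "norm (s *\<^sub>R a) < r"
          using small[OF s] tn d(2) by linarith+
        then have "(x + t *\<^sub>R b) + s *\<^sub>R a \<in> ball x r" "x + s *\<^sub>R a \<in> ball x r"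
          by (simp_all add: dist_norm add.assoc norm_minus_commute add.commute[of "s *\<^sub>R a"])
        then show "((\<lambda>s. \<phi> ((x + t *\<^sub>R b) + s *\<^sub>R a) - \<phi> (x + s *\<^sub>R a)) has_real_derivative
            D ((x + t *\<^sub>R b) + s *\<^sub>R a) \<bullet> a - D (x + s *\<^sub>R a) \<bullet> a) (at s)"
          by (intro DERIV_diff DERIV_along_line D1)
      qed
      then obtain s where s: "0 < s" "s < t"
        and eq: "\<Delta>' = t * ((D (x + (t *\<^sub>R b + s *\<^sub>R a)) - D (x + s *\<^sub>R a)) \<bullet> a)"
        unfolding \<Delta>' by (auto simp: algebra_simps inner_diff_left)
      define w where "w = D (x + (t *\<^sub>R b + s *\<^sub>R a)) - D (x + s *\<^sub>R a) - H *v (t *\<^sub>R b)"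
      have "w = (D (x + (t *\<^sub>R b + s *\<^sub>R a)) - D x - H *v (t *\<^sub>R b + s *\<^sub>R a)) - (D (x + s *\<^sub>R a) - D x - H *v (s *\<^sub>R a))"
        by (simp add: w_def matrix_vector_right_distrib)
      then have "norm w \<le> e * norm (t *\<^sub>R b + s *\<^sub>R a) + e * norm (s *\<^sub>R a)"
        using d(3)[OF le_less_trans[OF small(1)[OF less_imp_le[OF s(1)] less_imp_le[OF s(2)]] tn]]
          d(3)[OF le_less_trans[OF small(2)[OF less_imp_le[OF s(1)] less_imp_le[OF s(2)]] tn]]
          norm_triangle_ineq4[of "D (x + (t *\<^sub>R b + s *\<^sub>R a)) - D x - H *v (t *\<^sub>R b + s *\<^sub>R a)" "D (x + s *\<^sub>R a) - D x - H *v (s *\<^sub>R a)"]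
        by (simp only:)
      also have "\<dots> \<le> e * (t * n) + e * (t * n)"
        using small[of s] s e by (intro add_mono mult_left_mono) auto
      finally have w: "norm w \<le> 2 * e * t * n" by (simp add: mult_ac)
      have "\<Delta>' - t\<^sup>2 * ((H *v b) \<bullet> a) = t * (w \<bullet> a)"
        unfolding eq w_def by (simp add: matrix_vector_mult_scaleR inner_diff_left power2_eq_square algebra_simps)
      also have "\<bar>\<dots>\<bar> \<le> t * (norm w * norm a)"
        using t Cauchy_Schwarz_ineq2[of w a] by (simp add: abs_mult)
      also have "\<dots> \<le> t * ((2 * e * t * n) * n)"
      proof (intro mult_left_mono mult_mono w)
        show "0 \<le> 2 * e * t * n" using e t n by simp
        have "n = norm a + norm b + 1" using ab by simp
        then show "norm a \<le> n" using norm_ge_zero[of b] by linarith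
      qed (use t in simp_all)
      finally show ?thesis by (simp add: power2_eq_square mult_ac)
    qed
    have A: "\<bar>\<Delta> - t\<^sup>2 * ((H *v v) \<bullet> u)\<bar> \<le> 2 * e * t\<^sup>2 * n\<^sup>2"
      by (rule est) (simp_all add: n_def \<Delta>_def)
    have B: "\<bar>\<Delta> - t\<^sup>2 * ((H *v u) \<bullet> v)\<bar> \<le> 2 * e * t\<^sup>2 * n\<^sup>2"
      by (rule est) (simp_all add: n_def \<Delta>_def algebra_simps)
    have "t\<^sup>2 * g = \<bar>t\<^sup>2 * ((H *v v) \<bullet> u) - t\<^sup>2 * ((H *v u) \<bullet> v)\<bar>"
      by (simp add: g_def abs_mult flip: right_diff_distrib)
    also have "\<dots> \<le> 4 * e * t\<^sup>2 * n\<^sup>2"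
      using A B by linarith
    also have "\<dots> = t\<^sup>2 * (g / 2)"
      using n by (simp add: e_def)
    finally show False using t g by simp
  qed
  show ?thesis
  proof -
    have "H $ i $ j = H $ j $ i" for i j
      using swap[of "axis i 1" "axis j 1"]
      by (simp add: inner_axis matrix_vector_mult_basis column_def)
    then show ?thesis by (simp add: transpose_def vec_eq_iff)
  qed
qed

lemma taylor_second_order:
  assumes "e > 0"
  shows "\<forall>\<^sub>F h in nhds 0. \<bar>\<phi> (x + h) - \<phi> x - D x \<bullet> h - h \<bullet> (H *v h) / 2\<bar> \<le> e * (h \<bullet> h)"
proof -
  obtain d where d: "d > 0" "d \<le> r" "\<And>h. norm h < d \<Longrightarrow> norm (D (x + h) - D x - H *v h) \<le> e * norm h"
    using gradient_expansion[OF assms] by blast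
  have "\<bar>\<phi> (x + h) - \<phi> x - D x \<bullet> h - h \<bullet> (H *v h) / 2\<bar> \<le> e * (h \<bullet> h)" if h: "norm h < d" for h
  proof -
    define g where "g s = \<phi> (x + s *\<^sub>R h) - s * (D x \<bullet> h) - s\<^sup>2 * (h \<bullet> (H *v h) / 2)" for s
    have small: "norm (s *\<^sub>R h) < d" if "0 \<le> s" "s \<le> 1" for s
    proof -
      have "norm (s *\<^sub>R h) \<le> 1 * norm h" using that by (simp add: mult_left_le_one_le)
      then show ?thesis using h by simp
    qed
    have "\<exists>s. 0 < s \<and> s < 1 \<and> g 1 - g 0 = (1 - 0) * (D (x + s *\<^sub>R h) \<bullet> h - D x \<bullet> h - s * (h \<bullet> (H *v h)))"
    proof (rule MVT2)
      fix s :: real assume s: "0 \<le> s" "s \<le> 1"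
      have "x + s *\<^sub>R h \<in> ball x r"
        using small[OF s] d(2) by (simp add: dist_norm)
      then have "((\<lambda>s. \<phi> (x + s *\<^sub>R h)) has_real_derivative D (x + s *\<^sub>R h) \<bullet> h) (at s)"
        by (intro DERIV_along_line D1)
      then show "(g has_real_derivative D (x + s *\<^sub>R h) \<bullet> h - D x \<bullet> h - s * (h \<bullet> (H *v h))) (at s)"
        unfolding g_def by (auto intro!: derivative_eq_intros)
    qed simp
    then obtain s where s: "0 < s" "s < 1"
      and eq': "g 1 - g 0 = (1 - 0) * (D (x + s *\<^sub>R h) \<bullet> h - D x \<bullet> h - s * (h \<bullet> (H *v h)))"
      by blast
    have eq: "g 1 - g 0 = (D (x + s *\<^sub>R h) - D x - H *v (s *\<^sub>R h)) \<bullet> h"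
      unfolding eq' by (simp add: inner_diff_left matrix_vector_mult_scaleR inner_commute[of "H *v h"])
    have "\<bar>g 1 - g 0\<bar> \<le> norm (D (x + s *\<^sub>R h) - D x - H *v (s *\<^sub>R h)) * norm h"
      unfolding eq by (rule Cauchy_Schwarz_ineq2)
    also have "\<dots> \<le> (e * norm (s *\<^sub>R h)) * norm h"
      using d(3)[OF small[of s]] s by (intro mult_right_mono) simp_all
    also have "\<dots> \<le> (e * norm h) * norm h"
      using s assms by (intro mult_right_mono mult_left_mono) (auto simp: mult_left_le_one_le)
    also have "\<dots> = e * (h \<bullet> h)"
      by (simp add: power2_norm_eq_inner[symmetric] power2_eq_square)
    finally show ?thesis by (simp add: g_def algebra_simps)
  qed
  then show ?thesis
    unfolding eventually_nhds_metric using d(1) by (auto simp: dist_norm)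
qed

lemma superjet_twice_diff: "superjet \<phi> x (D x) H"
  unfolding superjet_def
proof (intro conjI allI impI second_derivative_symmetric)
  fix e :: real assume "e > 0"
  from taylor_second_order[OF this]
  show "\<forall>\<^sub>F h in nhds 0. \<phi> (x + h) \<le> \<phi> x + D x \<bullet> h + h \<bullet> (H *v h) / 2 + e * (h \<bullet> h)"
    by eventually_elim linarith
qed

lemma subjet_twice_diff: "subjet \<phi> x (D x) H"
  unfolding superjet_def subjet_def
proof (intro conjI allI impI)
  show "transpose (- H) = - H" by (simp add: second_derivative_symmetric)
  fix e :: real assume "e > 0"
  from taylor_second_order[OF this]
  show "\<forall>\<^sub>F h in nhds 0. - \<phi> (x + h) \<le> - \<phi> x + - D x \<bullet> h + h \<bullet> ((- H) *v h) / 2 + e * (h \<bullet> h)"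
    by eventually_elim (simp add: abs_le_iff)
qed

end

section \<open>Second differences of Lipschitz functions\<close>

lemma integral_translate_lborel:
  fixes f :: "'a::euclidean_space \<Rightarrow> real"
  assumes "f \<in> borel_measurable borel"
  shows "(\<integral>x. f (x + c) \<partial>lborel) = integral\<^sup>L lborel f"
    and "integrable lborel f \<Longrightarrow> integrable lborel (\<lambda>x. f (x + c))"
proof -
  have "integral\<^sup>L lborel f = integral\<^sup>L (distr lborel borel ((+) c)) f"
    by (simp add: lborel_distr_plus)
  also have "\<dots> = (\<integral>x. f (c + x) \<partial>lborel)"
    by (subst integral_distr) (use assms in auto)
  finally show "(\<integral>x. f (x + c) \<partial>lborel) = integral\<^sup>L lborel f"
    by (simp add: add.commute)
  assume "integrable lborel f"
  then have "integrable (distr lborel borel ((+) c)) f"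
    by (simp add: lborel_distr_plus)
  then have "integrable lborel (\<lambda>x. f (c + x))"
    by (subst (asm) integrable_distr_eq) (use assms in auto)
  then show "integrable lborel (\<lambda>x. f (x + c))"
    by (simp add: add.commute)
qed

lemma integral_bounded_support:
  fixes g :: "'a::euclidean_space \<Rightarrow> real"
  assumes "continuous_on UNIV g" "\<And>x. \<bar>g x\<bar> \<le> K" "\<And>x. norm x > S \<Longrightarrow> g x = 0"
  shows "integrable lborel g" "integral\<^sup>L lborel g \<le> K * measure lborel (cball (0::'a) S)"
proof -
  have fin: "emeasure lborel (cball (0::'a) S) < \<infinity>"
    by (rule emeasure_lborel_cball_finite)
  have int: "integrable lborel (\<lambda>x::'a. K * indicator (cball 0 S) x)"
    using fin by (intro integrable_mult_right integrable_real_indicator) auto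
  have K: "0 \<le> K" using assms(2)[of 0] by linarith
  have le: "\<bar>g x\<bar> \<le> K * indicator (cball 0 S) x" for x
    using assms(2)[of x] assms(3)[of x] by (cases "norm x > S") (auto simp: indicator_def)
  have meas: "g \<in> borel_measurable lborel"
    using borel_measurable_continuous_onI[OF assms(1)] by simp
  show I: "integrable lborel g"
  proof (rule Bochner_Integration.integrable_bound[OF int meas], rule AE_I2)
    show "norm (g x) \<le> norm (K * indicator (cball 0 S) x)" for x
      unfolding real_norm_def by (rule order_trans[OF le abs_ge_self])
  qed
  have "integral\<^sup>L lborel g \<le> (\<integral>x. K * indicator (cball (0::'a) S) x \<partial>lborel)"
    by (rule integral_mono[OF I int]) (rule abs_le_D1[OF le])
  then show "integral\<^sup>L lborel g \<le> K * measure lborel (cball (0::'a) S)"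
    by simp
qed

text \<open>Summable integrals of squares give a pointwise finite series almost everywhere, whose
  terms tend to 0.\<close>

lemma AE_tendsto_zero_of_bounded_integrals:
  fixes D :: "nat \<Rightarrow> 'a::euclidean_space \<Rightarrow> real"
  assumes int: "\<And>k. integrable lborel (\<lambda>x. (D k x)\<^sup>2)" and meas: "\<And>k. D k \<in> borel_measurable lborel"
    and bd: "\<And>N. (\<Sum>k<N. \<integral>x. (D k x)\<^sup>2 \<partial>lborel) \<le> C"
  shows "AE x in lborel. (\<lambda>k. D k x) \<longlonglongrightarrow> 0"
proof -
  have mb: "(\<lambda>x. ennreal ((D k x)\<^sup>2)) \<in> borel_measurable lborel" for k
    using meas[of k] by (intro measurable_compose[OF _ measurable_ennreal] borel_measurable_power)
  have nn: "(\<integral>\<^sup>+x. ennreal ((D k x)\<^sup>2) \<partial>lborel) = ennreal (\<integral>x. (D k x)\<^sup>2 \<partial>lborel)" for k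
    by (rule nn_integral_eq_integral[OF int]) simp
  have summ: "summable (\<lambda>k. \<integral>x. (D k x)\<^sup>2 \<partial>lborel)"
    by (rule summableI_nonneg_bounded[OF _ bd]) simp
  have "(\<integral>\<^sup>+x. (\<Sum>k. ennreal ((D k x)\<^sup>2)) \<partial>lborel) = (\<Sum>k. \<integral>\<^sup>+x. ennreal ((D k x)\<^sup>2) \<partial>lborel)"
    by (intro nn_integral_suminf mb)
  also have "\<dots> = ennreal (\<Sum>k. \<integral>x. (D k x)\<^sup>2 \<partial>lborel)"
    unfolding nn by (rule suminf_ennreal2[OF _ summ]) simp
  finally have "(\<integral>\<^sup>+x. (\<Sum>k. ennreal ((D k x)\<^sup>2)) \<partial>lborel) \<noteq> \<infinity>"
    by simp
  then have "AE x in lborel. (\<Sum>k. ennreal ((D k x)\<^sup>2)) \<noteq> \<infinity>"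
    by (intro nn_integral_PInf_AE borel_measurable_suminf_order mb)
  then show ?thesis
  proof eventually_elim
    case (elim x)
    then have "summable (\<lambda>k. (D k x)\<^sup>2)"
      by (intro summable_suminf_not_top) auto
    then have "(\<lambda>k. (D k x)\<^sup>2) \<longlonglongrightarrow> 0"
      by (rule summable_LIMSEQ_zero)
    then have "(\<lambda>k. sqrt ((D k x)\<^sup>2)) \<longlonglongrightarrow> sqrt 0"
      by (rule tendsto_real_sqrt)
    then show ?case
      by (simp add: tendsto_rabs_zero_iff)
  qed
qed

text \<open>A second difference with step h v, based at x + h b, for h = 2^-k, divided by h to the
  first power. Its vanishing for all \<open>b\<close> and \<open>v\<close> says that the difference
  quotients of \<open>f\<close> at \<open>x\<close> become affine in the limit, without claiming
  that they converge.\<close>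

definition second_diff :: "('a::real_vector \<Rightarrow> real) \<Rightarrow> nat \<Rightarrow> 'a \<Rightarrow> 'a \<Rightarrow> 'a \<Rightarrow> real" where
  "second_diff f k b v x = (f (x + (1/2)^k *\<^sub>R (b + 2 *\<^sub>R v)) - 2 * f (x + (1/2)^k *\<^sub>R (b + v))
     + f (x + (1/2)^k *\<^sub>R b)) / (1/2)^k"

text \<open>The Dirichlet energies of the dyadic difference quotients are bounded and increase with \<open>k\<close>;
  by the parallelogram law their increments are the squared norms of the second differences.\<close>

lemma AE_second_diff_compact_support:
  fixes f :: "'a::euclidean_space \<Rightarrow> real"
  assumes lip: "\<And>x y. \<bar>f x - f y\<bar> \<le> L * norm (x - y)" and supp: "\<And>x. norm x > R \<Longrightarrow> f x = 0"
  shows "AE x in lborel. (\<lambda>k. second_diff f k b v x) \<longlonglongrightarrow> 0"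
proof -
  define h where "h k = (1/2::real)^k" for k
  have h: "0 < h k" "h k \<le> 1" for k by (auto simp: h_def power_le_one)
  have hS: "h k = 2 * h (Suc k)" for k by (simp add: h_def)
  have cont: "continuous_on UNIV f"
  proof (rule lipschitz_on_continuous_on[of "\<bar>L\<bar>"], rule lipschitz_onI)
    show "dist (f x) (f y) \<le> \<bar>L\<bar> * dist x y" for x y
      using lip[of x y] mult_right_mono[OF abs_ge_self[of L] norm_ge_zero[of "x - y"]]
      by (simp add: dist_norm)
  qed simp
  have contc: "continuous_on UNIV (\<lambda>x. f (g x))" if "continuous_on UNIV g" for g :: "'a \<Rightarrow> 'a"
    by (rule continuous_on_compose2[OF cont that]) simp
  define q where "q k x = (f (x + h k *\<^sub>R v) - f x) / h k" for k x
  define C where "C = (L * norm v)\<^sup>2 * measure lborel (cball (0::'a) (R + norm v))"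
  have cq: "continuous_on UNIV (q k)" for k
    unfolding q_def using h[of k] by (intro continuous_intros contc) auto
  have qb: "\<bar>q k x\<bar> \<le> L * norm v" for k x
    using lip[of "x + h k *\<^sub>R v" x] h[of k] by (simp add: q_def abs_mult field_simps)
  have qs: "q k x = 0" if "norm x > R + norm v" for k x
  proof -
    have "norm (h k *\<^sub>R v) \<le> norm v"
      using h[of k] by (simp add: mult_left_le_one_le)
    then have "norm (x + h k *\<^sub>R v) > R" "norm x > R"
      using that norm_triangle_ineq4[of "x + h k *\<^sub>R v" "h k *\<^sub>R v"] norm_ge_zero[of v] by (auto simp del: norm_ge_zero)
    then show ?thesis by (simp add: q_def supp)
  qed
  have q2: "integrable lborel (\<lambda>x. (q k x)\<^sup>2)" "(\<integral>x. (q k x)\<^sup>2 \<partial>lborel) \<le> C" for k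
  proof -
    have b: "\<bar>(q k x)\<^sup>2\<bar> \<le> (L * norm v)\<^sup>2" for x
      using power_mono[OF qb abs_ge_zero, of k x 2] by simp
    have c: "continuous_on UNIV (\<lambda>x. (q k x)\<^sup>2)"
      by (intro continuous_intros cq)
    have s: "(q k x)\<^sup>2 = 0" if "norm x > R + norm v" for x
      using qs[OF that] by simp
    show "integrable lborel (\<lambda>x. (q k x)\<^sup>2)" "(\<integral>x. (q k x)\<^sup>2 \<partial>lborel) \<le> C"
      unfolding C_def by (rule integral_bounded_support[OF c b s]; assumption)+
  qed
  have mq: "(\<lambda>x. (q k x)\<^sup>2) \<in> borel_measurable borel" for k
    by (intro borel_measurable_continuous_onI continuous_intros cq)
  define E where "E k = (\<integral>x. (q k x)\<^sup>2 \<partial>lborel)" for k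
  define D where "D k x = q k (x + h k *\<^sub>R v) - q k x" for k x
  \<comment> \<open>The quotient at scale k is the mean of two quotients at scale k + 1, and this is
    |A - B|^2 = 2 A^2 + 2 B^2 - 4 ((A + B) / 2)^2.\<close>
  have par: "(D (Suc k) x)\<^sup>2 = 2 * (q (Suc k) x)\<^sup>2 + 2 * (q (Suc k) (x + h (Suc k) *\<^sub>R v))\<^sup>2 - 4 * (q k x)\<^sup>2" for k x
  proof -
    have qq: "q k x = (q (Suc k) x + q (Suc k) (x + h (Suc k) *\<^sub>R v)) / 2"
    proof -
      define H where "H = h (Suc k)"
      have H: "H > 0" using h(1) by (simp add: H_def)
      have e: "x + h k *\<^sub>R v = x + H *\<^sub>R v + H *\<^sub>R v"
        unfolding hS[of k] H_def[symmetric] by (simp add: scaleR_add_left[symmetric])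
      show ?thesis
        unfolding q_def e unfolding hS[of k] H_def[symmetric] using H by (simp add: field_simps)
    qed
    show ?thesis
      unfolding D_def qq by (simp add: power2_eq_square field_simps)
  qed
  have intD: "integrable lborel (\<lambda>x. (D (Suc k) x)\<^sup>2)"
    and valD: "(\<integral>x. (D (Suc k) x)\<^sup>2 \<partial>lborel) = 4 * (E (Suc k) - E k)" for k
  proof -
    note t = integral_translate_lborel[OF mq, of "Suc k" "h (Suc k) *\<^sub>R v"]
    show "integrable lborel (\<lambda>x. (D (Suc k) x)\<^sup>2)"
      unfolding par using q2(1) t(2) by (intro Bochner_Integration.integrable_diff Bochner_Integration.integrable_add integrable_mult_right) auto
    show "(\<integral>x. (D (Suc k) x)\<^sup>2 \<partial>lborel) = 4 * (E (Suc k) - E k)"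
      unfolding par E_def using q2(1) t by simp
  qed
  \<comment> \<open>The base point moves with \<open>k\<close>, but integrals do not notice the
    translation, so every offset \<open>b\<close> obeys the same bound as
    \<open>b = 0\<close>.\<close>
  define D' where "D' k x = D (Suc k) (x + h (Suc k) *\<^sub>R b)" for k x
  have mD: "(\<lambda>x. (D k x)\<^sup>2) \<in> borel_measurable borel" for k
    unfolding D_def by (intro borel_measurable_continuous_onI continuous_on_power continuous_on_diff
        cq continuous_on_compose2[OF cq, of UNIV "\<lambda>x. x + h k *\<^sub>R v"] continuous_intros subset_UNIV)
  have mD': "D' k \<in> borel_measurable lborel" for k
  proof -
    have "continuous_on UNIV (\<lambda>x. q (Suc k) (x + c))" for c
      by (intro continuous_on_compose2[OF cq, of UNIV "\<lambda>x. x + c"] continuous_intros subset_UNIV)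
    then have "continuous_on UNIV (D' k)"
      unfolding D'_def D_def add.assoc by (intro continuous_on_diff)
    then show ?thesis
      using borel_measurable_continuous_onI by simp
  qed
  have "AE x in lborel. (\<lambda>k. D' k x) \<longlonglongrightarrow> 0"
  proof (rule AE_tendsto_zero_of_bounded_integrals[where C="4 * C"])
    show "integrable lborel (\<lambda>x. (D' k x)\<^sup>2)" for k
      unfolding D'_def by (rule integral_translate_lborel(2)[OF mD intD])
    have eq: "(\<integral>x. (D' k x)\<^sup>2 \<partial>lborel) = 4 * (E (Suc k) - E k)" for k
      unfolding D'_def valD[symmetric] by (rule integral_translate_lborel(1)[OF mD])
    have E0: "E 0 \<ge> 0" by (simp add: E_def)
    show "(\<Sum>k<N. \<integral>x. (D' k x)\<^sup>2 \<partial>lborel) \<le> 4 * C" for N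
    proof -
      have "(\<Sum>k<N. \<integral>x. (D' k x)\<^sup>2 \<partial>lborel) = 4 * (E N - E 0)"
        unfolding eq sum_distrib_left[symmetric] by (simp add: sum_lessThan_telescope)
      moreover have "E N \<le> C" using q2(2)[of N] by (simp add: E_def)
      ultimately show ?thesis using E0 by argo
    qed
    show "D' k \<in> borel_measurable lborel" for k by (rule mD')
  qed
  then show ?thesis
  proof eventually_elim
    case (elim x)
    have "D' k x = second_diff f (Suc k) b v x" for k
    proof -
      have e1: "x + h (Suc k) *\<^sub>R b + h (Suc k) *\<^sub>R v + h (Suc k) *\<^sub>R v = x + h (Suc k) *\<^sub>R (b + 2 *\<^sub>R v)"
        by (simp add: algebra_simps scaleR_2)
      have e2: "x + h (Suc k) *\<^sub>R b + h (Suc k) *\<^sub>R v = x + h (Suc k) *\<^sub>R (b + v)"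
        by (simp add: algebra_simps)
      show ?thesis
        unfolding D'_def D_def q_def second_diff_def h_def[symmetric] e1 unfolding e2
        by (simp add: diff_divide_distrib add_divide_distrib)
    qed
    with elim have "(\<lambda>k. second_diff f (Suc k) b v x) \<longlonglongrightarrow> 0" by simp
    then show ?case by (rule LIMSEQ_imp_Suc)
  qed
qed

text \<open>The bound is uniform in \<open>k\<close>, so convergence for a dense set of
  \<open>b\<close> and \<open>v\<close> extends to all of them.\<close>

lemma second_diff_lipschitz:
  assumes lip: "\<And>x y. \<bar>f x - f y\<bar> \<le> L * norm (x - y)" and L: "L \<ge> 0"
  shows "\<bar>second_diff f k b v x - second_diff f k b' v' x\<bar> \<le> 4 * L * (norm (b - b') + norm (v - v'))"
proof -
  define h where "h = (1/2::real)^k"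
  have h: "h > 0" by (simp add: h_def)
  have le: "\<bar>f (x + h *\<^sub>R c) - f (x + h *\<^sub>R c')\<bar> \<le> h * (L * norm (c - c'))" for c c'
    using lip[of "x + h *\<^sub>R c" "x + h *\<^sub>R c'"] h by (simp flip: scaleR_diff_right add: mult_ac)
  have n1: "norm ((b + 2 *\<^sub>R v) - (b' + 2 *\<^sub>R v')) \<le> norm (b - b') + 2 * norm (v - v')"
  proof -
    have e: "(b + 2 *\<^sub>R v) - (b' + 2 *\<^sub>R v') = (b - b') + 2 *\<^sub>R (v - v')" by (simp add: algebra_simps)
    show ?thesis unfolding e using norm_triangle_ineq[of "b - b'" "2 *\<^sub>R (v - v')"] by simp
  qed
  have n2: "norm ((b + v) - (b' + v')) \<le> norm (b - b') + norm (v - v')"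
    by (metis add_diff_add norm_triangle_ineq)
  let ?A = "f (x + h *\<^sub>R (b + 2 *\<^sub>R v)) - f (x + h *\<^sub>R (b' + 2 *\<^sub>R v'))"
  let ?B = "f (x + h *\<^sub>R (b + v)) - f (x + h *\<^sub>R (b' + v'))"
  let ?C = "f (x + h *\<^sub>R b) - f (x + h *\<^sub>R b')"
  have "second_diff f k b v x - second_diff f k b' v' x = (?A - 2 * ?B + ?C) / h"
    unfolding second_diff_def h_def[symmetric] by (simp add: diff_divide_distrib add_divide_distrib algebra_simps)
  also have "\<bar>\<dots>\<bar> = \<bar>?A - 2 * ?B + ?C\<bar> / h" using h by simp
  also have "\<dots> \<le> (h * (4 * L * (norm (b - b') + norm (v - v')))) / h"
  proof (rule divide_right_mono)
    have "\<bar>?A\<bar> \<le> h * (L * (norm (b - b') + 2 * norm (v - v')))"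
      by (rule order_trans[OF le]) (use n1 h L in \<open>intro mult_left_mono; simp\<close>)
    moreover have "\<bar>?B\<bar> \<le> h * (L * (norm (b - b') + norm (v - v')))"
      by (rule order_trans[OF le]) (use n2 h L in \<open>intro mult_left_mono; simp\<close>)
    moreover have "\<bar>?C\<bar> \<le> h * (L * norm (b - b'))" by (rule le)
    ultimately show "\<bar>?A - 2 * ?B + ?C\<bar> \<le> h * (4 * L * (norm (b - b') + norm (v - v')))"
      by (simp add: algebra_simps)
  qed (use h in simp)
  finally show ?thesis using h by simp
qed

text \<open>One null set serves all \<open>b\<close> and \<open>v\<close>: the compactly supported
  case is applied to truncations on balls of every integer radius and to a countable dense set of
  directions.\<close>

proposition second_diff_tendsto_0:
  fixes f :: "'a::euclidean_space \<Rightarrow> real"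
  assumes lip: "\<And>x y. \<bar>f x - f y\<bar> \<le> L * norm (x - y)" and L: "L > 0"
  obtains N where "negligible N" "\<And>x b v. x \<notin> N \<Longrightarrow> (\<lambda>k. second_diff f k b v x) \<longlonglongrightarrow> 0"
proof -
  obtain Q :: "'a set" where Q: "countable Q" "\<And>X. open X \<Longrightarrow> X \<noteq> {} \<Longrightarrow> \<exists>d\<in>Q. d \<in> X"
    using countable_dense_exists by blast
  \<comment> \<open>On the ball of radius \<open>R\<close> the cone \<open>g R\<close> with this
    height exceeds |f|, so the truncation between \<open>- g R\<close> and \<open>g R\<close>
    changes nothing there; outside a larger ball it is 0.\<close>
  define M where "M R = \<bar>f 0\<bar> + 2 * L * real R" for R
  define g where "g R x = max 0 (M R - L * norm x)" for R and x :: 'a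
  define F where "F R x = max (- g R x) (min (f x) (g R x))" for R x
  have lg: "\<bar>g R x - g R y\<bar> \<le> L * norm (x - y)" for R x y
  proof -
    have "\<bar>L * norm x - L * norm y\<bar> \<le> L * norm (x - y)"
      using L norm_triangle_ineq3[of x y] by (simp add: abs_mult flip: right_diff_distrib)
    moreover have "0 \<le> L * norm (x - y)" using L by simp
    ultimately show ?thesis unfolding g_def max_def by (auto simp: abs_le_iff)
  qed
  have lF: "\<bar>F R x - F R y\<bar> \<le> L * norm (x - y)" for R x y
    using lg[of R x y] lip[of x y] unfolding F_def min_def max_def by (auto simp: abs_le_iff)
  have sF: "F R x = 0" if "norm x > M R / L" for R x
  proof -
    have "L * norm x > M R" using that L by (simp add: field_simps)
    then have "g R x = 0" by (simp add: g_def)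
    then show ?thesis by (simp add: F_def)
  qed
  have Ff: "F R x = f x" if "norm x \<le> real R" for R x
  proof -
    have "L * norm x \<le> L * real R" using that L by simp
    moreover have "\<bar>f x\<bar> \<le> \<bar>f 0\<bar> + L * norm x" using lip[of x 0] by simp
    ultimately have "\<bar>f x\<bar> \<le> g R x" unfolding g_def M_def by simp
    then show ?thesis unfolding F_def by (auto simp: abs_le_iff)
  qed
  have "AE x in lborel. \<forall>R. \<forall>b\<in>Q. \<forall>v\<in>Q. (\<lambda>k. second_diff (F R) k b v x) \<longlonglongrightarrow> 0"
    using Q(1) AE_second_diff_compact_support[OF lF sF]
    by (simp add: AE_all_countable AE_ball_countable)
  then obtain N where N: "N \<in> null_sets lborel"
    "{x. \<not> (\<forall>R. \<forall>b\<in>Q. \<forall>v\<in>Q. (\<lambda>k. second_diff (F R) k b v x) \<longlonglongrightarrow> 0)} \<subseteq> N"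
    by (auto elim!: AE_E simp: null_sets_def)
  have "negligible N"
    unfolding negligible_iff_null_sets using N(1) by (rule null_sets_completionI)
  moreover have "(\<lambda>k. second_diff f k b v x) \<longlonglongrightarrow> 0" if x: "x \<notin> N" for x b v
  proof (rule LIMSEQ_I)
    fix e :: real assume e: "e > 0"
    \<comment> \<open>Moving \<open>b\<close> and \<open>v\<close> by less than \<open>d\<close>
      costs at most 4 L (d + d) = e / 2.\<close>
    define d where "d = e / (16 * L)"
    have d: "d > 0" using e L by (simp add: d_def)
    obtain b' where b': "b' \<in> Q" "b' \<in> ball b d" using Q(2)[of "ball b d"] d by auto
    obtain v' where v': "v' \<in> Q" "v' \<in> ball v d" using Q(2)[of "ball v d"] d by auto
    define S where "S = norm x + norm b' + 2 * norm v'"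
    obtain R :: nat where R: "S < real R" using reals_Archimedean2 by blast
    have lim: "(\<lambda>k. second_diff (F R) k b' v' x) \<longlonglongrightarrow> 0"
      using x N(2) b'(1) v'(1) by blast
    have same: "second_diff (F R) k b' v' x = second_diff f k b' v' x" for k
    proof -
      have h: "0 \<le> (1/2::real)^k" "(1/2::real)^k \<le> 1" by (auto simp: power_le_one)
      have *: "norm (x + (1/2)^k *\<^sub>R c) \<le> real R" if "norm c \<le> norm b' + 2 * norm v'" for c
      proof -
        have "norm ((1/2)^k *\<^sub>R c) \<le> norm c" using h by (simp add: mult_left_le_one_le)
        then show ?thesis using norm_triangle_ineq[of x "(1/2)^k *\<^sub>R c"] that R unfolding S_def by linarith
      qed
      have "norm (b' + 2 *\<^sub>R v') \<le> norm b' + 2 * norm v'"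
        using norm_triangle_ineq[of b' "2 *\<^sub>R v'"] by simp
      moreover have "norm (b' + v') \<le> norm b' + 2 * norm v'"
        using norm_triangle_ineq[of b' v'] norm_ge_zero[of v'] by linarith
      ultimately show ?thesis
        unfolding second_diff_def by (simp add: Ff *)
    qed
    obtain n where n: "\<And>k. k \<ge> n \<Longrightarrow> \<bar>second_diff f k b' v' x\<bar> < e / 2"
      using LIMSEQ_D[OF lim, of "e / 2"] e unfolding same by auto
    have "norm (second_diff f k b v x - 0) < e" if k: "k \<ge> n" for k
    proof -
      have "\<bar>second_diff f k b v x - second_diff f k b' v' x\<bar> \<le> 4 * L * (norm (b - b') + norm (v - v'))"
        using second_diff_lipschitz[OF lip] L by simp
      also have "\<dots> \<le> 4 * L * (d + d)"
        using b'(2) v'(2) L by (intro mult_left_mono add_mono) (auto simp: dist_norm)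
      also have "\<dots> = e / 2" using L by (simp add: d_def)
      finally show ?thesis using n[OF k] unfolding real_norm_def by linarith
    qed
    then show "\<exists>no. \<forall>k\<ge>no. norm (second_diff f k b v x - 0) < e" by blast
  qed
  ultimately show thesis using that by blast
qed

section \<open>The theorem on sums\<close>

text \<open>A supporting paraboloid at every point expresses convexity of A + c/2 |x|^2 and supplies
  subgradients directly.\<close>

definition semiconvex :: "real \<Rightarrow> ('a::real_inner \<Rightarrow> real) \<Rightarrow> bool" where
  "semiconvex c A \<longleftrightarrow> (\<forall>x. \<exists>s. \<forall>y. A y \<ge> A x + s \<bullet> (y - x) - c / 2 * ((y - x) \<bullet> (y - x)))"

lemma semiconvexD:
  assumes "semiconvex c A"
  obtains s where "\<And>h. A (x + h) \<ge> A x + s \<bullet> h - c / 2 * (h \<bullet> h)"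
proof -
  obtain s where s: "\<And>y. A y \<ge> A x + s \<bullet> (y - x) - c / 2 * ((y - x) \<bullet> (y - x))"
    using assms unfolding semiconvex_def by blast
  show thesis
    by (rule that[of s]) (use s[of "x + _"] in simp)
qed

lemma semiconvex_mono: "semiconvex c A \<Longrightarrow> c \<le> d \<Longrightarrow> semiconvex d A"
  unfolding semiconvex_def
proof (intro allI)
  fix x assume A: "\<forall>x. \<exists>s. \<forall>y. A y \<ge> A x + s \<bullet> (y - x) - c / 2 * ((y - x) \<bullet> (y - x))" and cd: "c \<le> d"
  then obtain s where s: "\<And>y. A y \<ge> A x + s \<bullet> (y - x) - c / 2 * ((y - x) \<bullet> (y - x))" by blast
  have "A y \<ge> A x + s \<bullet> (y - x) - d / 2 * ((y - x) \<bullet> (y - x))" for y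
    using s[of y] mult_right_mono[OF cd inner_ge_zero[of "y - x"]] by linarith
  then show "\<exists>s. \<forall>y. A y \<ge> A x + s \<bullet> (y - x) - d / 2 * ((y - x) \<bullet> (y - x))" by blast
qed

lemma semiconvex_continuous:
  fixes A :: "'a::euclidean_space \<Rightarrow> real"
  assumes "semiconvex c A"
  shows "continuous_on UNIV A"
proof -
  define g where "g x = A x + c / 2 * (x \<bullet> x)" for x
  have sup: "\<exists>s. \<forall>w. g w \<ge> g z + s \<bullet> (w - z)" for z
  proof -
    obtain s where s: "\<And>y. A y \<ge> A z + s \<bullet> (y - z) - c / 2 * ((y - z) \<bullet> (y - z))"
      using assms unfolding semiconvex_def by blast
    have "g w \<ge> g z + (s + c *\<^sub>R z) \<bullet> (w - z)" for w
      using s[of w] unfolding g_def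
      by (simp add: inner_diff_left inner_diff_right inner_add_left inner_commute[of w z] field_simps)
    then show ?thesis by blast
  qed
  have "convex_on UNIV g"
  proof (rule convex_onI)
    fix t :: real and x y :: 'a
    assume t: "0 < t" "t < 1"
    define z where "z = (1 - t) *\<^sub>R x + t *\<^sub>R y"
    obtain s where s: "\<And>w. g w \<ge> g z + s \<bullet> (w - z)" using sup by blast
    have "(1 - t) * (g z + s \<bullet> (x - z)) + t * (g z + s \<bullet> (y - z)) \<le> (1 - t) * g x + t * g y"
      using t s by (intro add_mono mult_left_mono) auto
    moreover have "(1 - t) * (s \<bullet> (x - z)) + t * (s \<bullet> (y - z)) = s \<bullet> ((1 - t) *\<^sub>R x + t *\<^sub>R y - z)"
      by (simp add: inner_add_right inner_diff_right algebra_simps)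
    moreover have "(1 - t) *\<^sub>R x + t *\<^sub>R y - z = 0" by (simp add: z_def)
    ultimately show "g ((1 - t) *\<^sub>R x + t *\<^sub>R y) \<le> (1 - t) * g x + t * g y"
      unfolding z_def[symmetric] by (simp add: algebra_simps)
  qed simp
  then have "continuous_on UNIV g"
    by (rule convex_on_continuous[OF open_UNIV])
  then have "continuous_on UNIV (\<lambda>x. g x - c / 2 * (x \<bullet> x))"
    by (intro continuous_intros)
  then show ?thesis by (simp add: g_def)
qed

text \<open>\<open>p\<close> is a gradient at \<open>z\<close> with a global two-sided quadratic
  error: pointwise C^{1,1} information that survives rescaling.\<close>

definition pinched :: "real \<Rightarrow> ('a::real_inner \<Rightarrow> real) \<Rightarrow> 'a \<Rightarrow> 'a \<Rightarrow> bool" where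
  "pinched c A z p \<longleftrightarrow> (\<forall>h. \<bar>A (z + h) - A z - p \<bullet> h\<bar> \<le> c / 2 * (h \<bullet> h))"

text \<open>Expand around \<open>z\<close> and around \<open>z'\<close> at the same point
  \<open>z' + h\<close>, with \<open>h\<close> in the direction of \<open>p' - p\<close> and as long
  as \<open>z' - z\<close>; the errors add up to (4 + 1 + 1) c / 2 = 3 c times the squared distance.
  For equal points \<open>h\<close> shrinks to 0 instead.\<close>

lemma pinched_lipschitz:
  assumes A: "pinched c A z p" and A': "pinched c A z' p'" and c: "c \<ge> 0"
  shows "norm (p' - p) \<le> 3 * c * norm (z' - z)"
proof (cases "p' = p")
  case False
  define d where "d = z' - z"
  have est: "\<bar>(p' - p) \<bullet> h\<bar> \<le> c / 2 * ((d + h) \<bullet> (d + h)) + c / 2 * (h \<bullet> h) + c / 2 * (d \<bullet> d)" for h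
  proof -
    have 1: "\<bar>A (z + (d + h)) - A z - p \<bullet> (d + h)\<bar> \<le> c / 2 * ((d + h) \<bullet> (d + h))"
      and 2: "\<bar>A (z + d) - A z - p \<bullet> d\<bar> \<le> c / 2 * (d \<bullet> d)"
      using A unfolding pinched_def by blast+
    have 3: "\<bar>A (z' + h) - A z' - p' \<bullet> h\<bar> \<le> c / 2 * (h \<bullet> h)"
      using A' unfolding pinched_def by blast
    have e: "z + (d + h) = z' + h" "z + d = z'" by (simp_all add: d_def)
    show ?thesis
      using 1 2 3 unfolding e inner_diff_left inner_add_right[of p] by linarith
  qed
  have bound: "norm (p' - p) * t \<le> c / 2 * ((norm d + t)\<^sup>2 + t\<^sup>2 + (norm d)\<^sup>2)" if t: "t \<ge> 0" for t
  proof -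
    define h where "h = (t / norm (p' - p)) *\<^sub>R (p' - p)"
    have nh: "norm h = t" using False t by (simp add: h_def)
    have "(p' - p) \<bullet> h = norm (p' - p) * t"
      using False by (simp add: h_def power2_norm_eq_inner[symmetric] power2_eq_square)
    moreover have "(d + h) \<bullet> (d + h) \<le> (norm d + t)\<^sup>2"
      using norm_triangle_ineq[of d h] nh by (simp add: power2_norm_eq_inner[symmetric] power_mono)
    then have "c / 2 * ((d + h) \<bullet> (d + h)) \<le> c / 2 * (norm d + t)\<^sup>2"
      using c by (intro mult_left_mono) auto
    moreover have "h \<bullet> h = t\<^sup>2" "d \<bullet> d = (norm d)\<^sup>2"
      using nh by (simp_all add: power2_norm_eq_inner[symmetric])
    ultimately show ?thesis
      using est[of h] by (simp add: algebra_simps abs_le_iff)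
  qed
  show ?thesis
  proof (cases "d = 0")
    case True
    have "norm (p' - p) * t \<le> c * t\<^sup>2" if "t > 0" for t
      using bound[of t] that True by simp
    then have le: "norm (p' - p) \<le> c * t" if "t > 0" for t
      using mult_right_le_imp_le[of "norm (p' - p)" t "c * t"] that \<open>\<And>t. t > 0 \<Longrightarrow> norm (p' - p) * t \<le> c * t\<^sup>2\<close>[OF that]
      by (simp add: power2_eq_square mult.assoc)
    have "norm (p' - p) \<le> 0"
    proof (rule field_le_epsilon)
      fix e :: real assume e: "e > 0"
      have "norm (p' - p) \<le> c * (e / (c + 1))" using le[of "e / (c + 1)"] e c by simp
      also have "\<dots> = e * (c / (c + 1))" by simp
      also have "\<dots> \<le> e * 1" using e c by (intro mult_left_mono) auto
      finally show "norm (p' - p) \<le> 0 + e" by simp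
    qed
    then show ?thesis using False by simp
  next
    case nz: False
    have "norm (p' - p) * norm d \<le> (3 * c * norm d) * norm d"
      using bound[of "norm d"] by (simp add: power2_eq_square algebra_simps)
    then show ?thesis using nz by (simp add: d_def)
  qed
qed (use c in simp)

text \<open>McShane's extension: the lower envelope of the cones with vertices on the graph.\<close>

lemma lipschitz_extension:
  fixes f :: "'a::real_normed_vector \<Rightarrow> real"
  assumes "T \<noteq> {}" and lip: "\<And>x y. x \<in> T \<Longrightarrow> y \<in> T \<Longrightarrow> \<bar>f x - f y\<bar> \<le> L * norm (x - y)" and L: "L \<ge> 0"
  obtains g where "\<And>x. x \<in> T \<Longrightarrow> g x = f x" "\<And>x y. \<bar>g x - g y\<bar> \<le> L * norm (x - y)"
proof -
  define g where "g x = (INF t\<in>T. f t + L * norm (x - t))" for x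
  have low: "f t + L * norm (x - t) \<ge> f s - L * norm (x - s)" if "s \<in> T" "t \<in> T" for x s t
  proof -
    have "L * norm (s - t) \<le> L * norm (x - s) + L * norm (x - t)"
      using L norm_triangle_ineq4[of "x - t" "x - s"] by (simp flip: distrib_left add: mult_left_mono add.commute)
    then show ?thesis using lip[OF that] by linarith
  qed
  obtain s0 where s0: "s0 \<in> T" using assms(1) by blast
  have bdd: "bdd_below ((\<lambda>t. f t + L * norm (x - t)) ` T)" for x
    using low[OF s0] by (intro bdd_belowI2[where m="f s0 - L * norm (x - s0)"]) auto
  have eq: "g x = f x" if x: "x \<in> T" for x
  proof (rule antisym)
    show "g x \<le> f x"
      unfolding g_def using cINF_lower[OF bdd x, of x] by simp
    show "f x \<le> g x"
      unfolding g_def by (rule cINF_greatest[OF assms(1)]) (use low[OF x, of _ x] in simp)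
  qed
  have one: "g x \<le> g y + L * norm (x - y)" for x y
  proof -
    have "g x - L * norm (x - y) \<le> f t + L * norm (y - t)" if t: "t \<in> T" for t
    proof -
      have "g x \<le> f t + L * norm (x - t)"
        unfolding g_def by (rule cINF_lower[OF bdd t])
      moreover have "L * norm (x - t) \<le> L * norm (x - y) + L * norm (y - t)"
        using L norm_triangle_ineq[of "x - y" "y - t"] by (simp flip: distrib_left add: mult_left_mono)
      ultimately show ?thesis by linarith
    qed
    then have "g x - L * norm (x - y) \<le> g y"
      unfolding g_def[of y] by (intro cINF_greatest[OF assms(1)])
    then show ?thesis by simp
  qed
  have "\<bar>g x - g y\<bar> \<le> L * norm (x - y)" for x y
    using one[of x y] one[of y x] by (simp add: norm_minus_commute abs_le_iff)
  with eq that show thesis by blast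
qed

text \<open>The closure of the superjets. Convergence of the values is included because continuity
  of \<open>A\<close> is not presupposed.\<close>

definition csuperjet :: "(real^'n \<Rightarrow> real) \<Rightarrow> real^'n \<Rightarrow> real^'n \<Rightarrow> real^'n^'n \<Rightarrow> bool" where
  "csuperjet A z p X \<longleftrightarrow> transpose X = X \<and> (\<forall>e>0. \<exists>y q Y. dist y z < e \<and> \<bar>A y - A z\<bar> < e \<and> dist q p < e \<and>
     dist Y X < e \<and> superjet A y q Y)"

lemma transpose_tendsto:
  fixes X :: "nat \<Rightarrow> real^'n^'m"
  assumes "X \<longlonglongrightarrow> L"
  shows "(\<lambda>k. transpose (X k)) \<longlonglongrightarrow> transpose L"
  unfolding transpose_def
proof (intro vec_tendstoI)
  fix i j
  show "(\<lambda>k. (\<chi> i j. X k $ j $ i) $ i $ j) \<longlonglongrightarrow> (\<chi> i j. L $ j $ i) $ i $ j"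
    using tendsto_vec_nth[OF tendsto_vec_nth[OF assms], of j i] by simp
qed

lemma csuperjet_limit:
  assumes "z \<longlonglongrightarrow> z0" "(\<lambda>k. A (z k)) \<longlonglongrightarrow> A z0" "p \<longlonglongrightarrow> p0" "X \<longlonglongrightarrow> X0"
    and jet: "\<And>k. csuperjet A (z k) (p k) (X k)"
  shows "csuperjet A z0 p0 X0"
  unfolding csuperjet_def
proof (intro conjI allI impI)
  have "(\<lambda>k. transpose (X k)) \<longlonglongrightarrow> transpose X0"
    by (rule transpose_tendsto) fact
  moreover have "transpose (X k) = X k" for k
    using jet[of k] unfolding csuperjet_def by (rule conjunct1)
  ultimately have "X \<longlonglongrightarrow> transpose X0" by simp
  then show "transpose X0 = X0" by (rule LIMSEQ_unique[OF _ assms(4)])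
  fix e :: real assume e: "e > 0"
  then have e2: "e / 2 > 0" by simp
  have "\<forall>\<^sub>F k in sequentially. dist (z k) z0 < e / 2 \<and> dist (A (z k)) (A z0) < e / 2 \<and> dist (p k) p0 < e / 2 \<and> dist (X k) X0 < e / 2"
    using tendstoD[OF assms(1) e2] tendstoD[OF assms(2) e2] tendstoD[OF assms(3) e2] tendstoD[OF assms(4) e2]
    by eventually_elim simp
  then have "\<exists>k. dist (z k) z0 < e / 2 \<and> dist (A (z k)) (A z0) < e / 2 \<and> dist (p k) p0 < e / 2 \<and> dist (X k) X0 < e / 2"
    by (rule eventually_happens'[OF sequentially_bot])
  then obtain k where k: "dist (z k) z0 < e / 2" "dist (A (z k)) (A z0) < e / 2" "dist (p k) p0 < e / 2" "dist (X k) X0 < e / 2"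
    by (elim exE conjE)
  have "\<exists>y q Y. dist y (z k) < e / 2 \<and> \<bar>A y - A (z k)\<bar> < e / 2 \<and> dist q (p k) < e / 2 \<and> dist Y (X k) < e / 2 \<and> superjet A y q Y"
    using jet[of k] e2 unfolding csuperjet_def by (simp only:)
  then obtain y q Y where y: "dist y (z k) < e / 2" "\<bar>A y - A (z k)\<bar> < e / 2" "dist q (p k) < e / 2" "dist Y (X k) < e / 2" "superjet A y q Y"
    by (elim exE conjE)
  have "dist y z0 < e" using dist_triangle[of y z0 "z k"] k y by linarith
  moreover have "\<bar>A y - A z0\<bar> < e" using k y unfolding dist_real_def by linarith
  moreover have "dist q p0 < e" using dist_triangle[of q p0 "p k"] k y by linarith
  moreover have "dist Y X0 < e" using dist_triangle[of Y X0 "X k"] k y by linarith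
  ultimately show "\<exists>y q Y. dist y z0 < e \<and> \<bar>A y - A z0\<bar> < e \<and> dist q p0 < e \<and> dist Y X0 < e \<and> superjet A y q Y"
    using y(5) by blast
qed

section \<open>Linear limits of difference quotients\<close>

lemma mult_div_self: "k \<noteq> 0 \<Longrightarrow> k * (x / k) = x" for k x :: real
  by simp

lemma second_diff_quotient:
  fixes x y z p :: "'a::real_vector"
  shows "(x - p) /\<^sub>R t - 2 *\<^sub>R ((y - p) /\<^sub>R t) + (z - p) /\<^sub>R t = (x - 2 *\<^sub>R y + z) /\<^sub>R t"
  by (simp only: scaleR_2 scaleR_diff_right scaleR_add_right) (simp add: algebra_simps)

text \<open>Additivity gives homogeneity for integers. For a real factor \<open>r\<close>, split m r
  into integer and fractional part: \<open>m\<close> times the defect stays bounded for every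
  natural \<open>m\<close>, hence the defect is 0.\<close>

lemma additive_bounded_linear:
  fixes l :: "'a::real_normed_vector \<Rightarrow> 'b::real_normed_vector"
  assumes add: "\<And>x y. l (x + y) = l x + l y" and bd: "\<And>x. norm (l x) \<le> K * norm x"
  shows "linear l"
proof (rule linearI)
  show "l (x + y) = l x + l y" for x y by (rule add)
  have l0: "l 0 = 0" using add[of 0 0] by simp
  have neg: "l (- x) = - l x" for x using add[of x "- x"] l0 by (simp add: eq_neg_iff_add_eq_0 add.commute)
  have nat: "l (real n *\<^sub>R x) = real n *\<^sub>R l x" for n x
    by (induction n) (simp_all add: l0 add scaleR_add_left)
  have int: "l (real_of_int j *\<^sub>R x) = real_of_int j *\<^sub>R l x" for j x
  proof (cases "j \<ge> 0")
    case True
    then show ?thesis using nat[of "nat j" x] by simp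
  next
    case False
    then show ?thesis using nat[of "nat (- j)" x] neg[of "real_of_int (- j) *\<^sub>R x"] by simp
  qed
  show "l (r *\<^sub>R x) = r *\<^sub>R l x" for r x
  proof -
    define C where "C = 2 * (\<bar>K\<bar> * norm x)"
    have "real m * norm (l (r *\<^sub>R x) - r *\<^sub>R l x) \<le> C" for m
    proof -
      define j where "j = \<lfloor>real m * r\<rfloor>"
      define \<theta> where "\<theta> = real m * r - of_int j"
      have \<theta>: "0 \<le> \<theta>" "\<theta> \<le> 1" unfolding \<theta>_def j_def by linarith+
      have sp: "real m * r = of_int j + \<theta>" by (simp add: \<theta>_def)
      have "real m *\<^sub>R l (r *\<^sub>R x) = l ((real m * r) *\<^sub>R x)"
        using nat[of m "r *\<^sub>R x"] by simp
      also have "\<dots> = of_int j *\<^sub>R l x + l (\<theta> *\<^sub>R x)"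
        unfolding sp scaleR_add_left add int by (rule refl)
      finally have e: "real m *\<^sub>R (l (r *\<^sub>R x) - r *\<^sub>R l x) = l (\<theta> *\<^sub>R x) - \<theta> *\<^sub>R l x"
        by (simp add: scaleR_diff_right sp scaleR_add_left)
      have K: "norm (l y) \<le> \<bar>K\<bar> * norm y" for y
        using bd[of y] mult_right_mono[OF abs_ge_self[of K] norm_ge_zero[of y]] by linarith
      have t1: "norm (\<theta> *\<^sub>R y) \<le> norm y" for y :: 'b
        using \<theta> by (simp add: mult_left_le_one_le)
      have t2: "norm (\<theta> *\<^sub>R y) \<le> norm y" for y :: 'a
        using \<theta> by (simp add: mult_left_le_one_le)
      have "norm (l (\<theta> *\<^sub>R x)) \<le> \<bar>K\<bar> * norm x"
        using K[of "\<theta> *\<^sub>R x"] mult_left_mono[OF t2[of x] abs_ge_zero[of K]] by linarith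
      moreover have "norm (\<theta> *\<^sub>R l x) \<le> \<bar>K\<bar> * norm x"
        using t1[of "l x"] K[of x] by linarith
      ultimately have "norm (l (\<theta> *\<^sub>R x) - \<theta> *\<^sub>R l x) \<le> C"
        using norm_triangle_ineq4[of "l (\<theta> *\<^sub>R x)" "\<theta> *\<^sub>R l x"] unfolding C_def by linarith
      then show ?thesis unfolding e[symmetric] by simp
    qed
    then have "norm (l (r *\<^sub>R x) - r *\<^sub>R l x) \<le> 0"
      by (metis not_le ex_less_of_nat_mult)
    then show ?thesis by simp
  qed
qed

text \<open>Equi-Lipschitz difference quotients converge along a subsequence on a countable dense
  set, hence everywhere. Second differences of size o(h) give the limit a midpoint identity, so it
  is additive and, being bounded, linear. The limit exists only along the chosen scales, which is
  enough for limiting jets.\<close>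

lemma difference_quotient_linear_limit:
  fixes P :: "real^'n \<Rightarrow> real^'m"
  assumes lip: "\<And>x y. norm (P x - P y) \<le> K * norm (x - y)" and hpos: "\<And>k::nat. h k > (0::real)"
    and mid: "\<And>b v. (\<lambda>k. (P (z + h k *\<^sub>R (b + 2 *\<^sub>R v)) - 2 *\<^sub>R P (z + h k *\<^sub>R (b + v)) + P (z + h k *\<^sub>R b)) /\<^sub>R h k) \<longlonglongrightarrow> 0"
  obtains r M where "strict_mono (r::nat \<Rightarrow> nat)"
    "\<And>y. (\<lambda>k. (P (z + h (r k) *\<^sub>R y) - P z) /\<^sub>R h (r k)) \<longlonglongrightarrow> M *v y"
proof -
  define G where "G k y = (P (z + h k *\<^sub>R y) - P z) /\<^sub>R h k" for k y
  have Glip: "norm (G k y - G k y') \<le> K * norm (y - y')" for k y y'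
  proof -
    have "G k y - G k y' = (P (z + h k *\<^sub>R y) - P (z + h k *\<^sub>R y')) /\<^sub>R h k"
      by (simp add: G_def scaleR_diff_right)
    then have "norm (G k y - G k y') = norm (P (z + h k *\<^sub>R y) - P (z + h k *\<^sub>R y')) / h k"
      using hpos[of k] by (simp add: divide_inverse mult.commute)
    also have "\<dots> \<le> (K * norm (h k *\<^sub>R (y - y'))) / h k"
      using lip[of "z + h k *\<^sub>R y" "z + h k *\<^sub>R y'"] hpos[of k]
      by (intro divide_right_mono) (simp_all flip: scaleR_diff_right)
    also have "\<dots> = K * norm (y - y')" using hpos[of k] by simp
    finally show ?thesis .
  qed
  have G0: "G k 0 = 0" for k by (simp add: G_def)
  have Gb: "norm (G k y) \<le> K * norm y" for k y using Glip[of k y 0] by (simp add: G0)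
  have K0: "K \<ge> 0"
  proof -
    have "0 \<le> K * norm (axis undefined 1 :: real^'n)"
      using Gb[of 0 "axis undefined 1"] norm_ge_zero order_trans by blast
    then show ?thesis by simp
  qed
  obtain Q :: "(real^'n) set" where Q: "countable Q" "\<And>X. open X \<Longrightarrow> X \<noteq> {} \<Longrightarrow> \<exists>d\<in>Q. d \<in> X"
    using countable_dense_exists by blast
  \<comment> \<open>The extraction of a subsequence asks for one bound at all points, hence the
    weight 1 + |x|, removed again in \<open>convQ\<close>.\<close>
  have "norm (G k x /\<^sub>R (1 + norm x)) \<le> K" for k x
  proof -
    have pos: "1 + norm x > 0" using norm_ge_zero[of x] by linarith
    have "norm (G k x /\<^sub>R (1 + norm x)) = norm (G k x) / (1 + norm x)"
      using pos by (simp add: divide_inverse mult.commute)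
    also have "\<dots> \<le> K"
    proof -
      have "norm (G k x) \<le> K * (1 + norm x)" using Gb[of k x] K0 by (simp add: distrib_left)
      then show ?thesis using pos by (simp add: pos_divide_le_eq)
    qed
    finally show ?thesis .
  qed
  then obtain r where r: "strict_mono (r::nat \<Rightarrow> nat)"
    and rl: "\<And>x. x \<in> Q \<Longrightarrow> \<exists>l. (\<lambda>k. G (r k) x /\<^sub>R (1 + norm x)) \<longlonglongrightarrow> l"
    using function_convergent_subsequence[OF Q(1), of "\<lambda>k x. G k x /\<^sub>R (1 + norm x)" K] by metis
  have convQ: "\<exists>l. (\<lambda>k. G (r k) x) \<longlonglongrightarrow> l" if xQ: "x \<in> Q" for x
  proof -
    obtain l where "(\<lambda>k. G (r k) x /\<^sub>R (1 + norm x)) \<longlonglongrightarrow> l" using rl[OF xQ] by blast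
    then have "(\<lambda>k. (1 + norm x) *\<^sub>R (G (r k) x /\<^sub>R (1 + norm x))) \<longlonglongrightarrow> (1 + norm x) *\<^sub>R l"
      by (rule tendsto_scaleR[OF tendsto_const])
    moreover have "1 + norm x \<noteq> 0" using norm_ge_zero[of x] by linarith
    ultimately show ?thesis by auto
  qed
  have conv: "\<exists>l. (\<lambda>k. G (r k) y) \<longlonglongrightarrow> l" for y
  proof -
    have "Cauchy (\<lambda>k. G (r k) y)"
    proof (rule metric_CauchyI)
      fix e :: real assume e: "e > 0"
      define d where "d = e / 3 / (K + 1)"
      have d: "d > 0" using e K0 by (simp add: d_def)
      obtain x where x: "x \<in> Q" "x \<in> ball y d" using Q(2)[of "ball y d"] d by auto
      have "K * norm (y - x) \<le> K * d"
        using x(2) K0 by (intro mult_left_mono) (auto simp: dist_norm)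
      also have "\<dots> < (K + 1) * d" using d by simp
      also have "\<dots> = e / 3"
      proof -
        have "K + 1 \<noteq> 0" using K0 by linarith
        then show ?thesis unfolding d_def by (rule mult_div_self)
      qed
      finally have xs: "K * norm (y - x) < e / 3" .
      have "Cauchy (\<lambda>k. G (r k) x)"
        using convQ[OF x(1)] LIMSEQ_imp_Cauchy by blast
      then obtain N where N: "\<And>m n. m \<ge> N \<Longrightarrow> n \<ge> N \<Longrightarrow> dist (G (r m) x) (G (r n) x) < e / 3"
        using metric_CauchyD[of "\<lambda>k. G (r k) x" "e / 3"] e by auto
      have "dist (G (r m) y) (G (r n) y) < e" if "m \<ge> N" "n \<ge> N" for m n
      proof -
        have "dist (G (r m) y) (G (r m) x) < e / 3" "dist (G (r n) x) (G (r n) y) < e / 3"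
          using Glip[of "r m" y x] Glip[of "r n" y x] xs by (simp_all add: dist_norm norm_minus_commute)
        then show ?thesis
          using N[OF that] dist_triangle[of "G (r m) y" "G (r n) y" "G (r m) x"]
            dist_triangle[of "G (r m) x" "G (r n) y" "G (r n) x"] by linarith
      qed
      then show "\<exists>M. \<forall>m\<ge>M. \<forall>n\<ge>M. dist (G (r m) y) (G (r n) y) < e" by blast
    qed
    then show ?thesis
      using Cauchy_convergent convergent_def by blast
  qed
  define l where "l y = lim (\<lambda>k. G (r k) y)" for y
  have ll: "(\<lambda>k. G (r k) y) \<longlonglongrightarrow> l y" for y
    unfolding l_def using conv[of y] limI by blast
  have lb: "norm (l y) \<le> K * norm y" for y
    by (rule LIMSEQ_le_const2[OF tendsto_norm[OF ll]]) (use Gb in blast)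
  have lmid: "l (b + 2 *\<^sub>R v) - 2 *\<^sub>R l (b + v) + l b = 0" for b v
  proof -
    have "G k (b + 2 *\<^sub>R v) - 2 *\<^sub>R G k (b + v) + G k b =
       (P (z + h k *\<^sub>R (b + 2 *\<^sub>R v)) - 2 *\<^sub>R P (z + h k *\<^sub>R (b + v)) + P (z + h k *\<^sub>R b)) /\<^sub>R h k" for k
      unfolding G_def by (rule second_diff_quotient)
    then have "(\<lambda>k. G k (b + 2 *\<^sub>R v) - 2 *\<^sub>R G k (b + v) + G k b) \<longlonglongrightarrow> 0"
      using mid[of b v] by (simp only:)
    then have "(\<lambda>k. G (r k) (b + 2 *\<^sub>R v) - 2 *\<^sub>R G (r k) (b + v) + G (r k) b) \<longlonglongrightarrow> 0"
      by (rule LIMSEQ_subseq_LIMSEQ[OF _ r, unfolded o_def])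
    moreover have "(\<lambda>k. G (r k) (b + 2 *\<^sub>R v) - 2 *\<^sub>R G (r k) (b + v) + G (r k) b) \<longlonglongrightarrow> l (b + 2 *\<^sub>R v) - 2 *\<^sub>R l (b + v) + l b"
      by (intro tendsto_intros ll)
    ultimately show ?thesis by (rule LIMSEQ_unique[symmetric])
  qed
  have l0: "l 0 = 0" using lb[of 0] by simp
  have dbl: "l (2 *\<^sub>R v) = 2 *\<^sub>R l v" for v using lmid[of 0 v] l0 by simp
  \<comment> \<open>\<open>y + v\<close> is the midpoint of \<open>x\<close> and \<open>y\<close>;
    the doubling identity turns twice its value into \<open>l (x + y)\<close>.\<close>
  have "l (x + y) = l x + l y" for x y
  proof -
    define v where "v = (1/2) *\<^sub>R (x - y)"
    have e1: "y + 2 *\<^sub>R v = x" by (simp add: v_def)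
    have e2: "x + y = 2 *\<^sub>R (y + v)" by (simp add: v_def scaleR_add_right scaleR_diff_right scaleR_2)
    have "l x + l y - 2 *\<^sub>R l (y + v) = 0"
      using lmid[of y v] unfolding e1 by (simp only: diff_add_eq)
    then show ?thesis unfolding e2 dbl by simp
  qed
  then have "linear l" using lb by (rule additive_bounded_linear)
  then have lm: "matrix l *v y = l y" for y
    unfolding linear_matrix_vector_mul_eq[symmetric] by (rule matrix_works)
  show thesis
  proof (rule that[OF r])
    show "(\<lambda>k. (P (z + h (r k) *\<^sub>R y) - P z) /\<^sub>R h (r k)) \<longlonglongrightarrow> matrix l *v y" for y
      using ll[of y] unfolding G_def lm .
  qed
qed

section \<open>Second order blow-ups\<close>

definition blowup :: "('a::real_inner \<Rightarrow> real) \<Rightarrow> 'a \<Rightarrow> 'a \<Rightarrow> real \<Rightarrow> 'a \<Rightarrow> real" where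
  "blowup A p z h y = (A (z + h *\<^sub>R y) - A z - h * (p \<bullet> y)) / h\<^sup>2"

text \<open>The pinching constant is invariant under the rescaling: a pinched point near
  \<open>z\<close> becomes a pinched point of the blow-up, with the rescaled gradient difference as
  slope.\<close>

lemma blowup_pinched:
  assumes "pinched c A (z + h *\<^sub>R \<tau>) q" "h > 0"
  shows "\<bar>blowup A p z h y - blowup A p z h \<tau> - ((q - p) /\<^sub>R h) \<bullet> (y - \<tau>)\<bar> \<le> c / 2 * ((y - \<tau>) \<bullet> (y - \<tau>))"
proof -
  define g where "g = h *\<^sub>R (y - \<tau>)"
  have e: "z + h *\<^sub>R \<tau> + g = z + h *\<^sub>R y" by (simp add: g_def scaleR_diff_right)
  have gg: "g \<bullet> g = h\<^sup>2 * ((y - \<tau>) \<bullet> (y - \<tau>))" by (simp add: g_def power2_eq_square)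
  have "\<bar>A (z + h *\<^sub>R \<tau> + g) - A (z + h *\<^sub>R \<tau>) - q \<bullet> g\<bar> \<le> c / 2 * (g \<bullet> g)"
    using assms(1) unfolding pinched_def by blast
  then have "\<bar>A (z + h *\<^sub>R y) - A (z + h *\<^sub>R \<tau>) - q \<bullet> g\<bar> / h\<^sup>2 \<le> c / 2 * (g \<bullet> g) / h\<^sup>2"
    unfolding e by (intro divide_right_mono) auto
  also have "c / 2 * (g \<bullet> g) / h\<^sup>2 = c / 2 * ((y - \<tau>) \<bullet> (y - \<tau>))"
    unfolding gg using assms(2) by simp
  also have "\<bar>A (z + h *\<^sub>R y) - A (z + h *\<^sub>R \<tau>) - q \<bullet> g\<bar> / h\<^sup>2
      = \<bar>(A (z + h *\<^sub>R y) - A (z + h *\<^sub>R \<tau>) - q \<bullet> g) / h\<^sup>2\<bar>" by simp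
  also have "(A (z + h *\<^sub>R y) - A (z + h *\<^sub>R \<tau>) - q \<bullet> g) / h\<^sup>2
     = blowup A p z h y - blowup A p z h \<tau> - ((q - p) /\<^sub>R h) \<bullet> (y - \<tau>)"
    unfolding blowup_def g_def using assms(2)
    by (simp add: field_simps power2_eq_square inner_diff_left inner_diff_right)
  finally show ?thesis .
qed

lemma infdist_close_point:
  assumes "T \<noteq> {}" "e > 0"
  obtains t where "t \<in> T" "dist x t < infdist x T + e"
proof -
  have "infdist x T = (INF t\<in>T. dist x t)" using assms(1) by (simp add: infdist_def)
  then have "(INF t\<in>T. dist x t) < infdist x T + e" using assms(2) by simp
  then have "\<exists>y\<in>(\<lambda>t. dist x t) ` T. y < infdist x T + e"
    using assms(1) by (intro cInf_lessD) auto
  then show thesis using that by blast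
qed

context
  fixes A :: "real^'n \<Rightarrow> real" and P :: "real^'n \<Rightarrow> real^'n" and T z h M c K
  assumes zT: "z \<in> T" and c: "c \<ge> 0" and K: "K \<ge> 0" and hpos: "\<And>k::nat. h k > 0" and h0: "h \<longlonglongrightarrow> 0"
    and pin: "\<And>t. t \<in> T \<Longrightarrow> pinched c A t (P t)"
    and lipP: "\<And>x y. norm (P x - P y) \<le> K * norm (x - y)"
    and limP: "\<And>y. (\<lambda>k. (P (z + h k *\<^sub>R y) - P z) /\<^sub>R h k) \<longlonglongrightarrow> M *v y"
    and dens: "\<And>y. (\<lambda>k. infdist (z + h k *\<^sub>R y) T / h k) \<longlonglongrightarrow> 0"
begin

text \<open>\<open>T\<close> consists of pinched points and \<open>P\<close> extends their
  gradients. By \<open>dens\<close>, points of \<open>T\<close> lie within o(h) of every z + h y;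
  rescaled, they tend to \<open>y\<close>, with slopes tending to \<open>M *v y\<close>.\<close>

lemma blowup_approx_points:
  obtains \<tau> G where "\<tau> \<longlonglongrightarrow> y" "G \<longlonglongrightarrow> M *v y"
    "\<And>k w. \<bar>blowup A (P z) z (h k) w - blowup A (P z) z (h k) (\<tau> k) - G k \<bullet> (w - \<tau> k)\<bar>
        \<le> c / 2 * ((w - \<tau> k) \<bullet> (w - \<tau> k))"
proof -
  have "\<exists>t. t \<in> T \<and> dist (z + h k *\<^sub>R y) t < infdist (z + h k *\<^sub>R y) T + h k * inverse (real (Suc k))" for k
  proof -
    have "h k * inverse (real (Suc k)) > 0" using hpos[of k] by (intro mult_pos_pos) auto
    from infdist_close_point[OF _ this, of T "z + h k *\<^sub>R y"] zT show ?thesis by blast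
  qed
  then obtain t where t: "\<And>k. t k \<in> T"
    "\<And>k. dist (z + h k *\<^sub>R y) (t k) < infdist (z + h k *\<^sub>R y) T + h k * inverse (real (Suc k))"
    by metis
  define \<tau> where "\<tau> k = (t k - z) /\<^sub>R h k" for k
  have tz: "z + h k *\<^sub>R \<tau> k = t k" for k using hpos[of k] by (simp add: \<tau>_def)
  define G where "G k = (P (t k) - P z) /\<^sub>R h k" for k
  have close: "norm (\<tau> k - y) \<le> infdist (z + h k *\<^sub>R y) T / h k + inverse (real (Suc k))" for k
  proof -
    have "h k * norm (\<tau> k - y) = norm (h k *\<^sub>R (\<tau> k - y))" using hpos[of k] by simp
    also have "h k *\<^sub>R (\<tau> k - y) = t k - (z + h k *\<^sub>R y)" using tz[of k] by (simp add: scaleR_diff_right algebra_simps)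
    also have "norm \<dots> \<le> infdist (z + h k *\<^sub>R y) T + h k * inverse (real (Suc k))"
      using t(2)[of k] by (simp add: dist_norm norm_minus_commute)
    finally have "norm (\<tau> k - y) \<le> (infdist (z + h k *\<^sub>R y) T + h k * inverse (real (Suc k))) / h k"
      using hpos[of k] by (simp add: pos_le_divide_eq mult.commute)
    then show ?thesis using hpos[of k] by (simp add: add_divide_distrib del: of_nat_Suc)
  qed
  have "(\<lambda>k. infdist (z + h k *\<^sub>R y) T / h k + inverse (real (Suc k))) \<longlonglongrightarrow> 0 + 0"
    by (intro tendsto_add dens LIMSEQ_inverse_real_of_nat)
  then have lim0: "(\<lambda>k. infdist (z + h k *\<^sub>R y) T / h k + inverse (real (Suc k))) \<longlonglongrightarrow> 0" by simp
  have "(\<lambda>k. norm (\<tau> k - y)) \<longlonglongrightarrow> 0"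
    by (rule tendsto_sandwich[OF _ _ tendsto_const lim0]) (use close in \<open>auto intro!: always_eventually simp del: of_nat_Suc\<close>)
  then have n0: "(\<lambda>k. \<tau> k - y) \<longlonglongrightarrow> 0" by (rule tendsto_norm_zero_cancel)
  then have \<tau>y: "\<tau> \<longlonglongrightarrow> y" by (rule LIM_zero_cancel)
  have Gd: "norm (G k - (P (z + h k *\<^sub>R y) - P z) /\<^sub>R h k) \<le> K * norm (\<tau> k - y)" for k
  proof -
    have "G k - (P (z + h k *\<^sub>R y) - P z) /\<^sub>R h k = (P (t k) - P (z + h k *\<^sub>R y)) /\<^sub>R h k"
      by (simp add: G_def scaleR_diff_right)
    then have "norm (G k - (P (z + h k *\<^sub>R y) - P z) /\<^sub>R h k) = norm (P (t k) - P (z + h k *\<^sub>R y)) / h k"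
      using hpos[of k] by (simp add: divide_inverse mult.commute)
    also have "\<dots> \<le> (K * norm (h k *\<^sub>R (\<tau> k - y))) / h k"
      using lipP[of "t k" "z + h k *\<^sub>R y"] hpos[of k]
      by (intro divide_right_mono) (simp_all add: tz[symmetric] flip: scaleR_diff_right)
    also have "\<dots> = K * norm (\<tau> k - y)" using hpos[of k] by simp
    finally show ?thesis .
  qed
  have "(\<lambda>k. K * norm (\<tau> k - y)) \<longlonglongrightarrow> K * norm (0::real^'n)"
    by (intro tendsto_intros n0)
  then have lim1: "(\<lambda>k. K * norm (\<tau> k - y)) \<longlonglongrightarrow> 0" by simp
  have "(\<lambda>k. norm (G k - (P (z + h k *\<^sub>R y) - P z) /\<^sub>R h k)) \<longlonglongrightarrow> 0"
    by (rule tendsto_sandwich[OF _ _ tendsto_const lim1]) (use Gd in \<open>auto intro!: always_eventually\<close>)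
  then have "(\<lambda>k. G k - (P (z + h k *\<^sub>R y) - P z) /\<^sub>R h k) \<longlonglongrightarrow> 0" by (rule tendsto_norm_zero_cancel)
  from tendsto_add[OF this limP[of y]] have Gl: "G \<longlonglongrightarrow> M *v y" by simp
  show thesis
  proof (rule that[OF \<tau>y Gl])
    fix k w
    have "pinched c A (z + h k *\<^sub>R \<tau> k) (P (t k))" unfolding tz by (rule pin[OF t(1)])
    from blowup_pinched[OF this hpos]
    show "\<bar>blowup A (P z) z (h k) w - blowup A (P z) z (h k) (\<tau> k) - G k \<bullet> (w - \<tau> k)\<bar>
        \<le> c / 2 * ((w - \<tau> k) \<bullet> (w - \<tau> k))" unfolding G_def .
  qed
qed

text \<open>Pinching at the approximating points identifies the slope of the increment; the error is
  still quadratic in \<open>w\<close>, so this becomes sharp only for short steps.\<close>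

lemma blowup_increment:
  assumes e: "e > 0"
  shows "\<forall>\<^sub>F k in sequentially. \<bar>blowup A (P z) z (h k) (y + w) - blowup A (P z) z (h k) y - (M *v y) \<bullet> w\<bar>
    \<le> c / 2 * (w \<bullet> w) + e"
proof -
  obtain \<tau> G where \<tau>: "\<tau> \<longlonglongrightarrow> y" "G \<longlonglongrightarrow> M *v y"
    and le: "\<And>k w. \<bar>blowup A (P z) z (h k) w - blowup A (P z) z (h k) (\<tau> k) - G k \<bullet> (w - \<tau> k)\<bar>
        \<le> c / 2 * ((w - \<tau> k) \<bullet> (w - \<tau> k))"
    by (rule blowup_approx_points[of y]) (rule that)
  define B where "B k = c / 2 * ((y + w - \<tau> k) \<bullet> (y + w - \<tau> k)) + c / 2 * ((y - \<tau> k) \<bullet> (y - \<tau> k))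
      + \<bar>G k \<bullet> w - (M *v y) \<bullet> w\<bar>" for k
  have "B \<longlonglongrightarrow> c / 2 * ((y + w - y) \<bullet> (y + w - y)) + c / 2 * ((y - y) \<bullet> (y - y)) + \<bar>(M *v y) \<bullet> w - (M *v y) \<bullet> w\<bar>"
    unfolding B_def by (intro tendsto_intros \<tau>)
  then have "B \<longlonglongrightarrow> c / 2 * (w \<bullet> w)" by simp
  then have "\<forall>\<^sub>F k in sequentially. B k < c / 2 * (w \<bullet> w) + e"
    by (rule order_tendstoD) (use e in simp)
  then show ?thesis
  proof eventually_elim
    case (elim k)
    have "G k \<bullet> (y + w - \<tau> k) - G k \<bullet> (y - \<tau> k) = G k \<bullet> w"
      by (simp add: inner_diff_right inner_add_right)
    then show ?case
      using le[of k "y + w"] le[of k y] elim unfolding B_def by linarith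
  qed
qed

text \<open>The gradient field \<open>M\<close> is integrated along the segment from 0 to
  \<open>y\<close>: with N steps each increment errs by O(1/N^2), so the total error is
  O(1/N).\<close>

lemma blowup_tendsto: "(\<lambda>k. blowup A (P z) z (h k) y) \<longlonglongrightarrow> y \<bullet> (M *v y) / 2"
proof (rule LIMSEQ_I)
  fix e :: real assume e: "e > 0"
  define q where "q = (M *v y) \<bullet> y"
  \<comment> \<open>Divided by N, this collects the N step errors and the amount q / (2 N) by which
    the left Riemann sum misses q / 2.\<close>
  define C where "C = c / 2 * (y \<bullet> y) + 1 + \<bar>q\<bar> / 2"
  obtain N :: nat where N: "C / e < real N" using reals_Archimedean2 by blast
  have C: "C > 0" unfolding C_def using c by (intro add_pos_nonneg add_nonneg_pos) auto
  then have N0: "real N > 0" using N e by (meson divide_pos_pos less_trans)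
  have CN: "C / real N < e" using N N0 e by (simp add: field_simps)
  let ?a = "\<lambda>k. blowup A (P z) z (h k)"
  define v where "v j = (real j / real N) *\<^sub>R y" for j
  have vS: "v (Suc j) = v j + (1 / real N) *\<^sub>R y" for j
    by (simp add: v_def add_divide_distrib scaleR_add_left)
  have "\<forall>\<^sub>F k in sequentially. \<forall>j\<in>{..<N}. \<bar>?a k (v j + (1 / real N) *\<^sub>R y) - ?a k (v j) - (M *v v j) \<bullet> ((1 / real N) *\<^sub>R y)\<bar>
      \<le> c / 2 * (((1 / real N) *\<^sub>R y) \<bullet> ((1 / real N) *\<^sub>R y)) + 1 / (real N)\<^sup>2"
    using N0 by (intro eventually_ball_finite ballI blowup_increment) auto
  then have "\<forall>\<^sub>F k in sequentially. norm (?a k y - y \<bullet> (M *v y) / 2) < e"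
  proof eventually_elim
    case (elim k)
    have step: "\<bar>?a k (v (Suc j)) - ?a k (v j) - real j * q / (real N)\<^sup>2\<bar> \<le> (c / 2 * (y \<bullet> y) + 1) / (real N)\<^sup>2" if "j < N" for j
    proof -
      have "(M *v v j) \<bullet> ((1 / real N) *\<^sub>R y) = real j * q / (real N)\<^sup>2"
        unfolding v_def q_def by (simp add: matrix_vector_mult_scaleR power2_eq_square)
      moreover have "c / 2 * (((1 / real N) *\<^sub>R y) \<bullet> ((1 / real N) *\<^sub>R y)) + 1 / (real N)\<^sup>2 = (c / 2 * (y \<bullet> y) + 1) / (real N)\<^sup>2"
        by (simp add: power2_eq_square add_divide_distrib)
      moreover have "\<bar>?a k (v j + (1 / real N) *\<^sub>R y) - ?a k (v j) - (M *v v j) \<bullet> ((1 / real N) *\<^sub>R y)\<bar>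
      \<le> c / 2 * (((1 / real N) *\<^sub>R y) \<bullet> ((1 / real N) *\<^sub>R y)) + 1 / (real N)\<^sup>2"
        using elim that by blast
      ultimately show ?thesis unfolding vS by (simp only:)
    qed
    have tele: "\<bar>?a k (v m) - ?a k (v 0) - (real m * (real m - 1) / 2) * q / (real N)\<^sup>2\<bar> \<le> real m * ((c / 2 * (y \<bullet> y) + 1) / (real N)\<^sup>2)"
      if "m \<le> N" for m
      using that
    proof (induction m)
      case (Suc m)
      have IH: "\<bar>?a k (v m) - ?a k (v 0) - (real m * (real m - 1) / 2) * q / (real N)\<^sup>2\<bar> \<le> real m * ((c / 2 * (y \<bullet> y) + 1) / (real N)\<^sup>2)"
        using Suc by simp
      have "(real (Suc m) * (real (Suc m) - 1) / 2) * q / (real N)\<^sup>2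
         = (real m * (real m - 1) / 2) * q / (real N)\<^sup>2 + real m * q / (real N)\<^sup>2"
      proof -
        have s: "real (Suc m) * (real (Suc m) - 1) / 2 = real m * (real m - 1) / 2 + real m"
          by (simp add: field_simps)
        show ?thesis unfolding s by (simp add: distrib_right add_divide_distrib)
      qed
      moreover have "real (Suc m) * ((c / 2 * (y \<bullet> y) + 1) / (real N)\<^sup>2)
         = real m * ((c / 2 * (y \<bullet> y) + 1) / (real N)\<^sup>2) + (c / 2 * (y \<bullet> y) + 1) / (real N)\<^sup>2"
        by (simp only: of_nat_Suc distrib_right mult_1_left add.commute)
      ultimately show ?case
        using IH step[of m] Suc.prems by linarith
    qed simp
    have vN: "v N = y" using N0 by (simp add: v_def)
    have v0: "?a k (v 0) = 0" by (simp add: v_def blowup_def)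
    have e1: "(real N * (real N - 1) / 2) * q / (real N)\<^sup>2 = q / 2 - (q / 2) / real N"
      using N0 by (simp add: field_simps power2_eq_square)
    have e2: "real N * ((c / 2 * (y \<bullet> y) + 1) / (real N)\<^sup>2) = (c / 2 * (y \<bullet> y) + 1) / real N"
      using N0 by (simp add: power2_eq_square)
    have "\<bar>?a k y - q / 2 + (q / 2) / real N\<bar> \<le> (c / 2 * (y \<bullet> y) + 1) / real N"
      using tele[OF order_refl] unfolding vN v0 e1 e2 by linarith
    moreover have "\<bar>(q / 2) / real N\<bar> = (\<bar>q\<bar> / 2) / real N" using N0 by simp
    moreover have "C / real N = (c / 2 * (y \<bullet> y) + 1) / real N + (\<bar>q\<bar> / 2) / real N"
      by (simp add: C_def add_divide_distrib)
    ultimately have "\<bar>?a k y - q / 2\<bar> \<le> C / real N" by linarith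
    then show ?case using CN by (simp add: q_def inner_commute)
  qed
  then show "\<exists>no. \<forall>k\<ge>no. norm (?a k y - y \<bullet> (M *v y) / 2) < e"
    unfolding eventually_sequentially .
qed

text \<open>Pinching at \<open>z\<close> itself passes to the limit; the resulting bound on the
  Hessian later gives compactness.\<close>

lemma blowup_quad_bound: "\<bar>y \<bullet> (M *v y)\<bar> \<le> c * (y \<bullet> y)"
proof -
  have "\<bar>blowup A (P z) z (h k) y\<bar> \<le> c / 2 * (y \<bullet> y)" for k
    using blowup_pinched[of c A z "h k" 0 "P z" "P z" y] pin[OF zT] hpos[of k] by (simp add: blowup_def)
  then have "\<bar>y \<bullet> (M *v y) / 2\<bar> \<le> c / 2 * (y \<bullet> y)"
    by (intro LIMSEQ_le_const2[OF tendsto_rabs[OF blowup_tendsto]]) blast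
  then show ?thesis by simp
qed

lemma blowup_local_uniform:
  assumes e: "e > 0"
  shows "\<exists>d>0. \<forall>\<^sub>F k in sequentially. \<forall>w\<in>ball y d. \<bar>blowup A (P z) z (h k) w - w \<bullet> (M *v w) / 2\<bar> \<le> e"
proof -
  let ?a = "\<lambda>k. blowup A (P z) z (h k)"
  obtain \<tau> G where \<tau>: "\<tau> \<longlonglongrightarrow> y" "G \<longlonglongrightarrow> M *v y"
    and le: "\<And>k w. \<bar>?a k w - ?a k (\<tau> k) - G k \<bullet> (w - \<tau> k)\<bar> \<le> c / 2 * ((w - \<tau> k) \<bullet> (w - \<tau> k))"
    by (rule blowup_approx_points[of y]) (rule that)
  define B where "B = norm (M *v y) + 1"
  have B: "B > 0" unfolding B_def by (intro add_nonneg_pos) auto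
  define d1 where "d1 = min 1 (e / 4 / (3 * B + 3 * c + 1))"
  have den: "3 * B + 3 * c + 1 > 0" using B c by simp
  have d1: "d1 > 0" "d1 \<le> 1" using e den by (auto simp: d1_def)
  have d1e: "d1 * (3 * B + 3 * c) \<le> e / 4"
  proof -
    have "d1 * (3 * B + 3 * c) \<le> d1 * (3 * B + 3 * c + 1)" using d1 by (intro mult_left_mono) auto
    also have "\<dots> \<le> (e / 4 / (3 * B + 3 * c + 1)) * (3 * B + 3 * c + 1)"
      using den unfolding d1_def by (intro mult_right_mono) auto
    also have "\<dots> = e / 4" using mult_div_self[of "3 * B + 3 * c + 1" "e / 4"] den by (simp only: mult.commute)
    finally show ?thesis .
  qed
  have "isCont (\<lambda>w. w \<bullet> (M *v w) / 2) y"
    by (intro continuous_intros matrix_vector_mult_linear_continuous_at) auto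
  then obtain d2 where d2: "d2 > 0" "\<And>w. dist w y < d2 \<Longrightarrow> dist (w \<bullet> (M *v w) / 2) (y \<bullet> (M *v y) / 2) < e / 4"
    unfolding continuous_at_eps_delta using e by (metis dist_commute divide_pos_pos zero_less_numeral)
  define d where "d = min d1 d2"
  have d: "d > 0" "d \<le> d1" "d \<le> d2" using d1 d2 by (auto simp: d_def)
  have "\<forall>\<^sub>F k in sequentially. dist (\<tau> k) y < d \<and> norm (G k) < B \<and> dist (?a k y) (y \<bullet> (M *v y) / 2) < e / 4"
  proof (intro eventually_conj)
    show "\<forall>\<^sub>F k in sequentially. dist (\<tau> k) y < d" using tendstoD[OF \<tau>(1) d(1)] .
    show "\<forall>\<^sub>F k in sequentially. norm (G k) < B"
      by (rule order_tendstoD(2)[OF tendsto_norm[OF \<tau>(2)]]) (simp add: B_def)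
    show "\<forall>\<^sub>F k in sequentially. dist (?a k y) (y \<bullet> (M *v y) / 2) < e / 4"
      by (rule tendstoD[OF blowup_tendsto]) (use e in simp)
  qed
  then have "\<forall>\<^sub>F k in sequentially. \<forall>w\<in>ball y d. \<bar>?a k w - w \<bullet> (M *v w) / 2\<bar> \<le> e"
  proof eventually_elim
    case (elim k)
    show ?case
    proof
      fix w assume w: "w \<in> ball y d"
      have bnd: "\<bar>?a k v - ?a k (\<tau> k)\<bar> \<le> B * r + c / 2 * r\<^sup>2" if "norm (v - \<tau> k) \<le> r" for v r
      proof -
        have r0: "0 \<le> r" using that norm_ge_zero order_trans by blast
        have "\<bar>G k \<bullet> (v - \<tau> k)\<bar> \<le> norm (G k) * norm (v - \<tau> k)" by (rule Cauchy_Schwarz_ineq2)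
        also have "\<dots> \<le> B * r" using elim that B r0 by (intro mult_mono) auto
        finally have 1: "\<bar>G k \<bullet> (v - \<tau> k)\<bar> \<le> B * r" .
        have "(v - \<tau> k) \<bullet> (v - \<tau> k) \<le> r\<^sup>2"
          using that by (simp add: power2_norm_eq_inner[symmetric] power_mono)
        then have "c / 2 * ((v - \<tau> k) \<bullet> (v - \<tau> k)) \<le> c / 2 * r\<^sup>2" using c by (intro mult_left_mono) auto
        then show ?thesis using le[of k v] 1 by linarith
      qed
      have ty: "norm (y - \<tau> k) \<le> d" using elim by (simp add: dist_norm norm_minus_commute)
      have "norm (w - \<tau> k) \<le> norm (w - y) + norm (y - \<tau> k)"
        using norm_triangle_ineq[of "w - y" "y - \<tau> k"] by simp
      then have wt: "norm (w - \<tau> k) \<le> 2 * d" using ty w by (simp add: dist_norm norm_minus_commute)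
      have "\<bar>?a k w - ?a k y\<bar> \<le> (B * (2 * d) + c / 2 * (2 * d)\<^sup>2) + (B * d + c / 2 * d\<^sup>2)"
        using bnd[OF wt] bnd[OF ty] by linarith
      also have "\<dots> = d * (3 * B) + (5 / 2 * c * d) * d"
        by (simp add: power2_eq_square algebra_simps)
      also have "\<dots> \<le> d * (3 * B) + (3 * c * 1) * d"
        using d d1 c by (intro add_left_mono mult_right_mono mult_mono) auto
      also have "\<dots> \<le> d1 * (3 * B + 3 * c)"
        using d B c mult_right_mono[OF d(2), of "3 * B + 3 * c"] by (simp add: algebra_simps)
      finally have "\<bar>?a k w - ?a k y\<bar> \<le> e / 4" using d1e by linarith
      moreover have "dist (w \<bullet> (M *v w) / 2) (y \<bullet> (M *v y) / 2) < e / 4"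
        using w d(3) by (intro d2(2)) (auto simp: dist_commute)
      ultimately show "\<bar>?a k w - w \<bullet> (M *v w) / 2\<bar> \<le> e"
        using elim e unfolding dist_real_def by linarith
    qed
  qed
  with d(1) show ?thesis by blast
qed

lemma blowup_uniform:
  assumes e: "e > 0"
  shows "\<forall>\<^sub>F k in sequentially. \<forall>w\<in>cball 0 1. \<bar>blowup A (P z) z (h k) w - w \<bullet> (M *v w) / 2\<bar> \<le> e"
proof -
  have "\<exists>d. \<forall>y. d y > 0 \<and>
    (\<forall>\<^sub>F k in sequentially. \<forall>w\<in>ball y (d y). \<bar>blowup A (P z) z (h k) w - w \<bullet> (M *v w) / 2\<bar> \<le> e)"
    by (rule choice) (rule allI, rule blowup_local_uniform[OF e])
  then obtain d where dd: "\<forall>y. d y > 0 \<and>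
    (\<forall>\<^sub>F k in sequentially. \<forall>w\<in>ball y (d y). \<bar>blowup A (P z) z (h k) w - w \<bullet> (M *v w) / 2\<bar> \<le> e)"
    by (rule exE)
  have d: "d y > 0"
    "\<forall>\<^sub>F k in sequentially. \<forall>w\<in>ball y (d y). \<bar>blowup A (P z) z (h k) w - w \<bullet> (M *v w) / 2\<bar> \<le> e" for y
    using spec[OF dd, of y] by (rule conjunct1, rule conjunct2)
  have cov: "cball (0::real^'n) 1 \<subseteq> (\<Union>y\<in>cball 0 1. ball y (d y))"
    using d(1) centre_in_ball by blast
  obtain F where F: "F \<subseteq> cball (0::real^'n) 1" "finite F" "cball 0 1 \<subseteq> (\<Union>y\<in>F. ball y (d y))"
    by (rule compactE_image[OF compact_cball open_ball cov]) (rule that)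
  have "\<forall>\<^sub>F k in sequentially. \<forall>y\<in>F. \<forall>w\<in>ball y (d y). \<bar>blowup A (P z) z (h k) w - w \<bullet> (M *v w) / 2\<bar> \<le> e"
    by (rule eventually_ball_finite[OF F(2)]) (rule ballI, rule d(2))
  then show ?thesis
  proof (rule eventually_mono, intro ballI)
    fix k w assume *: "\<forall>y\<in>F. \<forall>w\<in>ball y (d y). \<bar>blowup A (P z) z (h k) w - w \<bullet> (M *v w) / 2\<bar> \<le> e"
      and w: "w \<in> cball (0::real^'n) 1"
    obtain y where "y \<in> F" "w \<in> ball y (d y)" using F(3) w by (meson UN_E subsetD)
    with * show "\<bar>blowup A (P z) z (h k) w - w \<bullet> (M *v w) / 2\<bar> \<le> e" by blast
  qed
qed

text \<open>Uniform convergence of the blow-ups yields jets of \<open>A\<close> itself nearby. Once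
  the limiting form is raised by \<eta> |w|^2, the blow-up minus the form is negative on the unit
  sphere but 0 at the origin, so its maximum is interior and gives a superjet at a point z + h w.
  \<open>M\<close> may fail to be symmetric; only its symmetric part enters the form.\<close>

lemma blowup_csuperjet:
  assumes contA: "continuous_on UNIV A"
  shows "csuperjet A z (P z) ((1/2) *\<^sub>R (M + transpose M))"
proof -
  define X where "X = (1/2) *\<^sub>R (M + transpose M)"
  have Xs: "transpose X = X" by (simp add: X_def transpose_scaleR transpose_add add.commute)
  have XM: "w \<bullet> (X *v w) = w \<bullet> (M *v w)" for w
  proof -
    have "w \<bullet> (transpose M *v w) = w \<bullet> (M *v w)"
      by (metis dot_lmul_matrix inner_commute transpose_matrix_vector)
    then show ?thesis
      by (simp add: X_def scaleR_matrix_vector_assoc[symmetric] matrix_vector_mult_add_rdistrib inner_add_right)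
  qed
  show ?thesis
    unfolding X_def[symmetric] csuperjet_def
  proof (intro conjI allI impI)
    show "transpose X = X" by (rule Xs)
    fix e :: real assume e: "e > 0"
    define \<eta> where "\<eta> = e / 4 / (norm (mat 1 :: real^'n^'n) + 1)"
    have nI: "norm (mat 1 :: real^'n^'n) + 1 > 0" by (intro add_nonneg_pos) auto
    have \<eta>: "\<eta> > 0" using e nI by (simp add: \<eta>_def)
    define Y where "Y = X + (2 * \<eta>) *\<^sub>R mat 1"
    have Ys: "transpose Y = Y" by (simp add: Y_def transpose_add transpose_scaleR Xs)
    have YX: "w \<bullet> (Y *v w) / 2 = w \<bullet> (X *v w) / 2 + \<eta> * (w \<bullet> w)" for w
      by (simp add: Y_def matrix_vector_mult_add_rdistrib scaleR_matrix_vector_assoc[symmetric] inner_add_right)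
    have distY: "dist Y X < e"
    proof -
      have "dist Y X = 2 * \<eta> * norm (mat 1 :: real^'n^'n)" using \<eta> by (simp add: Y_def dist_norm)
      also have "\<dots> \<le> 2 * \<eta> * (norm (mat 1 :: real^'n^'n) + 1)" using \<eta> by (intro mult_left_mono) auto
      finally have le: "dist Y X \<le> 2 * \<eta> * (norm (mat 1 :: real^'n^'n) + 1)" .
      have "(norm (mat 1 :: real^'n^'n) + 1) * \<eta> = e / 4"
        unfolding \<eta>_def using nI by (intro mult_div_self) simp
      then have "2 * \<eta> * (norm (mat 1 :: real^'n^'n) + 1) = e / 2"
        using mult.assoc[of 2 \<eta>] by (simp add: mult.commute)
      then show ?thesis using e le by linarith
    qed
    obtain d1 where d1: "d1 > 0" "\<And>y. dist y z < d1 \<Longrightarrow> \<bar>A y - A z\<bar> < e"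
    proof -
      have "isCont A z" using contA by (simp add: continuous_on_eq_continuous_at)
      then show thesis using that e unfolding continuous_at_eps_delta dist_real_def by blast
    qed
    define d2 where "d2 = min (min d1 e) (e / (norm Y + 1))"
    have nY: "norm Y + 1 > 0" by (intro add_nonneg_pos) auto
    have d2: "d2 > 0" using d1 e nY by (simp add: d2_def)
    have "\<forall>\<^sub>F k in sequentially. h k < d2" using h0 d2 by (rule order_tendstoD)
    moreover have "\<forall>\<^sub>F k in sequentially. \<forall>w\<in>cball 0 1. \<bar>blowup A (P z) z (h k) w - w \<bullet> (M *v w) / 2\<bar> \<le> \<eta> / 2"
      by (rule blowup_uniform) (use \<eta> in simp)
    ultimately have "\<exists>k. h k < d2 \<and> (\<forall>w\<in>cball 0 1. \<bar>blowup A (P z) z (h k) w - w \<bullet> (M *v w) / 2\<bar> \<le> \<eta> / 2)"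
      by (intro eventually_happens'[OF sequentially_bot] eventually_conj)
    then obtain k where k: "h k < d2"
      and close: "\<And>w. w \<in> cball 0 1 \<Longrightarrow> \<bar>blowup A (P z) z (h k) w - w \<bullet> (M *v w) / 2\<bar> \<le> \<eta> / 2" by blast
    define \<Phi> where "\<Phi> w = blowup A (P z) z (h k) w - w \<bullet> (Y *v w) / 2" for w
    have "continuous_on (cball 0 1) (\<lambda>w. A (z + h k *\<^sub>R w))"
      by (rule continuous_on_compose2[OF contA]) (auto intro!: continuous_intros)
    then have "continuous_on (cball 0 1) \<Phi>"
      unfolding \<Phi>_def blowup_def using hpos[of k] by (intro continuous_intros matrix_vector_mult_linear_continuous_on) auto
    then have "\<exists>w\<in>cball 0 1. \<forall>v\<in>cball 0 1. \<Phi> v \<le> \<Phi> w"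
      by (intro continuous_attains_sup) auto
    then obtain w where w: "w \<in> cball 0 1" "\<And>v. v \<in> cball 0 1 \<Longrightarrow> \<Phi> v \<le> \<Phi> w" by blast
    have w1: "norm w < 1"
    proof (rule ccontr)
      assume "\<not> norm w < 1"
      then have "norm w = 1" using w(1) by simp
      then have ww: "w \<bullet> w = 1" by (simp add: norm_eq_1)
      have "\<Phi> w \<le> \<eta> / 2 - \<eta>"
        using close[OF w(1)] unfolding \<Phi>_def YX XM ww by linarith
      moreover have "\<Phi> 0 = 0" by (simp add: \<Phi>_def blowup_def)
      ultimately show False using w(2)[of 0] \<eta> by simp
    qed
    define x where "x = z + h k *\<^sub>R w"
    have xz: "dist x z < d2"
    proof -
      have "dist x z = h k * norm w" using hpos[of k] by (simp add: x_def dist_norm)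
      also have "\<dots> \<le> h k * 1" using hpos[of k] w1 by (intro mult_left_mono) auto
      finally show ?thesis using k by simp
    qed
    have Aeq: "A (z + h k *\<^sub>R v) = A z + h k * (P z \<bullet> v) + (h k)\<^sup>2 * blowup A (P z) z (h k) v" for v
      using hpos[of k] by (simp add: blowup_def)
    have Qeq: "quadr 0 (P z) Y z (z + h k *\<^sub>R v) = h k * (P z \<bullet> v) + (h k)\<^sup>2 * (v \<bullet> (Y *v v) / 2)" for v
      by (simp add: quadr_def matrix_vector_mult_scaleR power2_eq_square)
    have "superjet A x (P z + Y *v (x - z)) Y"
    proof (rule superjet_translate[OF superjet_quadr[OF Ys]])
      have ev: "\<forall>\<^sub>F g in nhds (0::real^'n). norm g < h k * (1 - norm w)"
        unfolding eventually_nhds_metric using hpos[of k] w1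
        by (intro exI[of _ "h k * (1 - norm w)"]) (auto simp: dist_norm)
      then show "\<forall>\<^sub>F g in nhds 0. A (x + g) - A x \<le> quadr 0 (P z) Y z (x + g) - quadr 0 (P z) Y z x"
      proof eventually_elim
        case (elim g)
        define v where "v = w + g /\<^sub>R h k"
        have xg: "x + g = z + h k *\<^sub>R v" using hpos[of k] by (simp add: x_def v_def scaleR_add_right)
        have "norm (g /\<^sub>R h k) = norm g / h k" using hpos[of k] by (simp add: divide_inverse mult.commute)
        also have "\<dots> < 1 - norm w" using elim hpos[of k] by (simp add: pos_divide_less_eq mult.commute)
        finally have "norm v < 1" using norm_triangle_ineq[of w "g /\<^sub>R h k"] by (simp add: v_def)
        then have "\<Phi> v \<le> \<Phi> w" by (intro w(2)) simp
        then have "(h k)\<^sup>2 * \<Phi> v \<le> (h k)\<^sup>2 * \<Phi> w" by (intro mult_left_mono) auto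
        then show ?case
          unfolding xg unfolding x_def Aeq Qeq \<Phi>_def by (simp add: right_diff_distrib)
      qed
    qed
    moreover have "dist (P z + Y *v (x - z)) (P z) < e"
    proof -
      have "dist (P z + Y *v (x - z)) (P z) \<le> norm Y * dist x z"
        using norm_matrix_vector_le[of Y "x - z"] by (simp add: dist_norm)
      also have "\<dots> \<le> (norm Y + 1) * dist x z" by (intro mult_right_mono) auto
      also have "\<dots> < (norm Y + 1) * (e / (norm Y + 1))"
        using xz nY by (intro mult_strict_left_mono) (auto simp: d2_def)
      finally show ?thesis using nY by simp
    qed
    moreover have "dist x z < e" "\<bar>A x - A z\<bar> < e" using xz d1(2) by (auto simp: d2_def)
    ultimately show "\<exists>y q Y. dist y z < e \<and> \<bar>A y - A z\<bar> < e \<and> dist q (P z) < e \<and> dist Y X < e \<and> superjet A y q Y"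
      using distY by blast
  qed
qed

end

section \<open>Assembly of the theorem on sums\<close>

lemma linear_le_quadratic_imp_zero:
  fixes w :: "'a::real_inner"
  assumes "\<And>h. w \<bullet> h \<le> c * (h \<bullet> h)" "c \<ge> 0"
  shows "w = 0"
proof (rule ccontr)
  assume "w \<noteq> 0"
  then have ww: "w \<bullet> w > 0" by simp
  define t where "t = 1 / (2 * (c + 1))"
  have t: "t > 0" using assms(2) by (simp add: t_def)
  have "t * (w \<bullet> w) \<le> c * (t * t * (w \<bullet> w))"
    using assms(1)[of "t *\<^sub>R w"] by (simp add: mult.assoc)
  then have "t * (w \<bullet> w) * 1 \<le> t * (w \<bullet> w) * (c * t)" by (simp add: mult_ac)
  then have "1 \<le> c * t" using t ww by (simp only: mult_le_cancel_left_pos mult_pos_pos)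
  moreover have "c * t < 1" unfolding t_def using assms(2) by (simp add: divide_simps)
  ultimately show False by simp
qed

lemma lipschitz_extension_vec:
  fixes p :: "'a::real_normed_vector \<Rightarrow> real^'m"
  assumes "T \<noteq> {}" and lip: "\<And>x y. x \<in> T \<Longrightarrow> y \<in> T \<Longrightarrow> norm (p x - p y) \<le> L * norm (x - y)" and L: "L \<ge> 0"
  obtains P where "\<And>x. x \<in> T \<Longrightarrow> P x = p x" "\<And>x y i. \<bar>P x $ i - P y $ i\<bar> \<le> L * norm (x - y)"
    "\<And>x y. norm (P x - P y) \<le> real CARD('m) * L * norm (x - y)"
proof -
  have "\<exists>g. (\<forall>x\<in>T. g x = p x $ i) \<and> (\<forall>x y. \<bar>g x - g y\<bar> \<le> L * norm (x - y))" for i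
  proof -
    have "\<bar>p x $ i - p y $ i\<bar> \<le> L * norm (x - y)" if "x \<in> T" "y \<in> T" for x y
      using component_le_norm_cart[of "p x - p y" i] lip[OF that] by simp
    from lipschitz_extension[OF assms(1) this L]
    obtain g where "\<And>x. x \<in> T \<Longrightarrow> g x = p x $ i" "\<And>x y. \<bar>g x - g y\<bar> \<le> L * norm (x - y)" by blast
    then show ?thesis by blast
  qed
  then have "\<exists>g. \<forall>i. (\<forall>x\<in>T. g i x = p x $ i) \<and> (\<forall>x y. \<bar>g i x - g i y\<bar> \<le> L * norm (x - y))"
    by (intro choice allI)
  then obtain g where g: "\<forall>i. (\<forall>x\<in>T. g i x = p x $ i) \<and> (\<forall>x y. \<bar>g i x - g i y\<bar> \<le> L * norm (x - y))"
    by (rule exE)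
  define P where "P x = (\<chi> i. g i x)" for x
  have 1: "P x = p x" if "x \<in> T" for x
    using g that by (simp add: P_def vec_eq_iff)
  have 2: "\<bar>P x $ i - P y $ i\<bar> \<le> L * norm (x - y)" for x y i
    using g by (simp add: P_def)
  have 3: "norm (P x - P y) \<le> real CARD('m) * L * norm (x - y)" for x y
  proof -
    have "norm (P x - P y) \<le> (\<Sum>i\<in>UNIV. \<bar>(P x - P y) $ i\<bar>)" by (rule norm_le_l1_cart)
    also have "\<dots> \<le> (\<Sum>i\<in>(UNIV::'m set). L * norm (x - y))" using 2 by (intro sum_mono) simp
    finally show ?thesis by simp
  qed
  show thesis by (rule that[OF 1 2 3])
qed

lemma sym_part_quad:
  fixes M :: "real^'n^'n"
  shows "w \<bullet> (((1/2) *\<^sub>R (M + transpose M)) *v w) = w \<bullet> (M *v w)"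
proof -
  have "w \<bullet> (transpose M *v w) = (M *v w) \<bullet> w"
    by (metis dot_lmul_matrix inner_commute transpose_matrix_vector)
  then show ?thesis
    by (simp add: scaleR_matrix_vector_assoc[symmetric] matrix_vector_mult_add_rdistrib inner_add_right inner_commute)
qed

lemma negligible_finite_UN: "finite I \<Longrightarrow> (\<And>i. i \<in> I \<Longrightarrow> negligible (N i)) \<Longrightarrow> negligible (\<Union>i\<in>I. N i)"
  by (intro negligible_Union) auto

text \<open>The case of a maximum made strict by \<open>\<kappa>\<close>, with jets at a nearby
  point and opposite slopes up to \<open>\<delta>\<close>. As in Jensen's lemma, the tilted maxima
  form a non-negligible set \<open>T\<close>; the blow-up lemmas are applied at a point of
  \<open>T\<close> outside finitely many null sets.\<close>

lemma sums_perturbed: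
  fixes A B :: "real^'n \<Rightarrow> real"
  assumes A: "semiconvex c A" and B: "semiconvex c B" and c: "c \<ge> 0" and \<kappa>: "\<kappa> > 0" and \<delta>: "\<delta> > 0"
    and max: "\<And>x. A x + B x \<le> A z0 + B z0 - \<kappa> * ((x - z0) \<bullet> (x - z0))"
  obtains z p p' X Y where "dist z z0 \<le> \<delta> / \<kappa>" "csuperjet A z p X" "csuperjet B z p' Y" "norm (p + p') \<le> \<delta>"
    "\<And>y. y \<bullet> (X *v y) + y \<bullet> (Y *v y) \<le> 0" "\<And>y. \<bar>y \<bullet> (X *v y)\<bar> \<le> c * (y \<bullet> y)"
    "\<And>y. \<bar>y \<bullet> (Y *v y)\<bar> \<le> c * (y \<bullet> y)" "pinched c A z p"
proof -
  define \<theta> where "\<theta> x = A x + B x" for x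
  have contA: "continuous_on UNIV A" and contB: "continuous_on UNIV B"
    using A B semiconvex_continuous by blast+
  have cont\<theta>: "continuous_on S \<theta>" for S
    unfolding \<theta>_def using contA contB by (intro continuous_intros) (auto intro: continuous_on_subset)
  \<comment> \<open>At such a point a plane of slope p + p' touches the sum from above; the slope is
    the tilt.\<close>
  define good where "good z p p' \<longleftrightarrow> pinched c A z p \<and> pinched c B z p' \<and> norm (p + p') \<le> \<delta> \<and>
     (\<forall>x. \<theta> x \<le> \<theta> z + (p + p') \<bullet> (x - z)) \<and> dist z z0 \<le> \<delta> / \<kappa>" for z p p'
  define T where "T = {z. \<exists>p p'. good z p p'}"
  \<comment> \<open>Every small slope \<open>q\<close> is realised: outside the ball of radius
    \<delta> / \<kappa> the strictness of the maximum dominates the tilt, so the tilted sum has its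
    global maximum inside.\<close>
  have ex: "\<exists>z p p'. good z p p' \<and> p + p' = q" if q: "norm q \<le> \<delta>" for q
  proof -
    have "compact (cball z0 (\<delta> / \<kappa>))" "cball z0 (\<delta> / \<kappa>) \<noteq> {}"
      using divide_pos_pos[OF \<delta> \<kappa>] by (simp_all add: not_less)
    moreover have "continuous_on (cball z0 (\<delta> / \<kappa>)) (\<lambda>x. \<theta> x - q \<bullet> (x - z0))"
      by (intro continuous_intros cont\<theta>)
    ultimately have "\<exists>z\<in>cball z0 (\<delta> / \<kappa>). \<forall>x\<in>cball z0 (\<delta> / \<kappa>). \<theta> x - q \<bullet> (x - z0) \<le> \<theta> z - q \<bullet> (z - z0)"
      by (rule continuous_attains_sup)
    then obtain z where z: "z \<in> cball z0 (\<delta> / \<kappa>)"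
      and zm: "\<And>x. x \<in> cball z0 (\<delta> / \<kappa>) \<Longrightarrow> \<theta> x - q \<bullet> (x - z0) \<le> \<theta> z - q \<bullet> (z - z0)" by blast
    have glob: "\<theta> x \<le> \<theta> z + q \<bullet> (x - z)" for x
    proof -
      have "\<theta> x - q \<bullet> (x - z0) \<le> \<theta> z - q \<bullet> (z - z0)"
      proof (cases "x \<in> cball z0 (\<delta> / \<kappa>)")
        case True then show ?thesis by (rule zm)
      next
        case False
        define n where "n = norm (x - z0)"
        have n: "n > \<delta> / \<kappa>" using False by (simp add: n_def dist_norm norm_minus_commute)
        then have "\<kappa> * n > \<delta>" using \<kappa> by (simp add: pos_divide_less_eq mult.commute)
        moreover have "n > 0" using n \<delta> \<kappa> by (meson divide_pos_pos less_trans)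
        ultimately have "\<delta> * n \<le> \<kappa> * n * n" by (intro mult_right_mono) auto
        moreover have "\<bar>q \<bullet> (x - z0)\<bar> \<le> \<delta> * n"
          using Cauchy_Schwarz_ineq2[of q "x - z0"] mult_right_mono[OF q, of n] by (simp add: n_def)
        moreover have "(x - z0) \<bullet> (x - z0) = n * n" by (simp add: n_def power2_norm_eq_inner[symmetric] power2_eq_square)
        ultimately have "\<theta> x - q \<bullet> (x - z0) \<le> \<theta> z0"
          using max[of x] unfolding \<theta>_def by (simp add: mult.assoc abs_le_iff)
        also have "\<dots> \<le> \<theta> z - q \<bullet> (z - z0)" using zm[of z0] \<delta> \<kappa> by simp
        finally show ?thesis .
      qed
      then show ?thesis by (simp add: inner_diff_right)
    qed
    obtain s where s: "\<And>h. A (z + h) \<ge> A z + s \<bullet> h - c / 2 * (h \<bullet> h)" using semiconvexD[OF A] by blast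
    obtain s' where s': "\<And>h. B (z + h) \<ge> B z + s' \<bullet> h - c / 2 * (h \<bullet> h)" using semiconvexD[OF B] by blast
    \<comment> \<open>Semiconvexity bounds the sum from below with slope s + s', contact bounds it
      from above with slope q, so the slopes agree. The upper bound for the sum and the lower bound
      for one summand then pinch the other.\<close>
    have "(s + s' - q) \<bullet> h \<le> c * (h \<bullet> h)" for h
      using s[of h] s'[of h] glob[of "z + h"] unfolding \<theta>_def by (simp add: inner_diff_left inner_add_left)
    then have "s + s' - q = 0" by (rule linear_le_quadratic_imp_zero[OF _ c])
    then have sq: "s + s' = q" by simp
    have sqh: "q \<bullet> h = s \<bullet> h + s' \<bullet> h" for h by (simp add: sq[symmetric] inner_add_left)
    have up: "A (z + h) + B (z + h) \<le> A z + B z + (s \<bullet> h + s' \<bullet> h)" for h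
      using glob[of "z + h"] unfolding \<theta>_def by (simp add: sqh)
    have "pinched c A z s" unfolding pinched_def
    proof
      fix h show "\<bar>A (z + h) - A z - s \<bullet> h\<bar> \<le> c / 2 * (h \<bullet> h)"
        using s[of h] s'[of h] up[of h] by linarith
    qed
    moreover have "pinched c B z s'" unfolding pinched_def
    proof
      fix h show "\<bar>B (z + h) - B z - s' \<bullet> h\<bar> \<le> c / 2 * (h \<bullet> h)"
        using s[of h] s'[of h] up[of h] by linarith
    qed
    ultimately have "good z s s'"
      unfolding good_def sq using glob q z by (simp add: dist_commute)
    then show ?thesis using sq by blast
  qed
  have "\<forall>z\<in>T. \<exists>pp. good z (fst pp) (snd pp)" unfolding T_def by auto
  from bchoice[OF this] obtain pp where pp: "\<forall>z\<in>T. good z (fst (pp z)) (snd (pp z))" by (rule exE)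
  define pA pB where "pA z = fst (pp z)" and "pB z = snd (pp z)" for z
  have pg: "good z (pA z) (pB z)" if "z \<in> T" for z using pp that by (simp add: pA_def pB_def)
  have uA: "p = pA z" and uB: "p' = pB z" if g: "good z p p'" for z p p'
  proof -
    have "z \<in> T" using g unfolding T_def by blast
    from pg[OF this] have "pinched c A z (pA z)" "pinched c B z (pB z)" by (auto simp: good_def)
    moreover have "pinched c A z p" "pinched c B z p'" using g by (auto simp: good_def)
    ultimately have "norm (p - pA z) \<le> 3 * c * norm (z - z)" "norm (p' - pB z) \<le> 3 * c * norm (z - z)"
      using pinched_lipschitz[OF _ _ c] by blast+
    then show "p = pA z" "p' = pB z" by simp_all
  qed
  have lipA: "norm (pA x - pA y) \<le> 3 * c * norm (x - y)"
    and lipB: "norm (pB x - pB y) \<le> 3 * c * norm (x - y)" if "x \<in> T" "y \<in> T" for x y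
    using pinched_lipschitz[OF _ _ c, of A y "pA y" x "pA x"] pinched_lipschitz[OF _ _ c, of B y "pB y" x "pB x"]
      pg[OF that(1)] pg[OF that(2)] unfolding good_def by auto
  have Tn: "T \<noteq> {}"
  proof -
    have "norm (0::real^'n) \<le> \<delta>" using \<delta> by simp
    from ex[OF this] show ?thesis unfolding T_def by blast
  qed
  \<comment> \<open>The sum of the two gradients is Lipschitz on \<open>T\<close> and its image
    contains a ball, whereas a Lipschitz image of a negligible set would be negligible.\<close>
  have notneg: "\<not> negligible T"
  proof
    assume neg: "negligible T"
    have "negligible ((\<lambda>z. pA z + pB z) ` T)"
    proof (rule negligible_locally_Lipschitz_image)
      show "DIM(real^'n) \<le> DIM(real^'n)" by (rule order_refl)
      show "negligible T" by (rule neg)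
      fix x assume x: "x \<in> T"
      have "norm (pA y + pB y - (pA x + pB x)) \<le> (6 * c) * norm (y - x)" if "y \<in> T" for y
      proof -
        have e: "pA y + pB y - (pA x + pB x) = (pA y - pA x) + (pB y - pB x)" by simp
        show ?thesis unfolding e
          using norm_triangle_ineq[of "pA y - pA x" "pB y - pB x"] lipA[OF that x] lipB[OF that x] by linarith
      qed
      then show "\<exists>U b. open U \<and> x \<in> U \<and> (\<forall>y\<in>T \<inter> U. norm (pA y + pB y - (pA x + pB x)) \<le> b * norm (y - x))"
        by (intro exI[of _ UNIV] exI[of _ "6 * c"] conjI open_UNIV UNIV_I) blast
    qed
    moreover have "ball 0 \<delta> \<subseteq> (\<lambda>z. pA z + pB z) ` T"
    proof
      fix q :: "real^'n" assume "q \<in> ball 0 \<delta>"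
      then have "norm q \<le> \<delta>" by simp
      from ex[OF this] obtain z p p' where z: "good z p p'" "p + p' = q" by blast
      have "z \<in> T" using z(1) unfolding T_def by blast
      moreover have "q = pA z + pB z" using uA[OF z(1)] uB[OF z(1)] z(2) by simp
      ultimately show "q \<in> (\<lambda>z. pA z + pB z) ` T" by blast
    qed
    ultimately have "negligible (ball (0::real^'n) \<delta>)" by (rule negligible_subset)
    then show False using open_not_negligible[OF open_ball, of "0::real^'n" \<delta>] \<delta> by simp
  qed
  have c3: "3 * c \<ge> 0" using c by simp
  obtain PA where PA: "\<And>x. x \<in> T \<Longrightarrow> PA x = pA x" "\<And>x y i. \<bar>PA x $ i - PA y $ i\<bar> \<le> 3 * c * norm (x - y)"
    "\<And>x y. norm (PA x - PA y) \<le> real CARD('n) * (3 * c) * norm (x - y)"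
    by (rule lipschitz_extension_vec[OF Tn lipA c3]) (assumption, assumption, rule that)
  obtain PB where PB: "\<And>x. x \<in> T \<Longrightarrow> PB x = pB x" "\<And>x y i. \<bar>PB x $ i - PB y $ i\<bar> \<le> 3 * c * norm (x - y)"
    "\<And>x y. norm (PB x - PB y) \<le> real CARD('n) * (3 * c) * norm (x - y)"
    by (rule lipschitz_extension_vec[OF Tn lipB c3]) (assumption, assumption, rule that)
  have sd: "\<exists>N. negligible N \<and> (\<forall>x. x \<notin> N \<longrightarrow> (\<forall>b v. (\<lambda>k. second_diff f k b v x) \<longlonglongrightarrow> 0))"
    if f: "\<And>x y. \<bar>f x - f y\<bar> \<le> l * norm (x - y)" "l \<ge> 0" for f :: "real^'n \<Rightarrow> real" and l
  proof -
    have "\<bar>f x - f y\<bar> \<le> (l + 1) * norm (x - y)" for x y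
      using f(1)[of x y] norm_ge_zero[of "x - y"] unfolding distrib_right by linarith
    moreover have "l + 1 > 0" using f(2) by simp
    ultimately obtain N where N: "negligible N" "\<And>x b v. x \<notin> N \<Longrightarrow> (\<lambda>k. second_diff f k b v x) \<longlonglongrightarrow> 0"
      by (rule second_diff_tendsto_0) (rule that)
    show ?thesis
      by (intro exI[of _ N] conjI allI impI N)
  qed
  have "\<exists>NA. \<forall>i. negligible (NA i) \<and> (\<forall>x. x \<notin> NA i \<longrightarrow> (\<forall>b v. (\<lambda>k. second_diff (\<lambda>x. PA x $ i) k b v x) \<longlonglongrightarrow> 0))"
    by (intro choice allI sd[OF PA(2) c3])
  then obtain NA where NA: "\<forall>i. negligible (NA i) \<and> (\<forall>x. x \<notin> NA i \<longrightarrow> (\<forall>b v. (\<lambda>k. second_diff (\<lambda>x. PA x $ i) k b v x) \<longlonglongrightarrow> 0))"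
    by (rule exE)
  have "\<exists>NB. \<forall>i. negligible (NB i) \<and> (\<forall>x. x \<notin> NB i \<longrightarrow> (\<forall>b v. (\<lambda>k. second_diff (\<lambda>x. PB x $ i) k b v x) \<longlonglongrightarrow> 0))"
    by (intro choice allI sd[OF PB(2) c3])
  then obtain NB where NB: "\<forall>i. negligible (NB i) \<and> (\<forall>x. x \<notin> NB i \<longrightarrow> (\<forall>b v. (\<lambda>k. second_diff (\<lambda>x. PB x $ i) k b v x) \<longlonglongrightarrow> 0))"
    by (rule exE)
  have ld: "\<bar>infdist x T - infdist y T\<bar> \<le> 1 * norm (x - y)" for x y
    using infdist_triangle_abs[of x T y] by (simp add: dist_norm)
  from sd[OF ld zero_le_one]
  obtain Nd where Nd: "negligible Nd" "\<forall>x. x \<notin> Nd \<longrightarrow> (\<forall>b v. (\<lambda>k. second_diff (\<lambda>x. infdist x T) k b v x) \<longlonglongrightarrow> 0)"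
    by (elim exE conjE)
  have neg: "negligible ((\<Union>i. NA i) \<union> (\<Union>i. NB i) \<union> Nd)"
  proof (intro negligible_Un negligible_finite_UN)
    show "negligible (NA i)" for i by (rule conjunct1[OF spec[OF NA]])
    show "negligible (NB i)" for i by (rule conjunct1[OF spec[OF NB]])
    show "negligible Nd" by (rule Nd(1))
  qed simp_all
  \<comment> \<open>The exceptional sets belong to the components of the two extended gradients and
    to the distance from \<open>T\<close>.\<close>
  have "\<not> T \<subseteq> (\<Union>i. NA i) \<union> (\<Union>i. NB i) \<union> Nd"
    using notneg negligible_subset[OF neg] by iprover
  then obtain z where zT: "z \<in> T" and zn: "z \<notin> (\<Union>i. NA i) \<union> (\<Union>i. NB i) \<union> Nd"
    by (meson subsetI)
  have zN: "z \<notin> NA i" "z \<notin> NB i" "z \<notin> Nd" for i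
    using zn by simp_all
  have sA: "(\<lambda>k. second_diff (\<lambda>x. PA x $ i) k b v z) \<longlonglongrightarrow> 0" for i b v
    using conjunct2[OF spec[OF NA, of i]] zN(1)[of i] by iprover
  have sB: "(\<lambda>k. second_diff (\<lambda>x. PB x $ i) k b v z) \<longlonglongrightarrow> 0" for i b v
    using conjunct2[OF spec[OF NB, of i]] zN(2)[of i] by iprover
  have sd0: "(\<lambda>k. second_diff (\<lambda>x. infdist x T) k b v z) \<longlonglongrightarrow> 0" for b v
    using Nd(2) zN(3) by iprover
  define h where "h k = (1/2::real)^k" for k
  have hp: "h k > 0" for k by (simp add: h_def)
  have hl: "h \<longlonglongrightarrow> 0" unfolding h_def by (rule LIMSEQ_realpow_zero) auto
  have vmid: "(\<lambda>k. (P (z + h k *\<^sub>R (b + 2 *\<^sub>R v)) - 2 *\<^sub>R P (z + h k *\<^sub>R (b + v)) + P (z + h k *\<^sub>R b)) /\<^sub>R h k) \<longlonglongrightarrow> 0"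
    if s: "\<And>i b v. (\<lambda>k. second_diff (\<lambda>x. P x $ i) k b v z) \<longlonglongrightarrow> 0" for P :: "real^'n \<Rightarrow> real^'n" and b v
  proof (rule vec_tendstoI)
    fix i
    show "(\<lambda>k. ((P (z + h k *\<^sub>R (b + 2 *\<^sub>R v)) - 2 *\<^sub>R P (z + h k *\<^sub>R (b + v)) + P (z + h k *\<^sub>R b)) /\<^sub>R h k) $ i) \<longlonglongrightarrow> 0 $ i"
      using s[of i b v] unfolding second_diff_def h_def[symmetric] by (simp add: divide_inverse mult.commute)
  qed
  obtain r1 M1 where r1: "strict_mono (r1::nat \<Rightarrow> nat)"
    and M1: "\<And>y. (\<lambda>k. (PA (z + h (r1 k) *\<^sub>R y) - PA z) /\<^sub>R h (r1 k)) \<longlonglongrightarrow> M1 *v y"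
    by (rule difference_quotient_linear_limit[OF PA(3) hp vmid[OF sA]]) (rule that)
  \<comment> \<open>The second limit is extracted along the scales of the first, so that both
    Hessians live on one sequence.\<close>
  have vmidB: "(\<lambda>k. (PB (z + h (r1 k) *\<^sub>R (b + 2 *\<^sub>R v)) - 2 *\<^sub>R PB (z + h (r1 k) *\<^sub>R (b + v)) + PB (z + h (r1 k) *\<^sub>R b)) /\<^sub>R h (r1 k)) \<longlonglongrightarrow> 0" for b v
    using LIMSEQ_subseq_LIMSEQ[OF vmid[OF sB, of b v] r1] unfolding o_def .
  obtain r2 M2 where r2: "strict_mono (r2::nat \<Rightarrow> nat)"
    and M2: "\<And>y. (\<lambda>k. (PB (z + h (r1 (r2 k)) *\<^sub>R y) - PB z) /\<^sub>R h (r1 (r2 k))) \<longlonglongrightarrow> M2 *v y"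
    by (rule difference_quotient_linear_limit[of PB _ "\<lambda>k. h (r1 k)", OF PB(3) hp vmidB]) (rule that)
  define g where "g k = h (r1 (r2 k))" for k
  have gp: "g k > 0" for k by (simp add: g_def hp)
  have r12: "strict_mono (\<lambda>k. r1 (r2 k))" using strict_mono_o[OF r1 r2] by (simp add: o_def)
  have gl: "g \<longlonglongrightarrow> 0" using LIMSEQ_subseq_LIMSEQ[OF hl r12] unfolding g_def o_def .
  have gA: "(\<lambda>k. (PA (z + g k *\<^sub>R y) - PA z) /\<^sub>R g k) \<longlonglongrightarrow> M1 *v y" for y
    using LIMSEQ_subseq_LIMSEQ[OF M1[of y] r2] unfolding g_def o_def .
  have gB: "(\<lambda>k. (PB (z + g k *\<^sub>R y) - PB z) /\<^sub>R g k) \<longlonglongrightarrow> M2 *v y" for y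
    using M2[of y] unfolding g_def .
  \<comment> \<open>Take base \<open>- y\<close> and step \<open>y\<close>: as the distance vanishes
    at \<open>z\<close>, the second difference is the sum of two non-negative distances over the
    scale, so each of them is o(h).\<close>
  have dens: "(\<lambda>k. infdist (z + g k *\<^sub>R y) T / g k) \<longlonglongrightarrow> 0" for y
  proof (rule tendsto_sandwich[OF _ _ tendsto_const])
    have z0': "infdist z T = 0" using zT by simp
    have "(\<lambda>k. second_diff (\<lambda>x. infdist x T) (r1 (r2 k)) (- y) y z) \<longlonglongrightarrow> 0"
      using LIMSEQ_subseq_LIMSEQ[OF sd0[of "- y" y] r12] unfolding o_def .
    moreover have "second_diff (\<lambda>x. infdist x T) (r1 (r2 k)) (- y) y z = (infdist (z + g k *\<^sub>R y) T + infdist (z - g k *\<^sub>R y) T) / g k" for k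
    proof -
      have e: "- y + 2 *\<^sub>R y = y" "- y + y = 0" by (simp_all add: scaleR_2)
      show ?thesis unfolding second_diff_def e h_def[symmetric] g_def by (simp add: z0')
    qed
    ultimately show "(\<lambda>k. (infdist (z + g k *\<^sub>R y) T + infdist (z - g k *\<^sub>R y) T) / g k) \<longlonglongrightarrow> 0" by simp
    show "\<forall>\<^sub>F k in sequentially. 0 \<le> infdist (z + g k *\<^sub>R y) T / g k"
      using gp by (intro always_eventually allI divide_nonneg_pos infdist_nonneg)
    show "\<forall>\<^sub>F k in sequentially. infdist (z + g k *\<^sub>R y) T / g k \<le> (infdist (z + g k *\<^sub>R y) T + infdist (z - g k *\<^sub>R y) T) / g k"
      using less_imp_le[OF gp] by (intro always_eventually allI divide_right_mono) (simp_all add: infdist_nonneg)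
  qed
  have pinA: "pinched c A t (PA t)" and pinB: "pinched c B t (PB t)" if "t \<in> T" for t
    using pg[OF that] PA(1)[OF that] PB(1)[OF that] by (simp_all add: good_def)
  have K: "real CARD('n) * (3 * c) \<ge> 0" using c by simp
  note argsA = zT c K gp gl pinA PA(3) gA dens
  note argsB = zT c K gp gl pinB PB(3) gB dens
  have gz: "good z (PA z) (PB z)" using pg[OF zT] PA(1)[OF zT] PB(1)[OF zT] by simp
  have sum: "y \<bullet> (M1 *v y) + y \<bullet> (M2 *v y) \<le> 0" for y
  proof -
    have "(\<lambda>k. blowup A (PA z) z (g k) y + blowup B (PB z) z (g k) y) \<longlonglongrightarrow> y \<bullet> (M1 *v y) / 2 + y \<bullet> (M2 *v y) / 2"
      by (intro tendsto_add blowup_tendsto[OF argsA] blowup_tendsto[OF argsB])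
    moreover have "blowup A (PA z) z (g k) y + blowup B (PB z) z (g k) y \<le> 0" for k
    proof -
      have "blowup A (PA z) z (g k) y + blowup B (PB z) z (g k) y
          = (\<theta> (z + g k *\<^sub>R y) - \<theta> z - (PA z + PB z) \<bullet> (g k *\<^sub>R y)) / (g k)\<^sup>2"
        unfolding blowup_def \<theta>_def by (simp add: add_divide_distrib[symmetric] inner_add_left algebra_simps)
      moreover have "\<theta> (z + g k *\<^sub>R y) \<le> \<theta> z + (PA z + PB z) \<bullet> (z + g k *\<^sub>R y - z)"
        using gz unfolding good_def by blast
      ultimately show ?thesis by (simp add: divide_nonpos_nonneg)
    qed
    ultimately have "y \<bullet> (M1 *v y) / 2 + y \<bullet> (M2 *v y) / 2 \<le> 0"
      by (intro LIMSEQ_le_const2) auto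
    then show ?thesis by simp
  qed
  show thesis
  proof (rule that)
    show "dist z z0 \<le> \<delta> / \<kappa>" "norm (PA z + PB z) \<le> \<delta>" "pinched c A z (PA z)"
      using gz by (auto simp: good_def)
    show "csuperjet A z (PA z) ((1/2) *\<^sub>R (M1 + transpose M1))"
      by (rule blowup_csuperjet[OF argsA contA])
    show "csuperjet B z (PB z) ((1/2) *\<^sub>R (M2 + transpose M2))"
      by (rule blowup_csuperjet[OF argsB contB])
    show "y \<bullet> (((1/2) *\<^sub>R (M1 + transpose M1)) *v y) + y \<bullet> (((1/2) *\<^sub>R (M2 + transpose M2)) *v y) \<le> 0" for y
      unfolding sym_part_quad by (rule sum)
    show "\<bar>y \<bullet> (((1/2) *\<^sub>R (M1 + transpose M1)) *v y)\<bar> \<le> c * (y \<bullet> y)" for y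
      unfolding sym_part_quad by (rule blowup_quad_bound[OF argsA])
    show "\<bar>y \<bullet> (((1/2) *\<^sub>R (M2 + transpose M2)) *v y)\<bar> \<le> c * (y \<bullet> y)" for y
      unfolding sym_part_quad by (rule blowup_quad_bound[OF argsB])
  qed
qed

text \<open>Polarisation bounds the entries by the form; for a sequence of Hessians this provides
  compactness.\<close>

lemma sym_mat_norm_bound:
  fixes X :: "real^'n^'n"
  assumes sym: "transpose X = X" and bd: "\<And>y. \<bar>y \<bullet> (X *v y)\<bar> \<le> C * (y \<bullet> y)" and C: "C \<ge> 0"
  shows "norm X \<le> real CARD('n) * (real CARD('n) * (3 * C))"
proof -
  have entry: "\<bar>X $ i $ j\<bar> \<le> 3 * C" for i j
  proof -
    define e f where "e = (axis i 1 :: real^'n)" and "f = (axis j 1 :: real^'n)"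
    have ee: "e \<bullet> e = 1" "f \<bullet> f = 1" by (simp_all add: e_def f_def inner_axis_axis)
    have ef: "\<bar>e \<bullet> f\<bar> \<le> 1"
      using Cauchy_Schwarz_ineq2[of e f] by (simp add: norm_eq_sqrt_inner ee)
    have X: "e \<bullet> (X *v f) = X $ i $ j"
      by (simp add: e_def f_def inner_axis' matrix_vector_mult_basis column_def)
    have "(e + f) \<bullet> (X *v (e + f)) = e \<bullet> (X *v e) + 2 * (e \<bullet> (X *v f)) + f \<bullet> (X *v f)"
      using sym_mat_inner_swap[OF sym, of f e]
      by (simp add: matrix_vector_right_distrib inner_add_left inner_add_right)
    moreover have "(e + f) \<bullet> (e + f) = 2 + 2 * (e \<bullet> f)"
      by (simp add: inner_add_left inner_add_right ee inner_commute)
    moreover have "C * ((e + f) \<bullet> (e + f)) \<le> C * 4"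
      using C ef calculation(2) by (intro mult_left_mono) auto
    ultimately show ?thesis
      using bd[of "e + f"] bd[of e] bd[of f] unfolding ee X by linarith
  qed
  have row: "norm (X $ i) \<le> real CARD('n) * (3 * C)" for i
  proof -
    have "norm (X $ i) \<le> (\<Sum>j\<in>UNIV. \<bar>X $ i $ j\<bar>)" by (rule norm_le_l1_cart)
    also have "\<dots> \<le> (\<Sum>j\<in>(UNIV::'n set). 3 * C)" using entry by (intro sum_mono)
    finally show ?thesis by simp
  qed
  have "norm X \<le> (\<Sum>i\<in>UNIV. norm (X $ i))"
    unfolding norm_vec_def[of X] by (rule L2_set_le_sum) simp
  also have "\<dots> \<le> (\<Sum>i\<in>(UNIV::'n set). real CARD('n) * (3 * C))" using row by (intro sum_mono)
  finally show ?thesis by simp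
qed

lemma superjet_add_square:
  assumes "superjet (\<lambda>x. B x - \<kappa> * ((x - z0) \<bullet> (x - z0))) y q Y"
  shows "superjet B y (q + (2 * \<kappa>) *\<^sub>R (y - z0)) (Y + (2 * \<kappa>) *\<^sub>R mat 1)"
  unfolding superjet_def
proof (intro conjI allI impI)
  show "transpose (Y + (2 * \<kappa>) *\<^sub>R mat 1) = Y + (2 * \<kappa>) *\<^sub>R mat 1"
    using superjet_sym[OF assms] by (simp add: transpose_add transpose_scaleR)
  fix e :: real assume "e > 0"
  then have "\<forall>\<^sub>F h in nhds 0. B (y + h) - \<kappa> * ((y + h - z0) \<bullet> (y + h - z0))
      \<le> B y - \<kappa> * ((y - z0) \<bullet> (y - z0)) + q \<bullet> h + h \<bullet> (Y *v h) / 2 + e * (h \<bullet> h)"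
    using assms unfolding superjet_def by blast
  then show "\<forall>\<^sub>F h in nhds 0. B (y + h) \<le> B y + (q + (2 * \<kappa>) *\<^sub>R (y - z0)) \<bullet> h + h \<bullet> ((Y + (2 * \<kappa>) *\<^sub>R mat 1) *v h) / 2 + e * (h \<bullet> h)"
  proof eventually_elim
    case (elim h)
    define w where "w = y - z0"
    have e1: "y + h - z0 = w + h" by (simp add: w_def)
    have "(w + h) \<bullet> (w + h) = w \<bullet> w + 2 * (w \<bullet> h) + h \<bullet> h"
      by (simp add: inner_add_left inner_add_right inner_commute)
    then have "\<kappa> * ((w + h) \<bullet> (w + h)) = \<kappa> * (w \<bullet> w) + 2 * \<kappa> * (w \<bullet> h) + \<kappa> * (h \<bullet> h)"
      by (simp add: distrib_left)
    moreover have "h \<bullet> ((Y + (2 * \<kappa>) *\<^sub>R mat 1) *v h) / 2 = h \<bullet> (Y *v h) / 2 + \<kappa> * (h \<bullet> h)"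
      by (simp add: matrix_vector_mult_add_rdistrib scaleR_matrix_vector_assoc[symmetric] inner_add_right)
    moreover have "(q + (2 * \<kappa>) *\<^sub>R w) \<bullet> h = q \<bullet> h + 2 * \<kappa> * (w \<bullet> h)" by (simp add: inner_add_left)
    ultimately show ?case using elim unfolding e1 w_def[symmetric] by linarith
  qed
qed

text \<open>Removes the square that made the maximum strict. Limiting jets control the values of the
  perturbed function only, so continuity of \<open>B\<close> is used to recover its own.\<close>

lemma csuperjet_add_square:
  assumes jet: "csuperjet (\<lambda>x. B x - \<kappa> * ((x - z0) \<bullet> (x - z0))) z p Y" and cont: "continuous_on UNIV B" and \<kappa>: "\<kappa> > 0"
  shows "csuperjet B z (p + (2 * \<kappa>) *\<^sub>R (z - z0)) (Y + (2 * \<kappa>) *\<^sub>R mat 1)"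
  unfolding csuperjet_def
proof (intro conjI allI impI)
  have "transpose Y = Y" using jet unfolding csuperjet_def by (rule conjunct1)
  then show "transpose (Y + (2 * \<kappa>) *\<^sub>R mat 1) = Y + (2 * \<kappa>) *\<^sub>R mat 1"
    by (simp add: transpose_add transpose_scaleR)
  fix e :: real assume e: "e > 0"
  obtain d where d: "d > 0" "\<And>y. dist y z < d \<Longrightarrow> \<bar>B y - B z\<bar> < e"
  proof -
    have "isCont B z" using cont by (simp add: continuous_on_eq_continuous_at)
    then show thesis using that e unfolding continuous_at_eps_delta dist_real_def by blast
  qed
  define e' where "e' = min (min d e) (e / (1 + 2 * \<kappa>))"
  have k: "1 + 2 * \<kappa> > 0" using \<kappa> by simp
  have e': "e' > 0" using d e k by (simp add: e'_def)
  have "\<exists>y q Z. dist y z < e' \<and> \<bar>(B y - \<kappa> * ((y - z0) \<bullet> (y - z0))) - (B z - \<kappa> * ((z - z0) \<bullet> (z - z0)))\<bar> < e' \<and> dist q p < e' \<and>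
     dist Z Y < e' \<and> superjet (\<lambda>x. B x - \<kappa> * ((x - z0) \<bullet> (x - z0))) y q Z"
    using jet e' unfolding csuperjet_def by (simp only:)
  then obtain y q Z where y: "dist y z < e'" "dist q p < e'" "dist Z Y < e'"
    and sj: "superjet (\<lambda>x. B x - \<kappa> * ((x - z0) \<bullet> (x - z0))) y q Z"
    by (elim exE conjE)
  have "dist (q + (2 * \<kappa>) *\<^sub>R (y - z0)) (p + (2 * \<kappa>) *\<^sub>R (z - z0)) < e"
  proof -
    have eq: "q + (2 * \<kappa>) *\<^sub>R (y - z0) - (p + (2 * \<kappa>) *\<^sub>R (z - z0)) = (q - p) + (2 * \<kappa>) *\<^sub>R (y - z)"
      by (simp add: scaleR_diff_right)
    have "dist (q + (2 * \<kappa>) *\<^sub>R (y - z0)) (p + (2 * \<kappa>) *\<^sub>R (z - z0)) \<le> dist q p + 2 * \<kappa> * dist y z"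
      unfolding dist_norm eq using norm_triangle_ineq[of "q - p" "(2 * \<kappa>) *\<^sub>R (y - z)"] \<kappa> by (simp add: dist_norm)
    also have "\<dots> < e' + 2 * \<kappa> * e'" using y \<kappa> by (intro add_strict_mono mult_strict_left_mono) auto
    also have "\<dots> = (1 + 2 * \<kappa>) * e'" by (simp add: distrib_right)
    also have "\<dots> \<le> (1 + 2 * \<kappa>) * (e / (1 + 2 * \<kappa>))" using k by (intro mult_left_mono) (simp_all add: e'_def)
    also have "\<dots> = e" using k by (intro mult_div_self) simp
    finally show ?thesis .
  qed
  moreover have "dist (Z + (2 * \<kappa>) *\<^sub>R mat 1) (Y + (2 * \<kappa>) *\<^sub>R mat 1) < e"
    using y(3) by (simp add: e'_def)
  moreover have "dist y z < e" "\<bar>B y - B z\<bar> < e" using y(1) d(2) by (simp_all add: e'_def)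
  ultimately show "\<exists>y q Z. dist y z < e \<and> \<bar>B y - B z\<bar> < e \<and> dist q (p + (2 * \<kappa>) *\<^sub>R (z - z0)) < e \<and>
     dist Z (Y + (2 * \<kappa>) *\<^sub>R mat 1) < e \<and> superjet B y q Z"
    using superjet_add_square[OF sj] by (intro exI conjI)
qed

lemma semiconvex_minus_square:
  assumes B: "semiconvex c B"
  shows "semiconvex (c + 2 * \<kappa>) (\<lambda>x. B x - \<kappa> * ((x - z0) \<bullet> (x - z0)))"
  unfolding semiconvex_def
proof (intro allI)
  fix x
  obtain s where s: "\<And>h. B (x + h) \<ge> B x + s \<bullet> h - c / 2 * (h \<bullet> h)" using semiconvexD[OF B] by blast
  define w where "w = x - z0"
  have "B x - \<kappa> * ((x - z0) \<bullet> (x - z0)) + (s - (2 * \<kappa>) *\<^sub>R w) \<bullet> (y - x) - (c + 2 * \<kappa>) / 2 * ((y - x) \<bullet> (y - x))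
     \<le> B y - \<kappa> * ((y - z0) \<bullet> (y - z0))" for y
  proof -
    define h where "h = y - x"
    have e: "y = x + h" "y - z0 = w + h" by (simp_all add: h_def w_def)
    have "(w + h) \<bullet> (w + h) = w \<bullet> w + 2 * (w \<bullet> h) + h \<bullet> h"
      by (simp add: inner_add_left inner_add_right inner_commute)
    then have "\<kappa> * ((w + h) \<bullet> (w + h)) = \<kappa> * (w \<bullet> w) + 2 * \<kappa> * (w \<bullet> h) + \<kappa> * (h \<bullet> h)"
      by (simp add: distrib_left)
    moreover have "(s - (2 * \<kappa>) *\<^sub>R w) \<bullet> h = s \<bullet> h - 2 * \<kappa> * (w \<bullet> h)" by (simp add: inner_diff_left)
    moreover have "(c + 2 * \<kappa>) / 2 * (h \<bullet> h) = c / 2 * (h \<bullet> h) + \<kappa> * (h \<bullet> h)" by (simp add: field_simps)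
    ultimately show ?thesis
      using s[of h] unfolding e(2) h_def[symmetric] w_def[symmetric] e(1)[symmetric] by linarith
  qed
  then show "\<exists>s. \<forall>y. B x - \<kappa> * ((x - z0) \<bullet> (x - z0)) + s \<bullet> (y - x) - (c + 2 * \<kappa>) / 2 * ((y - x) \<bullet> (y - x))
     \<le> B y - \<kappa> * ((y - z0) \<bullet> (y - z0))" by blast
qed

text \<open>Subtracting \<kappa> |x - z0|^2 from \<open>B\<close> makes the maximum strict. The jets
  of the perturbed problems stay bounded, and a subsequence as \<kappa> tends to 0 gives jets at
  \<open>z0\<close> itself.\<close>

theorem theorem_on_sums:
  fixes A B :: "real^'n \<Rightarrow> real"
  assumes A: "semiconvex c A" and B: "semiconvex c B" and c: "c \<ge> 0"
    and max: "\<And>x. A x + B x \<le> A z0 + B z0"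
  obtains p X Y where "csuperjet A z0 p X" "csuperjet B z0 (- p) Y" "\<And>y. y \<bullet> (X *v y) + y \<bullet> (Y *v y) \<le> 0"
proof -
  define \<kappa> where "\<kappa> j = inverse (real (Suc j))" for j
  have \<kappa>: "\<kappa> j > 0" "\<kappa> j \<le> 1" for j by (auto simp: \<kappa>_def inverse_le_1_iff)
  have \<kappa>l: "\<kappa> \<longlonglongrightarrow> 0" unfolding \<kappa>_def by (rule LIMSEQ_inverse_real_of_nat)
  \<comment> \<open>The subtracted square costs 2 \<kappa>, at most 2, in the semiconvexity
    constant.\<close>
  define C where "C = c + 2"
  have C: "C \<ge> 0" using c by (simp add: C_def)
  have AC: "semiconvex C A" using semiconvex_mono[OF A] by (simp add: C_def)
  have contA: "continuous_on UNIV A" and contB: "continuous_on UNIV B"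
    using A B semiconvex_continuous by blast+
  define R where "R j z p p' X Y \<longleftrightarrow> dist z z0 \<le> \<kappa> j \<and> csuperjet A z p X \<and>
     csuperjet (\<lambda>x. B x - \<kappa> j * ((x - z0) \<bullet> (x - z0))) z p' Y \<and> norm (p + p') \<le> \<kappa> j \<and>
     (\<forall>y. y \<bullet> (X *v y) + y \<bullet> (Y *v y) \<le> 0) \<and> (\<forall>y. \<bar>y \<bullet> (X *v y)\<bar> \<le> C * (y \<bullet> y)) \<and>
     (\<forall>y. \<bar>y \<bullet> (Y *v y)\<bar> \<le> C * (y \<bullet> y)) \<and> pinched C A z p" for j z p p' X Y
  have "\<exists>z p p' X Y. R j z p p' X Y" for j
  proof -
    have BC: "semiconvex C (\<lambda>x. B x - \<kappa> j * ((x - z0) \<bullet> (x - z0)))"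
      by (rule semiconvex_mono[OF semiconvex_minus_square[OF B]]) (use \<kappa>[of j] in \<open>simp add: C_def\<close>)
    have m: "A x + (B x - \<kappa> j * ((x - z0) \<bullet> (x - z0))) \<le> A z0 + (B z0 - \<kappa> j * ((z0 - z0) \<bullet> (z0 - z0))) - \<kappa> j * ((x - z0) \<bullet> (x - z0))" for x
      using max[of x] by simp
    \<comment> \<open>The slope bound is \<kappa> squared, so that the distance bound, its quotient
      by \<kappa>, tends to 0 as well.\<close>
    have kk: "\<kappa> j * \<kappa> j > 0" "\<kappa> j * \<kappa> j / \<kappa> j = \<kappa> j" "\<kappa> j * \<kappa> j \<le> \<kappa> j"
      using \<kappa>[of j] by (simp_all add: mult_left_le)
    obtain z p p' X Y where "dist z z0 \<le> \<kappa> j * \<kappa> j / \<kappa> j" "csuperjet A z p X"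
      "csuperjet (\<lambda>x. B x - \<kappa> j * ((x - z0) \<bullet> (x - z0))) z p' Y" "norm (p + p') \<le> \<kappa> j * \<kappa> j"
      "\<And>y. y \<bullet> (X *v y) + y \<bullet> (Y *v y) \<le> 0" "\<And>y. \<bar>y \<bullet> (X *v y)\<bar> \<le> C * (y \<bullet> y)"
      "\<And>y. \<bar>y \<bullet> (Y *v y)\<bar> \<le> C * (y \<bullet> y)" "pinched C A z p"
      by (rule sums_perturbed[OF AC BC C \<kappa>(1) kk(1) m]) (rule that)
    then have "R j z p p' X Y" unfolding R_def kk(2) using kk(3) by auto
    then show ?thesis by blast
  qed
  then obtain z p p' X Y where R: "\<And>j. R j (z j) (p j) (p' j) (X j) (Y j)" by metis
  have zd: "dist (z j) z0 \<le> \<kappa> j" and jA: "csuperjet A (z j) (p j) (X j)"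
    and jB: "csuperjet (\<lambda>x. B x - \<kappa> j * ((x - z0) \<bullet> (x - z0))) (z j) (p' j) (Y j)"
    and pp: "norm (p j + p' j) \<le> \<kappa> j" and pinA: "pinched C A (z j) (p j)" for j
    using R[of j] unfolding R_def by auto
  have qs: "y \<bullet> (X j *v y) + y \<bullet> (Y j *v y) \<le> 0" and qX: "\<bar>y \<bullet> (X j *v y)\<bar> \<le> C * (y \<bullet> y)"
    and qY: "\<bar>y \<bullet> (Y j *v y)\<bar> \<le> C * (y \<bullet> y)" for j y
    using R[of j] unfolding R_def by auto
  define nb where "nb = real CARD('n) * (real CARD('n) * (3 * C))"
  have nX: "norm (X j) \<le> nb" and nY: "norm (Y j) \<le> nb" for j
    unfolding nb_def
    by (rule sym_mat_norm_bound[OF conjunct1[OF jA[unfolded csuperjet_def]] qX C],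
        rule sym_mat_norm_bound[OF conjunct1[OF jB[unfolded csuperjet_def]] qY C])
  have "compact (cball z0 2)" by simp
  then have "bounded (A ` cball z0 2)"
    by (intro compact_imp_bounded compact_continuous_image continuous_on_subset[OF contA]) auto
  then obtain m where m0: "\<forall>y\<in>A ` cball z0 2. norm y \<le> m"
    unfolding bounded_iff by (rule exE)
  have m: "\<bar>A x\<bar> \<le> m" if "x \<in> cball z0 2" for x
    using bspec[OF m0 imageI[OF that]] by simp
  \<comment> \<open>Pinching over a unit step in the direction of \<open>p j\<close> bounds the
    slope by values of \<open>A\<close>.\<close>
  have np: "norm (p j) \<le> 2 * m + C / 2" for j
  proof (cases "p j = 0")
    case True
    have "0 \<le> m" using m[of z0] abs_ge_zero[of "A z0"] by simp
    then show ?thesis using True C by simp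
  next
    case False
    define h where "h = p j /\<^sub>R norm (p j)"
    have nh: "norm h = 1" using False by (simp add: h_def)
    then have hh: "h \<bullet> h = 1" by (simp add: norm_eq_1)
    have ph: "p j \<bullet> h = norm (p j)"
      using False by (simp add: h_def power2_norm_eq_inner[symmetric] power2_eq_square)
    have d1: "dist (z j) z0 \<le> 1" using zd[of j] \<kappa>(2)[of j] by linarith
    then have "dist (z j + h) z0 \<le> 2"
      using norm_triangle_ineq[of "z j - z0" h] nh by (simp add: dist_norm algebra_simps)
    then have "\<bar>A (z j + h)\<bar> \<le> m" "\<bar>A (z j)\<bar> \<le> m" using d1 by (auto intro!: m simp: dist_commute)
    moreover have "\<bar>A (z j + h) - A (z j) - p j \<bullet> h\<bar> \<le> C / 2 * (h \<bullet> h)" using pinA[of j] unfolding pinched_def by blast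
    ultimately show ?thesis unfolding ph hh by linarith
  qed
  have "bounded (range (\<lambda>j. (p j, X j, Y j)))"
  proof (rule boundedI)
    fix x assume "x \<in> range (\<lambda>j. (p j, X j, Y j))"
    then obtain j where x: "x = (p j, X j, Y j)" by blast
    show "norm x \<le> (2 * m + C / 2) + (nb + nb)"
      unfolding x using norm_Pair_le[of "p j" "(X j, Y j)"] norm_Pair_le[of "X j" "Y j"] np[of j] nX[of j] nY[of j] by linarith
  qed
  then obtain l r where r: "strict_mono (r::nat \<Rightarrow> nat)" and l: "((\<lambda>j. (p j, X j, Y j)) \<circ> r) \<longlonglongrightarrow> l"
    using bounded_imp_convergent_subsequence by blast
  define p0 X0 Y0 where "p0 = fst l" and "X0 = fst (snd l)" and "Y0 = snd (snd l)"
  have pl: "(\<lambda>j. p (r j)) \<longlonglongrightarrow> p0" and Xl: "(\<lambda>j. X (r j)) \<longlonglongrightarrow> X0" and Yl: "(\<lambda>j. Y (r j)) \<longlonglongrightarrow> Y0"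
    using tendsto_fst[OF l] tendsto_fst[OF tendsto_snd[OF l]] tendsto_snd[OF tendsto_snd[OF l]]
    unfolding o_def p0_def X0_def Y0_def by simp_all
  have \<kappa>r: "(\<lambda>j. \<kappa> (r j)) \<longlonglongrightarrow> 0" using LIMSEQ_subseq_LIMSEQ[OF \<kappa>l r] unfolding o_def .
  have zl: "(\<lambda>j. z (r j)) \<longlonglongrightarrow> z0"
    by (rule metric_tendsto_imp_tendsto[OF \<kappa>r]) (use zd \<kappa>(1) in \<open>auto intro!: always_eventually simp: less_imp_le\<close>)
  have "(\<lambda>j. p (r j) + p' (r j)) \<longlonglongrightarrow> 0"
    by (rule metric_tendsto_imp_tendsto[OF \<kappa>r]) (use pp \<kappa>(1) in \<open>auto intro!: always_eventually simp: less_imp_le\<close>)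
  from tendsto_diff[OF this pl] have p'l: "(\<lambda>j. p' (r j)) \<longlonglongrightarrow> - p0" by simp
  have cl: "(\<lambda>j. f (z (r j))) \<longlonglongrightarrow> f z0" if "continuous_on UNIV f" for f :: "real^'n \<Rightarrow> real"
    using continuous_on_tendsto_compose[OF that zl] by simp
  have J1: "csuperjet A z0 p0 X0"
    by (rule csuperjet_limit[OF zl cl[OF contA] pl Xl]) (rule jA)
  have q1: "(\<lambda>j. p' (r j) + (2 * \<kappa> (r j)) *\<^sub>R (z (r j) - z0)) \<longlonglongrightarrow> - p0 + (2 * 0) *\<^sub>R (z0 - z0)"
    by (intro tendsto_intros p'l \<kappa>r zl)
  have q2: "(\<lambda>j. Y (r j) + (2 * \<kappa> (r j)) *\<^sub>R mat 1) \<longlonglongrightarrow> Y0 + (2 * 0) *\<^sub>R mat 1"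
    by (intro tendsto_intros Yl \<kappa>r)
  have J2: "csuperjet B z0 (- p0 + (2 * 0) *\<^sub>R (z0 - z0)) (Y0 + (2 * 0) *\<^sub>R mat 1)"
    by (rule csuperjet_limit[OF zl cl[OF contB] q1 q2]) (rule csuperjet_add_square[OF jB contB \<kappa>(1)])
  have "y \<bullet> (X0 *v y) + y \<bullet> (Y0 *v y) \<le> 0" for y
  proof -
    have mv: "(\<lambda>j. Z j *v y) \<longlonglongrightarrow> Z0 *v y" if "Z \<longlonglongrightarrow> Z0" for Z :: "nat \<Rightarrow> real^'n^'n" and Z0
    proof -
      have "(\<lambda>j. (Z j - Z0) *v y) \<longlonglongrightarrow> 0"
      proof (rule Lim_null_comparison)
        show "\<forall>\<^sub>F j in sequentially. norm ((Z j - Z0) *v y) \<le> norm (Z j - Z0) * norm y"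
          by (intro always_eventually allI norm_matrix_vector_le)
        have "(\<lambda>j. norm (Z j - Z0) * norm y) \<longlonglongrightarrow> norm (Z0 - Z0) * norm y"
          by (intro tendsto_intros that)
        then show "(\<lambda>j. norm (Z j - Z0) * norm y) \<longlonglongrightarrow> 0" by simp
      qed
      then show ?thesis
        unfolding matrix_vector_mult_diff_rdistrib by (rule LIM_zero_cancel)
    qed
    have "(\<lambda>j. y \<bullet> (X (r j) *v y) + y \<bullet> (Y (r j) *v y)) \<longlonglongrightarrow> y \<bullet> (X0 *v y) + y \<bullet> (Y0 *v y)"
      by (intro tendsto_intros mv Xl Yl)
    then show ?thesis by (rule LIMSEQ_le_const2) (use qs in blast)
  qed
  with J1 J2 show thesis by (intro that[of p0 X0 Y0]) simp_all
qed

section \<open>The comparison principle\<close>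

definition usc_on :: "'a::topological_space set \<Rightarrow> ('a \<Rightarrow> real) \<Rightarrow> bool" where
  "usc_on S u \<longleftrightarrow> (\<forall>x\<in>S. \<forall>c>u x. \<exists>U. open U \<and> x \<in> U \<and> (\<forall>y\<in>U \<inter> S. u y < c))"

lemma usc_onD:
  assumes "usc_on S u" "x \<in> S" "u x < c"
  obtains U where "open U" "x \<in> U" "\<And>y. y \<in> U \<Longrightarrow> y \<in> S \<Longrightarrow> u y < c"
proof -
  have "\<exists>U. open U \<and> x \<in> U \<and> (\<forall>y\<in>U \<inter> S. u y < c)" using assms unfolding usc_on_def by blast
  then show thesis using that by auto
qed

lemma usc_onI:
  assumes "\<And>x c. x \<in> S \<Longrightarrow> u x < c \<Longrightarrow> \<exists>U. open U \<and> x \<in> U \<and> (\<forall>y\<in>U \<inter> S. u y < c)"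
  shows "usc_on S u"
  unfolding usc_on_def by (intro ballI allI impI assms)

lemma usc_on_subset: "usc_on S u \<Longrightarrow> T \<subseteq> S \<Longrightarrow> usc_on T u"
proof (rule usc_onI)
  fix x c assume u: "usc_on S u" and T: "T \<subseteq> S" and x: "x \<in> T" "u x < c"
  have xS: "x \<in> S" using T x(1) by (rule subsetD)
  obtain U where U: "open U" "x \<in> U" "\<And>y. y \<in> U \<Longrightarrow> y \<in> S \<Longrightarrow> u y < c"
    by (rule usc_onD[OF u xS x(2)]) (rule that)
  then show "\<exists>U. open U \<and> x \<in> U \<and> (\<forall>y\<in>U \<inter> T. u y < c)"
    using T by (intro exI[of _ U]) auto
qed

lemma continuous_imp_usc_on: "continuous_on S u \<Longrightarrow> usc_on S u"
proof (rule usc_onI)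
  fix x c assume "continuous_on S u" "x \<in> S" "u x < c"
  then obtain U where "open U" "U \<inter> S = u -` {..<c} \<inter> S"
    unfolding continuous_on_open_invariant using open_lessThan by blast
  moreover from this have "x \<in> U" using \<open>x \<in> S\<close> \<open>u x < c\<close> by auto
  ultimately show "\<exists>U. open U \<and> x \<in> U \<and> (\<forall>y\<in>U \<inter> S. u y < c)" by auto
qed

lemma usc_on_add:
  assumes "usc_on S u" "usc_on S v"
  shows "usc_on S (\<lambda>x. u x + v x)"
proof (rule usc_onI)
  fix x c assume x: "x \<in> S" "u x + v x < c"
  define d where "d = (c - u x - v x) / 2"
  have d: "d > 0" using x by (simp add: d_def)
  obtain U where U: "open U" "x \<in> U" "\<And>y. y \<in> U \<Longrightarrow> y \<in> S \<Longrightarrow> u y < u x + d"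
    by (rule usc_onD[OF assms(1) x(1), of "u x + d"]) (use d in simp, rule that)
  obtain V where V: "open V" "x \<in> V" "\<And>y. y \<in> V \<Longrightarrow> y \<in> S \<Longrightarrow> v y < v x + d"
    by (rule usc_onD[OF assms(2) x(1), of "v x + d"]) (use d in simp, rule that)
  have "u y + v y < c" if "y \<in> U \<inter> V \<inter> S" for y
    using U(3)[of y] V(3)[of y] that unfolding d_def by (auto simp: field_simps)
  then show "\<exists>U. open U \<and> x \<in> U \<and> (\<forall>y\<in>U \<inter> S. u y + v y < c)"
    using U V by (intro exI[of _ "U \<inter> V"]) auto
qed

text \<open>Without a maximum every \<open>x\<close> has a strictly better \<open>g x\<close> and a
  neighbourhood lying below that value; finitely many of these cover \<open>K\<close>, and the best
  of the finitely many \<open>g x\<close> contradicts itself.\<close>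

lemma usc_attains_max:
  assumes K: "compact K" "K \<noteq> {}" and u: "usc_on K u"
  shows "\<exists>x\<in>K. \<forall>y\<in>K. u y \<le> u x"
proof (rule ccontr)
  assume "\<not> ?thesis"
  then have "\<forall>x\<in>K. \<exists>y. y \<in> K \<and> u x < u y" by (auto simp: not_le)
  from bchoice[OF this] obtain g where g: "\<forall>x\<in>K. g x \<in> K \<and> u x < u (g x)" by (rule exE)
  have "\<forall>x\<in>K. \<exists>U. open U \<and> x \<in> U \<and> (\<forall>y\<in>U \<inter> K. u y < u (g x))"
    using u g unfolding usc_on_def by blast
  from bchoice[OF this] obtain U where U: "\<forall>x\<in>K. open (U x) \<and> x \<in> U x \<and> (\<forall>y\<in>U x \<inter> K. u y < u (g x))" by (rule exE)
  have op: "open (U x)" if "x \<in> K" for x using U that by blast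
  have cov: "K \<subseteq> (\<Union>x\<in>K. U x)" using U by blast
  obtain C where C: "C \<subseteq> K" "finite C" "K \<subseteq> (\<Union>x\<in>C. U x)"
    by (rule compactE_image[OF K(1) op cov]) (assumption, rule that)
  have Cn: "C \<noteq> {}" using C(3) K(2) by auto
  have "Max ((\<lambda>x. u (g x)) ` C) \<in> (\<lambda>x. u (g x)) ` C" using C(2) Cn by (intro Max_in) auto
  then obtain x where x: "x \<in> C" "Max ((\<lambda>x. u (g x)) ` C) = u (g x)" by blast
  have "g x \<in> K" using g x C(1) by blast
  then obtain x' where x': "x' \<in> C" "g x \<in> U x'" using C(3) by blast
  then have "u (g x) < u (g x')" using U C(1) \<open>g x \<in> K\<close> by blast
  moreover have "u (g x') \<le> Max ((\<lambda>x. u (g x)) ` C)" using C(2) x'(1) by (intro Max_ge) auto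
  ultimately show False using x(2) by simp
qed

lemma usc_tendsto_le:
  assumes u: "usc_on S u" and x: "x \<in> S" and s: "\<And>k. s k \<in> S" "s \<longlonglongrightarrow> x" and l: "b \<longlonglongrightarrow> l" and le: "\<And>k::nat. b k \<le> u (s k)"
  shows "l \<le> u x"
proof (rule ccontr)
  assume "\<not> l \<le> u x"
  then obtain c where c: "u x < c" "c < l" using dense[of "u x" l] by auto
  obtain U where U: "open U" "x \<in> U" "\<And>y. y \<in> U \<Longrightarrow> y \<in> S \<Longrightarrow> u y < c"
    by (rule usc_onD[OF u x c(1)]) (rule that)
  have "\<forall>\<^sub>F k in sequentially. s k \<in> U" using topological_tendstoD[OF s(2) U(1,2)] .
  moreover have "\<forall>\<^sub>F k in sequentially. c < b k" using order_tendstoD(1)[OF l c(2)] .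
  ultimately have "\<forall>\<^sub>F k in sequentially. s k \<in> U \<and> c < b k" by (rule eventually_conj)
  then obtain k where "s k \<in> U" "c < b k" using eventually_happens'[OF sequentially_bot] by blast
  then show False using U(3)[of "s k"] s(1)[of k] le[of k] by simp
qed

section \<open>Sup-convolutions over a compact set\<close>

definition is_supconv :: "real \<Rightarrow> 'a::real_inner set \<Rightarrow> ('a \<Rightarrow> real) \<Rightarrow> ('a \<Rightarrow> real) \<Rightarrow> bool" where
  "is_supconv c K u A \<longleftrightarrow> (\<forall>x. (\<exists>y\<in>K. A x = u y - c / 2 * ((x - y) \<bullet> (x - y))) \<and>
     (\<forall>y\<in>K. u y - c / 2 * ((x - y) \<bullet> (x - y)) \<le> A x))"

lemma supconv_exists:
  fixes K :: "'a::euclidean_space set"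
  assumes "compact K" "K \<noteq> {}" "usc_on K u"
  obtains A where "is_supconv c K u A"
proof -
  have "\<forall>x. \<exists>m. (\<exists>y\<in>K. m = u y - c / 2 * ((x - y) \<bullet> (x - y))) \<and> (\<forall>y\<in>K. u y - c / 2 * ((x - y) \<bullet> (x - y)) \<le> m)"
  proof
    fix x
    have "continuous_on K (\<lambda>y. - (c / 2 * ((x - y) \<bullet> (x - y))))" by (intro continuous_intros)
    then have "usc_on K (\<lambda>y. u y + - (c / 2 * ((x - y) \<bullet> (x - y))))"
      by (intro usc_on_add assms(3) continuous_imp_usc_on)
    from usc_attains_max[OF assms(1,2) this]
    obtain y where "y \<in> K" "\<forall>z\<in>K. u z + - (c / 2 * ((x - z) \<bullet> (x - z))) \<le> u y + - (c / 2 * ((x - y) \<bullet> (x - y)))" by blast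
    then show "\<exists>m. (\<exists>y\<in>K. m = u y - c / 2 * ((x - y) \<bullet> (x - y))) \<and> (\<forall>y\<in>K. u y - c / 2 * ((x - y) \<bullet> (x - y)) \<le> m)"
      by (intro exI[of _ "u y - c / 2 * ((x - y) \<bullet> (x - y))"] conjI bexI[of _ y]) auto
  qed
  from choice[OF this] obtain A where "\<forall>x. (\<exists>y\<in>K. A x = u y - c / 2 * ((x - y) \<bullet> (x - y))) \<and> (\<forall>y\<in>K. u y - c / 2 * ((x - y) \<bullet> (x - y)) \<le> A x)" by (rule exE)
  then show thesis by (intro that) (simp only: is_supconv_def)
qed

lemma supconv_max:
  assumes "is_supconv c K u A"
  obtains y where "y \<in> K" "A x = u y - c / 2 * ((x - y) \<bullet> (x - y))"
  using assms unfolding is_supconv_def by blast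

lemma supconv_ge: "is_supconv c K u A \<Longrightarrow> y \<in> K \<Longrightarrow> u y - c / 2 * ((x - y) \<bullet> (x - y)) \<le> A x"
  unfolding is_supconv_def by blast

lemma supconv_semiconvex:
  assumes A: "is_supconv c K u A"
  shows "semiconvex c A"
  unfolding semiconvex_def
proof
  fix x
  obtain y where y: "y \<in> K" "A x = u y - c / 2 * ((x - y) \<bullet> (x - y))" by (rule supconv_max[OF A])
  have "A x + (c *\<^sub>R (y - x)) \<bullet> (x' - x) - c / 2 * ((x' - x) \<bullet> (x' - x)) \<le> A x'" for x'
  proof -
    have e: "(x' - y) \<bullet> (x' - y) = (x - y) \<bullet> (x - y) - 2 * ((y - x) \<bullet> (x' - x)) + (x' - x) \<bullet> (x' - x)"
      by (simp add: inner_diff_left inner_diff_right inner_commute)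
    have "c / 2 * ((x' - y) \<bullet> (x' - y)) = c / 2 * ((x - y) \<bullet> (x - y)) - (c *\<^sub>R (y - x)) \<bullet> (x' - x) + c / 2 * ((x' - x) \<bullet> (x' - x))"
      unfolding e by (simp add: right_diff_distrib distrib_left)
    then show ?thesis using supconv_ge[OF A y(1), of x'] y(2) by linarith
  qed
  then show "\<exists>s. \<forall>x'. A x + s \<bullet> (x' - x) - c / 2 * ((x' - x) \<bullet> (x' - x)) \<le> A x'" by blast
qed

text \<open>Moving \<open>x\<close> and the maximising point \<open>y\<close> together leaves the
  penalty unchanged, so a superjet of the sup-convolution at \<open>x\<close> is one of
  \<open>u\<close> at \<open>y\<close> with the same gradient and Hessian. For an equation that does
  not contain the point, nothing is lost by the shift.\<close>

lemma supconv_superjet: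
  assumes A: "is_supconv c K u A" and y: "y \<in> interior K" "A x = u y - c / 2 * ((x - y) \<bullet> (x - y))"
    and jet: "superjet A x p X"
  shows "superjet u y p X"
proof (rule superjet_translate[OF jet])
  have "\<forall>\<^sub>F w in nhds y. w \<in> interior K" using y(1) by (simp add: eventually_nhds_in_open)
  then have "\<forall>\<^sub>F h in nhds 0. y + h \<in> interior K"
    by (rule eventually_nhds_0_ball[where P="\<lambda>w. w \<in> interior K" and x=y, THEN iffD2])
  then show "\<forall>\<^sub>F h in nhds 0. u (y + h) - u y \<le> A (x + h) - A x"
  proof eventually_elim
    case (elim h)
    then have "y + h \<in> K" using interior_subset by blast
    from supconv_ge[OF A this, of "x + h"] show ?case using y(2) by simp
  qed
qed

lemma csuperjet_sequence:
  assumes "csuperjet A z p X"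
  obtains zs ps Xs where "zs \<longlonglongrightarrow> z" "(\<lambda>k. A (zs k)) \<longlonglongrightarrow> A z" "ps \<longlonglongrightarrow> p" "Xs \<longlonglongrightarrow> X"
    "\<And>k::nat. superjet A (zs k) (ps k) (Xs k)"
proof -
  define R where "R k y q Y \<longleftrightarrow> dist y z < inverse (real (Suc k)) \<and> \<bar>A y - A z\<bar> < inverse (real (Suc k)) \<and>
     dist q p < inverse (real (Suc k)) \<and> dist Y X < inverse (real (Suc k)) \<and> superjet A y q Y" for k y q Y
  have "\<exists>y q Y. R k y q Y" for k
  proof -
    have "inverse (real (Suc k)) > 0" by simp
    then show ?thesis using conjunct2[OF assms[unfolded csuperjet_def]] unfolding R_def by iprover
  qed
  then obtain zs ps Xs where R: "\<And>k. R k (zs k) (ps k) (Xs k)" by metis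
  have lim: "f \<longlonglongrightarrow> l" if "\<And>k. dist (f k) l < inverse (real (Suc k))" for f :: "nat \<Rightarrow> 'b::metric_space" and l
    by (rule metric_tendsto_imp_tendsto[OF LIMSEQ_inverse_real_of_nat])
      (use that in \<open>auto intro!: always_eventually less_imp_le simp del: of_nat_Suc\<close>)
  show thesis
  proof (rule that)
    show "zs \<longlonglongrightarrow> z" "(\<lambda>k. A (zs k)) \<longlonglongrightarrow> A z" "ps \<longlonglongrightarrow> p" "Xs \<longlonglongrightarrow> X"
      by (rule lim, use R in \<open>simp add: R_def dist_real_def del: of_nat_Suc\<close>)+
    show "superjet A (zs k) (ps k) (Xs k)" for k using R[of k] unfolding R_def by (elim conjE)
  qed
qed

text \<open>By upper semicontinuity, limits of maximising points for arguments tending to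
  \<open>z\<close> are maximising points for \<open>z\<close>, hence interior by \<open>int\<close>;
  so the approximating jets are eventually taken at interior points. The bounds \<open>b\<close>
  converge, whereas the values of the semicontinuous \<open>u\<close> might not.\<close>

lemma supconv_jet_points:
  fixes u :: "real^'n \<Rightarrow> real"
  assumes K: "compact K" and u: "usc_on K u" and A: "is_supconv c K u A" and c: "c \<ge> 0"
    and int: "\<And>y. y \<in> K \<Longrightarrow> A z = u y - c / 2 * ((z - y) \<bullet> (z - y)) \<Longrightarrow> y \<in> interior K"
    and jet: "csuperjet A z p X"
  obtains w q Z b where "\<And>k::nat. w k \<in> interior K" "\<And>k. superjet u (w k) (q k) (Z k)"
    "q \<longlonglongrightarrow> p" "Z \<longlonglongrightarrow> X" "b \<longlonglongrightarrow> A z" "\<And>k. b k \<le> u (w k)"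
proof -
  obtain zs ps Xs where s: "zs \<longlonglongrightarrow> z" "(\<lambda>k. A (zs k)) \<longlonglongrightarrow> A z" "ps \<longlonglongrightarrow> p" "Xs \<longlonglongrightarrow> X"
    "\<And>k::nat. superjet A (zs k) (ps k) (Xs k)"
    by (rule csuperjet_sequence[OF jet]) (rule that)
  have "\<forall>k. \<exists>y. y \<in> K \<and> A (zs k) = u y - c / 2 * ((zs k - y) \<bullet> (zs k - y))"
    using A unfolding is_supconv_def by blast
  from choice[OF this] obtain y where y: "\<forall>k. y k \<in> K \<and> A (zs k) = u (y k) - c / 2 * ((zs k - y k) \<bullet> (zs k - y k))"
    by (rule exE)
  have yK: "\<forall>k. y k \<in> K" using y by iprover
  obtain l r where l: "l \<in> K" and r: "strict_mono (r::nat \<Rightarrow> nat)" and yl: "(y \<circ> r) \<longlonglongrightarrow> l"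
    by (rule seq_compactE[OF compact_imp_seq_compact[OF K] yK]) (rule that)
  have yl': "(\<lambda>k. y (r k)) \<longlonglongrightarrow> l" using yl by (simp add: o_def)
  note sub = LIMSEQ_subseq_LIMSEQ[OF _ r, unfolded o_def]
  have bl: "(\<lambda>k. A (zs (r k)) + c / 2 * ((zs (r k) - y (r k)) \<bullet> (zs (r k) - y (r k)))) \<longlonglongrightarrow> A z + c / 2 * ((z - l) \<bullet> (z - l))"
    by (intro tendsto_intros sub[OF s(1)] sub[OF s(2)] yl')
  have "A z + c / 2 * ((z - l) \<bullet> (z - l)) \<le> u l"
  proof (rule usc_tendsto_le[OF u l _ yl' bl])
    show "y (r k) \<in> K" for k using yK by iprover
    show "A (zs (r k)) + c / 2 * ((zs (r k) - y (r k)) \<bullet> (zs (r k) - y (r k))) \<le> u (y (r k))" for k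
      using conjunct2[OF spec[OF y, of "r k"]] by linarith
  qed
  then have "A z = u l - c / 2 * ((z - l) \<bullet> (z - l))"
    using supconv_ge[OF A l, of z] by linarith
  then have li: "l \<in> interior K" by (rule int[OF l])
  have "\<forall>\<^sub>F k in sequentially. y (r k) \<in> interior K"
    using topological_tendstoD[OF yl' open_interior li] .
  then obtain N where N: "\<And>k. k \<ge> N \<Longrightarrow> y (r k) \<in> interior K" unfolding eventually_sequentially by blast
  define t where "t k = r (k + N)" for k
  have t: "strict_mono t" using r by (simp add: t_def strict_mono_def)
  note subt = LIMSEQ_subseq_LIMSEQ[OF _ t, unfolded o_def]
  show thesis
  proof (rule that[of "\<lambda>k. y (t k)" "\<lambda>k. ps (t k)" "\<lambda>k. Xs (t k)" "\<lambda>k. A (zs (t k))"])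
    show 1: "y (t k) \<in> interior K" for k unfolding t_def by (rule N) simp
    have e: "A (zs (t k)) = u (y (t k)) - c / 2 * ((zs (t k) - y (t k)) \<bullet> (zs (t k) - y (t k)))" for k
      using conjunct2[OF spec[OF y, of "t k"]] .
    show "superjet u (y (t k)) (ps (t k)) (Xs (t k))" for k
      by (rule supconv_superjet[OF A 1 e s(5)])
    show "(\<lambda>k. ps (t k)) \<longlonglongrightarrow> p" "(\<lambda>k. Xs (t k)) \<longlonglongrightarrow> X" "(\<lambda>k. A (zs (t k))) \<longlonglongrightarrow> A z"
      by (rule subt[OF s(3)], rule subt[OF s(4)], rule subt[OF s(2)])
    show "A (zs (t k)) \<le> u (y (t k))" for k
      unfolding e using c by simp
  qed
qed

section \<open>The operator in the logarithmic variable\<close>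

lemma outer_mult_vec: "outer p q *v h = (q \<bullet> h) *\<^sub>R p"
  by (simp add: outer_def matrix_vector_mult_def vec_eq_iff inner_vec_def sum_distrib_left mult_ac)

lemma transpose_outer_self [simp]: "transpose (outer p p) = outer p p"
  by (simp add: outer_def transpose_def vec_eq_iff mult.commute)

text \<open>With \<open>u = exp ((n - 2) / 2 * \<psi>)\<close> one has \<open>- A\<^sup>u = exp (- 2 * \<psi>) * Eop (\<nabla> \<psi>) (\<nabla>\<^sup>2 \<psi>)\<close>; in this variable the
  equation does not depend on the point and is strictly monotone in \<open>\<psi>\<close>.\<close>

definition Eop :: "real^'n \<Rightarrow> real^'n^'n \<Rightarrow> real^'n^'n" where
  "Eop p X = X - outer p p + ((p \<bullet> p) / 2) *\<^sub>R mat 1"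

lemma Eop_sym: "transpose X = X \<Longrightarrow> transpose (Eop p X) = Eop p X"
  by (simp add: Eop_def transpose_add transpose_diff transpose_scaleR)

lemma Eop_mult: "Eop p X *v h = X *v h - (p \<bullet> h) *\<^sub>R p + ((p \<bullet> p) / 2) *\<^sub>R h"
  by (simp add: Eop_def matrix_vector_mult_add_rdistrib matrix_vector_mult_diff_rdistrib outer_mult_vec
      scaleR_matrix_vector_assoc[symmetric])

lemma Eop_form: "h \<bullet> (Eop p X *v h) = h \<bullet> (X *v h) - (p \<bullet> h)\<^sup>2 + (p \<bullet> p) / 2 * (h \<bullet> h)"
  unfolding Eop_mult by (simp add: inner_add_right inner_diff_right power2_eq_square inner_commute)

lemma Eop_tendsto:
  fixes p :: "nat \<Rightarrow> real^'n"
  assumes "p \<longlonglongrightarrow> p0" "X \<longlonglongrightarrow> X0"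
  shows "(\<lambda>k. Eop (p k) (X k)) \<longlonglongrightarrow> Eop p0 X0"
proof -
  have "(\<lambda>k. outer (p k) (p k)) \<longlonglongrightarrow> outer p0 p0"
  proof (intro vec_tendstoI)
    fix i j
    have "(\<lambda>k. p k $ i * p k $ j) \<longlonglongrightarrow> p0 $ i * p0 $ j"
      by (intro tendsto_mult tendsto_vec_nth assms)
    then show "(\<lambda>k. outer (p k) (p k) $ i $ j) \<longlonglongrightarrow> outer p0 p0 $ i $ j" by (simp add: outer_def)
  qed
  then show ?thesis
    unfolding Eop_def by (intro tendsto_intros assms) simp_all
qed

context conf_op
begin

text \<open>A matrix close to \<open>X0\<close> lies between \<open>X0\<close> shifted down and up
  by small multiples of the identity, so monotonicity squeezes the value.\<close>

lemma F_tendsto: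
  assumes X: "X \<longlonglongrightarrow> X0" and sym: "\<And>k. transpose (X k) = X k"
  shows "(\<lambda>k. F (X k)) \<longlonglongrightarrow> F X0"
proof (rule LIMSEQ_I)
  have "(\<lambda>k. transpose (X k)) \<longlonglongrightarrow> transpose X0" by (rule transpose_tendsto[OF X])
  then have "X \<longlonglongrightarrow> transpose X0" by (simp add: sym)
  then have sym0: "transpose X0 = X0" by (rule LIMSEQ_unique[OF _ X])
  fix e :: real assume e: "e > 0"
  obtain d where d: "d > 0" "\<And>t. dist t 0 < d \<Longrightarrow> dist (F (X0 + t *\<^sub>R mat 1)) (F (X0 + 0 *\<^sub>R mat 1)) < e"
    using F_shift[OF sym0] e unfolding continuous_at_eps_delta by blast
  define t where "t = d / 2"
  have t: "t > 0" using d(1) by (simp add: t_def)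
  have up: "dist (F (X0 + t *\<^sub>R mat 1)) (F X0) < e" and lo: "dist (F (X0 + (- t) *\<^sub>R mat 1)) (F X0) < e"
    using d(2)[of t] d(2)[of "- t"] d(1) by (simp_all add: t_def)
  have st: "transpose (X0 + s *\<^sub>R mat 1) = X0 + s *\<^sub>R mat 1" for s
    by (simp add: transpose_add transpose_scaleR sym0)
  have form: "h \<bullet> ((X0 + s *\<^sub>R mat 1) *v h) = h \<bullet> (X0 *v h) + s * (h \<bullet> h)" for s h
    by (simp add: matrix_vector_mult_add_rdistrib scaleR_matrix_vector_assoc[symmetric] inner_add_right)
  obtain N where N: "\<And>k. k \<ge> N \<Longrightarrow> norm (X k - X0) < t" using LIMSEQ_D[OF X t] by blast
  have "norm (F (X k) - F X0) < e" if k: "k \<ge> N" for k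
  proof -
    have n: "norm (X k - X0) \<le> t" using N[OF k] by simp
    have b1: "h \<bullet> (X k *v h) \<le> h \<bullet> (X0 *v h) + t * (h \<bullet> h)" for h
      using quad_form_le[of h "X k - X0"] mult_right_mono[OF n inner_ge_zero[of h]]
      by (simp add: matrix_vector_mult_diff_rdistrib inner_diff_right)
    have n': "norm (X0 - X k) \<le> t" using n by (simp add: norm_minus_commute)
    have b2: "h \<bullet> (X0 *v h) \<le> h \<bullet> (X k *v h) + t * (h \<bullet> h)" for h
      using quad_form_le[of h "X0 - X k"] mult_right_mono[OF n' inner_ge_zero[of h]]
      by (simp add: matrix_vector_mult_diff_rdistrib inner_diff_right)
    have "F (X k) \<le> F (X0 + t *\<^sub>R mat 1)"
      by (rule F_mono[OF sym st]) (simp add: form b1)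
    moreover have "F (X0 + (- t) *\<^sub>R mat 1) \<le> F (X k)"
    proof (rule F_mono[OF st sym])
      show "h \<bullet> ((X0 + (- t) *\<^sub>R mat 1) *v h) \<le> h \<bullet> (X k *v h)" for h
        unfolding form using b2[of h] by linarith
    qed
    ultimately show ?thesis
      using up lo unfolding dist_real_def real_norm_def by linarith
  qed
  then show "\<exists>no. \<forall>k\<ge>no. norm (F (X k) - F X0) < e" by blast
qed

text \<open>By homogeneity of degree \<open>a\<close> the factor exp (- 2 \<psi>) leaves
  \<open>F\<close> as exp (- 2 a \<psi>) and is moved to the other side.\<close>

definition psub :: "(real^'n) set \<Rightarrow> (real^'n \<Rightarrow> real) \<Rightarrow> bool" where
  "psub U u \<longleftrightarrow> (\<forall>x\<in>U. \<forall>p X. superjet u x p X \<longrightarrow> exp (2 * a * u x) \<le> F (Eop p X))"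

definition psuper :: "(real^'n) set \<Rightarrow> (real^'n \<Rightarrow> real) \<Rightarrow> bool" where
  "psuper U u \<longleftrightarrow> (\<forall>x\<in>U. \<forall>p X. subjet u x p X \<longrightarrow> F (Eop p X) \<le> exp (2 * a * u x))"

lemma psub_subset: "psub U u \<Longrightarrow> V \<subseteq> U \<Longrightarrow> psub V u"
  unfolding psub_def by blast

lemma psuper_subset: "psuper U u \<Longrightarrow> V \<subseteq> U \<Longrightarrow> psuper V u"
  unfolding psuper_def by blast

theorem comparison:
  assumes U: "open U" and uu: "usc_on U u" and sub: "psub U u"
    and vv: "usc_on U (\<lambda>x. - v x)" and sup: "psuper U v"
    and bd: "\<And>d. d > 0 \<Longrightarrow> \<exists>K. compact K \<and> K \<subseteq> U \<and> (\<forall>x\<in>U - K. u x \<le> v x + d)"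
    and xU: "x0 \<in> U"
  shows "u x0 \<le> v x0"
proof (rule ccontr)
  assume "\<not> u x0 \<le> v x0"
  \<comment> \<open>Half of the assumed excess: outside \<open>K\<close> the difference is at most
    \<open>d0\<close>, so its maximum \<open>M\<close> on \<open>K\<close> is strictly
    larger.\<close>
  define d0 where "d0 = (u x0 - v x0) / 2"
  have d0: "d0 > 0" using \<open>\<not> u x0 \<le> v x0\<close> by (simp add: d0_def)
  obtain K where K: "compact K" "K \<subseteq> U" "\<And>x. x \<in> U \<Longrightarrow> x \<notin> K \<Longrightarrow> u x \<le> v x + d0"
    using bd[OF d0] by auto
  have x0K: "x0 \<in> K"
  proof (rule ccontr)
    assume "x0 \<notin> K"
    from K(3)[OF xU this] show False using d0 unfolding d0_def by argo
  qed
  have Kn: "K \<noteq> {}" using x0K by blast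
  have "usc_on K (\<lambda>x. u x + - v x)"
    using usc_on_add[OF uu vv] K(2) by (rule usc_on_subset)
  from usc_attains_max[OF K(1) Kn this] obtain xm where xm: "xm \<in> K" "\<And>x. x \<in> K \<Longrightarrow> u x - v x \<le> u xm - v xm" by auto
  define M where "M = u xm - v xm"
  have M: "M > d0" using xm(2)[OF x0K] d0 unfolding M_def d0_def by argo
  obtain r where r: "r > 0" "(\<Union>x\<in>K. cball x r) \<subseteq> U"
    using compact_subset_open_imp_cball_epsilon_subset[OF K(1) U K(2)] by blast
  \<comment> \<open>A compact neighbourhood of \<open>K\<close>, so that maximising points can be
    kept off its boundary \<open>Bd\<close>.\<close>
  define K1 where "K1 = (\<Union>x\<in>K. cball x r)"
  have K1: "compact K1" unfolding K1_def by (rule compact_minkowski_sum_cball[OF K(1)])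
  have K1U: "K1 \<subseteq> U" using r(2) by (simp add: K1_def)
  have Kint: "K \<subseteq> interior K1"
  proof
    fix x assume x: "x \<in> K"
    have "ball x r \<subseteq> K1" unfolding K1_def using x ball_subset_cball by blast
    then have "ball x r \<subseteq> interior K1" by (simp add: interior_maximal)
    then show "x \<in> interior K1" using r(1) by auto
  qed
  have KK1: "K \<subseteq> K1" using Kint interior_subset by blast
  have K1n: "K1 \<noteq> {}" using KK1 Kn by blast
  have u1: "usc_on K1 u" and v1: "usc_on K1 (\<lambda>x. - v x)" using uu vv K1U usc_on_subset by blast+
  obtain m1 where m1: "\<And>y. y \<in> K1 \<Longrightarrow> u y \<le> m1" using usc_attains_max[OF K1 K1n u1] by blast
  obtain m2 where m2: "\<And>y. y \<in> K1 \<Longrightarrow> - v y \<le> m2" using usc_attains_max[OF K1 K1n v1] by blast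
  define S where "S = m1 + m2 - M"
  have S0: "S \<ge> 0" using m1[of xm] m2[of xm] xm(1) KK1 unfolding S_def M_def by auto
  define Bd where "Bd = K1 - interior K1"
  have Bdc: "compact Bd" unfolding Bd_def using K1 by (intro compact_diff) auto
  \<comment> \<open>Open sets on which \<open>u\<close> and \<open>v\<close>, even at different
    points, differ by less than \<open>M\<close>. They cover \<open>Bd\<close>, and a Lebesgue
    number \<eta> of the cover forces close pairs with difference at least \<open>M\<close> into the
    interior of \<open>K1\<close>.\<close>
  define \<G> where "\<G> = {G. open G \<and> (\<forall>y\<in>G \<inter> K1. \<forall>y'\<in>G \<inter> K1. u y - v y' < M)}"
  have Bdcov: "Bd \<subseteq> \<Union>\<G>"
  proof
    fix x assume x: "x \<in> Bd"
    then have xK1: "x \<in> K1" and xnK: "x \<notin> K" using Kint by (auto simp: Bd_def)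
    then have xl: "u x - v x < M" using K(3)[of x] K1U M by force
    define e where "e = (M - (u x - v x)) / 2"
    have e: "e > 0" using xl by (simp add: e_def)
    obtain V1 where V1: "open V1" "x \<in> V1" "\<And>y. y \<in> V1 \<Longrightarrow> y \<in> K1 \<Longrightarrow> u y < u x + e"
      by (rule usc_onD[OF u1 xK1, of "u x + e"]) (use e in simp, rule that)
    obtain V2 where V2: "open V2" "x \<in> V2" "\<And>y. y \<in> V2 \<Longrightarrow> y \<in> K1 \<Longrightarrow> - v y < - v x + e"
      by (rule usc_onD[OF v1 xK1, of "- v x + e"]) (use e in simp, rule that)
    have "u y - v y' < M" if "y \<in> V1 \<inter> V2 \<inter> K1" "y' \<in> V1 \<inter> V2 \<inter> K1" for y y'
    proof -
      have "u y < u x + e" "- v y' < - v x + e" using V1(3)[of y] V2(3)[of y'] that by auto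
      then show ?thesis unfolding e_def by (simp add: field_simps)
    qed
    then have "V1 \<inter> V2 \<in> \<G>" unfolding \<G>_def using V1(1) V2(1) by auto
    then show "x \<in> \<Union>\<G>" using V1(2) V2(2) by blast
  qed
  obtain \<eta> where \<eta>: "\<eta> > 0" "\<And>x. x \<in> Bd \<Longrightarrow> \<exists>G\<in>\<G>. ball x \<eta> \<subseteq> G"
    using Heine_Borel_lemma[OF Bdc Bdcov] unfolding \<G>_def by blast
  have C1: "y \<in> interior K1 \<and> y' \<in> interior K1" if y: "y \<in> K1" "y' \<in> K1" "dist y y' < \<eta>" "u y - v y' \<ge> M" for y y'
  proof -
    have no: False if w: "w \<in> Bd" "y \<in> ball w \<eta>" "y' \<in> ball w \<eta>" for w
    proof -
      obtain G where "G \<in> \<G>" "ball w \<eta> \<subseteq> G" using \<eta>(2)[OF w(1)] by blast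
      then have "u y - v y' < M" using w y unfolding \<G>_def by blast
      then show False using y(4) by simp
    qed
    have "y \<notin> Bd" using no[of y] y(3) \<eta>(1) by auto
    moreover have "y' \<notin> Bd" using no[of y'] y(3) \<eta>(1) by (auto simp: dist_commute)
    ultimately show ?thesis using y by (simp add: Bd_def)
  qed
  \<comment> \<open>A penalty of at most \<open>S\<close>, the largest loss a maximising pair can
    afford, must confine each point to distance \<eta>/2; indeed c/2 (\<eta>/2)^2 = S + 1.\<close>
  define c where "c = 8 * (S + 1) / \<eta>\<^sup>2"
  have c: "c > 0" using S0 \<eta>(1) by (simp add: c_def)
  have near: "norm w < \<eta> / 2" if "c / 2 * (w \<bullet> w) \<le> S" for w :: "real^'n"
  proof (rule ccontr)
    assume "\<not> norm w < \<eta> / 2"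
    then have "(\<eta> / 2)\<^sup>2 \<le> (norm w)\<^sup>2" using \<eta>(1) by (intro power_mono) auto
    then have "c / 2 * (\<eta> / 2)\<^sup>2 \<le> c / 2 * (w \<bullet> w)" using c by (simp add: power2_norm_eq_inner mult_left_mono)
    moreover have "c / 2 * (\<eta> / 2)\<^sup>2 = S + 1" using \<eta>(1) by (simp add: c_def power2_eq_square)
    ultimately show False using that by linarith
  qed
  obtain A where A: "is_supconv c K1 u A" by (rule supconv_exists[OF K1 K1n u1])
  obtain B where B: "is_supconv c K1 (\<lambda>x. - v x) B" by (rule supconv_exists[OF K1 K1n v1])
  have Asc: "semiconvex c A" and Bsc: "semiconvex c B" using A B supconv_semiconvex by blast+
  have "xm \<in> K1" using xm(1) KK1 by blast
  then have ABM: "A xm + B xm \<ge> M"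
    using supconv_ge[OF A, of xm xm] supconv_ge[OF B, of xm xm] by (simp add: M_def)
  obtain \<rho> where \<rho>: "\<And>y. y \<in> K1 \<Longrightarrow> norm y \<le> \<rho>" using compact_imp_bounded[OF K1] unfolding bounded_iff by blast
  have \<rho>0: "\<rho> \<ge> 0" using \<rho>[OF \<open>xm \<in> K1\<close>] norm_ge_zero order_trans by blast
  \<comment> \<open>At distance \<open>t\<close> or more from \<open>K1\<close> the penalty exceeds
    \<open>S\<close>, so the sum is at most \<open>M\<close> there and a maximum over a large ball
    is global.\<close>
  define t where "t = 1 + 2 * S / c"
  have t: "t \<ge> 1" using S0 c by (simp add: t_def)
  have Bm: "B x \<le> m2" for x
  proof -
    obtain y where y: "y \<in> K1" "B x = - v y - c / 2 * ((x - y) \<bullet> (x - y))" by (rule supconv_max[OF B])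
    have "c / 2 * ((x - y) \<bullet> (x - y)) \<ge> 0" using c by simp
    then show ?thesis using y(2) m2[OF y(1)] by linarith
  qed
  have far: "A x + B x \<le> M" if x: "norm x \<ge> \<rho> + t" for x
  proof -
    obtain y where y: "y \<in> K1" "A x = u y - c / 2 * ((x - y) \<bullet> (x - y))" by (rule supconv_max[OF A])
    have "norm (x - y) \<ge> t" using x \<rho>[OF y(1)] norm_triangle_ineq2[of x y] by linarith
    then have "t * 1 \<le> norm (x - y) * norm (x - y)" using t by (intro mult_mono) auto
    then have "t \<le> (x - y) \<bullet> (x - y)" by (simp add: power2_norm_eq_inner[symmetric] power2_eq_square)
    then have "c / 2 * t \<le> c / 2 * ((x - y) \<bullet> (x - y))" using c by (intro mult_left_mono) auto
    moreover have "c / 2 * t = c / 2 + S" using c by (simp add: t_def distrib_left)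
    ultimately have "A x \<le> m1 - S" using y(2) m1[OF y(1)] c by linarith
    then show ?thesis using Bm[of x] by (simp add: S_def)
  qed
  have contAB: "continuous_on UNIV (\<lambda>x. A x + B x)"
    using semiconvex_continuous[OF Asc] semiconvex_continuous[OF Bsc] by (intro continuous_intros)
  have "\<exists>z\<in>cball 0 (\<rho> + t). \<forall>x\<in>cball 0 (\<rho> + t). A x + B x \<le> A z + B z"
  proof (rule continuous_attains_sup)
    show "cball (0::real^'n) (\<rho> + t) \<noteq> {}" using \<rho>0 t by simp
    show "continuous_on (cball 0 (\<rho> + t)) (\<lambda>x. A x + B x)" by (rule continuous_on_subset[OF contAB]) simp
  qed simp
  then obtain z0 where z0: "z0 \<in> cball 0 (\<rho> + t)" "\<And>x. x \<in> cball 0 (\<rho> + t) \<Longrightarrow> A x + B x \<le> A z0 + B z0" by blast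
  have "xm \<in> cball 0 (\<rho> + t)" using \<rho>[OF \<open>xm \<in> K1\<close>] t by simp
  then have z0M: "A z0 + B z0 \<ge> M" using z0(2) ABM by fastforce
  have zmax: "A x + B x \<le> A z0 + B z0" for x
  proof (cases "norm x \<le> \<rho> + t")
    case True
    then show ?thesis by (intro z0(2)) simp
  next
    case False
    then show ?thesis using far[of x] z0M by simp
  qed
  have maxint: "y \<in> interior K1 \<and> y' \<in> interior K1"
    if y: "y \<in> K1" "A z0 = u y - c / 2 * ((z0 - y) \<bullet> (z0 - y))"
      and y': "y' \<in> K1" "B z0 = - v y' - c / 2 * ((z0 - y') \<bullet> (z0 - y'))" for y y'
  proof (rule C1[OF y(1) y'(1)])
    have q: "c / 2 * ((z0 - y) \<bullet> (z0 - y)) \<ge> 0" "c / 2 * ((z0 - y') \<bullet> (z0 - y')) \<ge> 0" using c by simp_all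
    show "M \<le> u y - v y'" using z0M y(2) y'(2) q by linarith
    have "c / 2 * ((z0 - y) \<bullet> (z0 - y)) \<le> S" "c / 2 * ((z0 - y') \<bullet> (z0 - y')) \<le> S"
      using z0M y(2) y'(2) q m1[OF y(1)] m2[OF y'(1)] unfolding S_def by linarith+
    then have "norm (z0 - y) < \<eta> / 2" "norm (z0 - y') < \<eta> / 2" using near by blast+
    then show "dist y y' < \<eta>"
      using dist_triangle[of y y' z0] by (simp add: dist_norm norm_minus_commute)
  qed
  obtain ya where ya: "ya \<in> K1" "A z0 = u ya - c / 2 * ((z0 - ya) \<bullet> (z0 - ya))" by (rule supconv_max[OF A])
  obtain yb where yb: "yb \<in> K1" "B z0 = - v yb - c / 2 * ((z0 - yb) \<bullet> (z0 - yb))" by (rule supconv_max[OF B])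
  have intA: "y \<in> interior K1" if "y \<in> K1" "A z0 = u y - c / 2 * ((z0 - y) \<bullet> (z0 - y))" for y
    using maxint[OF that yb] by (rule conjunct1)
  have intB: "y \<in> interior K1" if "y \<in> K1" "B z0 = - v y - c / 2 * ((z0 - y) \<bullet> (z0 - y))" for y
    using maxint[OF ya that] by (rule conjunct2)
  have c0: "c \<ge> 0" using c by simp
  obtain p X Y where JA: "csuperjet A z0 p X" and JB: "csuperjet B z0 (- p) Y"
    and XY: "\<And>y. y \<bullet> (X *v y) + y \<bullet> (Y *v y) \<le> 0"
    by (rule theorem_on_sums[OF Asc Bsc c0 zmax]) (rule that)
  have iU: "interior K1 \<subseteq> U" using K1U interior_subset by blast
  have FA: "exp (2 * a * A z0) \<le> F (Eop p X)"
  proof -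
    obtain w q Z b where w: "\<And>k::nat. w k \<in> interior K1" "\<And>k. superjet u (w k) (q k) (Z k)"
      "q \<longlonglongrightarrow> p" "Z \<longlonglongrightarrow> X" "b \<longlonglongrightarrow> A z0" "\<And>k. b k \<le> u (w k)"
      by (rule supconv_jet_points[OF K1 u1 A c0 intA JA]) (assumption, assumption, rule that)
    have sZ: "transpose (Z k) = Z k" for k by (rule superjet_sym[OF w(2)])
    have "exp (2 * a * b k) \<le> F (Eop (q k) (Z k))" for k
    proof -
      have "exp (2 * a * b k) \<le> exp (2 * a * u (w k))" using w(6)[of k] a_pos by simp
      also have "\<dots> \<le> F (Eop (q k) (Z k))" using sub w(1,2)[of k] iU unfolding psub_def by blast
      finally show ?thesis .
    qed
    moreover have "(\<lambda>k. exp (2 * a * b k)) \<longlonglongrightarrow> exp (2 * a * A z0)" by (intro tendsto_intros w(5))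
    moreover have "(\<lambda>k. F (Eop (q k) (Z k))) \<longlonglongrightarrow> F (Eop p X)"
      by (rule F_tendsto[OF Eop_tendsto[OF w(3,4)] Eop_sym[OF sZ]])
    ultimately show ?thesis by (intro LIMSEQ_le[of "\<lambda>k. exp (2 * a * b k)" _ "\<lambda>k. F (Eop (q k) (Z k))"]) auto
  qed
  have FB: "F (Eop p (- Y)) \<le> exp (2 * a * (- B z0))"
  proof -
    obtain w q Z b where w: "\<And>k::nat. w k \<in> interior K1" "\<And>k. superjet (\<lambda>x. - v x) (w k) (q k) (Z k)"
      "q \<longlonglongrightarrow> - p" "Z \<longlonglongrightarrow> Y" "b \<longlonglongrightarrow> B z0" "\<And>k. b k \<le> - v (w k)"
      by (rule supconv_jet_points[OF K1 v1 B c0 intB JB]) (assumption, assumption, rule that)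
    have sZ: "transpose (- Z k) = - Z k" for k using superjet_sym[OF w(2)] by simp
    have "F (Eop (- q k) (- Z k)) \<le> exp (2 * a * (- b k))" for k
    proof -
      have "subjet v (w k) (- q k) (- Z k)" unfolding subjet_def using w(2)[of k] by simp
      then have "F (Eop (- q k) (- Z k)) \<le> exp (2 * a * v (w k))"
        using sup w(1)[of k] iU unfolding psuper_def by blast
      also have "v (w k) \<le> - b k" using w(6)[of k] by simp
      then have "2 * a * v (w k) \<le> 2 * a * (- b k)" using a_pos by (intro mult_left_mono) auto
      then have "exp (2 * a * v (w k)) \<le> exp (2 * a * (- b k))" by (simp only: exp_le_cancel_iff)
      finally show ?thesis .
    qed
    moreover have "(\<lambda>k. exp (2 * a * (- b k))) \<longlonglongrightarrow> exp (2 * a * (- B z0))" by (intro tendsto_intros w(5))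
    moreover have "(\<lambda>k. F (Eop (- q k) (- Z k))) \<longlonglongrightarrow> F (Eop p (- Y))"
    proof (rule F_tendsto[OF Eop_tendsto Eop_sym[OF sZ]])
      show "(\<lambda>k. - q k) \<longlonglongrightarrow> p" using tendsto_minus[OF w(3)] by simp
      show "(\<lambda>k. - Z k) \<longlonglongrightarrow> - Y" by (rule tendsto_minus[OF w(4)])
    qed
    ultimately show ?thesis by (intro LIMSEQ_le[of "\<lambda>k. F (Eop (- q k) (- Z k))" _ "\<lambda>k. exp (2 * a * (- b k))"]) auto
  qed
  have sX: "transpose X = X" "transpose (- Y) = - Y"
    using conjunct1[OF JA[unfolded csuperjet_def]] conjunct1[OF JB[unfolded csuperjet_def]] by simp_all
  have "F (Eop p X) \<le> F (Eop p (- Y))"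
  proof (rule F_mono[OF Eop_sym[OF sX(1)] Eop_sym[OF sX(2)]])
    show "h \<bullet> (Eop p X *v h) \<le> h \<bullet> (Eop p (- Y) *v h)" for h
      unfolding Eop_form using XY[of h] by simp
  qed
  then have "exp (2 * a * A z0) \<le> exp (2 * a * (- B z0))" using FA FB by linarith
  then have "2 * a * A z0 \<le> 2 * a * (- B z0)" by (simp only: exp_le_cancel_iff)
  then have "A z0 \<le> - B z0" using a_pos by (simp only: mult_le_cancel_left_pos mult_pos_pos zero_less_numeral)
  then show False using z0M M d0 by linarith
qed

end

section \<open>Barriers, inversions and viscosity solutions in the logarithmic variable\<close>

context conf_op
begin

text \<open>One jet from below suffices: every superjet at the point has the same gradient and a
  larger Hessian. This certifies explicit smooth functions.\<close>

lemma psubI_subjet: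
  assumes "\<And>x. x \<in> U \<Longrightarrow> \<exists>p X. subjet u x p X \<and> exp (2 * a * u x) \<le> F (Eop p X)"
  shows "psub U u"
  unfolding psub_def
proof (intro ballI allI impI)
  fix x q Z assume x: "x \<in> U" and jet: "superjet u x q Z"
  obtain p X where p: "subjet u x p X" "exp (2 * a * u x) \<le> F (Eop p X)" using assms[OF x] by blast
  have qp: "q = p" by (rule superjet_subjet_le(1)[OF jet p(1)])
  have sX: "transpose X = X" using p(1) unfolding subjet_def superjet_def by simp
  have "F (Eop p X) \<le> F (Eop q Z)"
  proof (rule F_mono[OF Eop_sym[OF sX] Eop_sym[OF superjet_sym[OF jet]]])
    show "h \<bullet> (Eop p X *v h) \<le> h \<bullet> (Eop q Z *v h)" for h
      unfolding Eop_form qp using superjet_subjet_le(2)[OF jet p(1), of h] by simp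
  qed
  with p(2) show "exp (2 * a * u x) \<le> F (Eop q Z)" by linarith
qed

lemma psuperI_superjet:
  assumes "\<And>x. x \<in> U \<Longrightarrow> \<exists>p X. superjet u x p X \<and> F (Eop p X) \<le> exp (2 * a * u x)"
  shows "psuper U u"
  unfolding psuper_def
proof (intro ballI allI impI)
  fix x q Z assume x: "x \<in> U" and jet: "subjet u x q Z"
  obtain p X where p: "superjet u x p X" "F (Eop p X) \<le> exp (2 * a * u x)" using assms[OF x] by blast
  have qp: "p = q" by (rule superjet_subjet_le(1)[OF p(1) jet])
  have sZ: "transpose Z = Z" using jet unfolding subjet_def superjet_def by simp
  have "F (Eop q Z) \<le> F (Eop p X)"
  proof (rule F_mono[OF Eop_sym[OF sZ] Eop_sym[OF superjet_sym[OF p(1)]]])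
    show "h \<bullet> (Eop q Z *v h) \<le> h \<bullet> (Eop p X *v h)" for h
      unfolding Eop_form qp using superjet_subjet_le(2)[OF p(1) jet, of h] by simp
  qed
  with p(2) show "F (Eop q Z) \<le> exp (2 * a * u x)" by linarith
qed

text \<open>For \<open>w = s * \<kappa> * (R\<^sup>2 - |x - c|\<^sup>2)\<close> the function \<open>- ln w\<close> is the hyperbolic metric inside (\<open>s = 1\<close>) or outside
  (\<open>s = - 1\<close>) the ball; the normalisation of \<open>\<kappa> = kk / R\<close> makes it an exact solution.\<close>

definition kk :: real where "kk = sqrt (F (mat 1) powr (- 1 / a) / 2)"

lemma kk_pos: "kk > 0"
  using F_one by (simp add: kk_def)

lemma kk_normalised: "(2 * kk\<^sup>2) powr a * F (mat 1) = 1"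
proof -
  have "2 * kk\<^sup>2 = F (mat 1) powr (- 1 / a)" by (simp add: kk_def)
  then have "(2 * kk\<^sup>2) powr a = F (mat 1) powr (- 1 / a * a)" by (simp add: powr_powr)
  also have "\<dots> = F (mat 1) powr (- 1)" using a_pos by simp
  also have "\<dots> = 1 / F (mat 1)" using F_one by (simp add: powr_minus_divide)
  finally show ?thesis using F_one by simp
qed

definition bw :: "real \<Rightarrow> real \<Rightarrow> real^'n \<Rightarrow> real^'n \<Rightarrow> real" where
  "bw s R c x = s * (kk / R) * (R\<^sup>2 - (x - c) \<bullet> (x - c))"

definition bar :: "real \<Rightarrow> real \<Rightarrow> real^'n \<Rightarrow> real^'n \<Rightarrow> real" where
  "bar s R c x = - ln (bw s R c x)"

lemma continuous_bw: "continuous_on S (bw s R c)"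
  unfolding bw_def by (intro continuous_intros)

lemma bar_jets:
  assumes s: "s\<^sup>2 = 1" and R: "R > 0" and x: "bw s R c x > 0"
  shows "\<exists>p X. superjet (bar s R c) x p X \<and> subjet (bar s R c) x p X \<and> F (Eop p X) = exp (2 * a * bar s R c x)"
proof -
  define \<kappa> where "\<kappa> = kk / R"
  define W where "W = bw s R c"
  define D where "D y = (2 * s * \<kappa> / W y) *\<^sub>R (y - c)" for y
  define H where "H = (2 * s * \<kappa> / W x) *\<^sub>R mat 1 + (4 * \<kappa>\<^sup>2 / (W x)\<^sup>2) *\<^sub>R outer (x - c) (x - c)"
  have Wd: "(W has_derivative (\<lambda>h. - (2 * s * \<kappa>) * ((y - c) \<bullet> h))) (at y)" for y
    unfolding W_def bw_def \<kappa>_def[symmetric]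
    by (auto intro!: derivative_eq_intros simp: inner_commute algebra_simps)
  have "open {y. W y > 0}"
    using continuous_on_open_vimage[of UNIV W] continuous_bw[of UNIV s R c]
    by (auto simp: W_def vimage_def greaterThan_def intro!: open_Collect_less continuous_intros)
  then obtain r where r: "r > 0" "ball x r \<subseteq> {y. W y > 0}"
    using x unfolding W_def[symmetric] by (auto simp: open_contains_ball)
  have D1: "(bar s R c has_derivative (\<lambda>h. D y \<bullet> h)) (at y)" if "y \<in> ball x r" for y
  proof -
    have Wy: "W y > 0" using r(2) that by blast
    have "((\<lambda>y. - ln (W y)) has_derivative (\<lambda>h. D y \<bullet> h)) (at y)"
      unfolding D_def using Wy
      by (auto intro!: derivative_eq_intros Wd simp: divide_simps)
    then show ?thesis unfolding bar_def[abs_def] W_def .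
  qed
  have Wx: "W x > 0" using x by (simp add: W_def)
  have D2: "(D has_derivative (\<lambda>h. H *v h)) (at x)"
  proof -
    have Hh: "H *v h = (2 * s * \<kappa> / W x) *\<^sub>R h + ((4 * \<kappa>\<^sup>2 / (W x)\<^sup>2) * ((x - c) \<bullet> h)) *\<^sub>R (x - c)" for h
      by (simp add: H_def matrix_vector_mult_add_rdistrib scaleR_matrix_vector_assoc[symmetric] outer_mult_vec)
    have q: "((\<lambda>y. 2 * s * \<kappa> / W y) has_derivative (\<lambda>h. (4 * \<kappa>\<^sup>2 / (W x)\<^sup>2) * ((x - c) \<bullet> h))) (at x)"
    proof -
      have e: "4 * \<kappa>\<^sup>2 = (2 * s * \<kappa>) * (2 * s * \<kappa>)" using s by (simp add: power2_eq_square)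
      show ?thesis unfolding e using Wx
        by (auto intro!: derivative_eq_intros Wd simp: divide_simps power2_eq_square)
    qed
    have "(D has_derivative (\<lambda>h. (2 * s * \<kappa> / W x) *\<^sub>R (h - 0) + ((4 * \<kappa>\<^sup>2 / (W x)\<^sup>2) * ((x - c) \<bullet> h)) *\<^sub>R (x - c))) (at x)"
      unfolding D_def
      by (rule has_derivative_scaleR[OF q]) (intro derivative_intros)
    then show ?thesis unfolding Hh by simp
  qed
  \<comment> \<open>The rank one part of the Hessian cancels the square of the gradient, and what
    remains is a multiple of the identity. Hence only the value of \<open>F\<close> at
    \<open>mat 1\<close> enters.\<close>
  have E: "Eop (D x) H = (2 * kk\<^sup>2 / (W x)\<^sup>2) *\<^sub>R mat 1"
  proof -
    define \<alpha> where "\<alpha> = 2 * s * \<kappa> / W x"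
    have e: "(2 * s * \<kappa>) * (2 * s * \<kappa>) = 4 * \<kappa>\<^sup>2" using s by (simp add: power2_eq_square)
    have al: "4 * \<kappa>\<^sup>2 / (W x)\<^sup>2 = \<alpha> * \<alpha>"
      unfolding \<alpha>_def e[symmetric] by (simp add: power2_eq_square)
    have DD: "D x \<bullet> D x = 4 * \<kappa>\<^sup>2 / (W x)\<^sup>2 * ((x - c) \<bullet> (x - c))"
      unfolding D_def \<alpha>_def[symmetric] al by (simp only: inner_scaleR_left inner_scaleR_right mult.assoc)
    have oD: "outer (D x) (D x) = (4 * \<kappa>\<^sup>2 / (W x)\<^sup>2) *\<^sub>R outer (x - c) (x - c)"
      unfolding D_def \<alpha>_def[symmetric] al outer_def by (simp add: vec_eq_iff mult_ac)
    have eq: "Eop (D x) H = (2 * s * \<kappa> / W x + D x \<bullet> D x / 2) *\<^sub>R mat 1"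
      unfolding Eop_def H_def oD by (simp add: scaleR_add_left)
    have "2 * s * \<kappa> / W x + D x \<bullet> D x / 2 = (2 * s * \<kappa> * W x + 2 * \<kappa>\<^sup>2 * ((x - c) \<bullet> (x - c))) / (W x)\<^sup>2"
      unfolding DD using Wx by (simp add: field_simps power2_eq_square)
    also have "2 * s * \<kappa> * W x + 2 * \<kappa>\<^sup>2 * ((x - c) \<bullet> (x - c)) = 2 * \<kappa>\<^sup>2 * R\<^sup>2"
    proof -
      have "2 * s * \<kappa> * W x = 2 * s\<^sup>2 * \<kappa>\<^sup>2 * (R\<^sup>2 - (x - c) \<bullet> (x - c))"
        unfolding W_def bw_def \<kappa>_def[symmetric] by (simp add: power2_eq_square)
      then show ?thesis using s by (simp add: right_diff_distrib)
    qed
    also have "\<dots> = 2 * kk\<^sup>2" using R by (simp add: \<kappa>_def power_divide)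
    finally show ?thesis unfolding eq by simp
  qed
  have "F (Eop (D x) H) = (2 * kk\<^sup>2 / (W x)\<^sup>2) powr a * F (mat 1)"
    unfolding E by (rule F_homog) (use Wx kk_pos in simp_all)
  also have "(2 * kk\<^sup>2 / (W x)\<^sup>2) powr a = (2 * kk\<^sup>2) powr a / (W x)\<^sup>2 powr a"
    using Wx by (simp add: powr_divide)
  also have "(2 * kk\<^sup>2) powr a / (W x)\<^sup>2 powr a * F (mat 1) = 1 / (W x)\<^sup>2 powr a"
    using kk_normalised by simp
  also have "\<dots> = exp (2 * a * bar s R c x)"
  proof -
    have "(W x)\<^sup>2 powr a = exp (a * ln ((W x)\<^sup>2))" using Wx by (simp add: powr_def)
    also have "ln ((W x)\<^sup>2) = 2 * ln (W x)" using Wx by (simp add: ln_realpow)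
    finally show ?thesis
      unfolding bar_def W_def[symmetric] by (simp add: exp_minus divide_inverse mult_ac)
  qed
  finally have "F (Eop (D x) H) = exp (2 * a * bar s R c x)" .
  moreover have "superjet (bar s R c) x (D x) H" by (rule superjet_twice_diff[OF r(1) D1 D2])
  moreover have "subjet (bar s R c) x (D x) H" by (rule subjet_twice_diff[OF r(1) D1 D2])
  ultimately show ?thesis by blast
qed

lemma psub_bar:
  assumes "s\<^sup>2 = 1" "R > 0" "\<And>x. x \<in> U \<Longrightarrow> bw s R c x > 0"
  shows "psub U (bar s R c)"
proof (rule psubI_subjet)
  fix x assume "x \<in> U"
  from bar_jets[OF assms(1,2) assms(3)[OF this]]
  show "\<exists>p X. subjet (bar s R c) x p X \<and> exp (2 * a * bar s R c x) \<le> F (Eop p X)" by force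
qed

lemma psuper_bar:
  assumes "s\<^sup>2 = 1" "R > 0" "\<And>x. x \<in> U \<Longrightarrow> bw s R c x > 0"
  shows "psuper U (bar s R c)"
proof (rule psuperI_superjet)
  fix x assume "x \<in> U"
  from bar_jets[OF assms(1,2) assms(3)[OF this]]
  show "\<exists>p X. superjet (bar s R c) x p X \<and> F (Eop p X) \<le> exp (2 * a * bar s R c x)" by force
qed

lemma continuous_bar:
  assumes "\<And>x. x \<in> S \<Longrightarrow> bw s R c x > 0"
  shows "continuous_on S (bar s R c)"
  unfolding bar_def by (intro continuous_intros continuous_bw) (use assms in force)

end

section \<open>Inversions and Kelvin transforms\<close>

lemma quadr_has_derivative:
  assumes "transpose X = X"
  shows "(quadr c p X z has_derivative (\<lambda>h. (p + X *v (y - z)) \<bullet> h)) (at y)"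
proof -
  have lin: "((\<lambda>y. X *v (y - z)) has_derivative (\<lambda>h. X *v h)) (at y)"
    by (rule has_derivative_eq_rhs[OF bounded_linear.has_derivative[OF matrix_vector_mul_bounded_linear]])
      (auto intro!: derivative_eq_intros)
  have id: "((\<lambda>y. y - z) has_derivative (\<lambda>h. h)) (at y)" by (auto intro!: derivative_eq_intros)
  have "((\<lambda>y. c + p \<bullet> (y - z) + (y - z) \<bullet> (X *v (y - z)) / 2) has_derivative
     (\<lambda>h. p \<bullet> h + ((y - z) \<bullet> (X *v h) + h \<bullet> (X *v (y - z))) / 2)) (at y)"
    by (rule derivative_eq_intros id lin has_derivative_inner[OF id lin] refl | simp)+
  moreover have "p \<bullet> h + ((y - z) \<bullet> (X *v h) + h \<bullet> (X *v (y - z))) / 2 = (p + X *v (y - z)) \<bullet> h" for h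
    unfolding inner_add_left using sym_mat_inner_swap[OF assms, of "y - z" h] inner_commute[of h "X *v (y - z)"] by simp
  ultimately show ?thesis unfolding quadr_def[abs_def] by simp
qed

text \<open>\<open>l\<close> is the squared radius of the fixed sphere.\<close>

definition inversion :: "real^'n \<Rightarrow> real \<Rightarrow> real^'n \<Rightarrow> real^'n" where
  "inversion c l y = c + (l / ((y - c) \<bullet> (y - c))) *\<^sub>R (y - c)"

text \<open>The logarithm of the conformal factor is added, since \<psi> stands for the metric exp
  (2 \<psi>) times the flat one.\<close>

definition kelvin :: "real^'n \<Rightarrow> real \<Rightarrow> (real^'n \<Rightarrow> real) \<Rightarrow> real^'n \<Rightarrow> real" where
  "kelvin c l u y = u (inversion c l y) + ln (l / ((y - c) \<bullet> (y - c)))"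

lemma inversion_facts:
  assumes l: "l > 0" and z: "z \<noteq> c"
  shows "inversion c l z \<noteq> c" "inversion c l (inversion c l z) = z"
    "kelvin c l u (inversion c l z) + ln (l / ((z - c) \<bullet> (z - c))) = u z"
proof -
  define \<zeta> where "\<zeta> = z - c"
  define \<mu> where "\<mu> = l / (\<zeta> \<bullet> \<zeta>)"
  have r2: "\<zeta> \<bullet> \<zeta> > 0" using z by (simp add: \<zeta>_def)
  have \<mu>: "\<mu> > 0" using l r2 by (simp add: \<mu>_def)
  have I: "inversion c l z = c + \<mu> *\<^sub>R \<zeta>" by (simp add: inversion_def \<zeta>_def \<mu>_def)
  show "inversion c l z \<noteq> c" unfolding I using \<mu> z by (simp add: \<zeta>_def)
  have q: "(c + \<mu> *\<^sub>R \<zeta> - c) \<bullet> (c + \<mu> *\<^sub>R \<zeta> - c) = \<mu> * l"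
    using r2 by (simp add: \<mu>_def)
  have q': "l / (\<mu> * l) = 1 / \<mu>" using l by simp
  show II: "inversion c l (inversion c l z) = z"
    unfolding I unfolding inversion_def q q' using \<mu> by (simp add: \<zeta>_def)
  show "kelvin c l u (inversion c l z) + ln (l / ((z - c) \<bullet> (z - c))) = u z"
    unfolding kelvin_def II unfolding I q q' \<zeta>_def[symmetric] \<mu>_def[symmetric] using \<mu> by (simp add: ln_div)
qed

lemma inversion_continuous:
  assumes "z \<noteq> c"
  shows "isCont (inversion c l) z"
  unfolding inversion_def using assms by (intro continuous_intros) auto

context conf_op
begin

text \<open>Conformal covariance, tested on jets. A quadratic above the Kelvin transform at
  \<open>y\<close> is pulled back by the inversion to a function above \<open>u\<close> at
  \<open>z\<close>. Its operator value is the original one conjugated by a reflection and multiplied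
  by the squared conformal factor, which the exponential on the other side matches.\<close>

lemma kelvin_psub:
  assumes sub: "psub V u" and l: "l > 0" and W: "\<And>y. y \<in> W \<Longrightarrow> y \<noteq> c \<and> inversion c l y \<in> V"
  shows "psub W (kelvin c l u)"
  unfolding psub_def
proof (intro ballI allI impI)
  fix y p X assume y: "y \<in> W" and jet: "superjet (kelvin c l u) y p X"
  have sX: "transpose X = X" by (rule superjet_sym[OF jet])
  define K where "K = kelvin c l u"
  define z where "z = inversion c l y"
  have zV: "z \<in> V" and yc: "y \<noteq> c" using W[OF y] by (simp_all add: z_def)
  have zc: "z \<noteq> c" unfolding z_def by (rule inversion_facts(1)[OF l yc])
  have Iz: "inversion c l z = y" unfolding z_def by (rule inversion_facts(2)[OF l yc])
  define \<zeta> where "\<zeta> = z - c"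
  have r2: "\<zeta> \<bullet> \<zeta> > 0" using zc by (simp add: \<zeta>_def)
  define k where "k = 1 / (\<zeta> \<bullet> \<zeta>)"
  have k: "k > 0" "k * (\<zeta> \<bullet> \<zeta>) = 1" using r2 by (simp_all add: k_def)
  define \<mu> where "\<mu> = l * k"
  have \<mu>: "\<mu> > 0" using l k by (simp add: \<mu>_def)
  have uz: "u z = K y + ln \<mu>"
    using inversion_facts(3)[OF l zc, of u] unfolding Iz K_def[symmetric] \<zeta>_def[symmetric] \<mu>_def k_def by simp
  \<comment> \<open>Raising the Hessian by 2 e turns the jet into a genuine local upper bound;
    continuity of \<open>F\<close> removes \<open>e\<close> at the end.\<close>
  have main: "exp (2 * a * K y) \<le> F (Eop p (X + (2 * e) *\<^sub>R mat 1))" if e: "e > 0" for e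
  proof -
    define Y where "Y = X + (2 * e) *\<^sub>R mat 1"
    have sY: "transpose Y = Y" by (simp add: Y_def transpose_add transpose_scaleR sX)
    define Q where "Q = quadr (K y) p Y y"
    have Qh: "Q (y + h) = K y + p \<bullet> h + h \<bullet> (X *v h) / 2 + e * (h \<bullet> h)" for h
      unfolding Q_def quadr_def Y_def
      by (simp add: matrix_vector_mult_add_rdistrib scaleR_matrix_vector_assoc[symmetric] inner_add_right)
    define kf where "kf x = 1 / ((x - c) \<bullet> (x - c))" for x
    define g where "g x = p + Y *v (inversion c l x - y)" for x
    define \<phi> where "\<phi> x = Q (inversion c l x) + ln (l / ((x - c) \<bullet> (x - c)))" for x
    define D where "D x = (l * kf x) *\<^sub>R (g x - (2 * (kf x * ((x - c) \<bullet> g x))) *\<^sub>R (x - c)) - (2 * kf x) *\<^sub>R (x - c)" for x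
    have gz: "g z = p" by (simp add: g_def Iz)
    have kz: "kf z = k" by (simp add: kf_def k_def \<zeta>_def)
    have d\<zeta>: "((\<lambda>x. x - c) has_derivative (\<lambda>h. h)) (at x)" for x by (auto intro!: derivative_eq_intros)
    have dk: "(kf has_derivative (\<lambda>h. - 2 * (kf x)\<^sup>2 * ((x - c) \<bullet> h))) (at x)" if "x \<noteq> c" for x
      unfolding kf_def using that
      by (auto intro!: derivative_eq_intros simp: divide_simps inner_commute power2_eq_square)
    have Ieq: "inversion c l x = c + (l * kf x) *\<^sub>R (x - c)" for x by (simp add: inversion_def kf_def)
    have dlk: "((\<lambda>x. l * kf x) has_derivative (\<lambda>h. l * (- 2 * (kf x)\<^sup>2 * ((x - c) \<bullet> h)))) (at x)" if "x \<noteq> c" for x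
      by (rule has_derivative_mult_right[OF dk[OF that]])
    have dI: "(inversion c l has_derivative (\<lambda>h. (l * kf x) *\<^sub>R h + (l * (- 2 * (kf x)\<^sup>2 * ((x - c) \<bullet> h))) *\<^sub>R (x - c))) (at x)" if "x \<noteq> c" for x
      unfolding Ieq[abs_def] using has_derivative_add[OF has_derivative_const[of c] has_derivative_scaleR[OF dlk[OF that] d\<zeta>]] by simp
    have dg: "(g has_derivative (\<lambda>h. Y *v ((l * kf x) *\<^sub>R h + (l * (- 2 * (kf x)\<^sup>2 * ((x - c) \<bullet> h))) *\<^sub>R (x - c)))) (at x)" if "x \<noteq> c" for x
    proof -
      have "((\<lambda>x. inversion c l x - y) has_derivative (\<lambda>h. ((l * kf x) *\<^sub>R h + (l * (- 2 * (kf x)\<^sup>2 * ((x - c) \<bullet> h))) *\<^sub>R (x - c)) - 0)) (at x)"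
        by (rule has_derivative_diff[OF dI[OF that] has_derivative_const])
      from has_derivative_add[OF has_derivative_const[of p] bounded_linear.has_derivative[OF matrix_vector_mul_bounded_linear[of Y] this]]
      show ?thesis unfolding g_def[abs_def] by simp
    qed
    define r where "r = norm (z - c)"
    have r: "r > 0" using zc by (simp add: r_def)
    have nc: "x \<noteq> c" if "x \<in> ball z r" for x using that by (auto simp: r_def dist_norm)
    have D1: "(\<phi> has_derivative (\<lambda>h. D x \<bullet> h)) (at x)" if "x \<in> ball z r" for x
    proof -
      have xc: "x \<noteq> c" by (rule nc[OF that])
      define w where "w = x - c"
      have w2: "w \<bullet> w > 0" using xc by (simp add: w_def)
      define m where "m = kf x"
      have m: "m > 0" "m * (w \<bullet> w) = 1" using w2 by (simp_all add: m_def kf_def w_def)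
      have 1: "((\<lambda>x. Q (inversion c l x)) has_derivative (\<lambda>h. g x \<bullet> ((l * m) *\<^sub>R h + (l * (- 2 * m\<^sup>2 * (w \<bullet> h))) *\<^sub>R w))) (at x)"
        using has_derivative_compose[OF dI[OF xc] quadr_has_derivative[OF sY, of "K y" p y "inversion c l x"]]
        unfolding g_def[symmetric] Q_def[symmetric] m_def[symmetric] w_def[symmetric] .
      have 2: "((\<lambda>x. ln (l * kf x)) has_derivative (\<lambda>h. (l * (- 2 * m\<^sup>2 * (w \<bullet> h))) / (l * m))) (at x)"
        using has_derivative_ln[OF _ dlk[OF xc]] l m unfolding m_def[symmetric] w_def[symmetric]
        by (simp add: divide_inverse mult.commute)
      have eq: "\<phi> = (\<lambda>x. Q (inversion c l x) + ln (l * kf x))" by (simp add: \<phi>_def kf_def fun_eq_iff)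
      have "(\<phi> has_derivative (\<lambda>h. g x \<bullet> ((l * m) *\<^sub>R h + (l * (- 2 * m\<^sup>2 * (w \<bullet> h))) *\<^sub>R w) + (l * (- 2 * m\<^sup>2 * (w \<bullet> h))) / (l * m))) (at x)"
        unfolding eq by (rule has_derivative_add[OF 1 2])
      moreover have "g x \<bullet> ((l * m) *\<^sub>R h + (l * (- 2 * m\<^sup>2 * (w \<bullet> h))) *\<^sub>R w) + (l * (- 2 * m\<^sup>2 * (w \<bullet> h))) / (l * m) = D x \<bullet> h" for h
      proof -
        have q: "(l * (- 2 * m\<^sup>2 * (w \<bullet> h))) / (l * m) = - 2 * m * (w \<bullet> h)"
          using l m(1) by (simp add: power2_eq_square)
        show ?thesis unfolding q D_def m_def[symmetric] w_def[symmetric]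
          by (simp add: inner_diff_left inner_add_right inner_commute[of w "g x"] power2_eq_square algebra_simps)
      qed
      ultimately show ?thesis by simp
    qed
    define \<mu>' where "\<mu>' h = l * (- 2 * k\<^sup>2 * (\<zeta> \<bullet> h))" for h
    define g' where "g' h = Y *v (\<mu> *\<^sub>R h + \<mu>' h *\<^sub>R \<zeta>)" for h
    define k' where "k' h = - 2 * k\<^sup>2 * (\<zeta> \<bullet> h)" for h
    define D' where "D' h = (\<mu> *\<^sub>R (g' h - ((2 * (k * (\<zeta> \<bullet> p))) *\<^sub>R h + (2 * (k * (\<zeta> \<bullet> g' h + h \<bullet> p) + k' h * (\<zeta> \<bullet> p))) *\<^sub>R \<zeta>))
        + \<mu>' h *\<^sub>R (p - (2 * (k * (\<zeta> \<bullet> p))) *\<^sub>R \<zeta>)) - ((2 * k) *\<^sub>R h + (2 * k' h) *\<^sub>R \<zeta>)" for h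
    have D2: "(D has_derivative D') (at z)"
    proof -
      note a1 = dk[OF zc, unfolded kz \<zeta>_def[symmetric], folded k'_def]
      note a2 = dlk[OF zc, unfolded kz \<zeta>_def[symmetric], folded \<mu>'_def]
      note a3 = dg[OF zc, unfolded kz \<zeta>_def[symmetric], folded \<mu>'_def \<mu>_def, folded g'_def]
      note b1 = has_derivative_inner[OF d\<zeta> a3]
      note b2 = has_derivative_mult[OF a1 b1]
      note b3 = has_derivative_mult_right[OF b2, of 2]
      note b4 = has_derivative_scaleR[OF b3 d\<zeta>]
      note b5 = has_derivative_scaleR[OF a2 has_derivative_diff[OF a3 b4]]
      note b6 = has_derivative_scaleR[OF has_derivative_mult_right[OF a1, of 2] d\<zeta>]
      show ?thesis
        unfolding D_def[abs_def] D'_def[abs_def]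
        using has_derivative_diff[OF b5 b6] unfolding kz gz \<zeta>_def[symmetric] \<mu>_def[symmetric] .
    qed
    define H where "H = matrix D'"
    have Hh: "H *v h = D' h" for h
    proof -
      have "linear D'" using D2 has_derivative_linear by blast
      then show ?thesis unfolding H_def linear_matrix_vector_mul_eq[symmetric] by (rule matrix_works)
    qed
    have D2': "(D has_derivative (\<lambda>h. H *v h)) (at z)" using D2 by (simp add: Hh)
    have \<phi>jet: "superjet \<phi> z (D z) H" by (rule superjet_twice_diff[OF r D1 D2'])
    have "superjet u z (D z) H"
    proof (rule superjet_translate[OF \<phi>jet])
      have "\<forall>\<^sub>F h in nhds 0. K (y + h) \<le> Q (y + h)"
        using jet e unfolding superjet_def K_def[symmetric] Qh by blast
      then have "\<forall>\<^sub>F x in nhds y. K x \<le> Q x"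
        by (rule eventually_nhds_0_ball[where P="\<lambda>x. K x \<le> Q x" and x=y, THEN iffD1])
      moreover have "filterlim (inversion c l) (nhds y) (nhds z)"
        using inversion_continuous[OF zc, of l] unfolding continuous_at tendsto_at_iff_tendsto_nhds unfolding Iz .
      ultimately have "\<forall>\<^sub>F x in nhds z. K (inversion c l x) \<le> Q (inversion c l x)"
        unfolding filterlim_iff by blast
      moreover have "\<forall>\<^sub>F x in nhds z. x \<in> ball z r"
        by (rule eventually_nhds_in_open) (use r in auto)
      ultimately have "\<forall>\<^sub>F x in nhds z. u x - u z \<le> \<phi> x - \<phi> z"
      proof eventually_elim
        case (elim x)
        have "u x = K (inversion c l x) + ln (l / ((x - c) \<bullet> (x - c)))"
          using inversion_facts(3)[OF l nc[OF elim(2)], of u] by (simp add: K_def)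
        moreover have "\<phi> z = u z"
          unfolding \<phi>_def Iz uz using Qh[of 0] by (simp add: \<mu>_def k_def \<zeta>_def)
        ultimately show ?case using elim(1) by (simp add: \<phi>_def)
      qed
      then show "\<forall>\<^sub>F h in nhds 0. u (z + h) - u z \<le> \<phi> (z + h) - \<phi> z"
        by (rule eventually_nhds_0_ball[where P="\<lambda>x. u x - u z \<le> \<phi> x - \<phi> z" and x=z, THEN iffD2])
    qed
    then have Fu: "exp (2 * a * u z) \<le> F (Eop (D z) H)" using sub zV unfolding psub_def by blast
    \<comment> \<open>The reflection in the hyperplane orthogonal to \<zeta>; the derivative of the
      inversion at \<open>z\<close> is \<mu> times \<open>Rm\<close>.\<close>
    define Rm where "Rm = mat 1 - (2 * k) *\<^sub>R outer \<zeta> \<zeta>"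
    have Rsym: "transpose Rm = Rm" by (simp add: Rm_def transpose_diff transpose_scaleR)
    have Rh: "Rm *v h = h - (2 * k * (\<zeta> \<bullet> h)) *\<^sub>R \<zeta>" for h
      by (simp add: Rm_def matrix_vector_mult_diff_rdistrib scaleR_matrix_vector_assoc[symmetric] outer_mult_vec)
    have \<zeta>R: "\<zeta> \<bullet> (Rm *v h) = - (\<zeta> \<bullet> h)" for h
    proof -
      have "\<zeta> \<bullet> (Rm *v h) = \<zeta> \<bullet> h - 2 * (\<zeta> \<bullet> h) * (k * (\<zeta> \<bullet> \<zeta>))" unfolding Rh by (simp add: inner_diff_right)
      then show ?thesis unfolding k(2) by simp
    qed
    have RR: "Rm *v (Rm *v h) = h" for h
      unfolding Rh[of "Rm *v h"] \<zeta>R unfolding Rh by simp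
    have Rorth: "orthogonal_matrix Rm"
    proof -
      have "(Rm ** Rm) *v h = mat 1 *v h" for h
        unfolding matrix_vector_mul_assoc[symmetric] RR by simp
      then have "Rm ** Rm = mat 1" by (simp add: matrix_eq)
      then show ?thesis unfolding orthogonal_matrix Rsym .
    qed
    \<comment> \<open>Both sides are applied to a vector and expanded in \<open>h\<close>,
      \<open>p\<close>, \<open>\<zeta>\<close> and \<open>V\<close>; k |\<zeta>|^2 = 1 removes the
      norm of \<zeta>.\<close>
    have Eeq: "Eop (D z) H = (\<mu>\<^sup>2) *\<^sub>R (Rm ** Eop p Y ** transpose Rm)"
    proof -
      define b where "b = \<zeta> \<bullet> p"
      have Dz: "D z = \<mu> *\<^sub>R (p - (2 * k * b) *\<^sub>R \<zeta>) - (2 * k) *\<^sub>R \<zeta>"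
        unfolding D_def kz gz \<zeta>_def[symmetric] \<mu>_def[symmetric] b_def by simp
      have DD: "D z \<bullet> D z = \<mu>\<^sup>2 * (p \<bullet> p) + 4 * \<mu> * k * b + 4 * k"
      proof -
        have "D z \<bullet> D z = \<mu>\<^sup>2 * (p \<bullet> p) - 4 * \<mu>\<^sup>2 * k * b * b + 4 * \<mu>\<^sup>2 * k * b * b * (k * (\<zeta> \<bullet> \<zeta>)) - 4 * \<mu> * k * b
            + 8 * \<mu> * k * b * (k * (\<zeta> \<bullet> \<zeta>)) + 4 * k * (k * (\<zeta> \<bullet> \<zeta>))"
          unfolding Dz b_def by (simp add: inner_diff_left inner_diff_right inner_commute[of p \<zeta>] power2_eq_square algebra_simps)
        then show ?thesis unfolding k(2) by simp
      qed
      have "Eop (D z) H *v h = ((\<mu>\<^sup>2) *\<^sub>R (Rm ** Eop p Y ** transpose Rm)) *v h" for h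
      proof -
        define q where "q = \<zeta> \<bullet> h"
        define d where "d = p \<bullet> h"
        define V where "V = Y *v (Rm *v h)"
        define s where "s = \<zeta> \<bullet> V"
        have mu'h: "\<mu>' h = - 2 * \<mu> * k * q" by (simp add: \<mu>'_def \<mu>_def q_def power2_eq_square)
        have k'h: "k' h = - 2 * k * k * q" by (simp add: k'_def q_def power2_eq_square)
        have gh: "g' h = \<mu> *\<^sub>R V"
        proof -
          have "\<mu> *\<^sub>R h + \<mu>' h *\<^sub>R \<zeta> = \<mu> *\<^sub>R (Rm *v h)"
            unfolding mu'h Rh q_def[symmetric] by (simp add: scaleR_diff_right mult_ac)
          then show ?thesis unfolding g'_def V_def by (simp add: matrix_vector_mult_scaleR)
        qed
        have Dh: "D z \<bullet> h = \<mu> * (d - 2 * k * b * q) - 2 * k * q"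
          unfolding Dz by (simp add: inner_diff_left d_def q_def)
        have L: "Eop (D z) H *v h = D' h - (D z \<bullet> h) *\<^sub>R D z + ((D z \<bullet> D z) / 2) *\<^sub>R h"
          unfolding Eop_mult Hh ..
        have R: "((\<mu>\<^sup>2) *\<^sub>R (Rm ** Eop p Y ** transpose Rm)) *v h = \<mu>\<^sup>2 *\<^sub>R (Rm *v (Eop p Y *v (Rm *v h)))"
          unfolding Rsym by (simp add: scaleR_matrix_vector_assoc[symmetric] matrix_vector_mul_assoc matrix_mul_assoc)
        have pR: "p \<bullet> (Rm *v h) = d - 2 * k * q * b"
          unfolding Rh by (simp add: inner_diff_right d_def q_def b_def inner_commute)
        have R2: "Rm *v (Eop p Y *v (Rm *v h)) = (V - (2 * k * s) *\<^sub>R \<zeta>) - (d - 2 * k * q * b) *\<^sub>R (p - (2 * k * b) *\<^sub>R \<zeta>) + ((p \<bullet> p) / 2) *\<^sub>R h"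
          unfolding Eop_mult pR V_def[symmetric] matrix_vector_right_distrib matrix_vector_mult_diff_distrib matrix_vector_mult_scaleR RR
          unfolding Rh s_def[symmetric] b_def[symmetric] by simp
        have hp: "h \<bullet> p = d" by (simp add: d_def inner_commute)
        have \<zeta>g: "\<zeta> \<bullet> (\<mu> *\<^sub>R V) = \<mu> * s" by (simp add: s_def)
        show ?thesis
          unfolding L R R2 D'_def gh mu'h k'h DD Dh b_def[symmetric] hp \<zeta>g unfolding Dz
          by (simp add: vec_eq_iff power2_eq_square) (simp add: algebra_simps)
      qed
      then show ?thesis by (simp add: matrix_eq)
    qed
    have sE: "transpose (Eop p Y) = Eop p Y" by (rule Eop_sym[OF sY])
    have sE': "transpose (Rm ** Eop p Y ** transpose Rm) = Rm ** Eop p Y ** transpose Rm"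
      by (simp add: matrix_transpose_mul sE matrix_mul_assoc)
    have "F (Eop (D z) H) = (\<mu>\<^sup>2) powr a * F (Eop p Y)"
      unfolding Eeq F_homog[OF sE', of "\<mu>\<^sup>2"] using \<mu> by (subst F_homog[OF sE']) (simp_all add: F_conj[OF sE Rorth])
    moreover have "exp (2 * a * u z) = (\<mu>\<^sup>2) powr a * exp (2 * a * K y)"
    proof -
      have "(\<mu>\<^sup>2) powr a = exp (2 * a * ln \<mu>)" using \<mu> by (simp add: powr_def ln_realpow mult_ac)
      then show ?thesis unfolding uz by (simp add: exp_add[symmetric] distrib_left add.commute)
    qed
    moreover have "(\<mu>\<^sup>2) powr a > 0" using \<mu> by simp
    ultimately have "exp (2 * a * K y) \<le> F (Eop p Y)"
      using Fu by (simp only: mult_le_cancel_left_pos)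
    then show ?thesis unfolding Y_def .
  qed
  define e where "e n = inverse (real (Suc n))" for n
  have "(\<lambda>n. X + (2 * e n) *\<^sub>R mat 1) \<longlonglongrightarrow> X + (2 * 0) *\<^sub>R mat 1"
    unfolding e_def by (intro tendsto_intros LIMSEQ_inverse_real_of_nat)
  then have "(\<lambda>n. X + (2 * e n) *\<^sub>R mat 1) \<longlonglongrightarrow> X" by simp
  then have "(\<lambda>n. Eop p (X + (2 * e n) *\<^sub>R mat 1)) \<longlonglongrightarrow> Eop p X"
    by (intro Eop_tendsto tendsto_const)
  then have "(\<lambda>n. F (Eop p (X + (2 * e n) *\<^sub>R mat 1))) \<longlonglongrightarrow> F (Eop p X)"
    by (rule F_tendsto) (intro Eop_sym, simp add: transpose_add transpose_scaleR sX)
  moreover have "exp (2 * a * K y) \<le> F (Eop p (X + (2 * e n) *\<^sub>R mat 1))" for n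
    by (rule main) (simp add: e_def)
  ultimately show "exp (2 * a * kelvin c l u y) \<le> F (Eop p X)"
    unfolding K_def by (intro LIMSEQ_le_const) blast+
qed

end

section \<open>Translation to the original equation\<close>

lemma outer_scaleR: "outer (s *\<^sub>R p) (s *\<^sub>R p) = (s * s) *\<^sub>R outer p p"
  by (simp add: outer_def vec_eq_iff mult_ac)

text \<open>The arguments are the value, gradient and Hessian of exp (m \<psi>) where \<psi> has
  value \<open>s\<close>, gradient \<open>p\<close> and Hessian \<open>X\<close>. This
  \<open>m\<close> makes all coefficients share the factor exp (- 2 s), and m - n/2 = - 1 fixes the
  coefficient of the outer product.\<close>

lemma conf_hess_exp:
  fixes p :: "real^'n" and X :: "real^'n^'n"
  assumes n: "CARD('n) \<ge> 3" and m: "m = (real CARD('n) - 2) / 2" and v: "v = exp (m * s)"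
  shows "- conf_hess v ((m * v) *\<^sub>R p) ((m * v) *\<^sub>R (X + m *\<^sub>R outer p p)) = exp (- 2 * s) *\<^sub>R Eop p X"
proof -
  define N where "N = real CARD('n)"
  have N: "N \<ge> 3" using n by (simp add: N_def)
  have mN: "m = (N - 2) / 2" and m0: "m > 0" "N - 2 = 2 * m" "N - 2 \<noteq> 0" using N m by (simp_all add: N_def)
  have v0: "v > 0" by (simp add: v)
  have lnv: "ln v = m * s" by (simp add: v)
  have e1: "2 / (N - 2) * v powr (- (N + 2) / (N - 2)) * (m * v) = exp (- 2 * s)"
  proof -
    have "v powr (- (N + 2) / (N - 2)) = exp (- (N + 2) / (N - 2) * (m * s))"
      using v0 by (simp add: powr_def lnv)
    also have "- (N + 2) / (N - 2) * (m * s) = - ((N + 2) / 2) * s"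
      unfolding m0(2) using m0(1) by (simp add: field_simps)
    finally have "v powr (- (N + 2) / (N - 2)) * v = exp (- ((N + 2) / 2) * s + m * s)" by (simp only: v exp_add)
    also have "- ((N + 2) / 2) * s + m * s = - 2 * s" unfolding mN by (simp add: field_simps)
    finally have *: "v powr (- (N + 2) / (N - 2)) * v = exp (- 2 * s)" .
    have "2 / (N - 2) * v powr (- (N + 2) / (N - 2)) * (m * v) = (2 / (N - 2) * m) * (v powr (- (N + 2) / (N - 2)) * v)" by (simp only: mult_ac)
    also have "2 / (N - 2) * m = 1" using m0 by simp
    finally show ?thesis using * by simp
  qed
  have e2: "v powr (- 2 * N / (N - 2)) * (v * v) = exp (- 2 * s)"
  proof -
    have "v powr (- 2 * N / (N - 2)) = exp (- 2 * N / (N - 2) * (m * s))"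
      using v0 by (simp add: powr_def lnv)
    also have "- 2 * N / (N - 2) * (m * s) = - N * s" using m0 by (simp add: m0(2))
    finally have "v powr (- 2 * N / (N - 2)) * (v * v) = exp (- N * s + (m * s + m * s))" by (simp only: v exp_add)
    also have "- N * s + (m * s + m * s) = - 2 * s" unfolding mN by (simp add: field_simps)
    finally show ?thesis .
  qed
  have c2: "2 * N / (N - 2)\<^sup>2 * v powr (- 2 * N / (N - 2)) * ((m * v) * (m * v)) = N / 2 * exp (- 2 * s)"
  proof -
    have "2 * N / (N - 2)\<^sup>2 * v powr (- 2 * N / (N - 2)) * ((m * v) * (m * v)) = (2 * N / (N - 2)\<^sup>2 * (m * m)) * (v powr (- 2 * N / (N - 2)) * (v * v))"
      by (simp only: mult_ac)
    also have "2 * N / (N - 2)\<^sup>2 * (m * m) = N / 2" using m0 by (simp add: m0(2) power2_eq_square)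
    finally show ?thesis unfolding e2 .
  qed
  have c3: "2 / (N - 2)\<^sup>2 * v powr (- 2 * N / (N - 2)) * ((m * v) * (m * v)) = 1 / 2 * exp (- 2 * s)"
  proof -
    have "2 / (N - 2)\<^sup>2 * v powr (- 2 * N / (N - 2)) * ((m * v) * (m * v)) = (2 / (N - 2)\<^sup>2 * (m * m)) * (v powr (- 2 * N / (N - 2)) * (v * v))"
      by (simp only: mult_ac)
    also have "2 / (N - 2)\<^sup>2 * (m * m) = 1 / 2" using m0 by (simp add: m0(2) power2_eq_square)
    finally show ?thesis unfolding e2 .
  qed
  have pp: "((m * v) *\<^sub>R p) \<bullet> ((m * v) *\<^sub>R p) = ((m * v) * (m * v)) * (p \<bullet> p)" by simp
  have ch: "- conf_hess v ((m * v) *\<^sub>R p) ((m * v) *\<^sub>R (X + m *\<^sub>R outer p p)) =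
      (2 / (N - 2) * v powr (- (N + 2) / (N - 2)) * (m * v)) *\<^sub>R (X + m *\<^sub>R outer p p)
      - (2 * N / (N - 2)\<^sup>2 * v powr (- 2 * N / (N - 2)) * ((m * v) * (m * v))) *\<^sub>R outer p p
      + (2 / (N - 2)\<^sup>2 * v powr (- 2 * N / (N - 2)) * ((m * v) * (m * v)) * (p \<bullet> p)) *\<^sub>R mat 1"
    unfolding conf_hess_def Let_def N_def[symmetric] outer_scaleR pp by (simp add: mult.assoc)
  have co: "m - N / 2 = - 1" unfolding mN by (simp add: field_simps)
  have "- conf_hess v ((m * v) *\<^sub>R p) ((m * v) *\<^sub>R (X + m *\<^sub>R outer p p)) =
     exp (- 2 * s) *\<^sub>R (X + m *\<^sub>R outer p p) - (N / 2 * exp (- 2 * s)) *\<^sub>R outer p p + (1 / 2 * exp (- 2 * s) * (p \<bullet> p)) *\<^sub>R mat 1"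
    unfolding ch e1 c2 c3 ..
  also have "\<dots> = exp (- 2 * s) *\<^sub>R (X + (m - N / 2) *\<^sub>R outer p p + ((p \<bullet> p) / 2) *\<^sub>R mat 1)"
    by (simp add: scaleR_add_right scaleR_diff_right scaleR_diff_left scaleR_add_left mult_ac)
  finally show ?thesis unfolding co Eop_def by simp
qed

text \<open>Viscosity test functions must be C^2 on the whole domain; exponentials of quadratics
  are, and their logarithms realise prescribed jets.\<close>

lemma C2_exp_quadr:
  fixes p :: "real^'n"
  assumes sY: "transpose Y = Y"
  shows "C2_with U (\<lambda>y. exp (m * quadr q p Y z y))
     (\<lambda>y. (m * exp (m * quadr q p Y z y)) *\<^sub>R (p + Y *v (y - z)))
     (\<lambda>y. (m * exp (m * quadr q p Y z y)) *\<^sub>R (Y + m *\<^sub>R outer (p + Y *v (y - z)) (p + Y *v (y - z))))"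
  unfolding C2_with_def
proof (intro conjI ballI)
  let ?g = "\<lambda>y. p + Y *v (y - z)"
  let ?\<phi> = "\<lambda>y. exp (m * quadr q p Y z y)"
  have d\<phi>: "(?\<phi> has_derivative (\<lambda>h. ?\<phi> y * (m * (?g y \<bullet> h)))) (at y)" for y
    by (rule has_derivative_eq_rhs[OF has_derivative_exp[OF has_derivative_mult_right[OF quadr_has_derivative[OF sY]]]])
      (simp add: fun_eq_iff mult_ac)
  show "(?\<phi> has_derivative (\<lambda>h. ((m * ?\<phi> y) *\<^sub>R ?g y) \<bullet> h)) (at y)" for y
    by (rule has_derivative_eq_rhs[OF d\<phi>]) (simp add: fun_eq_iff mult_ac)
  have dg: "(?g has_derivative (\<lambda>h. Y *v h)) (at y)" for y
  proof -
    have "((\<lambda>y. Y *v (y - z)) has_derivative (\<lambda>h. Y *v h)) (at y)"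
      by (rule has_derivative_eq_rhs[OF bounded_linear.has_derivative[OF matrix_vector_mul_bounded_linear]])
        (auto intro!: derivative_eq_intros)
    from has_derivative_add[OF has_derivative_const[of p] this] show ?thesis by simp
  qed
  show "((\<lambda>y. (m * ?\<phi> y) *\<^sub>R ?g y) has_derivative (\<lambda>h. ((m * ?\<phi> y) *\<^sub>R (Y + m *\<^sub>R outer (?g y) (?g y))) *v h)) (at y)" for y
  proof (rule has_derivative_eq_rhs[OF has_derivative_scaleR[OF has_derivative_mult_right[OF d\<phi>] dg]])
    show "(\<lambda>h. (m * ?\<phi> y) *\<^sub>R (Y *v h) + (m * (?\<phi> y * (m * (?g y \<bullet> h)))) *\<^sub>R ?g y)
       = (\<lambda>h. ((m * ?\<phi> y) *\<^sub>R (Y + m *\<^sub>R outer (?g y) (?g y))) *v h)"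
      by (rule ext) (simp add: matrix_vector_mult_add_rdistrib scaleR_matrix_vector_assoc[symmetric]
          outer_mult_vec scaleR_add_right mult_ac)
  qed
  have cg: "continuous_on U ?g"
    by (rule has_derivative_continuous_on[OF has_derivative_at_withinI[OF dg]])
  have c\<phi>: "continuous_on U ?\<phi>"
    by (rule has_derivative_continuous_on[OF has_derivative_at_withinI[OF d\<phi>]])
  have co: "continuous_on U (\<lambda>y. outer (?g y) (?g y))"
  proof -
    have "continuous_on U (\<lambda>y. \<chi> i j. ?g y $ i * ?g y $ j)"
      by (intro continuous_on_vec_lambda continuous_on_mult continuous_on_component cg)
    then show ?thesis unfolding outer_def .
  qed
  show "continuous_on U (\<lambda>y. (m * ?\<phi> y) *\<^sub>R (Y + m *\<^sub>R outer (?g y) (?g y)))"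
    by (intro continuous_on_scaleR continuous_on_mult continuous_on_add continuous_on_const c\<phi> co)
qed


text \<open>A test function is known to be positive only at \<open>x0\<close>, so its logarithm is
  studied on a small ball.\<close>

lemma log_test_jets:
  fixes \<phi> :: "real^'n \<Rightarrow> real"
  assumes U: "open U" "x0 \<in> U" and C2: "C2_with U \<phi> D H" and pos: "\<phi> x0 > 0" and m: "m > 0"
  obtains p X where "superjet (\<lambda>y. ln (\<phi> y) / m) x0 p X" "subjet (\<lambda>y. ln (\<phi> y) / m) x0 p X"
    "D x0 = (m * \<phi> x0) *\<^sub>R p" "H x0 = (m * \<phi> x0) *\<^sub>R (X + m *\<^sub>R outer p p)"
    "\<forall>\<^sub>F y in nhds x0. \<phi> y > 0"
proof -
  have d\<phi>: "(\<phi> has_derivative (\<lambda>h. D x \<bullet> h)) (at x)" and dD: "(D has_derivative (\<lambda>h. H x *v h)) (at x)" if "x \<in> U" for x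
    using C2 that unfolding C2_with_def by blast+
  have "isCont \<phi> x0" using has_derivative_continuous[OF d\<phi>[OF U(2)]] .
  then have "(\<phi> \<longlongrightarrow> \<phi> x0) (nhds x0)" unfolding continuous_at tendsto_at_iff_tendsto_nhds .
  then have evp: "\<forall>\<^sub>F y in nhds x0. \<phi> y > 0" using pos by (rule order_tendstoD)
  moreover have "\<forall>\<^sub>F y in nhds x0. y \<in> U" using U by (rule eventually_nhds_in_open)
  ultimately have "\<forall>\<^sub>F y in nhds x0. \<phi> y > 0 \<and> y \<in> U" by (rule eventually_conj)
  then obtain r where r: "r > 0" "\<And>y. y \<in> ball x0 r \<Longrightarrow> \<phi> y > 0 \<and> y \<in> U"
    unfolding eventually_nhds_metric by (auto simp: dist_commute)
  define L where "L y = ln (\<phi> y) / m" for y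
  define DL where "DL y = (1 / (m * \<phi> y)) *\<^sub>R D y" for y
  define X where "X = (1 / (m * \<phi> x0)) *\<^sub>R H x0 - (1 / (m * (\<phi> x0)\<^sup>2)) *\<^sub>R outer (D x0) (D x0)"
  have D1: "(L has_derivative (\<lambda>h. DL y \<bullet> h)) (at y)" if "y \<in> ball x0 r" for y
  proof -
    have y: "\<phi> y > 0" "y \<in> U" using r(2)[OF that] by auto
    have "((\<lambda>y. ln (\<phi> y) / m) has_derivative (\<lambda>h. DL y \<bullet> h)) (at y)"
      unfolding DL_def using y(1) m
      by (auto intro!: derivative_eq_intros d\<phi>[OF y(2)] simp: divide_simps)
    then show ?thesis unfolding L_def .
  qed
  have D2: "(DL has_derivative (\<lambda>h. X *v h)) (at x0)"
  proof -
    have q: "((\<lambda>y. 1 / (m * \<phi> y)) has_derivative (\<lambda>h. - (1 / (m * (\<phi> x0)\<^sup>2)) * (D x0 \<bullet> h))) (at x0)"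
      using pos m by (auto intro!: derivative_eq_intros d\<phi>[OF U(2)] simp: divide_simps power2_eq_square)
    have "(DL has_derivative (\<lambda>h. (1 / (m * \<phi> x0)) *\<^sub>R (H x0 *v h) + (- (1 / (m * (\<phi> x0)\<^sup>2)) * (D x0 \<bullet> h)) *\<^sub>R D x0)) (at x0)"
      unfolding DL_def[abs_def] by (rule has_derivative_scaleR[OF q dD[OF U(2)]])
    moreover have "X *v h = (1 / (m * \<phi> x0)) *\<^sub>R (H x0 *v h) + (- (1 / (m * (\<phi> x0)\<^sup>2)) * (D x0 \<bullet> h)) *\<^sub>R D x0" for h
      unfolding X_def by (simp add: matrix_vector_mult_diff_rdistrib scaleR_matrix_vector_assoc[symmetric] outer_mult_vec)
    ultimately show ?thesis by simp
  qed
  have mp: "m * \<phi> x0 \<noteq> 0" using m pos by simp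
  show thesis
  proof (rule that[of "DL x0" X])
    show "superjet (\<lambda>y. ln (\<phi> y) / m) x0 (DL x0) X" "subjet (\<lambda>y. ln (\<phi> y) / m) x0 (DL x0) X"
      unfolding L_def[symmetric] by (rule superjet_twice_diff[OF r(1) D1 D2], assumption, rule subjet_twice_diff[OF r(1) D1 D2], assumption)
    show "D x0 = (m * \<phi> x0) *\<^sub>R DL x0" unfolding DL_def using mp by simp
    have "(m * \<phi> x0) *\<^sub>R X = H x0 - (1 / \<phi> x0) *\<^sub>R outer (D x0) (D x0)"
      unfolding X_def scaleR_diff_right using m pos by (simp add: power2_eq_square)
    moreover have "(m * \<phi> x0) *\<^sub>R (m *\<^sub>R outer (DL x0) (DL x0)) = (1 / \<phi> x0) *\<^sub>R outer (D x0) (D x0)"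
      unfolding DL_def outer_scaleR using m pos by (simp add: power2_eq_square)
    ultimately show "H x0 = (m * \<phi> x0) *\<^sub>R (X + m *\<^sub>R outer (DL x0) (DL x0))"
      unfolding scaleR_add_right by simp
    show "\<forall>\<^sub>F y in nhds x0. \<phi> y > 0" by (rule evp)
  qed
qed

context conf_op
begin

lemma F_perturb_tendsto:
  assumes sX: "transpose X = X" and e: "e \<longlonglongrightarrow> 0"
  shows "(\<lambda>n. F (Eop p (X + e n *\<^sub>R mat 1))) \<longlonglongrightarrow> F (Eop p X)"
proof -
  have "(\<lambda>n. X + e n *\<^sub>R mat 1) \<longlonglongrightarrow> X + 0 *\<^sub>R mat 1" by (intro tendsto_intros e)
  then have "(\<lambda>n. X + e n *\<^sub>R mat 1) \<longlonglongrightarrow> X" by simp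
  then have "(\<lambda>n. Eop p (X + e n *\<^sub>R mat 1)) \<longlonglongrightarrow> Eop p X" by (intro Eop_tendsto tendsto_const)
  then show ?thesis
    by (rule F_tendsto) (intro Eop_sym, simp add: transpose_add transpose_scaleR sX)
qed

end

lemma quadr_perturb: "quadr q p (X + (2 * e) *\<^sub>R mat 1) x (x + h) = q + p \<bullet> h + h \<bullet> (X *v h) / 2 + e * (h \<bullet> h)"
  unfolding quadr_def by (simp add: matrix_vector_mult_add_rdistrib scaleR_matrix_vector_assoc[symmetric] inner_add_right)

context
  fixes f :: "real^'n \<Rightarrow> real" and \<Gamma> :: "(real^'n) set" and a m :: real
  assumes op: "conf_op (mat_op f \<Gamma>) a" and n: "CARD('n) \<ge> 3" and m: "m = (real CARD('n) - 2) / 2"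
begin

interpretation op: conf_op "mat_op f \<Gamma>" a by (rule op)

lemma m_pos: "m > 0" using n by (simp add: m)

text \<open>Homogeneity and the extension by 0 turn the conditions on \<open>eigs\<close>, including
  the clauses about the closed cone, into inequalities for \<open>Eop\<close>.\<close>

lemma test_value:
  assumes sX: "transpose X = X" and v: "v = exp (m * s)"
    and D: "D = (m * v) *\<^sub>R p" and H: "H = (m * v) *\<^sub>R (X + m *\<^sub>R outer p p)"
  shows "(eigs (- conf_hess v D H) \<in> closure \<Gamma> \<and> f (eigs (- conf_hess v D H)) \<ge> 1) \<longleftrightarrow> exp (2 * a * s) \<le> mat_op f \<Gamma> (Eop p X)"
    and "(eigs (- conf_hess v D H) \<notin> closure \<Gamma> \<or> f (eigs (- conf_hess v D H)) \<le> 1) \<longleftrightarrow> mat_op f \<Gamma> (Eop p X) \<le> exp (2 * a * s)"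
proof -
  define lam where "lam = eigs (- conf_hess v D H)"
  have "ext0 f \<Gamma> lam = mat_op f \<Gamma> (- conf_hess v D H)" by (simp add: mat_op_def lam_def)
  also have "\<dots> = mat_op f \<Gamma> (exp (- 2 * s) *\<^sub>R Eop p X)" unfolding D H conf_hess_exp[OF n m v] ..
  also have "\<dots> = exp (- 2 * s) powr a * mat_op f \<Gamma> (Eop p X)"
    by (rule op.F_homog[OF Eop_sym[OF sX]]) simp
  also have "exp (- 2 * s) powr a = 1 / exp (2 * a * s)"
  proof -
    have "exp (- 2 * s) powr a = exp (a * (- 2 * s))" by (simp only: powr_def exp_not_eq_zero if_False ln_exp)
    also have "a * (- 2 * s) = - (2 * a * s)" by simp
    finally show ?thesis by (simp only: exp_minus inverse_eq_divide)
  qed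
  finally have e: "ext0 f \<Gamma> lam = mat_op f \<Gamma> (Eop p X) / exp (2 * a * s)" by simp
  have p: "exp (2 * a * s) > 0" by simp
  have "(lam \<in> closure \<Gamma> \<and> f lam \<ge> 1) \<longleftrightarrow> ext0 f \<Gamma> lam \<ge> 1" by (auto simp: ext0_def)
  also have "\<dots> \<longleftrightarrow> exp (2 * a * s) \<le> mat_op f \<Gamma> (Eop p X)" unfolding e by (simp add: le_divide_eq)
  finally show "(eigs (- conf_hess v D H) \<in> closure \<Gamma> \<and> f (eigs (- conf_hess v D H)) \<ge> 1) \<longleftrightarrow> exp (2 * a * s) \<le> mat_op f \<Gamma> (Eop p X)"
    unfolding lam_def .
  have "(lam \<notin> closure \<Gamma> \<or> f lam \<le> 1) \<longleftrightarrow> ext0 f \<Gamma> lam \<le> 1" by (auto simp: ext0_def)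
  also have "\<dots> \<longleftrightarrow> mat_op f \<Gamma> (Eop p X) \<le> exp (2 * a * s)" unfolding e by (simp add: divide_le_eq)
  finally show "(eigs (- conf_hess v D H) \<notin> closure \<Gamma> \<or> f (eigs (- conf_hess v D H)) \<le> 1) \<longleftrightarrow> mat_op f \<Gamma> (Eop p X) \<le> exp (2 * a * s)"
    unfolding lam_def .
qed

text \<open>A superjet bounds the function only up to o(|h|^2), while a test function must bound it
  outright; so the Hessian is raised by 2 e and continuity of the operator removes
  \<open>e\<close>.\<close>

lemma visc_sub_imp_psub:
  assumes pos: "\<And>x. x \<in> \<Omega> \<Longrightarrow> u x > 0" and sub: "visc_sub f \<Gamma> \<Omega> u" and \<Omega>: "open \<Omega>"
  shows "op.psub \<Omega> (\<lambda>x. ln (u x) / m)"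
  unfolding op.psub_def
proof (intro ballI allI impI)
  fix x p X assume x: "x \<in> \<Omega>" and jet: "superjet (\<lambda>x. ln (u x) / m) x p X"
  define s where "s = ln (u x) / m"
  have us: "u x = exp (m * s)" using pos[OF x] m_pos by (simp add: s_def)
  have sX: "transpose X = X" by (rule superjet_sym[OF jet])
  have main: "exp (2 * a * s) \<le> mat_op f \<Gamma> (Eop p (X + (2 * e) *\<^sub>R mat 1))" if e: "e > 0" for e
  proof -
    define Y where "Y = X + (2 * e) *\<^sub>R mat 1"
    have sY: "transpose Y = Y" by (simp add: Y_def transpose_add transpose_scaleR sX)
    note C2 = C2_exp_quadr[OF sY, of \<Omega> m s p x]
    have q0: "quadr s p Y x x = s" by (simp add: quadr_def)
    have "\<forall>\<^sub>F h in nhds 0. ln (u (x + h)) / m \<le> quadr s p Y x (x + h)"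
      using jet e unfolding superjet_def Y_def quadr_perturb s_def by blast
    then have "\<forall>\<^sub>F y in nhds x. ln (u y) / m \<le> quadr s p Y x y"
      by (rule eventually_nhds_0_ball[where P="\<lambda>y. ln (u y) / m \<le> quadr s p Y x y" and x=x, THEN iffD1])
    then obtain d where d: "d > 0" "\<And>y. dist y x < d \<Longrightarrow> ln (u y) / m \<le> quadr s p Y x y"
      unfolding eventually_nhds_metric by blast
    have "u y \<le> exp (m * quadr s p Y x y)" if y: "y \<in> \<Omega> \<inter> ball x d" for y
    proof -
      have "ln (u y) / m \<le> quadr s p Y x y" using d(2)[of y] y by (simp add: dist_commute)
      then have "ln (u y) \<le> m * quadr s p Y x y" using m_pos by (simp add: pos_divide_le_eq mult.commute)
      then have "exp (ln (u y)) \<le> exp (m * quadr s p Y x y)" by (simp only: exp_le_cancel_iff)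
      moreover have "u y > 0" using pos y by blast
      ultimately show ?thesis by (simp only: exp_ln)
    qed
    then have "\<exists>e>0. \<forall>y\<in>\<Omega> \<inter> ball x e. u y \<le> exp (m * quadr s p Y x y)" using d(1) by blast
    moreover have "exp (m * quadr s p Y x x) = u x" unfolding q0 us ..
    ultimately have "let lam = eigs (- conf_hess (exp (m * quadr s p Y x x)) ((m * exp (m * quadr s p Y x x)) *\<^sub>R (p + Y *v (x - x)))
        ((m * exp (m * quadr s p Y x x)) *\<^sub>R (Y + m *\<^sub>R outer (p + Y *v (x - x)) (p + Y *v (x - x))))) in lam \<in> closure \<Gamma> \<and> f lam \<ge> 1"
      using sub[unfolded visc_sub_def, rule_format, OF x, of "\<lambda>y. exp (m * quadr s p Y x y)", OF conjI, OF C2] by simp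
    then show ?thesis
      unfolding Let_def q0 Y_def[symmetric] using test_value(1)[OF sY refl refl refl, of s p] by simp
  qed
  have "(\<lambda>k. 2 * inverse (real (Suc k))) \<longlonglongrightarrow> 2 * 0" by (intro tendsto_intros LIMSEQ_inverse_real_of_nat)
  then have "(\<lambda>k. 2 * inverse (real (Suc k))) \<longlonglongrightarrow> 0" by simp
  from op.F_perturb_tendsto[OF sX this, of p]
  have "exp (2 * a * s) \<le> mat_op f \<Gamma> (Eop p X)"
    by (rule LIMSEQ_le_const) (use main in \<open>auto simp del: of_nat_Suc\<close>)
  then show "exp (2 * a * (ln (u x) / m)) \<le> mat_op f \<Gamma> (Eop p X)" unfolding s_def .
qed

lemma visc_super_imp_psuper:
  assumes pos: "\<And>x. x \<in> \<Omega> \<Longrightarrow> u x > 0" and super: "visc_super f \<Gamma> \<Omega> u" and \<Omega>: "open \<Omega>"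
  shows "op.psuper \<Omega> (\<lambda>x. ln (u x) / m)"
  unfolding op.psuper_def
proof (intro ballI allI impI)
  fix x p X assume x: "x \<in> \<Omega>" and jet: "subjet (\<lambda>x. ln (u x) / m) x p X"
  define s where "s = ln (u x) / m"
  have us: "u x = exp (m * s)" using pos[OF x] m_pos by (simp add: s_def)
  have sX: "transpose X = X" using jet unfolding subjet_def superjet_def by simp
  have main: "mat_op f \<Gamma> (Eop p (X + (2 * (- e)) *\<^sub>R mat 1)) \<le> exp (2 * a * s)" if e: "e > 0" for e
  proof -
    define Y where "Y = X + (2 * (- e)) *\<^sub>R mat 1"
    have sY: "transpose Y = Y" by (simp add: Y_def transpose_add transpose_diff transpose_scaleR sX)
    note C2 = C2_exp_quadr[OF sY, of \<Omega> m s p x]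
    have q0: "quadr s p Y x x = s" by (simp add: quadr_def)
    have "\<forall>\<^sub>F h in nhds 0. - (ln (u (x + h)) / m) \<le> - s + (- p) \<bullet> h + h \<bullet> ((- X) *v h) / 2 + e * (h \<bullet> h)"
      using jet e unfolding superjet_def subjet_def s_def by blast
    then have "\<forall>\<^sub>F h in nhds 0. ln (u (x + h)) / m \<ge> quadr s p Y x (x + h)"
      unfolding Y_def quadr_perturb by eventually_elim simp
    then have "\<forall>\<^sub>F y in nhds x. ln (u y) / m \<ge> quadr s p Y x y"
      by (rule eventually_nhds_0_ball[where P="\<lambda>y. ln (u y) / m \<ge> quadr s p Y x y" and x=x, THEN iffD1])
    then obtain d where d: "d > 0" "\<And>y. dist y x < d \<Longrightarrow> ln (u y) / m \<ge> quadr s p Y x y"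
      unfolding eventually_nhds_metric by blast
    have "u y \<ge> exp (m * quadr s p Y x y)" if y: "y \<in> \<Omega> \<inter> ball x d" for y
    proof -
      have "ln (u y) / m \<ge> quadr s p Y x y" using d(2)[of y] y by (simp add: dist_commute)
      then have "ln (u y) \<ge> m * quadr s p Y x y" using m_pos by (simp add: pos_le_divide_eq mult.commute)
      then have "exp (ln (u y)) \<ge> exp (m * quadr s p Y x y)" by (simp only: exp_le_cancel_iff)
      moreover have "u y > 0" using pos y by blast
      ultimately show ?thesis by (simp only: exp_ln)
    qed
    then have "\<exists>e>0. \<forall>y\<in>\<Omega> \<inter> ball x e. u y \<ge> exp (m * quadr s p Y x y)" using d(1) by blast
    moreover have "exp (m * quadr s p Y x x) = u x" unfolding q0 us ..
    ultimately have "let lam = eigs (- conf_hess (exp (m * quadr s p Y x x)) ((m * exp (m * quadr s p Y x x)) *\<^sub>R (p + Y *v (x - x)))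
        ((m * exp (m * quadr s p Y x x)) *\<^sub>R (Y + m *\<^sub>R outer (p + Y *v (x - x)) (p + Y *v (x - x))))) in lam \<notin> closure \<Gamma> \<or> f lam \<le> 1"
      using super[unfolded visc_super_def, rule_format, OF x, of "\<lambda>y. exp (m * quadr s p Y x y)", OF conjI, OF C2] by simp
    then show ?thesis
      unfolding Let_def q0 Y_def[symmetric] using test_value(2)[OF sY refl refl refl, of s p] by simp
  qed
  have "(\<lambda>k. 2 * (- inverse (real (Suc k)))) \<longlonglongrightarrow> 2 * (- 0)" by (intro tendsto_intros LIMSEQ_inverse_real_of_nat)
  then have "(\<lambda>k. 2 * (- inverse (real (Suc k)))) \<longlonglongrightarrow> 0" by simp
  from op.F_perturb_tendsto[OF sX this, of p]
  have "mat_op f \<Gamma> (Eop p X) \<le> exp (2 * a * s)"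
  proof (rule LIMSEQ_le_const2, intro exI allI impI)
    show "mat_op f \<Gamma> (Eop p (X + (2 * (- inverse (real (Suc k)))) *\<^sub>R mat 1)) \<le> exp (2 * a * s)" for k
      by (rule main) simp
  qed
  then show "mat_op f \<Gamma> (Eop p X) \<le> exp (2 * a * (ln (u x) / m))" unfolding s_def .
qed

lemma psub_imp_visc_sub:
  assumes sub: "op.psub \<Omega> \<psi>" and \<Omega>: "open \<Omega>"
  shows "visc_sub f \<Gamma> \<Omega> (\<lambda>x. exp (m * \<psi> x))"
  unfolding visc_sub_def
proof (intro ballI allI impI, elim conjE exE)
  fix x0 \<phi> D H e
  assume x0: "x0 \<in> \<Omega>" and C2: "C2_with \<Omega> \<phi> D H" and eq: "\<phi> x0 = exp (m * \<psi> x0)" and e: "e > 0"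
    and le: "\<forall>x\<in>\<Omega> \<inter> ball x0 e. exp (m * \<psi> x) \<le> \<phi> x"
  have pos: "\<phi> x0 > 0" unfolding eq by simp
  obtain p X where j: "superjet (\<lambda>y. ln (\<phi> y) / m) x0 p X" "D x0 = (m * \<phi> x0) *\<^sub>R p" "H x0 = (m * \<phi> x0) *\<^sub>R (X + m *\<^sub>R outer p p)"
    and evp: "\<forall>\<^sub>F y in nhds x0. \<phi> y > 0"
    by (rule log_test_jets[OF \<Omega> x0 C2 pos m_pos]) (rule that)
  have "superjet \<psi> x0 p X"
  proof (rule superjet_translate[OF j(1)])
    have "\<forall>\<^sub>F y in nhds x0. y \<in> \<Omega> \<inter> ball x0 e" by (rule eventually_nhds_in_open) (use \<Omega> x0 e in auto)
    with evp have "\<forall>\<^sub>F y in nhds x0. \<psi> y - \<psi> x0 \<le> ln (\<phi> y) / m - ln (\<phi> x0) / m"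
    proof eventually_elim
      case (elim y)
      have "exp (m * \<psi> y) \<le> \<phi> y" using le elim(2) by blast
      then have "m * \<psi> y \<le> ln (\<phi> y)" using elim(1) by (simp add: ln_ge_iff)
      then have "\<psi> y \<le> ln (\<phi> y) / m" using m_pos by (simp add: pos_le_divide_eq mult.commute)
      moreover have "ln (\<phi> x0) / m = \<psi> x0" unfolding eq using m_pos by simp
      ultimately show ?case by simp
    qed
    then show "\<forall>\<^sub>F h in nhds 0. \<psi> (x0 + h) - \<psi> x0 \<le> ln (\<phi> (x0 + h)) / m - ln (\<phi> x0) / m"
      by (rule eventually_nhds_0_ball[where P="\<lambda>y. \<psi> y - \<psi> x0 \<le> ln (\<phi> y) / m - ln (\<phi> x0) / m" and x=x0, THEN iffD2])
  qed
  then have "exp (2 * a * \<psi> x0) \<le> mat_op f \<Gamma> (Eop p X)" using sub x0 unfolding op.psub_def by blast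
  then show "let lam = eigs (- conf_hess (\<phi> x0) (D x0) (H x0)) in lam \<in> closure \<Gamma> \<and> f lam \<ge> 1"
    unfolding Let_def using test_value(1)[OF superjet_sym[OF j(1)] eq j(2,3)] by simp
qed

lemma psuper_imp_visc_super:
  assumes super: "op.psuper \<Omega> \<psi>" and \<Omega>: "open \<Omega>"
  shows "visc_super f \<Gamma> \<Omega> (\<lambda>x. exp (m * \<psi> x))"
  unfolding visc_super_def
proof (intro ballI allI impI, elim conjE exE)
  fix x0 \<phi> D H e
  assume x0: "x0 \<in> \<Omega>" and C2: "C2_with \<Omega> \<phi> D H" and eq: "\<phi> x0 = exp (m * \<psi> x0)" and e: "e > 0"
    and le: "\<forall>x\<in>\<Omega> \<inter> ball x0 e. exp (m * \<psi> x) \<ge> \<phi> x"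
  have pos: "\<phi> x0 > 0" unfolding eq by simp
  obtain p X where j0: "superjet (\<lambda>y. ln (\<phi> y) / m) x0 p X" and j: "subjet (\<lambda>y. ln (\<phi> y) / m) x0 p X"
    "D x0 = (m * \<phi> x0) *\<^sub>R p" "H x0 = (m * \<phi> x0) *\<^sub>R (X + m *\<^sub>R outer p p)"
    and evp: "\<forall>\<^sub>F y in nhds x0. \<phi> y > 0"
    by (rule log_test_jets[OF \<Omega> x0 C2 pos m_pos]) (rule that)
  have "subjet \<psi> x0 p X"
    unfolding subjet_def
  proof (rule superjet_translate[OF j(1)[unfolded subjet_def]])
    have "\<forall>\<^sub>F y in nhds x0. y \<in> \<Omega> \<inter> ball x0 e" by (rule eventually_nhds_in_open) (use \<Omega> x0 e in auto)
    with evp have "\<forall>\<^sub>F y in nhds x0. - \<psi> y - - \<psi> x0 \<le> - (ln (\<phi> y) / m) - - (ln (\<phi> x0) / m)"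
    proof eventually_elim
      case (elim y)
      have "\<phi> y \<le> exp (m * \<psi> y)" using le elim(2) by blast
      then have "ln (\<phi> y) \<le> m * \<psi> y" using elim(1) by (metis exp_gt_zero ln_exp ln_le_cancel_iff)
      then have "ln (\<phi> y) / m \<le> \<psi> y" using m_pos by (simp add: pos_divide_le_eq mult.commute)
      moreover have "ln (\<phi> x0) / m = \<psi> x0" unfolding eq using m_pos by simp
      ultimately show ?case by simp
    qed
    then show "\<forall>\<^sub>F h in nhds 0. - \<psi> (x0 + h) - - \<psi> x0 \<le> - (ln (\<phi> (x0 + h)) / m) - - (ln (\<phi> x0) / m)"
      by (rule eventually_nhds_0_ball[where P="\<lambda>y. - \<psi> y - - \<psi> x0 \<le> - (ln (\<phi> y) / m) - - (ln (\<phi> x0) / m)" and x=x0, THEN iffD2])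
  qed
  then have "mat_op f \<Gamma> (Eop p X) \<le> exp (2 * a * \<psi> x0)" using super x0 unfolding op.psuper_def by blast
  then show "let lam = eigs (- conf_hess (\<phi> x0) (D x0) (H x0)) in lam \<notin> closure \<Gamma> \<or> f lam \<le> 1"
    unfolding Let_def using test_value(2)[OF superjet_sym[OF j0] eq j(2,3)] by simp
qed

end

section \<open>Perron's method\<close>

definition usc_env :: "'a::topological_space set \<Rightarrow> ('a \<Rightarrow> real) \<Rightarrow> 'a \<Rightarrow> real" where
  "usc_env S u x = Inf {c. \<exists>U. open U \<and> x \<in> U \<and> (\<forall>y\<in>U \<inter> S. u y \<le> c)}"

definition loc_bdd_above :: "'a::topological_space set \<Rightarrow> ('a \<Rightarrow> real) \<Rightarrow> bool" where
  "loc_bdd_above S u \<longleftrightarrow> (\<forall>x\<in>S. \<exists>c U. open U \<and> x \<in> U \<and> (\<forall>y\<in>U \<inter> S. u y \<le> c))"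

lemma usc_env_le:
  assumes "x \<in> S" "open U" "x \<in> U" "\<And>y. y \<in> U \<Longrightarrow> y \<in> S \<Longrightarrow> u y \<le> c"
  shows "usc_env S u x \<le> c"
  unfolding usc_env_def
proof (rule cInf_lower)
  show "c \<in> {c. \<exists>U. open U \<and> x \<in> U \<and> (\<forall>y\<in>U \<inter> S. u y \<le> c)}" using assms by auto
  show "bdd_below {c. \<exists>U. open U \<and> x \<in> U \<and> (\<forall>y\<in>U \<inter> S. u y \<le> c)}"
    using assms(1) by (intro bdd_belowI[of _ "u x"]) auto
qed

lemma usc_env_less:
  assumes b: "loc_bdd_above S u" and x: "x \<in> S" and c: "usc_env S u x < c"
  obtains U where "open U" "x \<in> U" "\<And>y. y \<in> U \<Longrightarrow> y \<in> S \<Longrightarrow> u y < c"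
proof -
  have ne: "{c. \<exists>U. open U \<and> x \<in> U \<and> (\<forall>y\<in>U \<inter> S. u y \<le> c)} \<noteq> {}"
    using b x unfolding loc_bdd_above_def by blast
  have "\<exists>d\<in>{c. \<exists>U. open U \<and> x \<in> U \<and> (\<forall>y\<in>U \<inter> S. u y \<le> c)}. d < c"
    using cInf_lessD[OF ne] c unfolding usc_env_def by blast
  then obtain d U where U: "d < c" "open U" "x \<in> U" "\<forall>y\<in>U \<inter> S. u y \<le> d" by blast
  show thesis
  proof (rule that[OF U(2,3)])
    fix y assume "y \<in> U" "y \<in> S"
    then have "u y \<le> d" using U(4) by blast
    then show "u y < c" using U(1) by simp
  qed
qed

lemma usc_env_ge:
  assumes b: "loc_bdd_above S u" and x: "x \<in> S"
  shows "u x \<le> usc_env S u x"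
proof (rule ccontr)
  assume "\<not> u x \<le> usc_env S u x"
  then have c: "usc_env S u x < u x" by simp
  obtain U where "open U" "x \<in> U" "\<And>y. y \<in> U \<Longrightarrow> y \<in> S \<Longrightarrow> u y < u x"
    by (rule usc_env_less[OF b x c]) (rule that)
  then show False using x by blast
qed

lemma usc_env_usc:
  assumes b: "loc_bdd_above S u"
  shows "usc_on S (usc_env S u)"
proof (rule usc_onI)
  fix x c assume x: "x \<in> S" "usc_env S u x < c"
  obtain d where d: "usc_env S u x < d" "d < c" using dense[OF x(2)] by blast
  obtain U where U: "open U" "x \<in> U" "\<And>y. y \<in> U \<Longrightarrow> y \<in> S \<Longrightarrow> u y < d"
    by (rule usc_env_less[OF b x(1) d(1)]) (rule that)
  have "usc_env S u y < c" if "y \<in> U \<inter> S" for y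
  proof -
    have "usc_env S u y \<le> d" by (rule usc_env_le[of y S U]) (use that U less_imp_le in auto)
    then show ?thesis using d(2) by simp
  qed
  then show "\<exists>U. open U \<and> x \<in> U \<and> (\<forall>y\<in>U \<inter> S. usc_env S u y < c)" using U by blast
qed

lemma usc_env_approx:
  assumes x: "x \<in> S" and c: "c < usc_env S u x" and U: "open U" "x \<in> U"
  obtains y where "y \<in> U" "y \<in> S" "c < u y"
proof -
  have "\<exists>y. y \<in> U \<and> y \<in> S \<and> c < u y"
  proof (rule ccontr)
    assume neg: "\<not> ?thesis"
    have le: "u y \<le> c" if "y \<in> U" "y \<in> S" for y using neg that by (meson not_le)
    have "usc_env S u x \<le> c" using x U by (rule usc_env_le) (rule le)
    then show False using c by simp
  qed
  then show thesis using that by blast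
qed

lemma quadr_continuous: "isCont (quadr c p X z) y"
  unfolding quadr_def[abs_def]
  by (intro continuous_intros bounded_linear.isCont[OF matrix_vector_mul_bounded_linear]) auto

lemma superjet_below:
  assumes "superjet v y q Z" "u y = v y" "\<forall>\<^sub>F x in nhds y. u x \<le> v x"
  shows "superjet u y q Z"
proof (rule superjet_translate[OF assms(1)])
  have "\<forall>\<^sub>F x in nhds y. u x - u y \<le> v x - v y" using assms(3) by eventually_elim (simp add: assms(2))
  then show "\<forall>\<^sub>F h in nhds 0. u (y + h) - u y \<le> v (y + h) - v y"
    by (rule eventually_nhds_0_ball[where P="\<lambda>x. u x - u y \<le> v x - v y" and x=y, THEN iffD2])
qed

section \<open>Perron's construction\<close>

context conf_op
begin

text \<open>A quadratic touching the envelope strictly from above at \<open>x\<close> is touched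
  nearby, up to constants, by members of the family with values close to the envelope. Strictness
  makes the contact points converge to \<open>x\<close>, and the inequality passes to the
  limit.\<close>

lemma env_of_sup_psub:
  assumes \<Omega>: "open \<Omega>" and b: "loc_bdd_above \<Omega> u"
    and S: "\<And>v. v \<in> S \<Longrightarrow> usc_on \<Omega> v \<and> psub \<Omega> v \<and> (\<forall>x\<in>\<Omega>. v x \<le> u x)"
    and sup: "\<And>x c. x \<in> \<Omega> \<Longrightarrow> c < u x \<Longrightarrow> \<exists>v\<in>S. c < v x"
  shows "psub \<Omega> (usc_env \<Omega> u)"
  unfolding psub_def
proof (intro ballI allI impI)
  fix x p X assume x: "x \<in> \<Omega>" and jet: "superjet (usc_env \<Omega> u) x p X"
  define w where "w = usc_env \<Omega> u"
  have sX: "transpose X = X" by (rule superjet_sym[OF jet])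
  have main: "exp (2 * a * w x) \<le> F (Eop p (X + (2 * (2 * e)) *\<^sub>R mat 1))" if e: "e > 0" for e
  proof -
    \<comment> \<open>Twice the usual increase: one \<open>e\<close> absorbs the error of the jet,
      the other leaves the gap e |h|^2 that forces the contact points to converge.\<close>
    define Y where "Y = X + (2 * (2 * e)) *\<^sub>R mat 1"
    have sY: "transpose Y = Y" by (simp add: Y_def transpose_add transpose_scaleR sX)
    define Q where "Q = quadr (w x) p Y x"
    have Qh: "Q (x + h) = w x + p \<bullet> h + h \<bullet> (X *v h) / 2 + 2 * e * (h \<bullet> h)" for h
      unfolding Q_def Y_def quadr_perturb ..
    have Qx: "Q x = w x" by (simp add: Q_def quadr_def)
    have "\<forall>\<^sub>F h in nhds 0. w (x + h) \<le> Q (x + h) - e * (h \<bullet> h)"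
    proof -
      have "\<forall>\<^sub>F h in nhds 0. w (x + h) \<le> w x + p \<bullet> h + h \<bullet> (X *v h) / 2 + e * (h \<bullet> h)"
        using jet e unfolding superjet_def w_def by blast
      then show ?thesis unfolding Qh by eventually_elim (simp add: algebra_simps)
    qed
    then obtain r0 where r0: "r0 > 0" "\<And>h. norm h < r0 \<Longrightarrow> w (x + h) \<le> Q (x + h) - e * (h \<bullet> h)"
      unfolding eventually_nhds_metric by (auto simp: dist_norm)
    obtain r1 where r1: "r1 > 0" "cball x r1 \<subseteq> \<Omega>" using \<Omega> x open_contains_cball by blast
    define r where "r = min (r0 / 2) r1"
    have r: "r > 0" "r < r0" "cball x r \<subseteq> \<Omega>"
      using r0(1) r1 by (auto simp: r_def min_def)
    have wQ: "w y \<le> Q y - e * ((y - x) \<bullet> (y - x))" if "y \<in> cball x r" for y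
      using r0(2)[of "y - x"] that r(2) by (simp add: dist_norm norm_minus_commute)
    have ex: "\<exists>z v. v \<in> S \<and> z \<in> cball x r \<and> (\<forall>y\<in>cball x r. v y - Q y \<le> v z - Q z) \<and> v z - Q z \<ge> - 2 * d" if d: "d > 0" for d
    proof -
      have "isCont Q x" unfolding Q_def by (rule quadr_continuous)
      then obtain s where s: "s > 0" "\<And>y. dist y x < s \<Longrightarrow> dist (Q y) (Q x) < d"
        unfolding continuous_at_eps_delta using d by blast
      have c: "w x - d < usc_env \<Omega> u x" using d by (simp add: w_def)
      obtain y where y: "y \<in> ball x (min r s)" "y \<in> \<Omega>" "w x - d < u y"
        by (rule usc_env_approx[OF x c open_ball, of x "min r s"]) (use r s in simp, rule that)
      obtain v where v: "v \<in> S" "w x - d < v y" using sup[OF y(2,3)] by blast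
      have "continuous_on (cball x r) (\<lambda>y. - Q y)"
        unfolding Q_def by (intro continuous_intros continuous_at_imp_continuous_on ballI quadr_continuous)
      then have "usc_on (cball x r) (\<lambda>y. v y + - Q y)"
        by (rule usc_on_add[OF usc_on_subset[OF conjunct1[OF S[OF v(1)]] r(3)] continuous_imp_usc_on])
      from usc_attains_max[OF compact_cball _ this] r(1) obtain z where z: "z \<in> cball x r" "\<forall>y\<in>cball x r. v y + - Q y \<le> v z + - Q z" by auto
      have yb: "y \<in> cball x r" using y(1) by simp
      have "dist (Q y) (Q x) < d" using s(2)[of y] y(1) by (simp add: dist_commute)
      then have "Q y < w x + d" unfolding Qx dist_real_def by simp
      then have "v y - Q y \<ge> - 2 * d" using v(2) by simp
      moreover have "v y - Q y \<le> v z - Q z" using z(2) yb by simp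
      ultimately have "v z - Q z \<ge> - 2 * d" by simp
      then show ?thesis using v(1) z by (intro exI[of _ z] exI[of _ v]) simp
    qed
    define d where "d k = inverse (real (Suc k))" for k
    have dp: "d k > 0" for k by (simp add: d_def)
    have dl: "d \<longlonglongrightarrow> 0" unfolding d_def by (rule LIMSEQ_inverse_real_of_nat)
    define R where "R k z v \<longleftrightarrow> v \<in> S \<and> z \<in> cball x r \<and> (\<forall>y\<in>cball x r. v y - Q y \<le> v z - Q z) \<and> v z - Q z \<ge> - 2 * d k" for k z v
    have "\<exists>z v. R k z v" for k unfolding R_def by (rule ex[OF dp])
    then obtain z v where R: "\<And>k. R k (z k) (v k)" by metis
    have vS: "v k \<in> S" and zb: "z k \<in> cball x r" and zm: "\<forall>y\<in>cball x r. v k y - Q y \<le> v k (z k) - Q (z k)"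
      and vz: "v k (z k) \<ge> Q (z k) - 2 * d k" for k
      using R[of k] unfolding R_def by auto
    have z\<Omega>: "z k \<in> \<Omega>" for k using zb r(3) by blast
    have sq: "e * ((z k - x) \<bullet> (z k - x)) \<le> 2 * d k" for k
    proof -
      have "v k (z k) \<le> u (z k)" using S[OF vS] z\<Omega> by blast
      also have "\<dots> \<le> w (z k)" unfolding w_def by (rule usc_env_ge[OF b z\<Omega>])
      also have "\<dots> \<le> Q (z k) - e * ((z k - x) \<bullet> (z k - x))" by (rule wQ[OF zb])
      finally show ?thesis using vz[of k] by linarith
    qed
    have zl: "z \<longlonglongrightarrow> x"
    proof -
      have "(\<lambda>k. (norm (z k - x))\<^sup>2) \<longlonglongrightarrow> 0"
      proof (rule tendsto_sandwich[OF _ _ tendsto_const])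
        have "(\<lambda>k. 2 * d k / e) \<longlonglongrightarrow> 2 * 0 / e" using e by (intro tendsto_intros dl) simp
        then show "(\<lambda>k. 2 * d k / e) \<longlonglongrightarrow> 0" by simp
        have "(norm (z k - x))\<^sup>2 \<le> 2 * d k / e" for k
          using sq[of k] e by (simp add: power2_norm_eq_inner pos_le_divide_eq mult.commute)
        then show "\<forall>\<^sub>F k in sequentially. (norm (z k - x))\<^sup>2 \<le> 2 * d k / e" by (intro always_eventually allI)
      qed simp
      then have "(\<lambda>k. sqrt ((norm (z k - x))\<^sup>2)) \<longlonglongrightarrow> sqrt 0" by (rule tendsto_real_sqrt)
      then have "(\<lambda>k. norm (z k - x)) \<longlonglongrightarrow> 0" by simp
      then have "(\<lambda>k. z k - x) \<longlonglongrightarrow> 0" by (rule tendsto_norm_zero_cancel)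
      then show ?thesis by (rule LIM_zero_cancel)
    qed
    have "\<forall>\<^sub>F k in sequentially. z k \<in> ball x r"
      by (rule topological_tendstoD[OF zl]) (use r in auto)
    then have ev: "\<forall>\<^sub>F k in sequentially. exp (2 * a * (Q (z k) - 2 * d k)) \<le> F (Eop (p + Y *v (z k - x)) Y)"
    proof eventually_elim
      case (elim k)
      have "superjet (v k) (z k) (p + Y *v (z k - x)) Y"
      proof (rule superjet_translate[OF superjet_quadr[OF sY, where c="w x" and p=p and z=x and y="z k"], folded Q_def])
        have "\<forall>\<^sub>F y in nhds (z k). y \<in> ball x r" by (rule eventually_nhds_in_open[OF open_ball elim])
        then have "\<forall>\<^sub>F y in nhds (z k). v k y - v k (z k) \<le> Q y - Q (z k)"
        proof eventually_elim
          case (elim y)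
          then have "v k y - Q y \<le> v k (z k) - Q (z k)" using zm[of k] by simp
          then show ?case by linarith
        qed
        then show "\<forall>\<^sub>F h in nhds 0. v k (z k + h) - v k (z k) \<le> Q (z k + h) - Q (z k)"
          by (rule eventually_nhds_0_ball[where P="\<lambda>y. v k y - v k (z k) \<le> Q y - Q (z k)" and x="z k", THEN iffD2])
      qed
      then have "exp (2 * a * v k (z k)) \<le> F (Eop (p + Y *v (z k - x)) Y)"
        using S[OF vS[of k]] z\<Omega>[of k] unfolding psub_def by blast
      moreover have "2 * a * (Q (z k) - 2 * d k) \<le> 2 * a * v k (z k)"
        using vz[of k] a_pos by (intro mult_left_mono) auto
      then have "exp (2 * a * (Q (z k) - 2 * d k)) \<le> exp (2 * a * v k (z k))" by (simp only: exp_le_cancel_iff)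
      ultimately show ?case by linarith
    qed
    have Ql: "(\<lambda>k. Q (z k)) \<longlonglongrightarrow> Q x"
      using quadr_continuous[where c="w x" and p=p and X=Y and z=x and y=x, folded Q_def] zl by (rule isCont_tendsto_compose)
    have l1: "(\<lambda>k. exp (2 * a * (Q (z k) - 2 * d k))) \<longlonglongrightarrow> exp (2 * a * (Q x - 2 * 0))"
      by (intro tendsto_intros Ql dl)
    have "(\<lambda>k. p + Y *v (z k - x)) \<longlonglongrightarrow> p + Y *v (x - x)"
    proof (intro tendsto_intros)
      have "isCont (\<lambda>y. Y *v (y - x)) x" by (intro continuous_intros bounded_linear.isCont[OF matrix_vector_mul_bounded_linear])
      then show "(\<lambda>k. Y *v (z k - x)) \<longlonglongrightarrow> Y *v (x - x)" using zl by (rule isCont_tendsto_compose)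
    qed
    then have "(\<lambda>k. Eop (p + Y *v (z k - x)) Y) \<longlonglongrightarrow> Eop (p + Y *v (x - x)) Y"
      by (intro Eop_tendsto tendsto_const)
    then have l2: "(\<lambda>k. F (Eop (p + Y *v (z k - x)) Y)) \<longlonglongrightarrow> F (Eop (p + Y *v (x - x)) Y)"
      by (rule F_tendsto[OF _ Eop_sym[OF sY]])
    have "exp (2 * a * (Q x - 2 * 0)) \<le> F (Eop (p + Y *v (x - x)) Y)"
      by (rule tendsto_le[OF sequentially_bot l2 l1 ev])
    then show ?thesis unfolding Qx Y_def by simp
  qed
  have "(\<lambda>k. 2 * (2 * inverse (real (Suc k)))) \<longlonglongrightarrow> 2 * (2 * 0)" by (intro tendsto_intros LIMSEQ_inverse_real_of_nat)
  then have "(\<lambda>k. 2 * (2 * inverse (real (Suc k)))) \<longlonglongrightarrow> 0" by simp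
  from F_perturb_tendsto[OF sX this, of p]
  have "exp (2 * a * w x) \<le> F (Eop p X)"
  proof (rule LIMSEQ_le_const, intro exI allI impI)
    show "exp (2 * a * w x) \<le> F (Eop p (X + (2 * (2 * inverse (real (Suc k)))) *\<^sub>R mat 1))" for k
      by (rule main) simp
  qed
  then show "exp (2 * a * usc_env \<Omega> u x) \<le> F (Eop p X)" unfolding w_def .
qed


text \<open>Bump argument. If the lower envelope failed the inequality at \<open>x\<close>, a
  quadratic with slightly lowered Hessian would still be a strict subsolution near \<open>x\<close>.
  Raised by a small constant, it stays below \<open>u\<close> on an annulus and exceeds
  \<open>u\<close> somewhere near \<open>x\<close>, so gluing by the maximum gives a subsolution
  larger than \<open>u\<close>.\<close>

lemma lsc_env_psuper:
  assumes \<Omega>: "open \<Omega>" and uusc: "usc_on \<Omega> u" and usub: "psub \<Omega> u"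
    and max: "\<And>v. usc_on \<Omega> v \<Longrightarrow> psub \<Omega> v \<Longrightarrow> (\<forall>x\<in>\<Omega>. v x \<le> u x)"
    and b: "loc_bdd_above \<Omega> (\<lambda>x. - u x)"
  shows "psuper \<Omega> (\<lambda>x. - usc_env \<Omega> (\<lambda>x. - u x) x)"
  unfolding psuper_def
proof (intro ballI allI impI, rule ccontr)
  define w where "w x = - usc_env \<Omega> (\<lambda>x. - u x) x" for x
  fix x p X assume x: "x \<in> \<Omega>" and jet0: "subjet (\<lambda>x. - usc_env \<Omega> (\<lambda>x. - u x) x) x p X"
    and neg0: "\<not> F (Eop p X) \<le> exp (2 * a * - usc_env \<Omega> (\<lambda>x. - u x) x)"
  have jet: "subjet w x p X" using jet0 unfolding w_def .
  have neg: "exp (2 * a * w x) < F (Eop p X)" using neg0 unfolding w_def by simp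
  have wu: "w y \<le> u y" if "y \<in> \<Omega>" for y using usc_env_ge[OF b that] unfolding w_def by simp
  have sX: "transpose X = X" using jet unfolding subjet_def superjet_def by simp
  have "(\<lambda>k. 2 * (- (2 * inverse (real (Suc k))))) \<longlonglongrightarrow> 2 * (- (2 * 0))" by (intro tendsto_intros LIMSEQ_inverse_real_of_nat)
  then have "(\<lambda>k. 2 * (- (2 * inverse (real (Suc k))))) \<longlonglongrightarrow> 0" by simp
  from order_tendstoD(1)[OF F_perturb_tendsto[OF sX this, of p] neg]
  have "\<exists>k. exp (2 * a * w x) < F (Eop p (X + (2 * (- (2 * inverse (real (Suc k))))) *\<^sub>R mat 1))"
    by (rule eventually_happens'[OF sequentially_bot])
  then obtain k where k: "exp (2 * a * w x) < F (Eop p (X + (2 * (- (2 * inverse (real (Suc k))))) *\<^sub>R mat 1))" by (rule exE)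
  define e where "e = inverse (real (Suc k))"
  have e: "e > 0" by (simp add: e_def)
  define Y where "Y = X + (2 * (- (2 * e))) *\<^sub>R mat 1"
  have sY: "transpose Y = Y" unfolding Y_def transpose_add transpose_scaleR by (simp add: sX)
  have FY: "exp (2 * a * w x) < F (Eop p Y)" using k unfolding Y_def e_def .
  define Q where "Q = quadr (w x) p Y x"
  have Qh: "Q (x + h) = w x + p \<bullet> h + h \<bullet> (X *v h) / 2 + (- (2 * e)) * (h \<bullet> h)" for h
    unfolding Q_def Y_def quadr_perturb ..
  have Qx: "Q x = w x" by (simp add: Q_def quadr_def)
  have Qc: "isCont Q y" for y unfolding Q_def by (rule quadr_continuous)
  have "\<forall>\<^sub>F h in nhds 0. w (x + h) \<ge> Q (x + h) + e * (h \<bullet> h)"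
  proof -
    have "\<forall>\<^sub>F h in nhds 0. - w (x + h) \<le> - w x + (- p) \<bullet> h + h \<bullet> ((- X) *v h) / 2 + e * (h \<bullet> h)"
      using jet e unfolding superjet_def subjet_def by blast
    then show ?thesis unfolding Qh by eventually_elim (simp add: algebra_simps)
  qed
  then obtain r0 where r0: "r0 > 0" "\<And>h. norm h < r0 \<Longrightarrow> w (x + h) \<ge> Q (x + h) + e * (h \<bullet> h)"
    unfolding eventually_nhds_metric by (auto simp: dist_norm)
  obtain c1 where c1: "exp (2 * a * w x) < c1" "c1 < F (Eop p Y)" using dense[OF FY] by blast
  have evF: "\<forall>\<^sub>F y in nhds x. c1 < F (Eop (p + Y *v (y - x)) Y)"
  proof (rule ccontr)
    assume "\<not> ?thesis"
    then have "\<not> (\<forall>s. s \<longlonglongrightarrow> x \<longrightarrow> (\<forall>\<^sub>F n in sequentially. c1 < F (Eop (p + Y *v (s n - x)) Y)))"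
      using sequentially_imp_eventually_nhds_within[where P="\<lambda>y. c1 < F (Eop (p + Y *v (y - x)) Y)" and a=x and s=UNIV]
      by (auto simp: eventually_nhds_iff_sequentially)
    then obtain s where s: "s \<longlonglongrightarrow> x" "\<not> (\<forall>\<^sub>F n in sequentially. c1 < F (Eop (p + Y *v (s n - x)) Y))" by blast
    have "isCont (\<lambda>y. p + Y *v (y - x)) x"
      by (intro continuous_intros bounded_linear.isCont[OF matrix_vector_mul_bounded_linear])
    then have "(\<lambda>n. p + Y *v (s n - x)) \<longlonglongrightarrow> p + Y *v (x - x)" using s(1) by (rule isCont_tendsto_compose)
    then have "(\<lambda>n. Eop (p + Y *v (s n - x)) Y) \<longlonglongrightarrow> Eop (p + Y *v (x - x)) Y" by (intro Eop_tendsto tendsto_const)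
    then have "(\<lambda>n. F (Eop (p + Y *v (s n - x)) Y)) \<longlonglongrightarrow> F (Eop (p + Y *v (x - x)) Y)"
      by (rule F_tendsto[OF _ Eop_sym[OF sY]])
    then have "(\<lambda>n. F (Eop (p + Y *v (s n - x)) Y)) \<longlonglongrightarrow> F (Eop p Y)" by simp
    from order_tendstoD(1)[OF this c1(2)] s(2) show False by blast
  qed
  \<comment> \<open>Half of the room between \<open>w x\<close> and the level where exp (2 a t)
    reaches \<open>c1\<close>: one half is spent on the variation of \<open>Q\<close>, the other on
    raising it.\<close>
  define d0 where "d0 = (ln c1 / (2 * a) - w x) / 2"
  have c1p: "c1 > 0" using c1(1) less_trans[OF exp_gt_zero] by blast
  have "2 * a * w x < ln c1" using c1(1) c1p by (metis exp_less_cancel_iff exp_ln)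
  then have "w x < ln c1 / (2 * a)" using a_pos by (simp add: pos_less_divide_eq mult.commute)
  then have d0: "d0 > 0" by (simp add: d0_def)
  have evQ: "\<forall>\<^sub>F y in nhds x. Q y < w x + d0"
  proof -
    have "(Q \<longlongrightarrow> Q x) (nhds x)" using Qc[of x] unfolding continuous_at tendsto_at_iff_tendsto_nhds .
    then show ?thesis by (rule order_tendstoD(2)) (use d0 Qx in simp)
  qed
  have "\<forall>\<^sub>F y in nhds x. c1 < F (Eop (p + Y *v (y - x)) Y) \<and> Q y < w x + d0 \<and> y \<in> \<Omega>"
    by (intro eventually_conj evF evQ eventually_nhds_in_open \<Omega> x)
  then obtain r1 where r1: "r1 > 0" "\<And>y. dist y x < r1 \<Longrightarrow> c1 < F (Eop (p + Y *v (y - x)) Y) \<and> Q y < w x + d0 \<and> y \<in> \<Omega>"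
    unfolding eventually_nhds_metric by blast
  define r where "r = min r0 r1"
  have r: "r > 0" "r \<le> r0" "r \<le> r1" using r0 r1 by (auto simp: r_def)
  \<comment> \<open>The second bound keeps the raised quadratic below \<open>u\<close> at distance
    at least r / 2 from \<open>x\<close>.\<close>
  define d where "d = min d0 (e * (r / 2)\<^sup>2)"
  have d: "d > 0" "d \<le> d0" "d \<le> e * (r / 2)\<^sup>2" using d0 e r by (auto simp: d_def)
  have ball\<Omega>: "ball x r \<subseteq> \<Omega>" using r1(2) r(3) by (auto simp: dist_commute)
  have strict: "exp (2 * a * (Q y + d)) \<le> F (Eop (p + Y *v (y - x)) Y)" if "y \<in> ball x r" for y
  proof -
    have y: "c1 < F (Eop (p + Y *v (y - x)) Y)" "Q y < w x + d0" using r1(2)[of y] that r(3) by (auto simp: dist_commute)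
    have "Q y + d \<le> w x + 2 * d0" using y(2) d(2) by linarith
    also have "w x + 2 * d0 = ln c1 / (2 * a)" unfolding d0_def by argo
    finally have "2 * a * (Q y + d) \<le> ln c1" using a_pos by (simp add: pos_le_divide_eq mult.commute)
    then have "exp (2 * a * (Q y + d)) \<le> exp (ln c1)" by (simp only: exp_le_cancel_iff)
    then show ?thesis using c1p y(1) by simp
  qed
  have annulus: "Q y + d \<le> u y" if "y \<in> ball x r" "dist x y \<ge> r / 2" for y
  proof -
    have "(r / 2)\<^sup>2 \<le> (norm (y - x))\<^sup>2" using that r(1) by (intro power_mono) (auto simp: dist_norm norm_minus_commute)
    then have "e * (r / 2)\<^sup>2 \<le> e * ((y - x) \<bullet> (y - x))" using e by (intro mult_left_mono) (auto simp: power2_norm_eq_inner)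
    moreover have "w y \<ge> Q y + e * ((y - x) \<bullet> (y - x))"
      using r0(2)[of "y - x"] that(1) r(2) by (simp add: dist_norm norm_minus_commute)
    moreover have "w y \<le> u y" using wu that(1) ball\<Omega> by blast
    ultimately show ?thesis using d(3) by linarith
  qed
  define v where "v y = (if y \<in> ball x r then max (u y) (Q y + d) else u y)" for y
  have vu: "v y = u y" if "dist x y \<ge> r / 2" for y
    unfolding v_def using annulus[of y] that by auto
  have vge: "u y \<le> v y" for y unfolding v_def by auto
  have vusc: "usc_on \<Omega> v"
  proof (rule usc_onI)
    fix y c assume y: "y \<in> \<Omega>" "v y < c"
    show "\<exists>U. open U \<and> y \<in> U \<and> (\<forall>t\<in>U \<inter> \<Omega>. v t < c)"
    proof (cases "y \<in> ball x r")
      case True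
      have uy: "u y < c" and Qy: "Q y < c - d" using y(2) True unfolding v_def by auto
      obtain U where U: "open U" "y \<in> U" "\<And>t. t \<in> U \<Longrightarrow> t \<in> \<Omega> \<Longrightarrow> u t < c"
        by (rule usc_onD[OF uusc y(1) uy]) (rule that)
      have "(Q \<longlongrightarrow> Q y) (nhds y)" using Qc[of y] unfolding continuous_at tendsto_at_iff_tendsto_nhds .
      then have "\<forall>\<^sub>F t in nhds y. Q t < c - d" using Qy by (rule order_tendstoD(2))
      then obtain V where V: "open V" "y \<in> V" "\<And>t. t \<in> V \<Longrightarrow> Q t < c - d" unfolding eventually_nhds by blast
      have "v t < c" if "t \<in> U \<inter> V \<inter> \<Omega>" for t
        using U(3)[of t] V(3)[of t] that unfolding v_def by auto
      then show ?thesis using U V by (intro exI[of _ "U \<inter> V"]) auto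
    next
      case False
      then have yd: "dist x y \<ge> r" by simp
      have uy: "u y < c" using y(2) False unfolding v_def by auto
      obtain U where U: "open U" "y \<in> U" "\<And>t. t \<in> U \<Longrightarrow> t \<in> \<Omega> \<Longrightarrow> u t < c"
        by (rule usc_onD[OF uusc y(1) uy]) (rule that)
      have "v t < c" if t: "t \<in> U \<inter> (- cball x (r / 2)) \<inter> \<Omega>" for t
      proof -
        have "v t = u t" by (rule vu) (use t in simp)
        then show ?thesis using U(3)[of t] t by simp
      qed
      moreover have "open (U \<inter> - cball x (r / 2))" using U(1) by (intro open_Int) auto
      moreover have "y \<in> U \<inter> - cball x (r / 2)" using U(2) yd r(1) by simp
      ultimately show ?thesis by (intro exI[of _ "U \<inter> - cball x (r / 2)"]) auto
    qed
  qed
  have vsub: "psub \<Omega> v"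
    unfolding psub_def
  proof (intro ballI allI impI)
    fix y q Z assume y: "y \<in> \<Omega>" and vjet: "superjet v y q Z"
    show "exp (2 * a * v y) \<le> F (Eop q Z)"
    proof (cases "v y = u y")
      case True
      have "superjet u y q Z"
        by (rule superjet_below[where u=u and v=v and y=y and q=q and Z=Z, OF vjet True[symmetric]]) (use vge in \<open>simp add: always_eventually\<close>)
      then show ?thesis using usub y True unfolding psub_def by auto
    next
      case False
      then have yb: "y \<in> ball x r" and vy: "v y = Q y + d" unfolding v_def by (auto split: if_splits simp: max_def)
      have Qj: "superjet (\<lambda>t. Q t + d) y q Z"
      proof (rule superjet_below[where u="\<lambda>t. Q t + d" and v=v and y=y and q=q and Z=Z, OF vjet vy[symmetric]])
        have "\<forall>\<^sub>F t in nhds y. t \<in> ball x r" by (rule eventually_nhds_in_open[OF open_ball yb])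
        then show "\<forall>\<^sub>F t in nhds y. Q t + d \<le> v t" by eventually_elim (simp add: v_def)
      qed
      have Qsub: "subjet (\<lambda>t. Q t + d) y (p + Y *v (y - x)) Y"
      proof -
        have "(\<lambda>t. Q t + d) = quadr (w x + d) p Y x" by (simp add: Q_def quadr_def fun_eq_iff)
        then show ?thesis using subjet_quadr[OF sY, where c="w x + d" and p=p and z=x and y=y] by simp
      qed
      have q: "q = p + Y *v (y - x)" by (rule superjet_subjet_le(1)[OF Qj Qsub])
      have "F (Eop (p + Y *v (y - x)) Y) \<le> F (Eop q Z)"
      proof (rule F_mono[OF Eop_sym[OF sY] Eop_sym[OF superjet_sym[OF vjet]]])
        show "h \<bullet> (Eop (p + Y *v (y - x)) Y *v h) \<le> h \<bullet> (Eop q Z *v h)" for h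
          unfolding Eop_form q using superjet_subjet_le(2)[OF Qj Qsub, of h] by simp
      qed
      then show ?thesis unfolding vy using strict[OF yb] by linarith
    qed
  qed
  have vle: "v y \<le> u y" if "y \<in> \<Omega>" for y using max[OF vusc vsub] that by blast
  have "\<forall>\<^sub>F y in nhds x. w x - d / 2 < Q y"
  proof -
    have "(Q \<longlongrightarrow> Q x) (nhds x)" using Qc[of x] unfolding continuous_at tendsto_at_iff_tendsto_nhds .
    then show ?thesis by (rule order_tendstoD(1)) (use d Qx in simp)
  qed
  then obtain s where s: "s > 0" "\<And>y. dist y x < s \<Longrightarrow> w x - d / 2 < Q y" unfolding eventually_nhds_metric by blast
  have lt: "- w x - d / 2 < usc_env \<Omega> (\<lambda>x. - u x) x" using d(1) by (simp add: w_def)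
  \<comment> \<open>The envelope is approached by values of \<open>u\<close>, so some point near
    \<open>x\<close> has \<open>u\<close> below \<open>Q + d\<close>.\<close>
  obtain y where y: "y \<in> ball x (min r s)" "y \<in> \<Omega>" "- w x - d / 2 < - u y"
    by (rule usc_env_approx[OF x lt open_ball, of x "min r s"]) (use r s in simp, rule that)
  have "w x - d / 2 < Q y" using s(2)[of y] y(1) by (simp add: dist_commute)
  moreover have "Q y + d \<le> v y" using y(1) unfolding v_def by simp
  ultimately have "u y < v y" using y(3) by simp
  then show False using vle[OF y(2)] by simp
qed

text \<open>The largest subsolution and its lower envelope; that they coincide has to come from a
  comparison. No boundary data are imposed: \<open>ub\<close> bounds the whole family, and the last
  conclusion passes continuous lower barriers on to \<open>w\<close>, since a continuous function
  below \<open>u\<close> lies below its lower envelope.\<close>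

theorem perron:
  assumes \<Omega>: "open \<Omega>"
    and ub: "\<And>x. x \<in> \<Omega> \<Longrightarrow> \<exists>U M. open U \<and> x \<in> U \<and> (\<forall>v. usc_on \<Omega> v \<longrightarrow> psub \<Omega> v \<longrightarrow> (\<forall>y\<in>U \<inter> \<Omega>. v y \<le> M))"
    and v0: "continuous_on \<Omega> v0" "psub \<Omega> v0"
  obtains u w where "usc_on \<Omega> u" "psub \<Omega> u" "usc_on \<Omega> (\<lambda>x. - w x)" "psuper \<Omega> w" "\<And>x. x \<in> \<Omega> \<Longrightarrow> w x \<le> u x"
    "\<And>v x. continuous_on \<Omega> v \<Longrightarrow> psub \<Omega> v \<Longrightarrow> x \<in> \<Omega> \<Longrightarrow> v x \<le> w x"
proof -
  define S where "S = {v. usc_on \<Omega> v \<and> psub \<Omega> v}"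
  define u where "u x = (SUP v\<in>S. v x)" for x
  have v0S: "v0 \<in> S" using v0 continuous_imp_usc_on by (simp add: S_def)
  have ubS: "\<exists>U M. open U \<and> x \<in> U \<and> (\<forall>v\<in>S. \<forall>y\<in>U \<inter> \<Omega>. v y \<le> M)" if "x \<in> \<Omega>" for x
    using ub[OF that] unfolding S_def by blast
  have bdd: "bdd_above ((\<lambda>v. v x) ` S)" if x: "x \<in> \<Omega>" for x
  proof -
    obtain U M where "x \<in> U" "\<forall>v\<in>S. \<forall>y\<in>U \<inter> \<Omega>. v y \<le> M" using ubS[OF x] by blast
    then show ?thesis using x by (intro bdd_aboveI2[of S _ M]) blast
  qed
  have le: "v x \<le> u x" if "v \<in> S" "x \<in> \<Omega>" for v x
    unfolding u_def by (rule cSUP_upper[OF that(1) bdd[OF that(2)]])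
  have sup: "\<exists>v\<in>S. c < v x" if x: "x \<in> \<Omega>" and c: "c < u x" for x c
    using c unfolding u_def by (subst (asm) less_cSUP_iff) (use v0S bdd[OF x] in auto)
  have lba: "loc_bdd_above \<Omega> u"
    unfolding loc_bdd_above_def
  proof
    fix x assume "x \<in> \<Omega>"
    from ubS[OF this] obtain U M where U: "open U" "x \<in> U" "\<forall>v\<in>S. \<forall>y\<in>U \<inter> \<Omega>. v y \<le> M" by blast
    have "u y \<le> M" if "y \<in> U \<inter> \<Omega>" for y
      unfolding u_def by (rule cSUP_least) (use v0S U(3) that in auto)
    then show "\<exists>c U. open U \<and> x \<in> U \<and> (\<forall>y\<in>U \<inter> \<Omega>. u y \<le> c)" using U(1,2) by blast
  qed
  define u' where "u' = usc_env \<Omega> u"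
  have S3: "usc_on \<Omega> v \<and> psub \<Omega> v \<and> (\<forall>x\<in>\<Omega>. v x \<le> u x)" if "v \<in> S" for v
    using that le[OF that] by (simp add: S_def)
  have u'sub: "psub \<Omega> u'" unfolding u'_def by (rule env_of_sup_psub[OF \<Omega> lba S3 sup])
  have u'usc: "usc_on \<Omega> u'" unfolding u'_def by (rule usc_env_usc[OF lba])
  have uu': "u x \<le> u' x" if "x \<in> \<Omega>" for x unfolding u'_def by (rule usc_env_ge[OF lba that])
  have max: "\<forall>x\<in>\<Omega>. v x \<le> u' x" if "usc_on \<Omega> v" "psub \<Omega> v" for v
  proof
    fix x assume x: "x \<in> \<Omega>"
    have "v \<in> S" using that by (simp add: S_def)
    from le[OF this x] uu'[OF x] show "v x \<le> u' x" by linarith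
  qed
  have lbb: "loc_bdd_above \<Omega> (\<lambda>x. - u' x)"
    unfolding loc_bdd_above_def
  proof
    fix x assume x: "x \<in> \<Omega>"
    have "usc_on \<Omega> (\<lambda>x. - v0 x)" by (intro continuous_imp_usc_on continuous_intros v0)
    then obtain U where U: "open U" "x \<in> U" "\<And>y. y \<in> U \<Longrightarrow> y \<in> \<Omega> \<Longrightarrow> - v0 y < - v0 x + 1"
      by (rule usc_onD[OF _ x, of _ "- v0 x + 1"]) (simp, rule that)
    have "- u' y \<le> - v0 x + 1" if "y \<in> U \<inter> \<Omega>" for y
    proof -
      have "- v0 y < - v0 x + 1" using U(3) that by blast
      moreover have "v0 y \<le> u' y" using max[OF continuous_imp_usc_on[OF v0(1)] v0(2)] that by blast
      ultimately show ?thesis by linarith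
    qed
    then show "\<exists>c U. open U \<and> x \<in> U \<and> (\<forall>y\<in>U \<inter> \<Omega>. - u' y \<le> c)" using U(1,2) by blast
  qed
  define w where "w x = - usc_env \<Omega> (\<lambda>x. - u' x) x" for x
  show thesis
  proof (rule that[OF u'usc u'sub])
    show "usc_on \<Omega> (\<lambda>x. - w x)" unfolding w_def using usc_env_usc[OF lbb] by simp
    show "psuper \<Omega> w" unfolding w_def[abs_def] by (rule lsc_env_psuper[OF \<Omega> u'usc u'sub max lbb])
    show "w x \<le> u' x" if "x \<in> \<Omega>" for x using usc_env_ge[OF lbb that] unfolding w_def by simp
    show "v x \<le> w x" if v: "continuous_on \<Omega> v" "psub \<Omega> v" and x: "x \<in> \<Omega>" for v x
    proof (rule field_le_epsilon)
      fix e :: real assume e: "e > 0"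
      have "usc_on \<Omega> (\<lambda>x. - v x)" by (intro continuous_imp_usc_on continuous_intros v)
      then obtain U where U: "open U" "x \<in> U" "\<And>y. y \<in> U \<Longrightarrow> y \<in> \<Omega> \<Longrightarrow> - v y < - v x + e"
        by (rule usc_onD[OF _ x, of _ "- v x + e"]) (use e in simp, rule that)
      have "usc_env \<Omega> (\<lambda>x. - u' x) x \<le> - v x + e"
      proof (rule usc_env_le[OF x U(1,2)])
        fix y assume y: "y \<in> U" "y \<in> \<Omega>"
        have "v y \<le> u' y" using max[OF continuous_imp_usc_on[OF v(1)] v(2)] y(2) by blast
        then show "- u' y \<le> - v x + e" using U(3)[OF y] by linarith
      qed
      then show "v x \<le> w x + e" unfolding w_def by linarith
    qed
  qed
qed

end

section \<open>Interior and exterior balls\<close>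

lemma Ck_Suc_gradient:
  fixes g :: "real^'n \<Rightarrow> real"
  assumes "Ck (Suc k) g"
  obtains G where "\<And>x. (g has_derivative (\<lambda>h. G x \<bullet> h)) (at x)" "\<And>i. Ck k (\<lambda>x. G x $ i)"
proof -
  obtain D where D: "\<forall>x. (g has_derivative (\<lambda>h. \<Sum>i\<in>UNIV. D i x * h $ i)) (at x)" "\<forall>i. Ck k (D i)"
    using assms by auto
  show thesis
  proof (rule that[of "\<lambda>x. \<chi> i. D i x"])
    show "(g has_derivative (\<lambda>h. (\<chi> i. D i x) \<bullet> h)) (at x)" for x
      using spec[OF D(1), of x] by (simp add: inner_vec_def)
    show "Ck k (\<lambda>x. (\<chi> i. D i x) $ i)" for i using spec[OF D(2), of i] by simp
  qed
qed

lemma Ck_continuous: "Ck k g \<Longrightarrow> continuous_on UNIV g"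
proof (cases k)
  case (Suc j)
  assume "Ck k g"
  then have "Ck (Suc j) g" by (simp add: Suc)
  then obtain G where "\<And>x. (g has_derivative (\<lambda>h. G x \<bullet> h)) (at x)" "\<And>i. Ck j (\<lambda>x. G x $ i)"
    by (rule Ck_Suc_gradient) (rule that)
  then show ?thesis by (intro has_derivative_continuous_on[of UNIV g "\<lambda>x h. G x \<bullet> h"]) simp
qed simp

lemma mvt_inner:
  fixes g :: "'a::real_inner \<Rightarrow> real"
  assumes "\<And>x. (g has_derivative (\<lambda>h. G x \<bullet> h)) (at x)"
  obtains t where "0 < t" "t < 1" "g y - g x = G (x + t *\<^sub>R (y - x)) \<bullet> (y - x)"
proof -
  have "\<exists>t. 0 < t \<and> t < 1 \<and> g (x + 1 *\<^sub>R (y - x)) - g (x + 0 *\<^sub>R (y - x)) = (1 - 0) * (G (x + t *\<^sub>R (y - x)) \<bullet> (y - x))"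
    by (rule MVT2) (use assms in \<open>auto intro!: DERIV_along_line\<close>)
  then show thesis using that by auto
qed

lemma C1_lipschitz_on_cball:
  fixes g :: "real^'n \<Rightarrow> real"
  assumes "Ck (Suc k) g"
  obtains B where "B \<ge> 0" "\<And>x y. x \<in> cball p r \<Longrightarrow> y \<in> cball p r \<Longrightarrow> \<bar>g y - g x\<bar> \<le> B * norm (y - x)"
proof -
  obtain G where G: "\<And>x. (g has_derivative (\<lambda>h. G x \<bullet> h)) (at x)" "\<And>i. Ck k (\<lambda>x. G x $ i)"
    by (rule Ck_Suc_gradient[OF assms]) (rule that)
  have "continuous_on UNIV (\<lambda>x. \<chi> i. G x $ i)"
    by (intro continuous_on_vec_lambda Ck_continuous[OF G(2)])
  then have "continuous_on UNIV G" by simp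
  then have "continuous_on (cball p r) G" by (rule continuous_on_subset) simp
  then have "bounded (G ` cball p r)"
    by (intro compact_imp_bounded compact_continuous_image) auto
  then obtain b where b: "\<And>x. x \<in> cball p r \<Longrightarrow> norm (G x) \<le> b" unfolding bounded_iff by (metis imageI)
  define B where "B = max b 0"
  have "\<bar>g y - g x\<bar> \<le> B * norm (y - x)" if xy: "x \<in> cball p r" "y \<in> cball p r" for x y
  proof -
    obtain t where t: "0 < t" "t < 1" "g y - g x = G (x + t *\<^sub>R (y - x)) \<bullet> (y - x)" by (rule mvt_inner[OF G(1)])
    have "(1 - t) *\<^sub>R x + t *\<^sub>R y \<in> cball p r"
      using xy t by (intro convexD_alt[OF convex_cball]) auto
    moreover have "(1 - t) *\<^sub>R x + t *\<^sub>R y = x + t *\<^sub>R (y - x)" by (simp add: algebra_simps)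
    ultimately have "norm (G (x + t *\<^sub>R (y - x))) \<le> B" using b by (simp add: B_def le_max_iff_disj)
    then have "norm (G (x + t *\<^sub>R (y - x))) * norm (y - x) \<le> B * norm (y - x)" by (intro mult_right_mono) auto
    then show ?thesis unfolding t(3) using Cauchy_Schwarz_ineq2[of "G (x + t *\<^sub>R (y - x))" "y - x"] by linarith
  qed
  then show thesis using that[of B] by (simp add: B_def)
qed

text \<open>Uniqueness of derivatives identifies \<open>G\<close> with the gradient supplied by
  \<open>Ck\<close>, whose components are Lipschitz on balls.\<close>

lemma smooth_quadratic_remainder:
  fixes \<rho> :: "real^'n \<Rightarrow> real"
  assumes sm: "smooth_fun \<rho>" and G: "\<And>x. (\<rho> has_derivative (\<lambda>h. G x \<bullet> h)) (at x)"
  obtains K where "K > 0" "continuous_on UNIV G"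
    "\<And>x y. x \<in> cball p r \<Longrightarrow> y \<in> cball p r \<Longrightarrow> \<bar>\<rho> y - \<rho> x - G x \<bullet> (y - x)\<bar> \<le> K * ((y - x) \<bullet> (y - x))"
proof -
  have C2: "Ck (Suc (Suc 0)) \<rho>" using sm unfolding smooth_fun_def by blast
  obtain G' where G': "\<And>x. (\<rho> has_derivative (\<lambda>h. G' x \<bullet> h)) (at x)" "\<And>i. Ck (Suc 0) (\<lambda>x. G' x $ i)"
    by (rule Ck_Suc_gradient[OF C2]) (rule that)
  have GG: "G x = G' x" for x
  proof -
    have "(\<lambda>h. G x \<bullet> h) = (\<lambda>h. G' x \<bullet> h)" by (rule has_derivative_unique[OF G G'(1)])
    then have "G x \<bullet> (G x - G' x) = G' x \<bullet> (G x - G' x)" by metis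
    then have "(G x - G' x) \<bullet> (G x - G' x) = 0" by (simp add: inner_diff_left)
    then show ?thesis by simp
  qed
  have contG: "continuous_on UNIV G"
  proof -
    have "continuous_on UNIV (\<lambda>x. \<chi> i. G' x $ i)"
      by (intro continuous_on_vec_lambda Ck_continuous[OF G'(2)])
    then show ?thesis by (simp add: GG[abs_def])
  qed
  have "\<forall>i. \<exists>B. B \<ge> 0 \<and> (\<forall>x\<in>cball p r. \<forall>y\<in>cball p r. \<bar>G x $ i - G y $ i\<bar> \<le> B * norm (x - y))"
  proof
    fix i
    obtain B where "B \<ge> 0" "\<And>x y. x \<in> cball p r \<Longrightarrow> y \<in> cball p r \<Longrightarrow> \<bar>G' y $ i - G' x $ i\<bar> \<le> B * norm (y - x)"
      by (rule C1_lipschitz_on_cball[OF G'(2)]) (rule that)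
    then show "\<exists>B. B \<ge> 0 \<and> (\<forall>x\<in>cball p r. \<forall>y\<in>cball p r. \<bar>G x $ i - G y $ i\<bar> \<le> B * norm (x - y))"
      unfolding GG by blast
  qed
  from choice[OF this] obtain B where B: "\<forall>i. B i \<ge> 0 \<and> (\<forall>x\<in>cball p r. \<forall>y\<in>cball p r. \<bar>G x $ i - G y $ i\<bar> \<le> B i * norm (x - y))" by (rule exE)
  define K where "K = (\<Sum>i\<in>UNIV. B i) + 1"
  have K: "K > 0" unfolding K_def using B by (intro add_nonneg_pos sum_nonneg) auto
  have lipG: "norm (G x - G y) \<le> K * norm (x - y)" if "x \<in> cball p r" "y \<in> cball p r" for x y
  proof -
    have "norm (G x - G y) \<le> (\<Sum>i\<in>UNIV. \<bar>(G x - G y) $ i\<bar>)" by (rule norm_le_l1_cart)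
    also have "\<dots> \<le> (\<Sum>i\<in>UNIV. B i * norm (x - y))" using B that by (intro sum_mono) simp
    also have "\<dots> = (\<Sum>i\<in>UNIV. B i) * norm (x - y)" by (simp add: sum_distrib_right)
    also have "\<dots> \<le> K * norm (x - y)" unfolding K_def by (intro mult_right_mono) auto
    finally show ?thesis .
  qed
  show thesis
  proof (rule that[OF K contG])
    fix x y assume xy: "x \<in> cball p r" "y \<in> cball p r"
    obtain t where t: "0 < t" "t < 1" "\<rho> y - \<rho> x = G (x + t *\<^sub>R (y - x)) \<bullet> (y - x)" by (rule mvt_inner[OF G])
    define z where "z = x + t *\<^sub>R (y - x)"
    have "(1 - t) *\<^sub>R x + t *\<^sub>R y \<in> cball p r"
      using xy t by (intro convexD_alt[OF convex_cball]) auto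
    moreover have "(1 - t) *\<^sub>R x + t *\<^sub>R y = z" by (simp add: z_def algebra_simps)
    ultimately have zc: "z \<in> cball p r" by simp
    have "norm (z - x) \<le> norm (y - x)" using t by (simp add: z_def mult_left_le_one_le)
    then have "K * norm (z - x) \<le> K * norm (y - x)" using K by (intro mult_left_mono) auto
    then have "norm (G z - G x) \<le> K * norm (y - x)" using lipG[OF zc xy(1)] by linarith
    then have "norm (G z - G x) * norm (y - x) \<le> (K * norm (y - x)) * norm (y - x)" by (intro mult_right_mono) auto
    also have "\<dots> = K * ((y - x) \<bullet> (y - x))" by (simp add: power2_norm_eq_inner[symmetric] power2_eq_square)
    finally have "\<bar>(G z - G x) \<bullet> (y - x)\<bar> \<le> K * ((y - x) \<bullet> (y - x))"
      using Cauchy_Schwarz_ineq2[of "G z - G x" "y - x"] by linarith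
    then show "\<bar>\<rho> y - \<rho> x - G x \<bullet> (y - x)\<bar> \<le> K * ((y - x) \<bullet> (y - x))"
      unfolding t(3) z_def by (simp add: inner_diff_left)
  qed
qed

text \<open>\<open>\<nu>\<close> is the outward unit normal at \<open>p\<close>; both balls have
  \<open>p\<close> on their boundary sphere.\<close>

definition touching_balls :: "(real^'n) set \<Rightarrow> real \<Rightarrow> real^'n \<Rightarrow> bool" where
  "touching_balls \<Omega> R p \<longleftrightarrow> (\<exists>\<nu>. norm \<nu> = 1 \<and> ball (p + R *\<^sub>R \<nu>) R \<inter> \<Omega> = {} \<and> ball (p - R *\<^sub>R \<nu>) R \<subseteq> \<Omega>)"

text \<open>In a ball of radius R' tangent at \<open>p\<close>, the displacement w satisfies |w|^2 <
  2 R' |\<nu> . w|, so for small R' the linear term of the defining function beats its quadratic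
  remainder and fixes the sign. All smaller radii are included to allow a common radius
  later.\<close>

lemma local_touching_balls:
  fixes \<Omega> :: "(real^'n) set"
  assumes \<Omega>: "open \<Omega>" and sb: "smooth_boundary \<Omega>" and p0: "p0 \<in> frontier \<Omega>"
  shows "\<exists>s>0. \<exists>R>0. \<forall>p\<in>frontier \<Omega> \<inter> ball p0 s. \<forall>R'>0. R' \<le> R \<longrightarrow> touching_balls \<Omega> R' p"
proof -
  obtain r \<rho> G where r: "r > 0" and sm: "smooth_fun \<rho>" and G: "\<And>x. (\<rho> has_derivative (\<lambda>h. G x \<bullet> h)) (at x)"
    and Gp: "G p0 \<noteq> 0" and eq: "\<Omega> \<inter> ball p0 r = {x \<in> ball p0 r. \<rho> x < 0}"
    using sb p0 unfolding smooth_boundary_def by blast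
  obtain K where K: "K > 0" and contG: "continuous_on UNIV G"
    and rem: "\<And>x y. x \<in> cball p0 r \<Longrightarrow> y \<in> cball p0 r \<Longrightarrow> \<bar>\<rho> y - \<rho> x - G x \<bullet> (y - x)\<bar> \<le> K * ((y - x) \<bullet> (y - x))"
    by (rule smooth_quadratic_remainder[OF sm G]) (rule that)
  define g where "g = norm (G p0) / 2"
  have g: "g > 0" using Gp by (simp add: g_def)
  have "isCont (\<lambda>x. norm (G x)) p0"
    using contG by (intro continuous_norm) (simp add: continuous_on_eq_continuous_at)
  then obtain s1 where s1: "s1 > 0" "\<And>x. dist x p0 < s1 \<Longrightarrow> dist (norm (G x)) (norm (G p0)) < g"
    unfolding continuous_at_eps_delta using g by blast
  define s where "s = min s1 (r / 2)"
  \<comment> \<open>Balls of diameter at most r / 2 stay in the chart, and 2 R K <= g / 2 stays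
    below the norm of the gradient.\<close>
  define R where "R = min (r / 4) (g / (4 * K))"
  have s: "s > 0" "s \<le> s1" "s \<le> r / 2" using s1 r by (auto simp: s_def)
  have R: "R > 0" "R \<le> r / 4" "R \<le> g / (4 * K)" using r g K by (auto simp: R_def)
  have "touching_balls \<Omega> R' p" if p: "p \<in> frontier \<Omega>" "p \<in> ball p0 s" and R': "R' > 0" "R' \<le> R" for p R'
  proof -
    have pr: "dist p0 p < r / 2" using p(2) s(3) by simp
    have Gg: "norm (G p) > g"
    proof -
      have "dist (norm (G p)) (norm (G p0)) < g" using s1(2)[of p] p(2) s(2) by (simp add: dist_commute)
      then have "- (norm (G p) - norm (G p0)) < g" unfolding dist_real_def abs_less_iff by blast
      then show ?thesis unfolding g_def by argo
    qed
    have KR: "2 * R' * K < norm (G p)"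
    proof -
      have "R * (4 * K) \<le> g" using R(3) K by (simp add: pos_le_divide_eq)
      moreover have "R' * (4 * K) \<le> R * (4 * K)" using R'(2) K by (intro mult_right_mono) auto
      ultimately have "R' * (4 * K) \<le> g" by linarith
      then show ?thesis using Gg g by (simp add: mult_ac)
    qed
    have pn: "p \<notin> \<Omega>" using p(1) \<Omega> by (simp add: frontier_def interior_open)
    have pb: "p \<in> ball p0 r" using pr r by simp
    \<comment> \<open>The chart tells only where \<open>\<rho>\<close> is negative; that
      \<open>\<rho>\<close> vanishes at \<open>p\<close> comes from \<open>p\<close> being in the
      closure but not in the open set.\<close>
    have "\<not> \<rho> p < 0" using eq pn pb by blast
    moreover have "\<not> \<rho> p > 0"
    proof
      assume pos: "\<rho> p > 0"
      have "isCont \<rho> p" using has_derivative_continuous[OF G] .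
      then have "(\<rho> \<longlongrightarrow> \<rho> p) (nhds p)" unfolding continuous_at tendsto_at_iff_tendsto_nhds .
      then have "\<forall>\<^sub>F x in nhds p. \<rho> x > 0" using pos by (rule order_tendstoD)
      moreover have "\<forall>\<^sub>F x in nhds p. x \<in> ball p0 r" by (rule eventually_nhds_in_open[OF open_ball pb])
      ultimately have "\<forall>\<^sub>F x in nhds p. x \<notin> \<Omega>" by eventually_elim (use eq in force)
      then obtain U where "open U" "p \<in> U" "\<And>x. x \<in> U \<Longrightarrow> x \<notin> \<Omega>" unfolding eventually_nhds by blast
      then have "p \<notin> closure \<Omega>" by (meson disjoint_iff open_Int_closure_eq_empty)
      then show False using p(1) by (simp add: frontier_def)
    qed
    ultimately have rp: "\<rho> p = 0" by simp
    define \<nu> where "\<nu> = G p /\<^sub>R norm (G p)"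
    have Gp0: "norm (G p) > 0" by (rule less_trans[OF g Gg])
    have \<nu>: "norm \<nu> = 1" using Gp0 by (simp add: \<nu>_def)
    have G\<nu>: "G p \<bullet> h = norm (G p) * (\<nu> \<bullet> h)" for h using Gp0 by (simp add: \<nu>_def)
    have near: "x \<in> ball p0 r" "\<bar>\<rho> x - G p \<bullet> (x - p)\<bar> \<le> K * ((x - p) \<bullet> (x - p))" if "norm (x - p) < 2 * R'" for x
    proof -
      have "norm (x - p) < r / 2" using that R'(2) R(2) by linarith
      then show 1: "x \<in> ball p0 r" using pr dist_triangle[of p0 x p] by (simp add: dist_norm norm_minus_commute)
      show "\<bar>\<rho> x - G p \<bullet> (x - p)\<bar> \<le> K * ((x - p) \<bullet> (x - p))"
        using rem[of p x] 1 pb rp by simp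
    qed
    have key: "(x - p) \<bullet> (x - p) < 2 * R' * (\<sigma> * (\<nu> \<bullet> (x - p))) \<and> norm (x - p) < 2 * R'"
      if x: "x \<in> ball (p + (\<sigma> * R') *\<^sub>R \<nu>) R'" and \<sigma>: "\<sigma> * \<sigma> = 1" for x \<sigma>
    proof -
      define w where "w = x - p"
      have "norm (w - (\<sigma> * R') *\<^sub>R \<nu>) < R'" using x by (simp add: w_def dist_norm norm_minus_commute algebra_simps)
      then have "(norm (w - (\<sigma> * R') *\<^sub>R \<nu>))\<^sup>2 < R'\<^sup>2" by (intro power_strict_mono) auto
      moreover have "(norm (w - (\<sigma> * R') *\<^sub>R \<nu>))\<^sup>2 = w \<bullet> w - 2 * R' * (\<sigma> * (\<nu> \<bullet> w)) + R'\<^sup>2"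
      proof -
        have "\<nu> \<bullet> \<nu> = 1" using \<nu> by (simp add: norm_eq_1)
        moreover have "(\<sigma> * R') * (\<sigma> * R') = R'\<^sup>2" using \<sigma> by (simp add: power2_eq_square mult_ac)
        ultimately show ?thesis
          by (simp add: power2_norm_eq_inner inner_diff_left inner_diff_right inner_commute mult_ac)
      qed
      ultimately have 1: "w \<bullet> w < 2 * R' * (\<sigma> * (\<nu> \<bullet> w))" by linarith
      have "\<bar>\<sigma>\<bar> = 1" using \<sigma> by (metis abs_mult_self_eq abs_one mult_cancel_left2 power2_eq_1_iff power2_eq_square abs_minus_cancel)
      then have "norm ((\<sigma> * R') *\<^sub>R \<nu>) = R'" using \<nu> R'(1) by (simp add: abs_mult)
      then have "norm w < 2 * R'"
        using \<open>norm (w - (\<sigma> * R') *\<^sub>R \<nu>) < R'\<close> norm_triangle_ineq2[of w "(\<sigma> * R') *\<^sub>R \<nu>"] by linarith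
      with 1 show ?thesis by (simp add: w_def)
    qed
    have dom: "K * (w \<bullet> w) < norm (G p) * t" if "w \<bullet> w < 2 * R' * t" for w :: "real^'n" and t
    proof -
      have t: "t > 0"
      proof (rule ccontr)
        assume "\<not> t > 0"
        then have "2 * R' * t \<le> 0" using R'(1) by (simp add: mult_nonneg_nonpos)
        then show False using that inner_ge_zero[of w] by linarith
      qed
      have "K * (w \<bullet> w) \<le> K * (2 * R' * t)" using that K by (intro mult_left_mono) auto
      also have "\<dots> = (2 * R' * K) * t" by (simp add: mult_ac)
      also have "\<dots> < norm (G p) * t" using KR t by (intro mult_strict_right_mono)
      finally show ?thesis .
    qed
    have "x \<notin> \<Omega>" if "x \<in> ball (p + R' *\<^sub>R \<nu>) R'" for x
    proof -
      have k: "(x - p) \<bullet> (x - p) < 2 * R' * (\<nu> \<bullet> (x - p))" "norm (x - p) < 2 * R'" using key[of x 1] that by auto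
      have "\<rho> x > 0" using near(2)[OF k(2)] dom[OF k(1)] unfolding G\<nu> by (simp add: abs_le_iff)
      then show ?thesis using near(1)[OF k(2)] eq by force
    qed
    moreover have "x \<in> \<Omega>" if "x \<in> ball (p - R' *\<^sub>R \<nu>) R'" for x
    proof -
      have k: "(x - p) \<bullet> (x - p) < 2 * R' * (- (\<nu> \<bullet> (x - p)))" "norm (x - p) < 2 * R'" using key[of x "- 1"] that by auto
      have "\<rho> x < 0" using near(2)[OF k(2)] dom[OF k(1)] unfolding G\<nu> by (simp add: abs_le_iff)
      then show ?thesis using near(1)[OF k(2)] eq by force
    qed
    ultimately show ?thesis unfolding touching_balls_def using \<nu> by blast
  qed
  then show ?thesis using s(1) R(1) by blast
qed

lemma uniform_touching_balls:
  assumes D: "bdd_smooth_domain \<Omega>"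
  obtains R where "R > 0" "\<And>p. p \<in> frontier \<Omega> \<Longrightarrow> touching_balls \<Omega> R p"
proof -
  have \<Omega>: "open \<Omega>" "smooth_boundary \<Omega>" "bounded \<Omega>" using D by (auto simp: bdd_smooth_domain_def)
  have cf: "compact (frontier \<Omega>)" using \<Omega>(3) by (rule compact_frontier_bounded)
  have "\<forall>p\<in>frontier \<Omega>. \<exists>s. s > 0 \<and> (\<exists>R>0. \<forall>q\<in>frontier \<Omega> \<inter> ball p s. \<forall>R'>0. R' \<le> R \<longrightarrow> touching_balls \<Omega> R' q)"
    using local_touching_balls[OF \<Omega>(1,2)] by blast
  from bchoice[OF this] obtain s where s: "\<forall>p\<in>frontier \<Omega>. s p > 0 \<and> (\<exists>R>0. \<forall>q\<in>frontier \<Omega> \<inter> ball p (s p). \<forall>R'>0. R' \<le> R \<longrightarrow> touching_balls \<Omega> R' q)"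
    by (rule exE)
  then have "\<forall>p\<in>frontier \<Omega>. \<exists>R. R > 0 \<and> (\<forall>q\<in>frontier \<Omega> \<inter> ball p (s p). \<forall>R'>0. R' \<le> R \<longrightarrow> touching_balls \<Omega> R' q)" by blast
  from bchoice[OF this] obtain r where r: "\<forall>p\<in>frontier \<Omega>. r p > 0 \<and> (\<forall>q\<in>frontier \<Omega> \<inter> ball p (s p). \<forall>R'>0. R' \<le> r p \<longrightarrow> touching_balls \<Omega> R' q)"
    by (rule exE)
  have cov: "frontier \<Omega> \<subseteq> (\<Union>p\<in>frontier \<Omega>. ball p (s p))" using s by fastforce
  obtain C where C: "C \<subseteq> frontier \<Omega>" "finite C" "frontier \<Omega> \<subseteq> (\<Union>p\<in>C. ball p (s p))"
    by (rule compactE_image[OF cf open_ball cov]) (rule that)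
  define R where "R = Min (insert 1 (r ` C))"
  have "R \<in> insert 1 (r ` C)" unfolding R_def using C(2) by (intro Min_in) auto
  then have R: "R > 0" using r C(1) by auto
  show thesis
  proof (rule that[OF R])
    fix p assume p: "p \<in> frontier \<Omega>"
    then obtain q where q: "q \<in> C" "p \<in> ball q (s q)" using C(3) by blast
    have "R \<le> r q" unfolding R_def using C(2) q(1) by (intro Min_le) auto
    then show "touching_balls \<Omega> R p" using r q p C(1) R by blast
  qed
qed

text \<open>The ball of radius \<open>d\<close> around \<open>x\<close> lies in the domain, hence
  misses the exterior ball at the nearest boundary point \<open>p\<close>: the centres are at least
  R + d apart, while the path over \<open>p\<close> has exactly this length. Equality in the
  triangle inequality puts \<open>x\<close> on the normal at \<open>p\<close>, so both distances to
  centres are exact.\<close>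

lemma touching_balls_distance:
  assumes D: "bdd_smooth_domain \<Omega>" and R: "R > 0" and tb: "\<And>p. p \<in> frontier \<Omega> \<Longrightarrow> touching_balls \<Omega> R p"
    and x: "x \<in> \<Omega>" and d: "d = infdist x (frontier \<Omega>)" "d < R"
  obtains c c' where "ball c R \<inter> \<Omega> = {}" "ball c' R \<subseteq> \<Omega>" "norm (x - c) = R + d" "norm (x - c') = R - d" "d > 0"
proof -
  have \<Omega>: "open \<Omega>" "bounded \<Omega>" "\<Omega> \<noteq> {}" using D by (auto simp: bdd_smooth_domain_def)
  have fn: "frontier \<Omega> \<noteq> {}"
    using frontier_eq_empty[of \<Omega>] \<Omega> not_bounded_UNIV by auto
  obtain p where p: "p \<in> frontier \<Omega>" "d = dist x p"
    using infdist_attains_inf[OF frontier_closed fn, of x] d(1) by blast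
  obtain \<nu> where \<nu>: "norm \<nu> = 1" "ball (p + R *\<^sub>R \<nu>) R \<inter> \<Omega> = {}" "ball (p - R *\<^sub>R \<nu>) R \<subseteq> \<Omega>"
    using tb[OF p(1)] unfolding touching_balls_def by blast
  have pn: "p \<notin> \<Omega>" using p(1) \<Omega>(1) by (simp add: frontier_def interior_open)
  have d0: "d > 0" using p(2) pn x by auto
  have bx: "ball x d \<subseteq> \<Omega>"
  proof (rule ccontr)
    assume "\<not> ball x d \<subseteq> \<Omega>"
    then have "ball x d - \<Omega> \<noteq> {}" by blast
    moreover have "ball x d \<inter> \<Omega> \<noteq> {}" using x d0 centre_in_ball by blast
    ultimately have "ball x d \<inter> frontier \<Omega> \<noteq> {}" by (intro connected_Int_frontier convex_connected) auto
    then obtain q where "q \<in> frontier \<Omega>" "dist x q < d" by auto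
    then show False using infdist_le[of q "frontier \<Omega>" x] d(1) by simp
  qed
  define c where "c = p + R *\<^sub>R \<nu>"
  have disj: "norm (x - c) \<ge> R + d"
  proof (rule ccontr)
    assume lt: "\<not> norm (x - c) \<ge> R + d"
    define n where "n = norm (x - c)"
    \<comment> \<open>The point dividing the segment between the centres in the ratio d : R would
      lie in both balls.\<close>
    define y where "y = x + (d / (R + d)) *\<^sub>R (c - x)"
    have Rd: "R + d > 0" using R d0 by simp
    have n: "n < R + d" using lt by (simp add: n_def)
    have "norm (y - x) = d / (R + d) * n" unfolding y_def n_def using d0 Rd by (simp add: norm_minus_commute)
    also have "\<dots> < d / (R + d) * (R + d)" using n d0 Rd by (intro mult_strict_left_mono) auto
    finally have 1: "norm (y - x) < d" using Rd by simp
    have "y - c = (R / (R + d)) *\<^sub>R (x - c)"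
    proof -
      have "y - c = (x - c) - (d / (R + d)) *\<^sub>R (x - c)" by (simp add: y_def scaleR_diff_right)
      also have "\<dots> = (1 - d / (R + d)) *\<^sub>R (x - c)" by (simp add: scaleR_diff_left)
      also have "1 - d / (R + d) = R / (R + d)" using Rd by (simp add: field_simps)
      finally show ?thesis .
    qed
    then have "norm (y - c) = R / (R + d) * n" unfolding n_def using R Rd by simp
    also have "\<dots> < R / (R + d) * (R + d)" using n R Rd by (intro mult_strict_left_mono) auto
    finally have 2: "norm (y - c) < R" using Rd by simp
    have "y \<in> \<Omega>" using bx 1 by (auto simp: dist_norm norm_minus_commute)
    moreover have "y \<in> ball (p + R *\<^sub>R \<nu>) R" using 2 by (simp add: c_def dist_norm norm_minus_commute)
    ultimately show False using \<nu>(2) by blast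
  qed
  define w where "w = x - p"
  have nw: "norm w = d" using p(2) by (simp add: w_def dist_norm)
  have xc: "x - c = w - R *\<^sub>R \<nu>" by (simp add: w_def c_def)
  have \<nu>\<nu>: "\<nu> \<bullet> \<nu> = 1" using \<nu>(1) by (simp add: norm_eq_1)
  have ww: "w \<bullet> w = d\<^sup>2" using nw by (simp add: power2_norm_eq_inner[symmetric])
  have sq: "(norm (x - c))\<^sup>2 = d\<^sup>2 - 2 * R * (w \<bullet> \<nu>) + R\<^sup>2"
    unfolding xc power2_norm_eq_inner by (simp add: inner_diff_left inner_diff_right ww \<nu>\<nu> inner_commute power2_eq_square)
  have "(R + d)\<^sup>2 \<le> (norm (x - c))\<^sup>2" using disj R d0 by (intro power_mono) auto
  then have "R * d \<le> R * (- (w \<bullet> \<nu>))" unfolding sq by (simp add: power2_eq_square algebra_simps)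
  then have le: "d \<le> - (w \<bullet> \<nu>)" using R by (simp only: mult_le_cancel_left_pos)
  moreover have "- (w \<bullet> \<nu>) \<le> d" using Cauchy_Schwarz_ineq2[of w \<nu>] nw \<nu>(1) by (simp add: abs_le_iff)
  ultimately have w\<nu>: "w \<bullet> \<nu> = - d" by simp
  have "norm (w + d *\<^sub>R \<nu>) = 0"
  proof -
    have "(norm (w + d *\<^sub>R \<nu>))\<^sup>2 = 0"
      unfolding power2_norm_eq_inner by (simp add: inner_add_left inner_add_right ww \<nu>\<nu> w\<nu> inner_commute[of \<nu> w] power2_eq_square)
    then show ?thesis by simp
  qed
  then have wd: "w = - (d *\<^sub>R \<nu>)" by (simp add: eq_neg_iff_add_eq_0)
  show thesis
  proof (rule that[of c "p - R *\<^sub>R \<nu>"])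
    show "ball c R \<inter> \<Omega> = {}" using \<nu>(2) by (simp add: c_def)
    show "ball (p - R *\<^sub>R \<nu>) R \<subseteq> \<Omega>" by (rule \<nu>(3))
    have "x - c = - ((R + d) *\<^sub>R \<nu>)" unfolding xc wd by (simp add: scaleR_add_left)
    then show "norm (x - c) = R + d" using \<nu>(1) R d0 by simp
    have "x - (p - R *\<^sub>R \<nu>) = w + R *\<^sub>R \<nu>" by (simp add: w_def)
    also have "\<dots> = (R - d) *\<^sub>R \<nu>" unfolding wd by (simp add: scaleR_diff_left)
    finally show "norm (x - (p - R *\<^sub>R \<nu>)) = R - d" using \<nu>(1) d(2) by simp
    show "d > 0" by (rule d0)
  qed
qed

section \<open>Boundary behaviour, uniqueness and regularity\<close>

definition blows_up :: "(real^'n) set \<Rightarrow> (real^'n \<Rightarrow> real) \<Rightarrow> bool" where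
  "blows_up \<Omega> u \<longleftrightarrow> (\<forall>M. \<exists>\<delta>>0. \<forall>x\<in>\<Omega>. infdist x (frontier \<Omega>) < \<delta> \<longrightarrow> u x > M)"

lemma compact_infdist_ge:
  fixes \<Omega> :: "'a::euclidean_space set"
  assumes "bounded \<Omega>" "open \<Omega>" "\<delta> > 0"
  shows "compact {x \<in> \<Omega>. infdist x (frontier \<Omega>) \<ge> \<delta>}"
proof -
  have "{x \<in> \<Omega>. infdist x (frontier \<Omega>) \<ge> \<delta>} = closure \<Omega> \<inter> {x. infdist x (frontier \<Omega>) \<ge> \<delta>}"
  proof (intro equalityI subsetI)
    fix x assume x: "x \<in> closure \<Omega> \<inter> {x. infdist x (frontier \<Omega>) \<ge> \<delta>}"
    have "x \<in> \<Omega>"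
    proof (rule ccontr)
      assume "x \<notin> \<Omega>"
      then have "x \<in> frontier \<Omega>" using x assms(2) by (simp add: frontier_def interior_open)
      then have "infdist x (frontier \<Omega>) = 0" by simp
      then show False using x assms(3) by simp
    qed
    then show "x \<in> {x \<in> \<Omega>. infdist x (frontier \<Omega>) \<ge> \<delta>}" using x by simp
  qed (use closure_subset in auto)
  moreover have "compact (closure \<Omega> \<inter> {x. infdist x (frontier \<Omega>) \<ge> \<delta>})"
  proof (rule compact_Int_closed)
    show "compact (closure \<Omega>)" using assms(1) by (simp add: compact_eq_bounded_closed bounded_closure)
    show "closed {x. infdist x (frontier \<Omega>) \<ge> \<delta>}" by (intro closed_Collect_le continuous_intros)
  qed
  ultimately show ?thesis by simp
qed

section \<open>Two-sided barrier bounds\<close>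

context conf_op
begin

lemma bw_pos_inner: "R > 0 \<Longrightarrow> norm (x - c) < R \<Longrightarrow> bw 1 R c x > 0"
proof -
  assume R: "R > 0" and x: "norm (x - c) < R"
  have "(norm (x - c))\<^sup>2 < R\<^sup>2" using x by (intro power_strict_mono) auto
  then show ?thesis unfolding bw_def using R kk_pos by (simp add: power2_norm_eq_inner)
qed

lemma bw_pos_outer: "R > 0 \<Longrightarrow> norm (x - c) > R \<Longrightarrow> bw (- 1) R c x > 0"
proof -
  assume R: "R > 0" and x: "norm (x - c) > R"
  have "R\<^sup>2 < (norm (x - c))\<^sup>2" using x R by (intro power_strict_mono) auto
  then have "0 < (kk / R) * ((x - c) \<bullet> (x - c) - R\<^sup>2)"
    using R kk_pos by (intro mult_pos_pos) (simp_all add: power2_norm_eq_inner)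
  then show ?thesis unfolding bw_def by (simp add: algebra_simps)
qed

text \<open>A universal upper bound for subsolutions: on a slightly smaller ball \<open>v\<close> is
  bounded above while the barrier is infinite on the sphere, so comparison applies; then the radius
  increases to \<open>R\<close>.\<close>

lemma psub_le_bar:
  assumes \<Omega>: "open \<Omega>" and v: "usc_on \<Omega> v" "psub \<Omega> v" and R: "R > 0" and B: "ball c R \<subseteq> \<Omega>" and x: "x \<in> ball c R"
  shows "v x \<le> bar 1 R c x"
proof -
  have n: "norm (x - c) < R" using x by (simp add: dist_norm norm_minus_commute)
  have le: "v x \<le> bar 1 r c x" if r: "norm (x - c) < r" "r < R" for r
  proof -
    have r0: "r > 0" using r(1) norm_ge_zero[of "x - c"] by linarith
    have cb: "cball c r \<subseteq> \<Omega>" using B r(2) by (auto simp: subset_iff)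
    have sub: "ball c r \<subseteq> \<Omega>" using cb ball_subset_cball by blast
    have "\<exists>y\<in>cball c r. \<forall>z\<in>cball c r. v z \<le> v y"
      using r0 by (intro usc_attains_max usc_on_subset[OF v(1) cb]) auto
    then obtain V where V: "\<And>z. z \<in> cball c r \<Longrightarrow> v z \<le> V" by blast
    have pos: "bw 1 r c y > 0" if "y \<in> ball c r" for y
      using that r0 by (intro bw_pos_inner) (auto simp: dist_norm norm_minus_commute)
    \<comment> \<open>Off this set the barrier already exceeds the bound \<open>V\<close>; the
      weight vanishes on the sphere, so the set stays in the open ball.\<close>
    define K where "K = {y \<in> cball c r. bw 1 r c y \<ge> exp (- V)}"
    have Kc: "compact K"
    proof -
      have "closed {y. exp (- V) \<le> bw 1 r c y}"
        by (intro closed_Collect_le continuous_on_const continuous_bw)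
      moreover have "K = cball c r \<inter> {y. exp (- V) \<le> bw 1 r c y}" by (auto simp: K_def)
      ultimately show ?thesis by (simp add: compact_Int_closed)
    qed
    have KU: "K \<subseteq> ball c r"
    proof
      fix y assume y: "y \<in> K"
      have "bw 1 r c y \<noteq> 0" using y exp_gt_zero[of "- V"] unfolding K_def by force
      moreover have "bw 1 r c y = 0" if "norm (y - c) = r"
        using that by (simp add: bw_def power2_norm_eq_inner[symmetric])
      moreover have "norm (y - c) \<le> r" using y by (simp add: K_def dist_norm norm_minus_commute)
      ultimately have "norm (y - c) < r" by force
      then show "y \<in> ball c r" by (simp add: dist_norm norm_minus_commute)
    qed
    show ?thesis
    proof (rule comparison[of "ball c r" v "bar 1 r c"])
      show "usc_on (ball c r) v" by (rule usc_on_subset[OF v(1) sub])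
      show "psub (ball c r) v" by (rule psub_subset[OF v(2) sub])
      show "usc_on (ball c r) (\<lambda>x. - bar 1 r c x)"
        by (intro continuous_imp_usc_on continuous_intros continuous_bar pos)
      show "psuper (ball c r) (bar 1 r c)" by (rule psuper_bar) (use r0 pos in auto)
      show "x \<in> ball c r" using r(1) by (simp add: dist_norm norm_minus_commute)
      fix d :: real assume d: "d > 0"
      have "v y \<le> bar 1 r c y + d" if y: "y \<in> ball c r - K" for y
      proof -
        have yc: "y \<in> cball c r" using y by auto
        then have "bw 1 r c y < exp (- V)" using y unfolding K_def by auto
        moreover have "bw 1 r c y > 0" using y pos by blast
        ultimately have "ln (bw 1 r c y) < - V" by (metis exp_gt_zero ln_exp ln_less_cancel_iff)
        then show ?thesis using V[OF yc] d unfolding bar_def by linarith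
      qed
      then show "\<exists>K. compact K \<and> K \<subseteq> ball c r \<and> (\<forall>y\<in>ball c r - K. v y \<le> bar 1 r c y + d)"
        using Kc KU by blast
    qed simp
  qed
  have pos: "bw 1 R c x > 0" by (rule bw_pos_inner[OF R n])
  have "((\<lambda>r. bar 1 r c x) \<longlongrightarrow> bar 1 R c x) (at_left R)"
    unfolding bar_def bw_def by (intro tendsto_intros) (use R pos in \<open>auto simp: bw_def\<close>)
  moreover have "\<forall>\<^sub>F r in at_left R. v x \<le> bar 1 r c x"
    using eventually_at_left_real[OF n] by eventually_elim (simp add: le)
  ultimately show ?thesis by (rule tendsto_lowerbound) simp
qed

text \<open>The exterior ball is shrunk first, so that the barrier is bounded on the domain and lies
  below \<open>v\<close> near the boundary; then the radius returns to \<open>R\<close>.\<close>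

lemma bar_le_psuper:
  assumes \<Omega>: "open \<Omega>" "bounded \<Omega>" and v: "usc_on \<Omega> (\<lambda>x. - v x)" "psuper \<Omega> v" "blows_up \<Omega> v"
    and R: "R > 0" and B: "ball c R \<inter> \<Omega> = {}" and x: "x \<in> \<Omega>"
  shows "bar (- 1) R c x \<le> v x"
proof -
  have out: "norm (y - c) \<ge> R" if "y \<in> \<Omega>" for y
    using B that by (auto simp: dist_norm norm_minus_commute disjoint_iff not_less)
  have le: "bar (- 1) r c x \<le> v x" if r: "0 < r" "r < R" for r
  proof -
    have pos: "bw (- 1) r c y > 0" if "y \<in> \<Omega>" for y
      using out[OF that] r by (intro bw_pos_outer) auto
    define b where "b = (kk / r) * (R\<^sup>2 - r\<^sup>2)"
    have b: "b > 0" unfolding b_def using r kk_pos by (intro mult_pos_pos) (auto intro!: power_strict_mono)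
    have bb: "bar (- 1) r c y \<le> - ln b" if "y \<in> \<Omega>" for y
    proof -
      have "R\<^sup>2 \<le> (norm (y - c))\<^sup>2" using out[OF that] R by (intro power_mono) auto
      then have "b \<le> (kk / r) * ((y - c) \<bullet> (y - c) - r\<^sup>2)"
        unfolding b_def using kk_pos r by (intro mult_left_mono) (auto simp: power2_norm_eq_inner)
      also have "\<dots> = bw (- 1) r c y" unfolding bw_def by (simp add: algebra_simps)
      finally have "ln b \<le> ln (bw (- 1) r c y)" using b pos[OF that] by simp
      then show ?thesis unfolding bar_def by simp
    qed
    obtain \<delta> where \<delta>: "\<delta> > 0" "\<And>y. y \<in> \<Omega> \<Longrightarrow> infdist y (frontier \<Omega>) < \<delta> \<Longrightarrow> v y > - ln b"
      using v(3) unfolding blows_up_def by blast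
    show ?thesis
    proof (rule comparison[of \<Omega> "bar (- 1) r c" v])
      show "usc_on \<Omega> (bar (- 1) r c)" by (intro continuous_imp_usc_on continuous_bar pos)
      show "psub \<Omega> (bar (- 1) r c)" by (rule psub_bar) (use r pos in auto)
      fix d :: real assume d: "d > 0"
      have "bar (- 1) r c y \<le> v y + d" if y: "y \<in> \<Omega> - {x \<in> \<Omega>. infdist x (frontier \<Omega>) \<ge> \<delta>}" for y
        using bb[of y] \<delta>(2)[of y] y d by auto
      then show "\<exists>K. compact K \<and> K \<subseteq> \<Omega> \<and> (\<forall>y\<in>\<Omega> - K. bar (- 1) r c y \<le> v y + d)"
        using compact_infdist_ge[OF \<Omega>(2,1) \<delta>(1)] by blast
    qed (use \<Omega> v x in auto)
  qed
  show ?thesis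
  \<comment> \<open>The first case is impossible, since an open set avoiding the open ball avoids
    its sphere too; positivity of the weight at \<open>x\<close> depends on it.\<close>
  proof (cases "norm (x - c) = R")
    case True
    have "open \<Omega>" by fact
    then obtain e where e: "e > 0" "ball x e \<subseteq> \<Omega>" using x open_contains_ball by blast
    define t where "t = min (1/2) (e / (2 * R))"
    have t: "t > 0" "t < 1" "t * R < e" using e(1) R by (auto simp: t_def min_def field_simps)
    define y where "y = x - t *\<^sub>R (x - c)"
    have "y - c = (1 - t) *\<^sub>R (x - c)" by (simp add: y_def algebra_simps)
    then have "norm (y - c) = (1 - t) * R" using t True by simp
    also have "\<dots> < 1 * R" using t R by (intro mult_strict_right_mono) auto
    finally have "norm (y - c) < R" by simp
    moreover have "y \<in> \<Omega>" using e(2) t(1,3) True by (auto simp: y_def dist_norm)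
    ultimately show ?thesis using out[of y] by simp
  next
    case False
    then have pos: "bw (- 1) R c x > 0" using out[OF x] R by (intro bw_pos_outer) auto
    have "((\<lambda>r. bar (- 1) r c x) \<longlongrightarrow> bar (- 1) R c x) (at_left R)"
      unfolding bar_def bw_def by (intro tendsto_intros) (use R pos in \<open>auto simp: bw_def\<close>)
    moreover have "\<forall>\<^sub>F r in at_left R. bar (- 1) r c x \<le> v x"
      using eventually_at_left_real[OF R] by eventually_elim (simp add: le)
    ultimately show ?thesis by (rule tendsto_upperbound) simp
  qed
qed

text \<open>The values of the barriers at distance \<open>d\<close> from the boundary, for touching balls of curvature \<open>t\<close>, up to sign.\<close>

definition G :: "real \<Rightarrow> real \<Rightarrow> real" where
  "G d t = - ln (kk * (2 * d + t * d\<^sup>2))"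

lemma bar_inner_value:
  assumes R: "R > 0" and n: "norm (x - c) = R - d"
  shows "bar 1 R c x = G d (- 1 / R)"
proof -
  have "bw 1 R c x = (kk / R) * (R\<^sup>2 - (R - d)\<^sup>2)"
    unfolding bw_def by (simp add: n[symmetric] power2_norm_eq_inner)
  also have "\<dots> = kk * (2 * d + (- 1 / R) * d\<^sup>2)" using R by (simp add: field_simps power2_eq_square)
  finally show ?thesis unfolding bar_def G_def by simp
qed

lemma bar_outer_value:
  assumes R: "R > 0" and n: "norm (x - c) = R + d"
  shows "bar (- 1) R c x = G d (1 / R)"
proof -
  have "bw (- 1) R c x = - (kk / R) * (R\<^sup>2 - (R + d)\<^sup>2)"
    unfolding bw_def by (simp add: n[symmetric] power2_norm_eq_inner)
  also have "\<dots> = kk * (2 * d + (1 / R) * d\<^sup>2)" using R by (simp add: field_simps power2_eq_square)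
  finally show ?thesis unfolding bar_def G_def by simp
qed

lemma G_ln:
  assumes "d > 0" "\<bar>t * d\<bar> < 2"
  shows "G d t = - ln d - ln (kk * (2 + t * d))"
proof -
  have eq: "kk * (2 * d + t * d\<^sup>2) = d * (kk * (2 + t * d))" by (simp add: power2_eq_square algebra_simps)
  have pos: "kk * (2 + t * d) > 0" using assms kk_pos by (intro mult_pos_pos) auto
  show ?thesis unfolding G_def eq ln_mult_pos[OF assms(1) pos] by simp
qed

text \<open>The interior and exterior bounds share the leading term - ln (2 kk d) and differ only
  through curvature, an effect of order d / R.\<close>

lemma G_gap:
  assumes R: "R > 0" and e: "e > 0"
  obtains \<delta> where "\<delta> > 0" "\<delta> \<le> R" "\<And>d. 0 < d \<Longrightarrow> d < \<delta> \<Longrightarrow> G d (- 1 / R) \<le> G d (1 / R) + e"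
proof -
  define f where "f d = ln (kk * (2 + 1 / R * d)) - ln (kk * (2 + - 1 / R * d))" for d
  have "isCont f 0" unfolding f_def using kk_pos by (intro continuous_intros) auto
  then have "(f \<longlongrightarrow> f 0) (at 0)" unfolding continuous_at .
  moreover have "f 0 = 0" by (simp add: f_def)
  ultimately have "\<forall>\<^sub>F d in at 0. f d < e" using e by (auto intro: order_tendstoD)
  then obtain s where s: "s > 0" "\<And>d. d \<noteq> 0 \<Longrightarrow> dist d 0 < s \<Longrightarrow> f d < e" unfolding eventually_at by blast
  show thesis
  proof (rule that[of "min s R"])
    fix d assume d: "0 < d" "d < min s R"
    have t: "\<bar>1 / R * d\<bar> < 2" "\<bar>- 1 / R * d\<bar> < 2" using d R by (auto simp: field_simps abs_mult)
    have "f d < e" using s(2)[of d] d by simp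
    then show "G d (- 1 / R) \<le> G d (1 / R) + e"
      unfolding G_ln[OF d(1) t(1)] G_ln[OF d(1) t(2)] f_def by linarith
  qed (use s R in auto)
qed

lemma psub_cong:
  assumes "open \<Omega>" "psub \<Omega> u" "\<And>x. x \<in> \<Omega> \<Longrightarrow> w x = u x"
  shows "psub \<Omega> w"
  unfolding psub_def
proof (intro ballI allI impI)
  fix x p X assume x: "x \<in> \<Omega>" and jet: "superjet w x p X"
  have "\<forall>\<^sub>F y in nhds x. u y \<le> w y"
    using eventually_nhds_in_open[OF assms(1) x] by eventually_elim (simp add: assms(3))
  then have "superjet u x p X"
    by (rule superjet_below[where u=u and v=w and y=x and q=p and Z=X, OF jet assms(3)[OF x, symmetric]])
  then show "exp (2 * a * w x) \<le> F (Eop p X)" using assms(2) x unfolding psub_def by (simp add: assms(3))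
qed

end

lemma usc_imp_continuous_on:
  assumes "usc_on S u" "usc_on S (\<lambda>x. - u x)"
  shows "continuous_on S u"
  unfolding continuous_on_def
proof (intro ballI order_tendstoI)
  fix x c assume x: "x \<in> S"
  show "\<forall>\<^sub>F y in at x within S. u y < c" if c: "u x < c"
  proof -
    obtain U where "open U" "x \<in> U" "\<And>y. y \<in> U \<Longrightarrow> y \<in> S \<Longrightarrow> u y < c" by (rule usc_onD[OF assms(1) x c]) (rule that)
    then show ?thesis unfolding eventually_at_topological by blast
  qed
  show "\<forall>\<^sub>F y in at x within S. c < u y" if "c < u x"
  proof -
    have c: "- u x < - c" using that by simp
    obtain U where "open U" "x \<in> U" "\<And>y. y \<in> U \<Longrightarrow> y \<in> S \<Longrightarrow> - u y < - c" by (rule usc_onD[OF assms(2) x c]) (rule that)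
    then show ?thesis unfolding eventually_at_topological by force
  qed
qed

lemma norm_inversion:
  assumes "l > 0" "y \<noteq> c"
  shows "norm (inversion c l y - c) = l / norm (y - c)"
proof -
  have "norm (inversion c l y - c) = l / (norm (y - c))\<^sup>2 * norm (y - c)"
    using assms by (simp add: inversion_def power2_norm_eq_inner)
  then show ?thesis using assms by (simp add: power2_eq_square)
qed

section \<open>Local bounds and moving spheres\<close>

context conf_op
begin

text \<open>One interior barrier bounds the whole family at once, as Perron's method
  requires.\<close>

lemma psub_locally_bounded:
  assumes \<Omega>: "open \<Omega>" "x \<in> \<Omega>"
  shows "\<exists>U M. open U \<and> x \<in> U \<and> (\<forall>v. usc_on \<Omega> v \<longrightarrow> psub \<Omega> v \<longrightarrow> (\<forall>y\<in>U \<inter> \<Omega>. v y \<le> M))"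
proof -
  obtain r where r: "r > 0" "ball x r \<subseteq> \<Omega>" using \<Omega> open_contains_ball by blast
  define b where "b = (kk / r) * (r\<^sup>2 - (r / 2)\<^sup>2)"
  have b: "b > 0" unfolding b_def using r(1) kk_pos by (intro mult_pos_pos) (auto intro!: power_strict_mono)
  have "v y \<le> - ln b" if v: "usc_on \<Omega> v" "psub \<Omega> v" and y: "y \<in> ball x (r / 2)" for v y
  proof -
    have n: "norm (y - x) < r / 2" using y by (simp add: dist_norm norm_minus_commute)
    have "(norm (y - x))\<^sup>2 \<le> (r / 2)\<^sup>2" using n by (intro power_mono) auto
    then have "b \<le> (kk / r) * (r\<^sup>2 - (y - x) \<bullet> (y - x))"
      unfolding b_def using kk_pos r(1) by (intro mult_left_mono) (auto simp: power2_norm_eq_inner)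
    then have "ln b \<le> ln (bw 1 r x y)" using b unfolding bw_def by simp
    moreover have "v y \<le> bar 1 r x y"
      by (rule psub_le_bar[OF \<Omega>(1) v r]) (use n r(1) in \<open>simp add: dist_norm norm_minus_commute\<close>)
    ultimately show ?thesis unfolding bar_def by simp
  qed
  then have "open (ball x (r / 2)) \<and> x \<in> ball x (r / 2) \<and>
     (\<forall>v. usc_on \<Omega> v \<longrightarrow> psub \<Omega> v \<longrightarrow> (\<forall>y\<in>ball x (r / 2) \<inter> \<Omega>. v y \<le> - ln b))"
    using r(1) by auto
  then show ?thesis by blast
qed

text \<open>Outside the sphere the Kelvin transform is a bounded subsolution that equals
  \<open>v\<close> on the sphere, whereas \<open>v\<close> is infinite at the boundary of the
  domain; comparison in the region between gives the inequality.\<close>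

lemma moving_sphere:
  assumes \<Omega>: "open \<Omega>" "bounded \<Omega>" and v: "continuous_on \<Omega> v" "psub \<Omega> v" "psuper \<Omega> v" "blows_up \<Omega> v"
    and l: "l > 0" and B: "cball c (sqrt l) \<subseteq> \<Omega>" and y: "y \<in> \<Omega>" "norm (y - c) > sqrt l"
  shows "kelvin c l v y \<le> v y"
proof -
  define \<sigma> where "\<sigma> = sqrt l"
  have \<sigma>: "\<sigma> > 0" "l = \<sigma> * \<sigma>" using l by (simp_all add: \<sigma>_def)
  define W where "W = \<Omega> - cball c \<sigma>"
  have nc: "z \<noteq> c" if "norm (z - c) \<ge> \<sigma>" for z using that \<sigma> by auto
  have inv: "inversion c l z \<in> cball c \<sigma>" if z: "norm (z - c) \<ge> \<sigma>" for z
  proof -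
    have "l / norm (z - c) \<le> l / \<sigma>" using z \<sigma>(1) l by (intro divide_left_mono mult_pos_pos) auto
    also have "\<dots> = \<sigma>" using \<sigma> by simp
    finally show ?thesis using norm_inversion[OF l nc[OF z]] by (simp add: dist_norm norm_minus_commute)
  qed
  have B': "cball c \<sigma> \<subseteq> \<Omega>" using B by (simp add: \<sigma>_def)
  have invO: "inversion c l z \<in> \<Omega>" if "norm (z - c) \<ge> \<sigma>" for z using inv[OF that] B' by blast
  have "compact (v ` cball c \<sigma>)"
    by (intro compact_continuous_image continuous_on_subset[OF v(1) B']) simp
  then have "bdd_above (v ` cball c \<sigma>)" by (intro bounded_imp_bdd_above compact_imp_bounded)
  then obtain M where M: "\<And>z. z \<in> cball c \<sigma> \<Longrightarrow> v z \<le> M" unfolding bdd_above_def by blast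
  have kM: "kelvin c l v z \<le> M" if z: "norm (z - c) \<ge> \<sigma>" for z
  proof -
    have "\<sigma>\<^sup>2 \<le> (norm (z - c))\<^sup>2" using z \<sigma>(1) by (intro power_mono) auto
    then have "l \<le> (z - c) \<bullet> (z - c)" by (simp add: \<sigma>(2) power2_eq_square[of \<sigma>] power2_norm_eq_inner)
    then have "l / ((z - c) \<bullet> (z - c)) \<le> 1" "l / ((z - c) \<bullet> (z - c)) > 0" using l by (auto simp: divide_le_eq intro!: divide_pos_pos)
    then have "ln (l / ((z - c) \<bullet> (z - c))) \<le> 0" by simp
    then show ?thesis using M[OF inv[OF z]] unfolding kelvin_def by simp
  qed
  have kcont: "continuous_on {z. norm (z - c) \<ge> \<sigma>} (kelvin c l v)"
  proof -
    have ci: "continuous_on {z. norm (z - c) \<ge> \<sigma>} (inversion c l)"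
      using nc by (intro continuous_at_imp_continuous_on ballI inversion_continuous) auto
    have "continuous_on {z. norm (z - c) \<ge> \<sigma>} (\<lambda>z. v (inversion c l z))"
      by (rule continuous_on_compose2[OF v(1) ci]) (use invO in auto)
    moreover have "continuous_on {z. norm (z - c) \<ge> \<sigma>} (\<lambda>z. ln (l / ((z - c) \<bullet> (z - c))))"
      using nc l by (intro continuous_intros) auto
    ultimately show ?thesis unfolding kelvin_def[abs_def] by (intro continuous_on_add)
  qed
  have W\<sigma>: "z \<in> \<Omega>" "norm (z - c) > \<sigma>" if "z \<in> W" for z
    using that by (auto simp: W_def dist_norm norm_minus_commute)
  have WO: "W \<subseteq> \<Omega>" by (auto simp: W_def)
  obtain \<delta> where \<delta>: "\<delta> > 0" "\<And>z. z \<in> \<Omega> \<Longrightarrow> infdist z (frontier \<Omega>) < \<delta> \<Longrightarrow> v z > M"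
    using v(4) unfolding blows_up_def by blast
  define A where "A = {z \<in> \<Omega>. infdist z (frontier \<Omega>) \<ge> \<delta>} \<inter> {z. norm (z - c) \<ge> \<sigma>}"
  have Ac: "compact A" unfolding A_def
    by (intro compact_Int_closed compact_infdist_ge \<Omega> \<delta>(1) closed_Collect_le continuous_intros)
  show ?thesis
  proof (rule comparison[of W "kelvin c l v" v])
    show "open W" unfolding W_def using \<Omega> by (intro open_Diff) auto
    show "usc_on W (kelvin c l v)"
      by (intro continuous_imp_usc_on continuous_on_subset[OF kcont]) (use W\<sigma> in force)
    show "psub W (kelvin c l v)"
    proof (rule kelvin_psub[OF v(2) l])
      fix z assume "z \<in> W"
      then have "norm (z - c) \<ge> \<sigma>" using W\<sigma>(2)[of z] by simp
      then show "z \<noteq> c \<and> inversion c l z \<in> \<Omega>" using nc invO by blast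
    qed
    show "usc_on W (\<lambda>x. - v x)"
      by (intro continuous_imp_usc_on continuous_intros continuous_on_subset[OF v(1) WO])
    show "psuper W v" by (rule psuper_subset[OF v(3) WO])
    show "y \<in> W" using y by (simp add: W_def \<sigma>_def dist_norm norm_minus_commute)
    fix e :: real assume e: "e > 0"
    \<comment> \<open>The points of \<open>A\<close> with excess at least \<open>e\<close>: a closed
      subset of the compact \<open>A\<close>, off the sphere because the two functions agree
      there.\<close>
    define K where "K = {z \<in> A. v z + e \<le> kelvin c l v z}"
    have "closed K" unfolding K_def
    proof (rule continuous_on_closed_Collect_le)
      show "continuous_on A (\<lambda>z. v z + e)"
        by (intro continuous_intros continuous_on_subset[OF v(1)]) (auto simp: A_def)
      show "continuous_on A (kelvin c l v)" by (rule continuous_on_subset[OF kcont]) (auto simp: A_def)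
      show "closed A" using Ac by (rule compact_imp_closed)
    qed
    then have "compact (A \<inter> K)" by (rule compact_Int_closed[OF Ac])
    moreover have "A \<inter> K = K" by (auto simp: K_def)
    ultimately have Kc: "compact K" by simp
    have KW: "K \<subseteq> W"
    proof
      fix z assume z: "z \<in> K"
      then have zO: "z \<in> \<Omega>" "norm (z - c) \<ge> \<sigma>" "v z + e \<le> kelvin c l v z" by (auto simp: K_def A_def)
      have "norm (z - c) \<noteq> \<sigma>"
      proof
        assume "norm (z - c) = \<sigma>"
        then have "(z - c) \<bullet> (z - c) = l" by (simp add: \<sigma>(2) power2_norm_eq_inner[symmetric] power2_eq_square)
        then have "kelvin c l v z = v z" using l by (simp add: kelvin_def inversion_def)
        then show False using zO(3) e by simp
      qed
      then show "z \<in> W" using zO by (simp add: W_def dist_norm norm_minus_commute)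
    qed
    have "kelvin c l v z \<le> v z + e" if z: "z \<in> W - K" for z
    proof (cases "infdist z (frontier \<Omega>) < \<delta>")
      case True
      then show ?thesis using kM[of z] \<delta>(2)[of z] W\<sigma>[of z] z e by force
    next
      case False
      then have "z \<in> A" using W\<sigma>[of z] z by (simp add: A_def)
      then show ?thesis using z by (simp add: K_def)
    qed
    then show "\<exists>K. compact K \<and> K \<subseteq> W \<and> (\<forall>x\<in>W - K. kelvin c l v x \<le> v x + e)" using Kc KW by blast
  qed
qed

text \<open>The sphere is chosen so that \<open>y\<close> and \<open>z\<close> are inverse points:
  its centre lies beyond \<open>z\<close> on the line from \<open>y\<close>, at distance
  \<open>r\<close> from \<open>z\<close> and r + |y - z| from \<open>y\<close>, and its squared
  radius is the product. The Kelvin transform at \<open>y\<close> is then v z - ln (1 + |y - z| /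
  r).\<close>

lemma blowup_log_lipschitz:
  assumes \<Omega>: "open \<Omega>" "bounded \<Omega>" and v: "continuous_on \<Omega> v" "psub \<Omega> v" "psuper \<Omega> v" "blows_up \<Omega> v"
    and r: "r > 0" "ball x (5 * r) \<subseteq> \<Omega>" and yz: "y \<in> ball x r" "z \<in> ball x r"
  shows "v z - v y \<le> norm (y - z) / r"
proof (cases "y = z")
  case False
  define t where "t = norm (z - y)"
  have t: "t > 0" using False by (simp add: t_def)
  define e where "e = (1 / t) *\<^sub>R (z - y)"
  have ne: "norm e = 1" and te: "t *\<^sub>R e = z - y" using t by (simp_all add: e_def t_def)
  define c where "c = z + r *\<^sub>R e"
  define s where "s = r + t"
  define l where "l = r * s"
  have yc: "y - c = - (s *\<^sub>R e)" using te by (simp add: c_def s_def algebra_simps)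
  have s: "s > r" "s > 0" and l: "l > 0" using t r(1) by (simp_all add: s_def l_def)
  have nyc: "norm (y - c) = s" unfolding yc using s ne by simp
  have ls: "sqrt l < s"
  proof -
    have "l < s\<^sup>2" unfolding l_def power2_eq_square using s by (intro mult_strict_right_mono) auto
    then show ?thesis using s by (intro real_less_lsqrt) auto
  qed
  have dx: "norm (y - x) < r" "norm (z - x) < r" using yz by (simp_all add: dist_norm norm_minus_commute)
  have t2: "t < 2 * r"
  proof -
    have "t = norm ((z - x) - (y - x))" by (simp add: t_def)
    also have "\<dots> \<le> norm (z - x) + norm (y - x)" by (rule norm_triangle_ineq4)
    finally show ?thesis using dx by linarith
  qed
  have cx: "norm (c - x) < 2 * r"
  proof -
    have cx: "c - x = (z - x) + r *\<^sub>R e" by (simp add: c_def)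
    have "norm (c - x) \<le> norm (z - x) + norm (r *\<^sub>R e)" unfolding cx by (rule norm_triangle_ineq)
    then show ?thesis using dx ne r(1) by simp
  qed
  \<comment> \<open>The centre is within 2 r of \<open>x\<close> and the radius is below r + t < 3
    r; this is the origin of the factor 5.\<close>
  have B: "cball c (sqrt l) \<subseteq> \<Omega>"
  proof
    fix w assume "w \<in> cball c (sqrt l)"
    then have w: "norm (w - c) \<le> sqrt l" by (simp add: dist_norm norm_minus_commute)
    have "norm (w - x) \<le> norm (w - c) + norm (c - x)" using norm_triangle_ineq[of "w - c" "c - x"] by simp
    also have "\<dots> < 5 * r" using w ls t2 cx by (simp add: s_def)
    finally show "w \<in> \<Omega>" using r(2) by (auto simp: dist_norm norm_minus_commute)
  qed
  have yO: "y \<in> \<Omega>" using yz(1) r by (auto simp: subset_iff)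
  have k: "kelvin c l v y \<le> v y"
    by (rule moving_sphere[OF \<Omega> v l B yO]) (use nyc ls in simp)
  have yy: "(y - c) \<bullet> (y - c) = s * s" using nyc by (simp add: power2_norm_eq_inner[symmetric] power2_eq_square)
  have ly: "l / ((y - c) \<bullet> (y - c)) = r / s" unfolding yy l_def using s by simp
  have "inversion c l y = c + (r / s) *\<^sub>R (y - c)" unfolding inversion_def ly ..
  also have "\<dots> = z" unfolding yc using s by (simp add: c_def)
  finally have "kelvin c l v y = v z + ln (r / s)" unfolding kelvin_def ly by simp
  moreover have "ln (r / s) = - ln (s / r)" using r(1) s by (simp add: ln_div)
  moreover have "ln (s / r) \<le> s / r - 1" using r(1) s by (intro ln_le_minus_one) simp
  moreover have "s / r - 1 = norm (y - z) / r" using r(1) by (simp add: s_def t_def norm_minus_commute field_simps)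
  ultimately show ?thesis using k by linarith
qed (use r in simp)

section \<open>Blow-up solutions on a smooth domain\<close>

context
  fixes \<Omega> :: "(real^'n) set" and R :: real
  assumes D: "bdd_smooth_domain \<Omega>" and R: "R > 0" and tb: "\<And>p. p \<in> frontier \<Omega> \<Longrightarrow> touching_balls \<Omega> R p"
begin

lemma smooth_domain: "open \<Omega>" "bounded \<Omega>" "\<Omega> \<noteq> {}" "frontier \<Omega> \<noteq> {}"
proof -
  show \<Omega>: "open \<Omega>" "bounded \<Omega>" "\<Omega> \<noteq> {}" using D by (auto simp: bdd_smooth_domain_def)
  have "\<Omega> \<noteq> UNIV" using \<Omega>(2) not_bounded_UNIV by blast
  then show "frontier \<Omega> \<noteq> {}" using \<Omega>(3) frontier_eq_empty by blast
qed

lemma psub_le_G: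
  assumes v: "usc_on \<Omega> v" "psub \<Omega> v" and x: "x \<in> \<Omega>" "infdist x (frontier \<Omega>) < R"
  shows "v x \<le> G (infdist x (frontier \<Omega>)) (- 1 / R)"
proof -
  obtain c c' where c: "ball c' R \<subseteq> \<Omega>" "norm (x - c') = R - infdist x (frontier \<Omega>)" "infdist x (frontier \<Omega>) > 0"
    by (rule touching_balls_distance[OF D R tb x(1) refl x(2)]) (assumption, rule that)
  have "v x \<le> bar 1 R c' x"
    by (rule psub_le_bar[OF smooth_domain(1) v R c(1)]) (use c(2,3) in \<open>simp add: dist_norm norm_minus_commute\<close>)
  then show ?thesis unfolding bar_inner_value[OF R c(2)] .
qed

lemma G_le_psuper:
  assumes v: "usc_on \<Omega> (\<lambda>x. - v x)" "psuper \<Omega> v" "blows_up \<Omega> v" and x: "x \<in> \<Omega>" "infdist x (frontier \<Omega>) < R"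
  shows "G (infdist x (frontier \<Omega>)) (1 / R) \<le> v x"
proof -
  obtain c c' where c: "ball c R \<inter> \<Omega> = {}" "norm (x - c) = R + infdist x (frontier \<Omega>)"
    by (rule touching_balls_distance[OF D R tb x(1) refl x(2)]) (assumption, rule that)
  show ?thesis using bar_le_psuper[OF smooth_domain(1,2) v R c(1) x(1)] unfolding bar_outer_value[OF R c(2)] .
qed

lemma infdist_frontier_pos:
  assumes "x \<in> \<Omega>" shows "infdist x (frontier \<Omega>) > 0"
proof -
  have "x \<notin> frontier \<Omega>" using assms smooth_domain(1) frontier_disjoint_eq by blast
  then have "infdist x (frontier \<Omega>) \<noteq> 0"
    using in_closed_iff_infdist_zero[OF frontier_closed smooth_domain(4)] by blast
  then show ?thesis using infdist_nonneg[of x "frontier \<Omega>"] by linarith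
qed

text \<open>The hypothesis on \<open>w\<close> is the exterior barrier bound itself, so the lemma
  serves uniqueness as well as the Perron pair. Near the boundary the two barrier bounds differ
  arbitrarily little.\<close>

lemma boundary_comparison:
  assumes u: "usc_on \<Omega> u" "psub \<Omega> u" and w: "usc_on \<Omega> (\<lambda>x. - w x)" "psuper \<Omega> w"
    and ge: "\<And>x. x \<in> \<Omega> \<Longrightarrow> infdist x (frontier \<Omega>) < R \<Longrightarrow> G (infdist x (frontier \<Omega>)) (1 / R) \<le> w x"
    and x: "x \<in> \<Omega>"
  shows "u x \<le> w x"
proof (rule comparison[OF smooth_domain(1) u w _ x])
  fix e :: real assume e: "e > 0"
  obtain \<delta> where \<delta>: "\<delta> > 0" "\<delta> \<le> R" "\<And>d. 0 < d \<Longrightarrow> d < \<delta> \<Longrightarrow> G d (- 1 / R) \<le> G d (1 / R) + e"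
    by (rule G_gap[OF R e]) (rule that)
  have "u y \<le> w y + e" if y: "y \<in> \<Omega>" "infdist y (frontier \<Omega>) < \<delta>" for y
  proof -
    have yR: "infdist y (frontier \<Omega>) < R" using y \<delta>(2) by simp
    show ?thesis
      using psub_le_G[OF u y(1) yR] ge[OF y(1) yR] \<delta>(3)[OF infdist_frontier_pos[OF y(1)] y(2)] by linarith
  qed
  then have "\<forall>y\<in>\<Omega> - {x \<in> \<Omega>. infdist x (frontier \<Omega>) \<ge> \<delta>}. u y \<le> w y + e" by (simp add: not_le)
  then show "\<exists>K. compact K \<and> K \<subseteq> \<Omega> \<and> (\<forall>y\<in>\<Omega> - K. u y \<le> w y + e)"
    using compact_infdist_ge[OF smooth_domain(2,1) \<delta>(1)] by blast
qed

lemma blowup_unique: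
  assumes u: "continuous_on \<Omega> u" "psub \<Omega> u" "psuper \<Omega> u" "blows_up \<Omega> u"
    and v: "continuous_on \<Omega> v" "psub \<Omega> v" "psuper \<Omega> v" "blows_up \<Omega> v" and x: "x \<in> \<Omega>"
  shows "u x = v x"
proof -
  note uc = continuous_imp_usc_on[OF u(1)] continuous_imp_usc_on[OF continuous_on_minus[OF u(1)]]
  note vc = continuous_imp_usc_on[OF v(1)] continuous_imp_usc_on[OF continuous_on_minus[OF v(1)]]
  have "u x \<le> v x" by (rule boundary_comparison[OF uc(1) u(2) vc(2) v(3) G_le_psuper[OF vc(2) v(3,4)] x])
  moreover have "v x \<le> u x" by (rule boundary_comparison[OF vc(1) v(2) uc(2) u(3) G_le_psuper[OF uc(2) u(3,4)] x])
  ultimately show ?thesis by simp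
qed

text \<open>Exterior barriers are subsolutions on the whole domain, so they bound the lower envelope
  \<open>w\<close> from below near every boundary point. Comparison then gives
  \<open>u \<le> w\<close> for the Perron pair; the two coincide, are continuous, and inherit the
  blow-up from the barriers.\<close>

lemma blowup_exists:
  obtains w where "continuous_on \<Omega> w" "psub \<Omega> w" "psuper \<Omega> w" "blows_up \<Omega> w"
proof -
  have bars: "continuous_on \<Omega> (bar (- 1) R c)" "psub \<Omega> (bar (- 1) R c)" if c: "ball c R \<inter> \<Omega> = {}" for c
  proof -
    \<comment> \<open>The weight vanishes on the sphere of the touching ball; openness of the domain
      keeps it off the closed ball.\<close>
    have pos: "bw (- 1) R c y > 0" if y: "y \<in> \<Omega>" for y
    proof (rule bw_pos_outer[OF R])
      have "ball c R \<inter> closure \<Omega> = {}" using c open_Int_closure_eq_empty[OF open_ball] by blast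
      then have "closure (ball c R) \<inter> \<Omega> = {}"
        using open_Int_closure_eq_empty[OF smooth_domain(1), of "ball c R"] c by blast
      then have "y \<notin> cball c R" using y R by auto
      then show "norm (y - c) > R" by (simp add: dist_norm norm_minus_commute)
    qed
    show "continuous_on \<Omega> (bar (- 1) R c)" by (rule continuous_bar[OF pos])
    show "psub \<Omega> (bar (- 1) R c)" by (rule psub_bar) (use R pos in auto)
  qed
  obtain p where p: "p \<in> frontier \<Omega>" using smooth_domain(4) by blast
  obtain \<nu> where \<nu>: "ball (p + R *\<^sub>R \<nu>) R \<inter> \<Omega> = {}" using tb[OF p] unfolding touching_balls_def by blast
  obtain u w where u: "usc_on \<Omega> u" "psub \<Omega> u" and w: "usc_on \<Omega> (\<lambda>x. - w x)" "psuper \<Omega> w"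
    and wu: "\<And>x. x \<in> \<Omega> \<Longrightarrow> w x \<le> u x"
    and low: "\<And>v x. continuous_on \<Omega> v \<Longrightarrow> psub \<Omega> v \<Longrightarrow> x \<in> \<Omega> \<Longrightarrow> v x \<le> w x"
    by (rule perron[OF smooth_domain(1) psub_locally_bounded[OF smooth_domain(1)] bars[OF \<nu>]]) (assumption, rule that)
  have ge: "G (infdist x (frontier \<Omega>)) (1 / R) \<le> w x" if x: "x \<in> \<Omega>" "infdist x (frontier \<Omega>) < R" for x
  proof -
    obtain c c' where c: "ball c R \<inter> \<Omega> = {}" "norm (x - c) = R + infdist x (frontier \<Omega>)"
      by (rule touching_balls_distance[OF D R tb x(1) refl x(2)]) (assumption, rule that)
    show ?thesis using low[OF bars[OF c(1)] x(1)] unfolding bar_outer_value[OF R c(2)] .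
  qed
  have eq: "w x = u x" if x: "x \<in> \<Omega>" for x
    using boundary_comparison[OF u w ge x] wu[OF x] by simp
  show thesis
  proof (rule that[of w])
    have "usc_on \<Omega> w" using u(1) unfolding usc_on_def by (simp add: eq)
    then show "continuous_on \<Omega> w" using w(1) by (rule usc_imp_continuous_on)
    show "psub \<Omega> w" by (rule psub_cong[OF smooth_domain(1) u(2) eq])
    show "psuper \<Omega> w" by fact
    show "blows_up \<Omega> w" unfolding blows_up_def
    proof
      fix M :: real
      \<comment> \<open>For d < R the weight is at most 3 kk d, as d^2 / R <= d.\<close>
      define \<delta> where "\<delta> = min R (exp (- M) / (3 * kk))"
      have "w x > M" if x: "x \<in> \<Omega>" "infdist x (frontier \<Omega>) < \<delta>" for x
      proof -
        define d where "d = infdist x (frontier \<Omega>)"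
        have d: "d > 0" "d < R" "d < exp (- M) / (3 * kk)"
          using infdist_frontier_pos[OF x(1)] x(2) by (simp_all add: d_def \<delta>_def)
        have "1 / R * d\<^sup>2 \<le> d" using d R by (simp add: field_simps power2_eq_square)
        then have "kk * (2 * d + 1 / R * d\<^sup>2) \<le> kk * (3 * d)" using kk_pos by (intro mult_left_mono) auto
        also have "\<dots> < exp (- M)" using d(3) kk_pos by (simp add: field_simps)
        finally have "kk * (2 * d + 1 / R * d\<^sup>2) < exp (- M)" .
        moreover have "kk * (2 * d + 1 / R * d\<^sup>2) > 0" using kk_pos d R by (intro mult_pos_pos add_pos_nonneg) auto
        ultimately have "ln (kk * (2 * d + 1 / R * d\<^sup>2)) < - M" by (metis exp_gt_zero ln_exp ln_less_cancel_iff)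
        moreover have "G d (1 / R) \<le> w x" using ge[OF x(1)] d(2) by (simp add: d_def)
        ultimately show ?thesis unfolding G_def by linarith
      qed
      moreover have "\<delta> > 0" using R kk_pos by (simp add: \<delta>_def)
      ultimately show "\<exists>\<delta>>0. \<forall>x\<in>\<Omega>. infdist x (frontier \<Omega>) < \<delta> \<longrightarrow> M < w x" by blast
    qed
  qed
qed

text \<open>Both bounds have the form - ln d - ln (kk (2 + t)) with |t| = d / R, so continuity at t
  = 0 squeezes the rescaled solution.\<close>

lemma blowup_rate:
  assumes v: "continuous_on \<Omega> v" "psub \<Omega> v" "psuper \<Omega> v" "blows_up \<Omega> v" and m: "m > 0" and e: "e > 0"
  shows "\<exists>\<delta>>0. \<forall>x\<in>\<Omega>. infdist x (frontier \<Omega>) < \<delta> \<longrightarrow>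
    \<bar>exp (m * (ln (infdist x (frontier \<Omega>)) + v x)) - exp (- m * ln (kk * 2))\<bar> < e"
proof -
  define h where "h t = exp (- m * ln (kk * (2 + t)))" for t
  have "isCont h 0" unfolding h_def using kk_pos by (intro continuous_intros) auto
  then have "\<exists>s>0. \<forall>t. dist t 0 < s \<longrightarrow> dist (h t) (h 0) < e" using e unfolding continuous_at_eps_delta by blast
  then obtain s where s: "s > 0" "\<And>t. \<bar>t\<bar> < s \<Longrightarrow> \<bar>h t - h 0\<bar> < e" by (auto simp: dist_real_def)
  have h0: "exp (- m * ln (kk * 2)) = h 0" by (simp add: h_def)
  note vc = continuous_imp_usc_on[OF v(1)] continuous_imp_usc_on[OF continuous_on_minus[OF v(1)]]
  have "\<bar>exp (m * (ln (infdist x (frontier \<Omega>)) + v x)) - h 0\<bar> < e"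
    if x: "x \<in> \<Omega>" "infdist x (frontier \<Omega>) < min R (s * R)" for x
  proof -
    define d where "d = infdist x (frontier \<Omega>)"
    have d: "d > 0" "d < R" "d < s * R" using infdist_frontier_pos[OF x(1)] x(2) by (simp_all add: d_def)
    have t: "\<bar>1 / R * d\<bar> < 2" "\<bar>- 1 / R * d\<bar> < 2" "\<bar>1 / R * d\<bar> < s" "\<bar>- 1 / R * d\<bar> < s"
      using d R by (auto simp: field_simps abs_mult)
    have dR: "infdist x (frontier \<Omega>) < R" using d(2) by (simp add: d_def)
    have up: "ln d + v x \<le> - ln (kk * (2 + - 1 / R * d))"
      using psub_le_G[OF vc(1) v(2) x(1) dR] unfolding d_def[symmetric] G_ln[OF d(1) t(2)] by linarith
    have lo: "- ln (kk * (2 + 1 / R * d)) \<le> ln d + v x"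
      using G_le_psuper[OF vc(2) v(3,4) x(1) dR] unfolding d_def[symmetric] G_ln[OF d(1) t(1)] by linarith
    have "h (1 / R * d) = exp (m * - ln (kk * (2 + 1 / R * d)))" by (simp add: h_def)
    also have "\<dots> \<le> exp (m * (ln d + v x))"
      unfolding exp_le_cancel_iff using m by (intro mult_left_mono lo) simp
    finally have a: "h (1 / R * d) \<le> exp (m * (ln d + v x))" .
    have "exp (m * (ln d + v x)) \<le> exp (m * - ln (kk * (2 + - 1 / R * d)))"
      unfolding exp_le_cancel_iff using m by (intro mult_left_mono up) simp
    also have "\<dots> = h (- 1 / R * d)" by (simp add: h_def)
    finally have b: "exp (m * (ln d + v x)) \<le> h (- 1 / R * d)" .
    show ?thesis using a b s(2)[OF t(3)] s(2)[OF t(4)] unfolding d_def[symmetric] abs_less_iff by linarith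
  qed
  moreover have "min R (s * R) > 0" using R s(1) by simp
  ultimately show ?thesis unfolding h0 by blast
qed

end

end

section \<open>Return to the original unknown\<close>

lemma exp_diff_le: "exp x - exp y \<le> exp x * (x - y)" for x y :: real
proof -
  have "1 + (y - x) \<le> exp (y - x)" by (rule exp_ge_add_one_self)
  then have "exp x * (1 + (y - x)) \<le> exp x * exp (y - x)" by (intro mult_left_mono) auto
  then show ?thesis by (simp add: exp_diff algebra_simps)
qed

context
  fixes f :: "real^'n \<Rightarrow> real" and \<Gamma> :: "(real^'n) set" and a m :: real
  assumes op: "conf_op (mat_op f \<Gamma>) a" and n: "CARD('n) \<ge> 3" and m: "m = (real CARD('n) - 2) / 2"
begin

interpretation op: conf_op "mat_op f \<Gamma>" a by (rule op)

lemma blowup_sol_log: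
  assumes \<Omega>: "open \<Omega>" and u: "blowup_sol f \<Gamma> \<Omega> u"
  shows "continuous_on \<Omega> (\<lambda>x. ln (u x) / m)" "op.psub \<Omega> (\<lambda>x. ln (u x) / m)" "op.psuper \<Omega> (\<lambda>x. ln (u x) / m)"
    "blows_up \<Omega> (\<lambda>x. ln (u x) / m)"
proof -
  have m0: "m > 0" using n by (simp add: m)
  have s: "continuous_on \<Omega> u" "visc_sub f \<Gamma> \<Omega> u" "visc_super f \<Gamma> \<Omega> u" and pos: "\<And>x. x \<in> \<Omega> \<Longrightarrow> u x > 0"
    and bl: "\<forall>M. \<exists>\<delta>>0. \<forall>x\<in>\<Omega>. infdist x (frontier \<Omega>) < \<delta> \<longrightarrow> u x > M"
    using u by (auto simp: blowup_sol_def visc_sol_def)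
  show "continuous_on \<Omega> (\<lambda>x. ln (u x) / m)"
    using m0 pos by (intro continuous_intros s) force+
  show "op.psub \<Omega> (\<lambda>x. ln (u x) / m)" by (rule visc_sub_imp_psub[OF op n m pos s(2) \<Omega>])
  show "op.psuper \<Omega> (\<lambda>x. ln (u x) / m)" by (rule visc_super_imp_psuper[OF op n m pos s(3) \<Omega>])
  show "blows_up \<Omega> (\<lambda>x. ln (u x) / m)" unfolding blows_up_def
  proof
    fix M :: real
    obtain \<delta> where \<delta>: "\<delta> > 0" "\<And>x. x \<in> \<Omega> \<Longrightarrow> infdist x (frontier \<Omega>) < \<delta> \<Longrightarrow> u x > exp (m * M)" using bl by blast
    have "ln (u x) / m > M" if x: "x \<in> \<Omega>" "infdist x (frontier \<Omega>) < \<delta>" for x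
    proof -
      have "ln (exp (m * M)) < ln (u x)" using \<delta>(2)[OF x] pos[OF x(1)] by (subst ln_less_cancel_iff) auto
      then show ?thesis using m0 by (simp add: field_simps)
    qed
    then show "\<exists>\<delta>>0. \<forall>x\<in>\<Omega>. infdist x (frontier \<Omega>) < \<delta> \<longrightarrow> M < ln (u x) / m" using \<delta>(1) by blast
  qed
qed

lemma blowup_sol_exp:
  assumes \<Omega>: "open \<Omega>" and w: "continuous_on \<Omega> w" "op.psub \<Omega> w" "op.psuper \<Omega> w" "blows_up \<Omega> w"
  shows "blowup_sol f \<Gamma> \<Omega> (\<lambda>x. exp (m * w x))"
  unfolding blowup_sol_def visc_sol_def
proof (intro conjI allI)
  have m0: "m > 0" using n by (simp add: m)
  show "continuous_on \<Omega> (\<lambda>x. exp (m * w x))" by (intro continuous_intros w)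
  show "visc_sub f \<Gamma> \<Omega> (\<lambda>x. exp (m * w x))" by (rule psub_imp_visc_sub[OF op n m w(2) \<Omega>])
  show "visc_super f \<Gamma> \<Omega> (\<lambda>x. exp (m * w x))" by (rule psuper_imp_visc_super[OF op n m w(3) \<Omega>])
  show "\<forall>x\<in>\<Omega>. exp (m * w x) > 0" by simp
  fix M :: real
  obtain \<delta> where \<delta>: "\<delta> > 0" "\<And>x. x \<in> \<Omega> \<Longrightarrow> infdist x (frontier \<Omega>) < \<delta> \<Longrightarrow> w x > ln (max M 1) / m"
    using w(4) unfolding blows_up_def by blast
  have "exp (m * w x) > M" if x: "x \<in> \<Omega>" "infdist x (frontier \<Omega>) < \<delta>" for x
  proof -
    have "ln (max M 1) < m * w x" using \<delta>(2)[OF x] m0 by (simp add: field_simps)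
    then have "exp (ln (max M 1)) < exp (m * w x)" by (simp only: exp_less_cancel_iff)
    moreover have "exp (ln (max M 1)) = max M 1" by (intro exp_ln) simp
    ultimately show ?thesis by simp
  qed
  then show "\<exists>\<delta>>0. \<forall>x\<in>\<Omega>. infdist x (frontier \<Omega>) < \<delta> \<longrightarrow> exp (m * w x) > M" using \<delta>(1) by blast
qed

text \<open>The logarithm is Lipschitz near \<open>x\<close> by inversions; a local upper bound
  \<open>E\<close> of \<open>u\<close> and the tangent inequality of the exponential carry this over
  to \<open>u\<close>.\<close>

lemma blowup_sol_locally_lipschitz:
  assumes \<Omega>: "open \<Omega>" "bounded \<Omega>" and u: "blowup_sol f \<Gamma> \<Omega> u" and x: "x \<in> \<Omega>"
  shows "\<exists>r>0. \<exists>L. L-lipschitz_on (\<Omega> \<inter> ball x r) u"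
proof -
  have m0: "m > 0" using n by (simp add: m)
  have pos: "\<And>x. x \<in> \<Omega> \<Longrightarrow> u x > 0" and uc: "continuous_on \<Omega> u"
    using u by (auto simp: blowup_sol_def visc_sol_def)
  obtain r0 where r0: "r0 > 0" "ball x r0 \<subseteq> \<Omega>" using \<Omega>(1) x open_contains_ball by blast
  define r where "r = r0 / 5"
  have r: "r > 0" "ball x (5 * r) \<subseteq> \<Omega>" using r0 by (simp_all add: r_def)
  have cb: "cball x r \<subseteq> \<Omega>" using r by (auto simp: subset_iff)
  have "compact (u ` cball x r)"
    by (intro compact_continuous_image continuous_on_subset[OF uc cb]) simp
  then have "bdd_above (u ` cball x r)" by (intro bounded_imp_bdd_above compact_imp_bounded)
  then obtain E where E: "\<And>z. z \<in> cball x r \<Longrightarrow> u z \<le> E" unfolding bdd_above_def by blast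
  have E0: "E > 0" using E[of x] pos[OF x] r(1) by simp
  have le: "u z - u y \<le> E * m / r * dist y z" if yz: "y \<in> ball x r" "z \<in> ball x r" for y z
  proof -
    have O: "y \<in> \<Omega>" "z \<in> \<Omega>" using yz cb by auto
    have "ln (u z) / m - ln (u y) / m \<le> norm (y - z) / r"
      by (rule op.blowup_log_lipschitz[OF \<Omega> blowup_sol_log[OF \<Omega>(1) u] r yz])
    then have "ln (u z) - ln (u y) \<le> m / r * dist y z" using m0 r(1) by (simp add: field_simps dist_norm)
    then have "u z * (ln (u z) - ln (u y)) \<le> u z * (m / r * dist y z)" using pos[OF O(2)] by (intro mult_left_mono) auto
    also have "\<dots> \<le> E * (m / r * dist y z)"
      using E[of z] yz(2) m0 r(1) by (intro mult_right_mono) auto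
    finally show ?thesis using exp_diff_le[of "ln (u z)" "ln (u y)"] pos[OF O(1)] pos[OF O(2)] by simp
  qed
  have "(E * m / r)-lipschitz_on (\<Omega> \<inter> ball x r) u"
  proof (rule lipschitz_onI)
    fix y z assume "y \<in> \<Omega> \<inter> ball x r" "z \<in> \<Omega> \<inter> ball x r"
    then show "dist (u y) (u z) \<le> E * m / r * dist y z"
      using le[of y z] le[of z y] unfolding dist_real_def by (simp add: dist_commute abs_le_iff)
  qed (use E0 m0 r(1) in simp)
  then show ?thesis using r(1) by blast
qed

end

theorem theorem1p1:
  fixes f :: "real^'n \<Rightarrow> real" and \<Gamma> :: "(real^'n) set"
  assumes "CARD('n) \<ge> 3"
    and "structural f \<Gamma>"
  shows "\<exists>C::real. C > 0 \<and>
    (\<forall>\<Omega>::(real^'n) set. bdd_smooth_domain \<Omega> \<longrightarrow>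
       (\<exists>u. blowup_sol f \<Gamma> \<Omega> u \<and>
            (\<forall>v. blowup_sol f \<Gamma> \<Omega> v \<longrightarrow> (\<forall>x\<in>\<Omega>. v x = u x))) \<and>
       (\<forall>u. blowup_sol f \<Gamma> \<Omega> u \<longrightarrow>
            (\<forall>x\<in>\<Omega>. \<exists>r>0. \<exists>L. L-lipschitz_on (\<Omega> \<inter> ball x r) u) \<and>
            (\<forall>\<epsilon>>0. \<exists>\<delta>>0. \<forall>x\<in>\<Omega>. infdist x (frontier \<Omega>) < \<delta> \<longrightarrow>
               \<bar>infdist x (frontier \<Omega>) powr ((real CARD('n) - 2) / 2) * u x - C\<bar> < \<epsilon>)))"
proof -
  obtain a where op: "conf_op (mat_op f \<Gamma>) a" using conf_op_mat_op[OF assms(2)] by (rule exE)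
  interpret op: conf_op "mat_op f \<Gamma>" a by (rule op)
  define m where m: "m = (real CARD('n) - 2) / 2"
  have m0: "m > 0" using assms(1) by (simp add: m)
  note log = blowup_sol_log[OF op assms(1) m] and lip = blowup_sol_locally_lipschitz[OF op assms(1) m]
  show ?thesis unfolding m[symmetric]
  \<comment> \<open>The constant (2 kk)^(- m) comes from the leading term of the barriers;
    \<open>kk\<close> is built from the degree of homogeneity and the value of the operator at the
    identity, hence from \<open>(f, \<Gamma>)\<close> alone.\<close>
  proof (rule exI[of _ "exp (- m * ln (op.kk * 2))"], intro conjI allI impI)
    show "exp (- m * ln (op.kk * 2)) > 0" by simp
  next
    fix \<Omega> :: "(real^'n) set" assume D: "bdd_smooth_domain \<Omega>"
    obtain R where R: "R > 0" "\<And>p. p \<in> frontier \<Omega> \<Longrightarrow> touching_balls \<Omega> R p"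
      by (rule uniform_touching_balls[OF D]) (rule that)
    have \<Omega>: "open \<Omega>" using D by (simp add: bdd_smooth_domain_def)
    obtain w where w: "continuous_on \<Omega> w" "op.psub \<Omega> w" "op.psuper \<Omega> w" "blows_up \<Omega> w"
      by (rule op.blowup_exists[OF D R]) (assumption, rule that)
    have "v x = exp (m * w x)" if v: "blowup_sol f \<Gamma> \<Omega> v" and x: "x \<in> \<Omega>" for v x
    proof -
      have "ln (v x) / m = w x" by (rule op.blowup_unique[OF D R log[OF \<Omega> v] w x])
      then have "ln (v x) = m * w x" using m0 by (simp add: field_simps)
      moreover have "v x > 0" using v x by (simp add: blowup_sol_def)
      ultimately show ?thesis by (metis exp_ln)
    qed
    then show "\<exists>u. blowup_sol f \<Gamma> \<Omega> u \<and> (\<forall>v. blowup_sol f \<Gamma> \<Omega> v \<longrightarrow> (\<forall>x\<in>\<Omega>. v x = u x))"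
      using blowup_sol_exp[OF op assms(1) m \<Omega> w] by (intro exI[of _ "\<lambda>x. exp (m * w x)"]) simp
  next
    fix \<Omega> :: "(real^'n) set" and u assume D: "bdd_smooth_domain \<Omega>" and u: "blowup_sol f \<Gamma> \<Omega> u"
    show "\<forall>x\<in>\<Omega>. \<exists>r>0. \<exists>L. L-lipschitz_on (\<Omega> \<inter> ball x r) u"
      using lip[OF _ _ u] D by (simp add: bdd_smooth_domain_def)
  next
    fix \<Omega> :: "(real^'n) set" and u and \<epsilon> :: real
    assume D: "bdd_smooth_domain \<Omega>" and u: "blowup_sol f \<Gamma> \<Omega> u" and e: "\<epsilon> > 0"
    obtain R where R: "R > 0" "\<And>p. p \<in> frontier \<Omega> \<Longrightarrow> touching_balls \<Omega> R p"
      by (rule uniform_touching_balls[OF D]) (rule that)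
    have \<Omega>: "open \<Omega>" using D by (simp add: bdd_smooth_domain_def)
    obtain \<delta> where \<delta>: "\<delta> > 0" "\<And>x. x \<in> \<Omega> \<Longrightarrow> infdist x (frontier \<Omega>) < \<delta> \<Longrightarrow>
      \<bar>exp (m * (ln (infdist x (frontier \<Omega>)) + ln (u x) / m)) - exp (- m * ln (op.kk * 2))\<bar> < \<epsilon>"
      using op.blowup_rate[OF D R log[OF \<Omega> u] m0 e] by blast
    have eq: "exp (m * (ln (infdist x (frontier \<Omega>)) + ln (u x) / m)) = infdist x (frontier \<Omega>) powr m * u x"
      if x: "x \<in> \<Omega>" for x
    proof -
      have "infdist x (frontier \<Omega>) > 0" by (rule op.infdist_frontier_pos[OF D R x])
      moreover have "u x > 0" using u x by (simp add: blowup_sol_def)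
      ultimately show ?thesis using m0 by (simp add: powr_def distrib_left exp_add)
    qed
    show "\<exists>\<delta>>0. \<forall>x\<in>\<Omega>. infdist x (frontier \<Omega>) < \<delta> \<longrightarrow>
       \<bar>infdist x (frontier \<Omega>) powr m * u x - exp (- m * ln (op.kk * 2))\<bar> < \<epsilon>"
      using \<delta> eq by (intro exI[of _ \<delta>]) auto
  qed
qed

end
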